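(* Let $N\ge 2$, let $\Omega\subset\mathbb{R}^N$ be a bounded domain with boundary $\partial\Omega$ of class $C^{1,1}$, and let $A(x)$ be a symmetric $N\times N$ matrix of functions satisfying assumptions (a), (b) of the context. Let $f\in C(\partial\Omega)$ and suppose that the sets $$\mathcal{S}^+=\{x\in\partial\Omega:f(x)>0\},\quad \mathcal{S}^-=\{x\in\partial\Omega:f(x)<0\}$$ are non-empty; set $\mathcal{S}=\mathcal{S}^+\cup\mathcal{S}^-$. Let $u=u(x,t)$ be the solution of $$u_t-\operatorname{tr}[A(x)\nabla^2u]=0\ \text{ in }\Omega\times(0,\infty),\quad u=0\ \text{ on }\Omega\times\{0\},\quad u=f\ \text{ on }\partial\Omega\times(0,\infty),$$ and, for each $\varepsilon>0$, let $U_\varepsilon$ be the solution of $$\varepsilon^2\operatorname{tr}[A(x)\nabla^2U_\varepsilon]-U_\varepsilon=0\ \text{ in }\Omega,\quad U_\varepsilon=f\ \text{ on }\partial\Omega.$$ Then, for every $x\in\Omega\cup\mathcal{S}$ with $d_{\mathcal{S}^+}(x)\neq d_{\mathcal{S}^-}(x)$, $$\lim_{t\to0^+}\bigl[-4t\log|u(x,t)|\bigr]=d_{\mathcal{S}}(x)^2=\begin{cases}d_{\mathcal{S}^+}(x)^2&\text{if }d_{\mathcal{S}^+}(x)<d_{\mathcal{S}^-}(x),\\ d_{\mathcal{S}^-}(x)^2&\text{if }d_{\mathcal{S}^+}(x)>d_{\mathcal{S}^-}(x),\end{cases}$$ and $$\lim_{\varepsilon\to0^+}\bigl[-\varepsilon\log|U_\varepsilon(x)|\bigr]=d_{\mathcal{S}}(x)=\begin{cases}d_{\mathcal{S}^+}(x)&\text{if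 }d_{\mathcal{S}^+}(x)<d_{\mathcal{S}^-}(x),\\ d_{\mathcal{S}^-}(x)&\text{if }d_{\mathcal{S}^+}(x)>d_{\mathcal{S}^-}(x).\end{cases}$$ The limits are uniform on compact subsets of $\{x\in\Omega\cup\mathcal{S}:d_{\mathcal{S}^+}(x)\ne d_{\mathcal{S}^-}(x)\}$.
   Context: Assumptions on $A$: (a) $A$ is differentiable and locally Lipschitz continuous in $\mathbb{R}^N$ and, for every compact set $K$, there is a constant $L_K>0$ with $|A(x)|,|\nabla A(x)|\le L_K$ for $x\in K$; (b) there is $\lambda>0$ such that $\langle A(x)\xi,\xi\rangle\ge\lambda|\xi|^2$ for all $x,\xi\in\mathbb{R}^N$. Solutions are bounded classical solutions attaining the data continuously (for the parabolic problem, continuously on $\overline{\Omega}\times[0,\infty)$ except on $\partial\Omega\times\{0\}$). $\nabla^2$ denotes the Hessian matrix and $\operatorname{tr}$ the trace. Distance $d_{\mathcal{T}}$ for $\mathcal{T}\subseteq\partial\Omega$: for a path $\gamma$ and $w\in\mathbb{R}^N$ let $|w|_A=\sqrt{\langle A^{-1}(\gamma(t))w,w\rangle}$ at the point $\gamma(t)$. For $x\in\overline{\Omega}$ and $\gamma\in H^1_{loc}([0,\infty);\mathbb{R}^N)$ with $\gamma(0)=x$, let $T_x=\inf\{\tau>0:\gamma(\tau)\in\mathbb{R}^N\setminus\Omega\}$ ($+\infty$ if the set is empty). Then $$d_{\mathcal{T}}(x)=\inf\Bigl\{\int_0^{T_x}|\gamma'(t)|_A\,dt:\ \gamma(0)=x,\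 T_x<\infty,\ \gamma(T_x)\in\mathcal{T}\Bigr\}.$$ *)

theory Defs
  imports "HOL-Analysis.Analysis"
begin

section \<open>Domains with boundary of class \<open>C\<^sup>1\<^sup>,\<^sup>1\<close>\<close>

definition C11_function :: "(real ^ 'n \<Rightarrow> real) \<Rightarrow> bool" where
  "C11_function \<phi> \<longleftrightarrow>
     (\<exists>G L. (\<forall>y. (\<phi> has_derivative (\<lambda>h. G y \<bullet> h)) (at y)) \<and> L-lipschitz_on UNIV G)"

(* Near each boundary point the set is the region above the graph of a C^{1,1} function, in
   orthonormal coordinates whose last axis is the unit vector nu. The graph function is
   evaluated only on the hyperplane orthogonal to nu, through the projection
   y |-> y - (y . nu) nu, so it plays the role of a function of N - 1 variables (such a function
   extends to the whole space, constantly along nu, with the same regularity). *)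
definition C11_boundary :: "(real ^ 'n) set \<Rightarrow> bool" where
  "C11_boundary \<Omega> \<longleftrightarrow>
     (\<forall>x0\<in>frontier \<Omega>. \<exists>r>0. \<exists>\<nu> \<phi>. norm \<nu> = 1 \<and> C11_function \<phi> \<and>
        \<Omega> \<inter> ball x0 r = {y \<in> ball x0 r. y \<bullet> \<nu> > \<phi> (y - (y \<bullet> \<nu>) *\<^sub>R \<nu>)})"

section \<open>The coefficient matrix\<close>

definition coeff_regular :: "(real ^ 'n \<Rightarrow> real ^ 'n ^ 'n) \<Rightarrow> bool" where
  "coeff_regular A \<longleftrightarrow>
     (\<forall>x. A differentiable (at x)) \<and>
     local_lipschitz (UNIV :: real set) UNIV (\<lambda>_. A) \<and>
     (\<forall>K. compact K \<longrightarrow>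
        (\<exists>L>0. \<forall>x\<in>K. norm (A x) \<le> L \<and> onorm (frechet_derivative A (at x)) \<le> L))"

definition uniformly_elliptic :: "(real ^ 'n \<Rightarrow> real ^ 'n ^ 'n) \<Rightarrow> bool" where
  "uniformly_elliptic A \<longleftrightarrow> (\<exists>c>0. \<forall>x \<xi>. (A x *v \<xi>) \<bullet> \<xi> \<ge> c * (norm \<xi>)\<^sup>2)"

section \<open>Classical solutions\<close>

definition grad :: "(real ^ 'n \<Rightarrow> real) \<Rightarrow> real ^ 'n \<Rightarrow> real ^ 'n" where
  "grad v x = (\<chi> i. frechet_derivative v (at x) (axis i 1))"

definition hessian :: "(real ^ 'n \<Rightarrow> real) \<Rightarrow> real ^ 'n \<Rightarrow> real ^ 'n ^ 'n" where
  "hessian v x = jacobian (grad v) (at x)"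

definition twice_differentiable_in :: "(real ^ 'n \<Rightarrow> real) \<Rightarrow> (real ^ 'n) set \<Rightarrow> bool" where
  "twice_differentiable_in v \<Omega> \<longleftrightarrow>
     (\<forall>x\<in>\<Omega>. v differentiable (at x) \<and> grad v differentiable (at x))"

(* The values of u on (frontier \<Omega>) \<times> {0} are irrelevant and not constrained. *)
definition parabolic_solution ::
  "(real ^ 'n \<Rightarrow> real ^ 'n ^ 'n) \<Rightarrow> (real ^ 'n) set \<Rightarrow> (real ^ 'n \<Rightarrow> real) \<Rightarrow>
   (real ^ 'n \<Rightarrow> real \<Rightarrow> real) \<Rightarrow> bool" where
  "parabolic_solution A \<Omega> f u \<longleftrightarrow>
     (\<forall>t>0. twice_differentiable_in (\<lambda>y. u y t) \<Omega>) \<and>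
     (\<forall>x\<in>\<Omega>. \<forall>t>0. (\<lambda>s. u x s) differentiable (at t)) \<and>
     continuous_on (\<Omega> \<times> {0<..}) (\<lambda>(x, t). grad (\<lambda>y. u y t) x) \<and>
     continuous_on (\<Omega> \<times> {0<..}) (\<lambda>(x, t). hessian (\<lambda>y. u y t) x) \<and>
     continuous_on (\<Omega> \<times> {0<..}) (\<lambda>(x, t). deriv (\<lambda>s. u x s) t) \<and>
     continuous_on (closure \<Omega> \<times> {0..} - frontier \<Omega> \<times> {0}) (\<lambda>(x, t). u x t) \<and>
     bounded ((\<lambda>(x, t). u x t) ` (\<Omega> \<times> {0<..})) \<and>
     (\<forall>x\<in>\<Omega>. \<forall>t>0. deriv (\<lambda>s. u x s) t - trace (A x ** hessian (\<lambda>y. u y t) x) = 0) \<and>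
     (\<forall>x\<in>\<Omega>. u x 0 = 0) \<and>
     (\<forall>x\<in>frontier \<Omega>. \<forall>t>0. u x t = f x)"

definition elliptic_solution ::
  "(real ^ 'n \<Rightarrow> real ^ 'n ^ 'n) \<Rightarrow> (real ^ 'n) set \<Rightarrow> (real ^ 'n \<Rightarrow> real) \<Rightarrow> real \<Rightarrow>
   (real ^ 'n \<Rightarrow> real) \<Rightarrow> bool" where
  "elliptic_solution A \<Omega> f \<epsilon> U \<longleftrightarrow>
     twice_differentiable_in U \<Omega> \<and>
     continuous_on \<Omega> (hessian U) \<and>
     continuous_on (closure \<Omega>) U \<and>
     bounded (U ` \<Omega>) \<and>
     (\<forall>x\<in>\<Omega>. \<epsilon>\<^sup>2 * trace (A x ** hessian U x) - U x = 0) \<and>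
     (\<forall>x\<in>frontier \<Omega>. U x = f x)"

section \<open>The distance associated with the coefficient matrix\<close>

(* Smooth real functions with compact support in (0, \<infinity>). *)
definition test_function :: "(real \<Rightarrow> real) \<Rightarrow> bool" where
  "test_function \<phi> \<longleftrightarrow>
     (\<forall>k t. ((deriv ^^ k) \<phi>) differentiable (at t)) \<and>
     (\<exists>a b. 0 < a \<and> (\<forall>t. t \<notin> {a..b} \<longrightarrow> \<phi> t = 0))"

definition L2_loc :: "(real \<Rightarrow> real ^ 'n) \<Rightarrow> bool" where
  "L2_loc g \<longleftrightarrow>
     set_borel_measurable lebesgue {0..} g \<and>
     (\<forall>T>0. set_integrable lebesgue {0..T} (\<lambda>t. (norm (g t))\<^sup>2))"

(* gam belongs to H^1_loc([0, \<infinity>)) with weak derivative g. As pointwise values of gam are used,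
   gam is taken to be the continuous representative. *)
definition H1_loc_path :: "(real \<Rightarrow> real ^ 'n) \<Rightarrow> (real \<Rightarrow> real ^ 'n) \<Rightarrow> bool" where
  "H1_loc_path gam g \<longleftrightarrow>
     continuous_on {0..} gam \<and> L2_loc gam \<and> L2_loc g \<and>
     (\<forall>\<phi>. test_function \<phi> \<longrightarrow>
        (LINT t:{0..}|lebesgue. deriv \<phi> t *\<^sub>R gam t) = - (LINT t:{0..}|lebesgue. \<phi> t *\<^sub>R g t))"

(* The infimum of the empty set is \<infinity> in ereal. *)
definition exit_time :: "(real ^ 'n) set \<Rightarrow> (real \<Rightarrow> real ^ 'n) \<Rightarrow> ereal" where
  "exit_time \<Omega> gam = (INF \<tau>\<in>{\<tau>. \<tau> > 0 \<and> gam \<tau> \<notin> \<Omega>}. ereal \<tau>)"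

definition A_norm :: "(real ^ 'n \<Rightarrow> real ^ 'n ^ 'n) \<Rightarrow> real ^ 'n \<Rightarrow> real ^ 'n \<Rightarrow> real" where
  "A_norm A p w = sqrt ((matrix_inv (A p) *v w) \<bullet> w)"

definition A_dist ::
  "(real ^ 'n \<Rightarrow> real ^ 'n ^ 'n) \<Rightarrow> (real ^ 'n) set \<Rightarrow> (real ^ 'n) set \<Rightarrow> real ^ 'n \<Rightarrow> ennreal"
where
  "A_dist A \<Omega> \<T> x =
     Inf {(\<integral>\<^sup>+t\<in>{0..real_of_ereal (exit_time \<Omega> gam)}. ennreal (A_norm A (gam t) (g t)) \<partial>lebesgue)
          | gam g. H1_loc_path gam g \<and> gam 0 = x \<and>
              exit_time \<Omega> gam < \<infinity> \<and> gam (real_of_ereal (exit_time \<Omega> gam)) \<in> \<T>}"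

section \<open>Logarithm with value \<open>-\<infinity>\<close> at zero\<close>

(* The real function ln has ln 0 = 0, which would make -4 t ln |u| vanish at zeros of u. *)
definition elog :: "real \<Rightarrow> ereal" where
  "elog r = (if r \<le> 0 then - \<infinity> else ereal (ln r))"

end

theory Submission
  imports Defs
begin

text \<open>Barriers reduce the asymptotics to properties of the distance, without any existence theory.

  Upper bounds: a sup-convolution of \<open>d\<close> gives a semiconvex \<open>v\<close> close to \<open>d\<close> with
  \<open>\<langle>A \<nabla>v, \<nabla>v\<rangle> < 1\<close>, so \<open>M exp (t / \<epsilon>\<^sup>2 - v / \<epsilon>)\<close> is a supersolution for small \<open>\<epsilon>\<close>; the choice
  \<open>\<epsilon> = 2 t / d\<close> turns the exponent into \<open>- d\<^sup>2 / (4 t)\<close>. For the elliptic problem one uses that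
  \<open>exp (t / \<epsilon>\<^sup>2) U\<^sub>\<epsilon>\<close> solves the parabolic equation.

  Lower bounds: adding the upper barrier of the negative part of the data to \<open>u\<close> gives a
  nonnegative supersolution, which is bounded below by \<open>m exp (- a\<^sup>2 / (4 t))\<close> along any polygon of
  length less than \<open>a\<close> ending at a point with \<open>f > 0\<close>, by comparison with Gaussians frozen at
  successive centres. Where the two distances differ, the added barrier is exponentially smaller
  than this lower bound. A viscosity notion of subsolution copes with the nonsmooth barriers.\<close>

subsection \<open>Second order jets along lines\<close>

text \<open>The data change sign, so no lower barrier can be compared with the solution itself.
  Hence \<open>Hlow\<close> speaks of all nonnegative supersolutions at once, with constants fixed
  before the supersolution: the correction added to the solution depends on \<epsilon>, and the
  parabolic estimate takes \<epsilon> proportional to t, so a different supersolution is used at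
  every time. The second obstacle is the boundary. Distances are infima over paths inside the
  domain, so they are handled on \<open>\<Omega>\<close> only, and the boundary is approached along
  cone axes. The axes differ from chart to chart, so the upper barrier is glued from pieces on
  overlapping closed balls by taking the upper envelope. The Gaussian chain needs a strict
  inequality of order 1/t^2 in order to absorb terms of order 1/t. It is bought by inflating each
  length by a factor \<kappa> > 1 and by keeping the level a positive. The chain starts from a
  centre outside the closure of the domain, where nothing has to be known in advance.\<close>

definition deriv2_at :: "(real \<Rightarrow> real) \<Rightarrow> real \<Rightarrow> real \<Rightarrow> real \<Rightarrow> bool" where
  "deriv2_at h a h1 h2 \<longleftrightarrow> (\<exists>h'. (\<forall>\<^sub>F s in nhds a. (h has_real_derivative h' s) (at s)) \<and>
     h' a = h1 \<and> (h' has_real_derivative h2) (at a))"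

lemma deriv2_atI:
  assumes "\<And>s. (h has_real_derivative h' s) (at s)" "h' a = h1" "(h' has_real_derivative h2) (at a)"
  shows "deriv2_at h a h1 h2"
  unfolding deriv2_at_def using assms by (intro exI[of _ h']) auto

lemma deriv2_at_const: "deriv2_at (\<lambda>s. c) a 0 0"
  by (rule deriv2_atI[where h' = "\<lambda>s. 0"]) (auto intro!: derivative_eq_intros)

lemma deriv2_at_quadratic: "deriv2_at (\<lambda>s. c + s * p + s\<^sup>2 * q / 2) 0 p q"
  by (rule deriv2_atI[where h' = "\<lambda>s. p + s * q"]) (auto intro!: derivative_eq_intros)

lemma deriv2_at_add:
  assumes "deriv2_at f a f1 f2" "deriv2_at g a g1 g2"
  shows "deriv2_at (\<lambda>s. f s + g s) a (f1 + g1) (f2 + g2)"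
proof -
  from assms obtain f' g' where 1: "\<forall>\<^sub>F s in nhds a. (f has_real_derivative f' s) (at s)"
    "f' a = f1" "(f' has_real_derivative f2) (at a)"
    "\<forall>\<^sub>F s in nhds a. (g has_real_derivative g' s) (at s)"
    "g' a = g1" "(g' has_real_derivative g2) (at a)"
    unfolding deriv2_at_def by blast
  show ?thesis unfolding deriv2_at_def
  proof (intro exI[of _ "\<lambda>s. f' s + g' s"] conjI)
    show "\<forall>\<^sub>F s in nhds a. ((\<lambda>s. f s + g s) has_real_derivative f' s + g' s) (at s)"
      using 1(1,4) by eventually_elim (rule DERIV_add)
  qed (use 1 in \<open>auto intro!: derivative_eq_intros\<close>)
qed

lemma deriv2_at_cmult:
  assumes "deriv2_at f a f1 f2"
  shows "deriv2_at (\<lambda>s. c * f s) a (c * f1) (c * f2)"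
proof -
  from assms obtain f' where 1: "\<forall>\<^sub>F s in nhds a. (f has_real_derivative f' s) (at s)"
    "f' a = f1" "(f' has_real_derivative f2) (at a)"
    unfolding deriv2_at_def by blast
  show ?thesis unfolding deriv2_at_def
  proof (intro exI[of _ "\<lambda>s. c * f' s"] conjI)
    show "\<forall>\<^sub>F s in nhds a. ((\<lambda>s. c * f s) has_real_derivative c * f' s) (at s)"
      using 1(1) by eventually_elim (rule DERIV_cmult)
  qed (use 1 in \<open>auto intro!: derivative_eq_intros\<close>)
qed

lemma deriv2_at_compose:
  assumes F: "deriv2_at F (p a) F1 F2" and p: "deriv2_at p a p1 p2"
  shows "deriv2_at (\<lambda>s. F (p s)) a (F1 * p1) (F2 * p1\<^sup>2 + F1 * p2)"
proof -
  from F obtain F' where F': "\<forall>\<^sub>F s in nhds (p a). (F has_real_derivative F' s) (at s)"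
    "F' (p a) = F1" "(F' has_real_derivative F2) (at (p a))"
    unfolding deriv2_at_def by blast
  from p obtain p' where p': "\<forall>\<^sub>F s in nhds a. (p has_real_derivative p' s) (at s)"
    "p' a = p1" "(p' has_real_derivative p2) (at a)"
    unfolding deriv2_at_def by blast
  have pa: "(p has_real_derivative p1) (at a)"
    using eventually_nhds_x_imp_x[OF p'(1)] p'(2) by simp
  have "(p \<longlongrightarrow> p a) (nhds a)"
    using DERIV_isCont[OF pa] unfolding isCont_def tendsto_at_iff_tendsto_nhds .
  then have "\<forall>\<^sub>F s in nhds a. (F has_real_derivative F' (p s)) (at (p s))"
    using F'(1) unfolding filterlim_iff by blast
  with p'(1) have ev: "\<forall>\<^sub>F s in nhds a. ((\<lambda>s. F (p s)) has_real_derivative F' (p s) * p' s) (at s)"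
    by eventually_elim (rule DERIV_chain2)
  have "((\<lambda>s. F' (p s)) has_real_derivative F2 * p1) (at a)"
    by (rule DERIV_chain2[OF F'(3) pa])
  then have "((\<lambda>s. F' (p s) * p' s) has_real_derivative F2 * p1 * p' a + p2 * F' (p a)) (at a)"
    by (rule DERIV_mult[OF _ p'(3)])
  then show ?thesis unfolding deriv2_at_def
    using ev p'(2) F'(2)
    by (intro exI[of _ "\<lambda>s. F' (p s) * p' s"]) (auto simp: power2_eq_square algebra_simps)
qed

lemma deriv2_at_exp: "deriv2_at exp a (exp a) (exp a :: real)"
  by (rule deriv2_atI[where h' = exp]) (auto intro!: derivative_eq_intros)

text \<open>If \<open>h2\<close> were positive, \<open>h'\<close> would be positive just to the
  right of its zero \<open>a\<close>, and \<open>h\<close> would exceed \<open>h a\<close>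
  there.\<close>

lemma deriv2_at_local_max:
  assumes h: "deriv2_at h a h1 h2" and mx: "\<forall>\<^sub>F s in nhds a. h s \<le> h a"
  shows "h2 \<le> 0"
proof (rule ccontr)
  assume "\<not> h2 \<le> 0"
  from h obtain h' where h': "\<forall>\<^sub>F s in nhds a. (h has_real_derivative h' s) (at s)"
    "h' a = h1" "(h' has_real_derivative h2) (at a)"
    unfolding deriv2_at_def by blast
  from h'(1) mx have "\<forall>\<^sub>F s in nhds a. (h has_real_derivative h' s) (at s) \<and> h s \<le> h a"
    by eventually_elim auto
  then obtain d where d: "d > 0" "\<And>s. \<bar>s - a\<bar> < d \<Longrightarrow> (h has_real_derivative h' s) (at s) \<and> h s \<le> h a"
    unfolding eventually_nhds_metric dist_real_def by auto
  have "h' a = 0"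
    by (rule DERIV_local_max[of h "h' a" a d]) (use d in \<open>auto simp: abs_minus_commute\<close>)
  moreover obtain e where e: "e > 0" "\<And>s. 0 < s \<Longrightarrow> s < e \<Longrightarrow> h' a < h' (a + s)"
    using DERIV_pos_inc_right[OF h'(3)] \<open>\<not> h2 \<le> 0\<close> by auto
  ultimately have pos: "0 < h' s" if "a < s" "s < a + e" for s
    using e(2)[of "s - a"] that by simp
  define b where "b = a + min d e / 2"
  have b: "a < b" "b < a + d" "b < a + e" using d e unfolding b_def by auto
  have "h a < h b"
  proof (rule DERIV_pos_imp_increasing_open[OF b(1)])
    fix x assume "a < x" "x < b"
    then show "\<exists>y. DERIV h x :> y \<and> y > 0" using pos[of x] d(2)[of x] b by auto
  next
    show "continuous_on {a..b} h"
    proof (rule DERIV_atLeastAtMost_imp_continuous_on)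
      fix x assume "a \<le> x" "x \<le> b"
      then show "\<exists>y. DERIV h x :> y" using d(2)[of x] b by auto
    qed
  qed
  moreover have "h b \<le> h a" using d(2)[of b] b by auto
  ultimately show False by simp
qed

text \<open>Only restrictions to lines are recorded: the operator is a sum of second derivatives
  along the directions \<open>dir x k\<close>, so a test function is described without a gradient or
  a Hessian. No linearity of \<open>b\<close> or quadratic dependence of \<open>W\<close> is built
  in.\<close>

definition jet2 :: "('a::real_normed_vector \<Rightarrow> real) \<Rightarrow> 'a \<Rightarrow> ('a \<Rightarrow> real) \<Rightarrow> ('a \<Rightarrow> real) \<Rightarrow> bool" where
  "jet2 v x b W \<longleftrightarrow> (\<forall>\<xi>. deriv2_at (\<lambda>s. v (x + s *\<^sub>R \<xi>)) 0 (b \<xi>) (W \<xi>))"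

lemma jet2_const: "jet2 (\<lambda>y. c) x (\<lambda>\<xi>. 0) (\<lambda>\<xi>. 0)"
  unfolding jet2_def by (simp add: deriv2_at_const)

lemma jet2_add: "jet2 f x b W \<Longrightarrow> jet2 g x c V \<Longrightarrow> jet2 (\<lambda>y. f y + g y) x (\<lambda>\<xi>. b \<xi> + c \<xi>) (\<lambda>\<xi>. W \<xi> + V \<xi>)"
  unfolding jet2_def by (auto intro: deriv2_at_add)

lemma jet2_cmult: "jet2 f x b W \<Longrightarrow> jet2 (\<lambda>y. c * f y) x (\<lambda>\<xi>. c * b \<xi>) (\<lambda>\<xi>. c * W \<xi>)"
  unfolding jet2_def by (auto intro: deriv2_at_cmult)

lemma jet2_minus: "jet2 f x b W \<Longrightarrow> jet2 (\<lambda>y. - f y) x (\<lambda>\<xi>. - b \<xi>) (\<lambda>\<xi>. - W \<xi>)"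
  using jet2_cmult[of f x b W "-1"] by simp

lemma jet2_compose:
  assumes "deriv2_at F (p x) F1 F2" "jet2 p x b W"
  shows "jet2 (\<lambda>y. F (p y)) x (\<lambda>\<xi>. F1 * b \<xi>) (\<lambda>\<xi>. F2 * (b \<xi>)\<^sup>2 + F1 * W \<xi>)"
  unfolding jet2_def
proof
  fix \<xi>
  have "deriv2_at (\<lambda>s. F (p (x + s *\<^sub>R \<xi>))) 0 (F1 * b \<xi>) (F2 * (b \<xi>)\<^sup>2 + F1 * W \<xi>)"
    by (rule deriv2_at_compose[of F "\<lambda>s. p (x + s *\<^sub>R \<xi>)"]) (use assms in \<open>auto simp: jet2_def\<close>)
  then show "deriv2_at (\<lambda>s. F (p (x + s *\<^sub>R \<xi>))) 0 (F1 * b \<xi>) (F2 * (b \<xi>)\<^sup>2 + F1 * W \<xi>)" .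
qed

lemma jet2_exp:
  assumes "jet2 p x b W"
  shows "jet2 (\<lambda>y. exp (p y)) x (\<lambda>\<xi>. exp (p x) * b \<xi>) (\<lambda>\<xi>. exp (p x) * ((b \<xi>)\<^sup>2 + W \<xi>))"
  using jet2_compose[OF deriv2_at_exp assms] by (simp add: algebra_simps)

lemma jet2_power2:
  assumes "jet2 p x b W"
  shows "jet2 (\<lambda>y. (p y)\<^sup>2) x (\<lambda>\<xi>. 2 * p x * b \<xi>) (\<lambda>\<xi>. 2 * (b \<xi>)\<^sup>2 + 2 * p x * W \<xi>)"
proof -
  have "deriv2_at (\<lambda>s. s\<^sup>2) (p x) (2 * p x) 2"
    by (rule deriv2_atI[where h' = "\<lambda>s. 2 * s"]) (auto intro!: derivative_eq_intros)
  from jet2_compose[of "\<lambda>s. s\<^sup>2", OF this assms] show ?thesis .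
qed

lemma jet2_quadratic:
  assumes "\<And>s \<xi>. p (x + s *\<^sub>R \<xi>) = p x + s * b \<xi> + s\<^sup>2 * W \<xi> / 2"
  shows "jet2 p x b W"
  unfolding jet2_def assms by (simp add: deriv2_at_quadratic)

lemma jet2_local_max:
  assumes j: "jet2 f x b W" "jet2 g x c V" and mx: "\<forall>\<^sub>F y in nhds x. f y - g y \<le> f x - g x"
  shows "W \<xi> \<le> V \<xi>"
proof -
  have "deriv2_at (\<lambda>s. f (x + s *\<^sub>R \<xi>) + (-1) * g (x + s *\<^sub>R \<xi>)) 0 (b \<xi> + (-1) * c \<xi>) (W \<xi> + (-1) * V \<xi>)"
    using j by (intro deriv2_at_add deriv2_at_cmult) (auto simp: jet2_def)
  moreover have "((\<lambda>s. x + s *\<^sub>R \<xi>) \<longlongrightarrow> x + 0 *\<^sub>R \<xi>) (nhds 0)"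
    by (intro tendsto_intros filterlim_ident)
  then have "\<forall>\<^sub>F s in nhds 0. f (x + s *\<^sub>R \<xi>) - g (x + s *\<^sub>R \<xi>) \<le> f x - g x"
    using eventually_compose_filterlim[OF mx, of "\<lambda>s. x + s *\<^sub>R \<xi>" "nhds 0"] by simp
  ultimately have "W \<xi> + (-1) * V \<xi> \<le> 0"
    by (intro deriv2_at_local_max) auto
  then show ?thesis by simp
qed

text \<open>The maximum over a time interval may sit at its right end, so only earlier times are
  compared and only an inequality survives.\<close>

lemma deriv_backward_local_max:
  fixes f g :: "real \<Rightarrow> real"
  assumes "(f has_real_derivative f') (at t)" "(g has_real_derivative g') (at t)"
    and mx: "\<forall>\<^sub>F s in nhds t. s \<le> t \<longrightarrow> f s - g s \<le> f t - g t"
  shows "f' \<ge> g'"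
proof (rule ccontr)
  assume "\<not> f' \<ge> g'"
  have "((\<lambda>s. f s - g s) has_real_derivative f' - g') (at t)"
    using assms(1,2) by (rule DERIV_diff)
  then obtain e where e: "e > 0" "\<And>s. 0 < s \<Longrightarrow> s < e \<Longrightarrow> f t - g t < f (t - s) - g (t - s)"
    using DERIV_neg_dec_left[of "\<lambda>s. f s - g s" "f' - g'" t] \<open>\<not> f' \<ge> g'\<close> by auto
  obtain d where d: "d > 0" "\<And>s. \<bar>s - t\<bar> < d \<Longrightarrow> s \<le> t \<longrightarrow> f s - g s \<le> f t - g t"
    using mx unfolding eventually_nhds_metric dist_real_def by auto
  define s where "s = min d e / 2"
  have "0 < s" "s < e" "\<bar>(t - s) - t\<bar> < d" using d(1) e(1) unfolding s_def by auto
  then show False using e(2)[of s] d(2)[of "t - s"] by auto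
qed

subsection \<open>Classical derivatives\<close>

lemma frechet_derivative_grad:
  fixes v :: "real ^ 'n \<Rightarrow> real"
  assumes "v differentiable (at x)"
  shows "frechet_derivative v (at x) \<xi> = grad v x \<bullet> \<xi>"
proof -
  have "linear (frechet_derivative v (at x))"
    using assms by (rule linear_frechet_derivative)
  then have "frechet_derivative v (at x) (\<Sum>i\<in>UNIV. \<xi> $ i *\<^sub>R axis i 1)
      = (\<Sum>i\<in>UNIV. \<xi> $ i *\<^sub>R frechet_derivative v (at x) (axis i 1))"
    by (simp add: linear_sum linear_cmul)
  moreover have "(\<Sum>i\<in>UNIV. \<xi> $ i *\<^sub>R axis i 1) = \<xi>"
    using basis_expansion[of \<xi>] by (simp add: scalar_mult_eq_scaleR)
  ultimately show ?thesis
    by (simp add: grad_def inner_vec_def mult.commute)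
qed

lemma jet2_classical:
  fixes v :: "real ^ 'n \<Rightarrow> real"
  assumes v: "twice_differentiable_in v \<Omega>" and "open \<Omega>" "x \<in> \<Omega>"
  shows "jet2 v x (\<lambda>\<xi>. grad v x \<bullet> \<xi>) (\<lambda>\<xi>. (hessian v x *v \<xi>) \<bullet> \<xi>)"
  unfolding jet2_def deriv2_at_def
proof (intro allI exI conjI)
  fix \<xi> :: "real ^ 'n"
  have line: "((\<lambda>s. x + s *\<^sub>R \<xi>) has_derivative (\<lambda>h. h *\<^sub>R \<xi>)) (at s)" for s
    by (auto intro!: derivative_eq_intros)
  have "((\<lambda>s. x + s *\<^sub>R \<xi>) \<longlongrightarrow> x + 0 *\<^sub>R \<xi>) (nhds 0)"
    by (intro tendsto_intros filterlim_ident)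
  then have "\<forall>\<^sub>F s in nhds (0::real). x + s *\<^sub>R \<xi> \<in> \<Omega>"
    using \<open>open \<Omega>\<close> \<open>x \<in> \<Omega>\<close> by (simp add: topological_tendstoD)
  then show "\<forall>\<^sub>F s in nhds 0. ((\<lambda>s. v (x + s *\<^sub>R \<xi>)) has_real_derivative grad v (x + s *\<^sub>R \<xi>) \<bullet> \<xi>) (at s)"
  proof eventually_elim
    case (elim s)
    then have d: "v differentiable (at (x + s *\<^sub>R \<xi>))" using v by (auto simp: twice_differentiable_in_def)
    then have "(v has_derivative frechet_derivative v (at (x + s *\<^sub>R \<xi>))) (at (x + s *\<^sub>R \<xi>))"
      by (simp add: frechet_derivative_works)
    from has_derivative_compose[OF line this] show ?case
      unfolding has_field_derivative_def frechet_derivative_grad[OF d]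
      by (rule has_derivative_eq_rhs) (auto simp: fun_eq_iff)
  qed
  have "grad v differentiable (at x)" using v assms(3) by (auto simp: twice_differentiable_in_def)
  then have "(grad v has_derivative (\<lambda>h. hessian v x *v h)) (at x)"
    unfolding hessian_def by (rule jacobian_works[THEN iffD1])
  then have "((\<lambda>s. grad v (x + s *\<^sub>R \<xi>)) has_derivative (\<lambda>h. hessian v x *v (h *\<^sub>R \<xi>))) (at 0)"
    using has_derivative_compose[OF line[of 0], of "grad v" "\<lambda>h. hessian v x *v h"] by simp
  then have "((\<lambda>s. grad v (x + s *\<^sub>R \<xi>) \<bullet> \<xi>) has_derivative (\<lambda>h. (hessian v x *v (h *\<^sub>R \<xi>)) \<bullet> \<xi>)) (at 0)"
    by (rule has_derivative_inner_left)
  then show "((\<lambda>s. grad v (x + s *\<^sub>R \<xi>) \<bullet> \<xi>) has_real_derivative (hessian v x *v \<xi>) \<bullet> \<xi>) (at 0)"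
    unfolding has_field_derivative_def
    by (rule has_derivative_eq_rhs) (auto simp: fun_eq_iff matrix_vector_mult_scaleR)
qed simp

subsection \<open>Positive semidefinite matrices as sums of rank one matrices\<close>

text \<open>With a zero diagonal entry the form at \<open>?a - r *\<^sub>R ?e\<close> is affine in
  \<open>r\<close> with slope -2 |?a|^2, so a large \<open>r\<close> makes it negative; the
  \<open>r\<close> below gives the value -1.\<close>

lemma psd_zero_diagonal:
  fixes A :: "real ^ 'n ^ 'n"
  assumes sym: "transpose A = A" and psd: "\<And>\<xi>. (A *v \<xi>) \<bullet> \<xi> \<ge> 0" and z: "A $ i $ i = 0"
  shows "A *v axis i 1 = 0"
proof (rule ccontr)
  let ?e = "axis i 1 :: real ^ 'n" and ?a = "A *v axis i 1"
  assume "?a \<noteq> 0"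
  then have a: "?a \<bullet> ?a > 0" by simp
  have Ae: "?a \<bullet> ?e = 0"
    using z by (simp add: inner_axis matrix_vector_mult_basis column_def)
  have s: "(A *v y) \<bullet> z = y \<bullet> (A *v z)" for y z
    using sym by (metis dot_lmul_matrix vector_transpose_matrix inner_commute)
  define r where "r = ((A *v ?a) \<bullet> ?a + 1) / (2 * (?a \<bullet> ?a))"
  have "(A *v (?a - r *\<^sub>R ?e)) \<bullet> (?a - r *\<^sub>R ?e) = (A *v ?a) \<bullet> ?a - r * ((A *v ?a) \<bullet> ?e) - r * (?a \<bullet> ?a)
     + r * r * (?a \<bullet> ?e)"
    by (simp add: matrix_vector_mult_diff_distrib matrix_vector_mult_scaleR inner_diff_left inner_diff_right algebra_simps)
  also have "(A *v ?a) \<bullet> ?e = ?a \<bullet> ?a" by (rule s)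
  also have "r * (?a \<bullet> ?a) = ((A *v ?a) \<bullet> ?a + 1) / 2" using a by (simp add: r_def)
  finally show False using psd[of "?a - r *\<^sub>R ?e"] Ae by simp
qed

text \<open>One step of Cholesky elimination: the rank one matrix built from column \<open>i\<close>
  is removed. The remainder is nonnegative because its form is the minimum of the old form over
  translates of \<xi> along the i-th axis. The last clause keeps cleared rows cleared during the
  induction.\<close>

lemma psd_rank_one_step:
  fixes A :: "real ^ 'n ^ 'n"
  assumes sym: "transpose A = A" and psd: "\<And>\<xi>. (A *v \<xi>) \<bullet> \<xi> \<ge> 0" and z: "A $ i $ i \<noteq> 0"
  defines "a \<equiv> A *v axis i 1"
  defines "A' \<equiv> (\<chi> k l. A $ k $ l - a $ k * a $ l / A $ i $ i)"
  shows "transpose A' = A'" "(A' *v \<xi>) \<bullet> \<xi> = (A *v \<xi>) \<bullet> \<xi> - (a \<bullet> \<xi>)\<^sup>2 / A $ i $ i"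
    "(A' *v \<xi>) \<bullet> \<xi> \<ge> 0" "A' $ i $ l = 0" "A $ i $ i > 0"
    "A $ k = 0 \<Longrightarrow> A' $ k = 0"
proof -
  have ak: "a $ k = A $ k $ i" for k by (simp add: a_def matrix_vector_mult_basis column_def)
  have symk: "A $ k $ l = A $ l $ k" for k l using sym by (metis transpose_def vec_lambda_beta)
  have s: "(A *v y) \<bullet> z = y \<bullet> (A *v z)" for y z
    using sym by (metis dot_lmul_matrix vector_transpose_matrix inner_commute)
  show "transpose A' = A'" by (simp add: A'_def transpose_def vec_eq_iff symk mult.commute)
  show q: "(A' *v \<xi>) \<bullet> \<xi> = (A *v \<xi>) \<bullet> \<xi> - (a \<bullet> \<xi>)\<^sup>2 / A $ i $ i" for \<xi>
  proof -
    have "(A' *v \<xi>) $ k = (A *v \<xi>) $ k - a $ k * (a \<bullet> \<xi>) / A $ i $ i" for k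
    proof -
      have "(\<Sum>l\<in>UNIV. a $ k * a $ l / A $ i $ i * \<xi> $ l) = a $ k / A $ i $ i * (a \<bullet> \<xi>)"
        unfolding inner_vec_def sum_distrib_left by (intro sum.cong) auto
      then show ?thesis
        by (simp add: A'_def matrix_vector_mult_def left_diff_distrib sum_subtractf)
    qed
    then have "(A' *v \<xi>) = (A *v \<xi>) - ((a \<bullet> \<xi>) / A $ i $ i) *\<^sub>R a"
      by (simp add: vec_eq_iff)
    then show ?thesis by (simp add: inner_diff_left power2_eq_square)
  qed
  have eAe: "(A *v axis i 1) \<bullet> axis i 1 = A $ i $ i"
    by (simp add: inner_axis matrix_vector_mult_basis column_def)
  then show pos: "A $ i $ i > 0" using psd[of "axis i 1"] z by simp
  show "(A' *v \<xi>) \<bullet> \<xi> \<ge> 0"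
  proof -
    define r where "r = (a \<bullet> \<xi>) / A $ i $ i"
    have "0 \<le> (A *v (\<xi> - r *\<^sub>R axis i 1)) \<bullet> (\<xi> - r *\<^sub>R axis i 1)" by (rule psd)
    also have "\<dots> = (A *v \<xi>) \<bullet> \<xi> - r * ((A *v \<xi>) \<bullet> axis i 1) - r * (a \<bullet> \<xi>) + r * r * A $ i $ i"
      unfolding eAe[symmetric] a_def
      by (simp add: matrix_vector_mult_diff_distrib matrix_vector_mult_scaleR inner_diff_left inner_diff_right algebra_simps)
    also have "(A *v \<xi>) \<bullet> axis i 1 = a \<bullet> \<xi>" unfolding a_def by (metis s inner_commute)
    also have "r * r * A $ i $ i = r * (a \<bullet> \<xi>)" using z by (simp add: r_def)
    also have "(A *v \<xi>) \<bullet> \<xi> - r * (a \<bullet> \<xi>) - r * (a \<bullet> \<xi>) + r * (a \<bullet> \<xi>) = (A' *v \<xi>) \<bullet> \<xi>"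
      unfolding q r_def by (simp add: power2_eq_square)
    finally show ?thesis .
  qed
  show "A' $ i $ l = 0" using z by (simp add: A'_def ak symk)
  show "A $ k = 0 \<Longrightarrow> A' $ k = 0" by (simp add: A'_def ak vec_eq_iff)
qed

text \<open>Cholesky decomposition by induction on a set \<open>J\<close> that contains the indices
  of all nonzero rows; a zero diagonal entry contributes the zero vector.\<close>

lemma psd_sum_squares_aux:
  fixes A :: "real ^ 'n ^ 'n"
  assumes "finite J" "transpose A = A" "\<And>\<xi>. (A *v \<xi>) \<bullet> \<xi> \<ge> 0" "\<And>i. i \<notin> J \<Longrightarrow> A $ i = 0"
  shows "\<exists>b :: 'n \<Rightarrow> real ^ 'n. A = (\<chi> k l. \<Sum>j\<in>J. b j $ k * b j $ l)"
  using assms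
proof (induction J arbitrary: A rule: finite_induct)
  case empty
  then show ?case by (simp add: vec_eq_iff)
next
  case (insert i J)
  have symk: "A $ k $ l = A $ l $ k" for k l using insert.prems(1) by (metis transpose_def vec_lambda_beta)
  show ?case
  proof (cases "A $ i $ i = 0")
    case True
    have "A *v axis i 1 = 0" by (rule psd_zero_diagonal[OF insert.prems(1,2) True])
    then have "A $ i $ k = 0" for k using symk[of i k]
      by (metis column_def matrix_vector_mult_basis vec_lambda_beta zero_index)
    then have "A $ i = 0" by (simp add: vec_eq_iff)
    then have "A $ k = 0" if "k \<notin> J" for k using insert.prems(3)[of k] that by (cases "k = i") auto
    from insert.IH[OF insert.prems(1,2) this] obtain b :: "'n \<Rightarrow> real ^ 'n"
      where b: "A = (\<chi> k l. \<Sum>j\<in>J. b j $ k * b j $ l)" by blast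
    have "(\<Sum>j\<in>insert i J. (b(i := 0)) j $ k * (b(i := 0)) j $ l) = (\<Sum>j\<in>J. b j $ k * b j $ l)" for k l
      using insert.hyps by (auto intro!: sum.cong)
    then show ?thesis using b by (intro exI[of _ "b(i := 0)"]) (simp add: vec_eq_iff)
  next
    case False
    define a where "a = A *v axis i 1"
    define A' where "A' = (\<chi> k l. A $ k $ l - a $ k * a $ l / A $ i $ i)"
    note st = psd_rank_one_step[OF insert.prems(1,2) False, folded a_def, folded A'_def]
    have "A' $ k = 0" if "k \<notin> J" for k
      using insert.prems(3)[of k] st(4,6) that by (cases "k = i") (auto simp: vec_eq_iff)
    from insert.IH[OF st(1,3) this] obtain b :: "'n \<Rightarrow> real ^ 'n"
      where b: "A' = (\<chi> k l. \<Sum>j\<in>J. b j $ k * b j $ l)" by blast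
    define b' where "b' = b(i := (1 / sqrt (A $ i $ i)) *\<^sub>R a)"
    have "(\<Sum>j\<in>insert i J. b' j $ k * b' j $ l) = A $ k $ l" for k l
    proof -
      have "(\<Sum>j\<in>insert i J. b' j $ k * b' j $ l) = a $ k * a $ l / A $ i $ i + (\<Sum>j\<in>J. b' j $ k * b' j $ l)"
        using insert.hyps st(5) by (simp add: b'_def)
      also have "(\<Sum>j\<in>J. b' j $ k * b' j $ l) = (\<Sum>j\<in>J. b j $ k * b j $ l)"
        using insert.hyps by (auto intro!: sum.cong simp: b'_def)
      also have "\<dots> = A' $ k $ l" by (simp add: b)
      finally show ?thesis by (simp add: A'_def)
    qed
    then show ?thesis by (intro exI[of _ b']) (simp add: vec_eq_iff)
  qed
qed

lemma sum_swap3: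
  "(\<Sum>k\<in>A. \<Sum>l\<in>B. \<Sum>j\<in>C. X k l j) = (\<Sum>j\<in>C. \<Sum>l\<in>B. \<Sum>k\<in>A. X k l j)"
proof -
  have "(\<Sum>k\<in>A. \<Sum>l\<in>B. \<Sum>j\<in>C. X k l j) = (\<Sum>l\<in>B. \<Sum>k\<in>A. \<Sum>j\<in>C. X k l j)" by (rule sum.swap)
  also have "\<dots> = (\<Sum>l\<in>B. \<Sum>j\<in>C. \<Sum>k\<in>A. X k l j)" by (intro sum.cong refl sum.swap)
  also have "\<dots> = (\<Sum>j\<in>C. \<Sum>l\<in>B. \<Sum>k\<in>A. X k l j)" by (rule sum.swap)
  finally show ?thesis .
qed

lemma psd_sum_squares:
  fixes A :: "real ^ 'n ^ 'n"
  assumes "transpose A = A" "\<And>\<xi>. (A *v \<xi>) \<bullet> \<xi> \<ge> 0"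
  obtains b :: "'n \<Rightarrow> real ^ 'n" where
    "\<And>H. trace (A ** H) = (\<Sum>j\<in>UNIV. (H *v b j) \<bullet> b j)"
    "\<And>\<zeta>. (A *v \<zeta>) \<bullet> \<zeta> = (\<Sum>j\<in>UNIV. (\<zeta> \<bullet> b j)\<^sup>2)"
proof -
  from psd_sum_squares_aux[of UNIV A] assms obtain b :: "'n \<Rightarrow> real ^ 'n"
    where b: "A = (\<chi> k l. \<Sum>j\<in>UNIV. b j $ k * b j $ l)" by auto
  have "trace (A ** H) = (\<Sum>j\<in>UNIV. (H *v b j) \<bullet> b j)" for H
  proof -
    have "trace (A ** H) = (\<Sum>k\<in>UNIV. \<Sum>l\<in>UNIV. \<Sum>j\<in>UNIV. H $ l $ k * b j $ k * b j $ l)"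
      unfolding b trace_def matrix_matrix_mult_def by (simp add: sum_distrib_left sum_distrib_right mult_ac)
    also have "\<dots> = (\<Sum>j\<in>UNIV. \<Sum>l\<in>UNIV. \<Sum>k\<in>UNIV. H $ l $ k * b j $ k * b j $ l)"
      by (rule sum_swap3)
    also have "\<dots> = (\<Sum>j\<in>UNIV. (H *v b j) \<bullet> b j)"
      unfolding inner_vec_def matrix_vector_mult_def by (simp add: sum_distrib_left sum_distrib_right mult_ac)
    finally show ?thesis .
  qed
  moreover have "(A *v \<zeta>) \<bullet> \<zeta> = (\<Sum>j\<in>UNIV. (\<zeta> \<bullet> b j)\<^sup>2)" for \<zeta>
  proof -
    have "(A *v \<zeta>) \<bullet> \<zeta> = (\<Sum>k\<in>UNIV. \<Sum>l\<in>UNIV. \<Sum>j\<in>UNIV. \<zeta> $ k * b j $ k * \<zeta> $ l * b j $ l)"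
      unfolding b inner_vec_def matrix_vector_mult_def by (simp add: sum_distrib_left sum_distrib_right mult_ac)
    also have "\<dots> = (\<Sum>j\<in>UNIV. \<Sum>k\<in>UNIV. \<Sum>l\<in>UNIV. \<zeta> $ k * b j $ k * \<zeta> $ l * b j $ l)"
      by (subst sum_swap3) (intro sum.cong refl sum.swap)
    also have "\<dots> = (\<Sum>j\<in>UNIV. (\<zeta> \<bullet> b j)\<^sup>2)"
      by (simp add: power2_eq_square inner_vec_def sum_product mult_ac)
    finally show ?thesis .
  qed
  ultimately show thesis by (rule that)
qed

text \<open>The norm of a matrix is here the Euclidean norm of its entries (Frobenius), so
  Cauchy-Schwarz is applied row by row.\<close>

lemma norm_matrix_vector_le:
  fixes A :: "real ^ 'n ^ 'm"
  shows "norm (A *v x) \<le> norm A * norm x"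
proof -
  have "norm (A *v x) \<le> L2_set (\<lambda>i. norm (A $ i) * norm x) UNIV"
    unfolding norm_vec_def[of "A *v x"]
    by (rule L2_set_mono) (auto simp: matrix_vector_mul_component intro: Cauchy_Schwarz_ineq2)
  also have "\<dots> = norm A * norm x"
    unfolding norm_vec_def[of A] by (rule L2_set_left_distrib[symmetric]) simp
  finally show ?thesis .
qed

subsection \<open>The norm given by the coefficient matrix\<close>

locale elliptic_coefficients =
  fixes A :: "real ^ 'n \<Rightarrow> real ^ 'n ^ 'n"
  assumes sym: "\<And>x. transpose (A x) = A x"
    and reg: "coeff_regular A"
    and ell: "uniformly_elliptic A"
begin

definition lam :: real where
  "lam = (SOME c. c > 0 \<and> (\<forall>x \<xi>. (A x *v \<xi>) \<bullet> \<xi> \<ge> c * (norm \<xi>)\<^sup>2))"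

lemma lam: "lam > 0" "(A x *v \<xi>) \<bullet> \<xi> \<ge> lam * (norm \<xi>)\<^sup>2"
proof -
  have "lam > 0 \<and> (\<forall>x \<xi>. (A x *v \<xi>) \<bullet> \<xi> \<ge> lam * (norm \<xi>)\<^sup>2)"
    unfolding lam_def using ell unfolding uniformly_elliptic_def by (rule someI_ex)
  then show "lam > 0" "(A x *v \<xi>) \<bullet> \<xi> \<ge> lam * (norm \<xi>)\<^sup>2" by auto
qed

lemma A_psd: "(A x *v \<xi>) \<bullet> \<xi> \<ge> 0"
  by (rule order_trans[OF _ lam(2)]) (use lam(1) in simp)

lemma A_sym_inner: "(A x *v y) \<bullet> z = y \<bullet> (A x *v z)"
  using sym[of x] by (metis dot_lmul_matrix vector_transpose_matrix inner_commute)

lemma continuous_A: "continuous_on S A"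
  using reg unfolding coeff_regular_def
  by (meson continuous_at_imp_continuous_on differentiable_imp_continuous_within)

lemma A_inverse: "A p ** matrix_inv (A p) = mat 1" "matrix_inv (A p) ** A p = mat 1"
proof -
  have "x = 0" if "A p *v x = 0" for x
  proof -
    have "lam * (norm x)\<^sup>2 \<le> 0" using lam(2)[of x p] that by simp
    then show "x = 0" using lam(1) by (simp add: mult_le_0_iff)
  qed
  then have "invertible (A p)"
    by (simp add: invertible_left_inverse matrix_left_invertible_ker)
  then have "\<exists>B. A p ** B = mat 1 \<and> B ** A p = mat 1"
    unfolding invertible_def .
  from someI_ex[OF this] show "A p ** matrix_inv (A p) = mat 1" "matrix_inv (A p) ** A p = mat 1"
    unfolding matrix_inv_def by auto
qed

abbreviation Ai :: "real ^ 'n \<Rightarrow> real ^ 'n \<Rightarrow> real ^ 'n" where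
  "Ai p w \<equiv> matrix_inv (A p) *v w"

lemma A_Ai [simp]: "A p *v Ai p w = w"
  by (simp add: matrix_vector_mul_assoc A_inverse)

lemma Ai_A [simp]: "Ai p (A p *v w) = w"
  by (simp add: matrix_vector_mul_assoc A_inverse)

lemma Ai_form: "Ai p w \<bullet> w = (A p *v Ai p w) \<bullet> Ai p w"
  by (simp add: inner_commute)

lemma Ai_sym: "Ai p v \<bullet> w = v \<bullet> Ai p w"
  using A_sym_inner[of p "Ai p v" "Ai p w"] by simp

lemma A_norm_square: "(A_norm A p w)\<^sup>2 = Ai p w \<bullet> w"
  unfolding A_norm_def using A_psd[of p "Ai p w"] by (simp add: Ai_form[symmetric] inner_commute)

lemma A_norm_nonneg [simp]: "A_norm A p w \<ge> 0"
  unfolding A_norm_def using A_psd[of p "Ai p w"] by (simp add: Ai_form[symmetric] inner_commute)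

lemma A_norm_Ai: "lam * (norm (Ai p w))\<^sup>2 \<le> (A_norm A p w)\<^sup>2"
  unfolding A_norm_square Ai_form by (rule lam)

lemma norm_Ai_le: "sqrt lam * norm (Ai p w) \<le> A_norm A p w"
  using A_norm_Ai[of p w] lam(1)
  by (auto simp: power_mult_distrib intro: power2_le_imp_le[of "sqrt lam * norm (Ai p w)"])

lemma A_norm_scale: "A_norm A p (r *\<^sub>R w) = \<bar>r\<bar> * A_norm A p w"
proof -
  have "Ai p (r *\<^sub>R w) \<bullet> (r *\<^sub>R w) = r\<^sup>2 * (Ai p w \<bullet> w)"
    by (simp add: matrix_vector_mult_scaleR power2_eq_square)
  then show ?thesis by (simp add: A_norm_def real_sqrt_mult)
qed

lemma A_norm_minus: "A_norm A p (- w) = A_norm A p w"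
  using A_norm_scale[of p "-1" w] by simp

lemma A_norm_minus_commute: "A_norm A p (v - w) = A_norm A p (w - v)"
  using A_norm_minus[of p "v - w"] by simp

lemma A_norm_zero [simp]: "A_norm A p 0 = 0"
  by (simp add: A_norm_def)

definition Cn :: real where "Cn = 1 / sqrt lam"

lemma Cn_pos: "Cn > 0" using lam(1) by (simp add: Cn_def)

lemma A_norm_le: "A_norm A p w \<le> Cn * norm w"
proof -
  have "(A_norm A p w)\<^sup>2 \<le> norm (Ai p w) * norm w"
    unfolding A_norm_square by (rule norm_cauchy_schwarz)
  also have "\<dots> \<le> (Cn * A_norm A p w) * norm w"
    using norm_Ai_le[of p w] lam(1) by (intro mult_right_mono) (auto simp: Cn_def field_simps)
  finally have "A_norm A p w * A_norm A p w \<le> A_norm A p w * (Cn * norm w)"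
    by (simp add: power2_eq_square mult_ac)
  then show ?thesis
    using Cn_pos by (cases "A_norm A p w = 0") (auto simp: less_le)
qed

lemma norm_le_A_norm: "norm w \<le> norm (A p) * Cn * A_norm A p w"
proof -
  have "norm w \<le> norm (A p) * norm (Ai p w)"
    using norm_matrix_vector_le[of "A p" "Ai p w"] by simp
  also have "\<dots> \<le> norm (A p) * (Cn * A_norm A p w)"
    using norm_Ai_le[of p w] lam(1) by (intro mult_left_mono) (auto simp: Cn_def field_simps)
  finally show ?thesis by (simp add: mult.assoc)
qed

text \<open>The inverses are compared through A_p^-1 - A_q^-1 = A_p^-1 (A_q - A_p) A_q^-1, and
  ellipticity turns both outer factors into A-norms of \<open>w\<close>. This gives a^2 - b^2 \<le>
  e a b, which forces a \<le> (1 + e) b.\<close>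

lemma A_norm_compare: "A_norm A p w \<le> (1 + norm (A p - A q) / lam) * A_norm A q w"
proof -
  let ?a = "A_norm A p w" and ?b = "A_norm A q w" and ?e = "norm (A p - A q) / lam"
  have "?a\<^sup>2 - ?b\<^sup>2 = Ai p w \<bullet> (A q *v Ai q w) - Ai q w \<bullet> (A p *v Ai p w)"
    by (simp add: A_norm_square)
  also have "\<dots> = Ai p w \<bullet> ((A q - A p) *v Ai q w)"
    by (simp add: matrix_vector_mult_diff_rdistrib inner_diff_right A_sym_inner[symmetric] inner_commute)
  also have "\<dots> \<le> norm (Ai p w) * (norm (A q - A p) * norm (Ai q w))"
    by (rule order_trans[OF norm_cauchy_schwarz mult_left_mono[OF norm_matrix_vector_le]]) simp
  also have "\<dots> \<le> (Cn * ?a) * (norm (A q - A p) * (Cn * ?b))"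
    using norm_Ai_le[of p w] norm_Ai_le[of q w] lam(1) Cn_pos
    by (intro mult_mono) (auto simp: Cn_def field_simps)
  also have "\<dots> = ?e * ?a * ?b"
  proof -
    have "Cn * Cn = 1 / lam" using lam(1) by (simp add: Cn_def)
    then have "Cn * ?a * (norm (A q - A p) * (Cn * ?b)) = (1 / lam) * (?a * norm (A q - A p) * ?b)"
      by (metis (no_types, lifting) mult.assoc mult.left_commute)
    then show ?thesis by (simp add: norm_minus_commute mult_ac)
  qed
  finally have *: "?a\<^sup>2 \<le> ?b\<^sup>2 + ?e * ?a * ?b" by simp
  have e: "?e \<ge> 0" using lam(1) by simp
  show ?thesis
  proof (rule ccontr)
    assume "\<not> ?thesis"
    then have gt: "?a > ?b + ?e * ?b" by (simp add: algebra_simps)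
    moreover have "?e * ?b \<ge> 0" using e by (intro mult_nonneg_nonneg) simp_all
    ultimately have "?a > ?b" by linarith
    moreover have "?b \<ge> 0" by simp
    moreover from calculation have "?a > 0" by linarith
    ultimately have "?a * ?a > ?a * (?b + ?e * ?b)" "?a * ?b \<ge> ?b * ?b"
      using gt by (auto intro!: mult_right_mono mult_strict_left_mono simp del: times_divide_eq_left)
    with * show False by (simp add: power2_eq_square algebra_simps)
  qed
qed

lemma A_near:
  assumes "compact K" "e > 0"
  obtains \<rho> where "\<rho> > 0" "\<And>p q. p \<in> K \<Longrightarrow> q \<in> K \<Longrightarrow> norm (p - q) < \<rho> \<Longrightarrow> norm (A p - A q) < e"
  using compact_uniformly_continuous[OF continuous_A[of K] assms(1)] assms(2)
  unfolding uniformly_continuous_on_def dist_norm by (metis norm_minus_commute)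

lemma A_norm_near:
  assumes "compact K" "\<kappa> > 1"
  obtains \<rho> where "\<rho> > 0" "\<And>p q w. p \<in> K \<Longrightarrow> q \<in> K \<Longrightarrow> norm (p - q) < \<rho> \<Longrightarrow> A_norm A p w \<le> \<kappa> * A_norm A q w"
proof -
  have "(\<kappa> - 1) * lam > 0" using lam(1) assms(2) by simp
  from A_near[OF assms(1) this] obtain \<rho> where r: "\<rho> > 0"
    "\<And>p q. p \<in> K \<Longrightarrow> q \<in> K \<Longrightarrow> norm (p - q) < \<rho> \<Longrightarrow> norm (A p - A q) < (\<kappa> - 1) * lam" by blast
  show thesis
  proof (rule that[OF r(1)])
    fix p q w assume "p \<in> K" "q \<in> K" "norm (p - q) < \<rho>"
    then have "1 + norm (A p - A q) / lam \<le> \<kappa>"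
      using r(2)[of p q] lam(1) by (simp add: field_simps)
    then show "A_norm A p w \<le> \<kappa> * A_norm A q w"
      using A_norm_compare[of p w q] by (meson A_norm_nonneg mult_right_mono order_trans)
  qed
qed

lemma continuous_A_norm_right: "continuous_on S (\<lambda>w. A_norm A p w)"
proof -
  have "continuous_on S (\<lambda>w. matrix_inv (A p) *v w)"
    by (intro linear_continuous_on linear_linear[THEN iffD2] matrix_vector_mul_bounded_linear)
  then show ?thesis unfolding A_norm_def by (intro continuous_intros)
qed

text \<open>Joint continuity makes the length integrand of a path measurable. A change of the base
  point is handled by \<open>A_norm_compare\<close>, whose error is linear in the norm of the
  vector.\<close>

lemma continuous_A_norm: "continuous_on UNIV (\<lambda>x. A_norm A (fst x) (snd x))"
proof (intro continuous_at_imp_continuous_on ballI)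
  fix x0 :: "(real ^ 'n) \<times> (real ^ 'n)"
  obtain p0 w0 where x0: "x0 = (p0, w0)" by (cases x0)
  have tp: "((\<lambda>x. A (fst x)) \<longlongrightarrow> A p0) (at x0)"
    by (rule tendsto_compose[where f = fst and g = A and l = p0])
      (use continuous_A[of UNIV] x0 in \<open>auto simp: continuous_on_eq_continuous_at isCont_def intro!: tendsto_eq_intros\<close>)
  have tw: "((\<lambda>x. A_norm A p0 (snd x)) \<longlongrightarrow> A_norm A p0 w0) (at x0)"
    by (rule tendsto_compose[where f = snd and g = "A_norm A p0" and l = w0])
      (use continuous_A_norm_right[of UNIV p0] x0 in \<open>auto simp: continuous_on_eq_continuous_at isCont_def intro!: tendsto_eq_intros\<close>)
  define e where "e x = norm (A (fst x) - A p0) / lam * (Cn * norm (snd x))" for x :: "(real ^ 'n) \<times> (real ^ 'n)"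
  have te: "(e \<longlongrightarrow> norm (A p0 - A p0) / lam * (Cn * norm w0)) (at x0)"
    unfolding e_def using lam(1) x0 by (intro tendsto_intros tp) (auto intro!: tendsto_eq_intros)
  have bd: "norm (A_norm A (fst x) (snd x) - A_norm A p0 (snd x)) \<le> e x" for x
  proof -
    have 1: "A_norm A q w - A_norm A q' w \<le> norm (A q - A q') / lam * (Cn * norm w)" for q q' w
    proof -
      have "A_norm A q w - A_norm A q' w \<le> norm (A q - A q') / lam * A_norm A q' w"
        using A_norm_compare[of q w q'] by (simp add: algebra_simps)
      also have "\<dots> \<le> norm (A q - A q') / lam * (Cn * norm w)"
        using lam(1) by (intro mult_left_mono A_norm_le) auto
      finally show ?thesis .
    qed
    show ?thesis using 1[of "fst x" "snd x" p0] 1[of p0 "snd x" "fst x"]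
      by (simp add: e_def norm_minus_commute abs_le_iff)
  qed
  have "((\<lambda>x. A_norm A (fst x) (snd x) - A_norm A p0 (snd x)) \<longlongrightarrow> 0) (at x0)"
    by (rule Lim_null_comparison[OF always_eventually[OF allI[OF bd]]]) (use te in simp)
  from tendsto_add[OF this tw] show "isCont (\<lambda>x. A_norm A (fst x) (snd x)) x0"
    by (simp add: isCont_def x0)
qed

lemma A_norm_Cauchy_Schwarz: "\<bar>Ai p v \<bullet> w\<bar> \<le> A_norm A p v * A_norm A p w"
proof -
  have q: "0 \<le> (A_norm A p v)\<^sup>2 - 2 * r * (Ai p v \<bullet> w) + r\<^sup>2 * (A_norm A p w)\<^sup>2" for r
  proof -
    have "0 \<le> (A_norm A p (v - r *\<^sub>R w))\<^sup>2" by simp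
    also have "\<dots> = (A_norm A p v)\<^sup>2 - 2 * r * (Ai p v \<bullet> w) + r\<^sup>2 * (A_norm A p w)\<^sup>2"
      unfolding A_norm_square
      by (simp add: matrix_vector_mult_diff_distrib matrix_vector_mult_scaleR inner_diff_left inner_diff_right
          Ai_sym[of p w v] inner_commute[of w] power2_eq_square algebra_simps)
    finally show ?thesis .
  qed
  show ?thesis
  proof (cases "A_norm A p w = 0")
    case True
    then have "norm w = 0" using norm_le_A_norm[of w p] by simp
    then show ?thesis by simp
  next
    case False
    then have pos: "(A_norm A p w)\<^sup>2 > 0" by simp
    define r where "r = (Ai p v \<bullet> w) / (A_norm A p w)\<^sup>2"
    have "2 * r * (Ai p v \<bullet> w) - r\<^sup>2 * (A_norm A p w)\<^sup>2 = (Ai p v \<bullet> w)\<^sup>2 / (A_norm A p w)\<^sup>2"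
      using pos by (simp add: r_def field_simps power2_eq_square)
    with q[of r] have "(Ai p v \<bullet> w)\<^sup>2 / (A_norm A p w)\<^sup>2 \<le> (A_norm A p v)\<^sup>2" by linarith
    then have "(Ai p v \<bullet> w)\<^sup>2 \<le> (A_norm A p v * A_norm A p w)\<^sup>2"
      using pos by (simp add: field_simps power_mult_distrib)
    then show ?thesis by (metis abs_le_square_iff abs_of_nonneg A_norm_nonneg mult_nonneg_nonneg)
  qed
qed

text \<open>The columns of a square root of \<open>A x\<close>: second order operators with principal part \<open>A x\<close>
  are sums of second derivatives along these directions.\<close>

definition dir :: "real ^ 'n \<Rightarrow> 'n \<Rightarrow> real ^ 'n" where
  "dir x = (SOME b. (\<forall>H. trace (A x ** H) = (\<Sum>j\<in>UNIV. (H *v b j) \<bullet> b j)) \<and>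
     (\<forall>\<zeta>. (A x *v \<zeta>) \<bullet> \<zeta> = (\<Sum>j\<in>UNIV. (\<zeta> \<bullet> b j)\<^sup>2)))"

lemma trace_dir: "trace (A x ** H) = (\<Sum>j\<in>UNIV. (H *v dir x j) \<bullet> dir x j)"
  and form_dir: "(A x *v \<zeta>) \<bullet> \<zeta> = (\<Sum>j\<in>UNIV. (\<zeta> \<bullet> dir x j)\<^sup>2)"
proof -
  have "\<exists>b :: 'n \<Rightarrow> real ^ 'n. (\<forall>H. trace (A x ** H) = (\<Sum>j\<in>UNIV. (H *v b j) \<bullet> b j)) \<and>
     (\<forall>\<zeta>. (A x *v \<zeta>) \<bullet> \<zeta> = (\<Sum>j\<in>UNIV. (\<zeta> \<bullet> b j)\<^sup>2))"
  proof (rule psd_sum_squares[OF sym[of x] A_psd])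
    fix b :: "'n \<Rightarrow> real ^ 'n" assume "\<And>H. trace (A x ** H) = (\<Sum>j\<in>UNIV. (H *v b j) \<bullet> b j)"
      "\<And>\<zeta>. (A x *v \<zeta>) \<bullet> \<zeta> = (\<Sum>j\<in>UNIV. (\<zeta> \<bullet> b j)\<^sup>2)"
    then show ?thesis by (intro exI[of _ b]) simp
  qed
  from someI_ex[OF this, folded dir_def]
  show "trace (A x ** H) = (\<Sum>j\<in>UNIV. (H *v dir x j) \<bullet> dir x j)"
    "(A x *v \<zeta>) \<bullet> \<zeta> = (\<Sum>j\<in>UNIV. (\<zeta> \<bullet> dir x j)\<^sup>2)" by auto
qed

lemma sum_norm_dir: "(\<Sum>j\<in>UNIV. (norm (dir x j))\<^sup>2) = trace (A x)"
  using trace_dir[of x "mat 1"] by (simp add: power2_norm_eq_inner)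

lemma trace_bound:
  assumes "bounded K"
  obtains C where "C > 0" "\<forall>x\<in>K. trace (A x) \<le> C" "\<forall>x\<in>K. norm (A x) \<le> C"
proof -
  have "continuous_on (closure K) (\<lambda>x. trace (A x))"
    unfolding trace_def by (intro continuous_intros continuous_A)
  moreover have "compact (closure K)" using assms by (simp add: compact_closure)
  ultimately have "bounded ((\<lambda>x. trace (A x)) ` closure K)" "bounded (A ` closure K)"
    using compact_imp_bounded compact_continuous_image continuous_A by blast+
  then obtain C1 C2 where C: "\<And>x. x \<in> closure K \<Longrightarrow> \<bar>trace (A x)\<bar> \<le> C1" "\<And>x. x \<in> closure K \<Longrightarrow> norm (A x) \<le> C2"
    unfolding bounded_iff by auto
  show thesis
  proof (rule that[of "max 1 (max C1 C2)"])
    show "\<forall>x\<in>K. trace (A x) \<le> max 1 (max C1 C2)" "\<forall>x\<in>K. norm (A x) \<le> max 1 (max C1 C2)"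
      using C closure_subset[of K] by fastforce+
  qed simp
qed

lemma form_le: "(A x *v \<zeta>) \<bullet> \<zeta> \<le> norm (A x) * (norm \<zeta>)\<^sup>2"
proof -
  have "(A x *v \<zeta>) \<bullet> \<zeta> \<le> norm (A x *v \<zeta>) * norm \<zeta>" by (rule norm_cauchy_schwarz)
  also have "\<dots> \<le> norm (A x) * norm \<zeta> * norm \<zeta>" by (intro mult_right_mono norm_matrix_vector_le) simp
  finally show ?thesis by (simp add: power2_eq_square mult.assoc)
qed

lemma form_diff: "\<bar>(A x *v \<zeta>) \<bullet> \<zeta> - (A y *v \<zeta>) \<bullet> \<zeta>\<bar> \<le> norm (A x - A y) * (norm \<zeta>)\<^sup>2"
proof -
  have "\<bar>(A x *v \<zeta>) \<bullet> \<zeta> - (A y *v \<zeta>) \<bullet> \<zeta>\<bar> = \<bar>((A x - A y) *v \<zeta>) \<bullet> \<zeta>\<bar>"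
    by (simp add: matrix_vector_mult_diff_rdistrib inner_diff_left)
  also have "\<dots> \<le> norm ((A x - A y) *v \<zeta>) * norm \<zeta>" by (rule Cauchy_Schwarz_ineq2)
  also have "\<dots> \<le> norm (A x - A y) * norm \<zeta> * norm \<zeta>" by (intro mult_right_mono norm_matrix_vector_le) simp
  finally show ?thesis by (simp add: power2_eq_square mult.assoc)
qed

end

subsection \<open>Cut-off functions and increments of paths with a weak derivative\<close>

text \<open>\<open>smooth_upto n\<close> asks for \<open>n + 1\<close> derivatives. The recursion
  passes to \<open>deriv f\<close>, which suits the sum, product and chain rules;
  \<open>smooth_upto_iterate\<close> returns to the iterates that occur in
  \<open>test_function\<close>.\<close>

fun smooth_upto :: "nat \<Rightarrow> (real \<Rightarrow> real) \<Rightarrow> bool" where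
  "smooth_upto 0 f \<longleftrightarrow> (\<forall>t. f differentiable (at t))"
| "smooth_upto (Suc n) f \<longleftrightarrow> (\<forall>t. f differentiable (at t)) \<and> smooth_upto n (deriv f)"

lemma smooth_upto_differentiable: "smooth_upto n f \<Longrightarrow> f differentiable (at t)"
  by (cases n) auto

lemma smooth_upto_DERIV: "smooth_upto n f \<Longrightarrow> (f has_real_derivative deriv f t) (at t)"
  using smooth_upto_differentiable[of n f t] by (simp add: DERIV_deriv_iff_real_differentiable)

lemma smooth_upto_Suc_imp: "smooth_upto (Suc n) f \<Longrightarrow> smooth_upto n f"
  by (induction n arbitrary: f) auto

lemma smooth_upto_iterate: "smooth_upto n f \<Longrightarrow> ((deriv ^^ n) f) differentiable (at t)"
  by (induction n arbitrary: f) (auto simp: funpow_Suc_right simp del: funpow.simps)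

lemma smooth_uptoI_DERIV:
  assumes "\<And>t. (f has_real_derivative f' t) (at t)" "smooth_upto n f'"
  shows "smooth_upto (Suc n) f"
proof -
  have "deriv f = f'" using assms(1) by (auto intro!: DERIV_imp_deriv)
  then show ?thesis using assms by (auto simp: real_differentiable_def)
qed

lemma smooth_upto_add: "smooth_upto n f \<Longrightarrow> smooth_upto n g \<Longrightarrow> smooth_upto n (\<lambda>t. f t + g t)"
proof (induction n arbitrary: f g)
  case (Suc n)
  show ?case
    by (rule smooth_uptoI_DERIV[where f' = "\<lambda>t. deriv f t + deriv g t"])
      (use Suc in \<open>auto intro!: DERIV_add simp: DERIV_deriv_iff_real_differentiable\<close>)
qed auto

lemma smooth_upto_mult: "smooth_upto n f \<Longrightarrow> smooth_upto n g \<Longrightarrow> smooth_upto n (\<lambda>t. f t * g t)"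
proof (induction n arbitrary: f g)
  case (Suc n)
  have *: "smooth_upto n f" "smooth_upto n g" using Suc.prems by (auto intro: smooth_upto_Suc_imp)
  show ?case
  proof (rule smooth_uptoI_DERIV[where f' = "\<lambda>t. deriv f t * g t + deriv g t * f t"])
    show "((\<lambda>t. f t * g t) has_real_derivative deriv f t * g t + deriv g t * f t) (at t)" for t
      using Suc.prems by (intro DERIV_mult) (auto simp: DERIV_deriv_iff_real_differentiable)
    show "smooth_upto n (\<lambda>t. deriv f t * g t + deriv g t * f t)"
      using Suc * by (intro smooth_upto_add Suc.IH) auto
  qed
qed auto

lemma smooth_upto_const: "smooth_upto n (\<lambda>t. c)"
proof (induction n arbitrary: c)
  case (Suc n)
  show ?case by (rule smooth_uptoI_DERIV[where f' = "\<lambda>t. 0"]) (auto intro: Suc)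
qed auto

lemma smooth_upto_affine: "smooth_upto n f \<Longrightarrow> smooth_upto n (\<lambda>t. f (r * t + a))"
proof (induction n arbitrary: f)
  case 0
  then have "(f has_real_derivative deriv f t) (at t)" for t
    using smooth_upto_DERIV[of 0] by simp
  then have "((\<lambda>t. f (r * t + a)) has_real_derivative deriv f (r * t + a) * r) (at t)" for t
    by (rule DERIV_chain2) (auto intro!: derivative_eq_intros)
  then show ?case by (auto simp: real_differentiable_def)
next
  case (Suc n)
  show ?case
  proof (rule smooth_uptoI_DERIV[where f' = "\<lambda>t. deriv f (r * t + a) * r"])
    show "((\<lambda>t. f (r * t + a)) has_real_derivative deriv f (r * t + a) * r) (at t)" for t
      by (rule DERIV_chain2[OF smooth_upto_DERIV[OF Suc.prems]]) (auto intro!: derivative_eq_intros)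
    show "smooth_upto n (\<lambda>t. deriv f (r * t + a) * r)"
      using Suc by (intro smooth_upto_mult smooth_upto_const) auto
  qed
qed

text \<open>The functions P(1/t) exp(-1/t), extended by 0, form a class closed under
  differentiation, so that one induction makes all of them smooth.\<close>

definition poly_exp :: "real poly \<Rightarrow> real \<Rightarrow> real" where
  "poly_exp P t = (if t > 0 then poly P (1 / t) * exp (- (1 / t)) else 0)"

lemma poly_exp_decay: "((\<lambda>y. poly P y * exp (- y)) \<longlongrightarrow> (0::real)) at_top"
proof -
  have "((\<lambda>y. \<Sum>i\<le>degree P. coeff P i * (y ^ i / exp y)) \<longlongrightarrow> (\<Sum>i\<le>degree P. coeff P i * 0)) at_top"
    by (intro tendsto_intros tendsto_power_div_exp_0)
  then show ?thesis
    by (simp add: poly_altdef sum_distrib_right sum_divide_distrib exp_minus field_simps)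
qed

text \<open>With y = 1/t one has d/dt = - y^2 d/dy, so P(y) exp(-y) goes to y^2 (P - P')(y) exp(-y).
  At 0 the difference quotient from the right is y P(y) exp(-y), which tends to 0.\<close>

lemma DERIV_poly_exp:
  "(poly_exp P has_real_derivative poly_exp (monom 1 2 * (P - pderiv P)) t) (at t)"
proof -
  consider "t > 0" | "t < 0" | "t = 0" by linarith
  then show ?thesis
  proof cases
    case 1
    have "((\<lambda>t. poly P (1 / t) * exp (- (1 / t))) has_real_derivative
        poly (monom 1 2 * (P - pderiv P)) (1 / t) * exp (- (1 / t))) (at t)"
      using 1 by (auto intro!: derivative_eq_intros DERIV_chain2[OF poly_DERIV]
          simp: poly_monom field_simps power2_eq_square)
    then show ?thesis
    proof (rule has_field_derivative_transform_within_open[where S = "{0<..}", THEN DERIV_cong])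
    qed (use 1 in \<open>auto simp: poly_exp_def\<close>)
  next
    case 2
    have "((\<lambda>t. 0) has_real_derivative 0) (at t)" by simp
    then show ?thesis
    proof (rule has_field_derivative_transform_within_open[where S = "{..<0}", THEN DERIV_cong])
    qed (use 2 in \<open>auto simp: poly_exp_def\<close>)
  next
    case 3
    have "filterlim (\<lambda>h. 1 / h) at_top (at_right (0::real))"
      using filterlim_inverse_at_top_right by (simp add: inverse_eq_divide)
    from filterlim_compose[OF poly_exp_decay[of "pCons 0 P"] this]
    have "((\<lambda>h. poly (pCons 0 P) (1 / h) * exp (- (1 / h))) \<longlongrightarrow> 0) (at_right 0)" .
    then have r: "((\<lambda>h. poly_exp P h / h) \<longlongrightarrow> 0) (at_right 0)"
      by (rule Lim_transform_eventually)
        (auto simp: poly_exp_def eventually_at_right_less field_simps intro!: eventually_mono[OF eventually_at_right_less])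
    have "((\<lambda>h. poly_exp P h / h) \<longlongrightarrow> 0) (at_left 0)"
      by (rule Lim_transform_eventually[OF tendsto_const])
        (auto simp: poly_exp_def eventually_at_filter)
    with r have "((\<lambda>h. poly_exp P h / h) \<longlongrightarrow> 0) (at 0)"
      by (simp add: filterlim_at_split)
    then show ?thesis using 3 by (simp add: DERIV_def poly_exp_def)
  qed
qed

lemma smooth_poly_exp: "smooth_upto n (poly_exp P)"
proof (induction n arbitrary: P)
  case 0
  show ?case using DERIV_poly_exp[of P] by (auto simp: real_differentiable_def)
next
  case (Suc n)
  show ?case by (rule smooth_uptoI_DERIV[OF DERIV_poly_exp Suc])
qed

text \<open>Two one-sided profiles facing each other give a smooth function that is positive exactly
  between a and a + h. The arguments are spelled in the form required by
  \<open>smooth_upto_affine\<close>.\<close>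

definition bump0 :: "real \<Rightarrow> real \<Rightarrow> real \<Rightarrow> real" where
  "bump0 a h t = poly_exp 1 (1 * t + (- a)) * poly_exp 1 ((-1) * t + (a + h))"

lemma smooth_bump0: "smooth_upto n (bump0 a h)"
  unfolding bump0_def by (intro smooth_upto_mult smooth_upto_affine smooth_poly_exp)

lemma bump0: "bump0 a h t \<ge> 0" "t \<notin> {a..a+h} \<Longrightarrow> bump0 a h t = 0"
  "a < t \<Longrightarrow> t < a + h \<Longrightarrow> bump0 a h t > 0"
  by (auto simp: bump0_def poly_exp_def)

lemma continuous_bump0: "continuous_on S (bump0 a h)"
  using smooth_upto_differentiable[OF smooth_bump0[of 0 a h]]
  by (meson continuous_at_imp_continuous_on differentiable_imp_continuous_within)

lemma integral_bump0_pos: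
  assumes "h > 0" shows "integral {a..a+h} (bump0 a h) > 0"
proof -
  have "integral {a..a+h} (bump0 a h) \<noteq> 0"
    using integral_eq_0_iff[OF continuous_bump0[of "{a..a+h}" a h]] bump0(1) bump0(3)[of a "a + h / 2" h] assms
    by force
  moreover have "integral {a..a+h} (bump0 a h) \<ge> 0"
    by (intro integral_nonneg integrable_continuous_real continuous_bump0 bump0)
  ultimately show ?thesis by simp
qed

definition bump :: "real \<Rightarrow> real \<Rightarrow> real \<Rightarrow> real" where
  "bump a h t = bump0 a h t * (1 / integral {a..a+h} (bump0 a h))"

lemma bump:
  assumes "h > 0"
  shows "smooth_upto n (bump a h)" "bump a h t \<ge> 0" "t \<notin> {a..a+h} \<Longrightarrow> bump a h t = 0"
    "continuous_on S (bump a h)" "(bump a h has_integral 1) {a..a+h}"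
proof -
  let ?I = "integral {a..a+h} (bump0 a h)"
  have I: "?I > 0" using integral_bump0_pos assms .
  show "smooth_upto n (bump a h)"
    unfolding bump_def by (intro smooth_upto_mult smooth_upto_const smooth_bump0)
  show "bump a h t \<ge> 0" "t \<notin> {a..a+h} \<Longrightarrow> bump a h t = 0"
    using bump0 I by (auto simp: bump_def)
  show "continuous_on S (bump a h)"
    unfolding bump_def by (intro continuous_intros continuous_bump0)
  have "(bump0 a h has_integral ?I) {a..a+h}"
    by (intro integrable_integral integrable_continuous_real continuous_bump0)
  from has_integral_mult_left[OF this, of "1 / ?I"] show "(bump a h has_integral 1) {a..a+h}"
    using I by (simp add: bump_def[abs_def])
qed

definition ramp :: "real \<Rightarrow> real \<Rightarrow> real \<Rightarrow> real" where
  "ramp a h t = integral {a..t} (bump a h)"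

lemma ramp:
  assumes h: "h > 0"
  shows ramp_le: "t \<le> a \<Longrightarrow> ramp a h t = 0" and ramp_ge: "t \<ge> a + h \<Longrightarrow> ramp a h t = 1"
    and ramp_bounds: "0 \<le> ramp a h t" "ramp a h t \<le> 1"
    and ramp_DERIV: "(ramp a h has_real_derivative bump a h t) (at t)"
proof -
  have int: "bump a h integrable_on {c..d}" for c d
    by (intro integrable_continuous_real bump h)
  show z: "ramp a h t = 0" if "t \<le> a" for t
    using that unfolding ramp_def by (cases "t = a") auto
  show one: "ramp a h t = 1" if "t \<ge> a + h" for t
  proof -
    have "(bump a h has_integral 0) {a+h..t}"
      by (rule has_integral_is_0) (use bump(3)[OF h, of _ a] bump0(2) in \<open>force simp: bump_def bump0_def poly_exp_def\<close>)
    from has_integral_combine[OF _ that bump(5)[OF h] this] h show ?thesis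
      unfolding ramp_def by (simp add: integral_unique)
  qed
  show nonneg: "0 \<le> ramp a h t" for t
    unfolding ramp_def by (intro integral_nonneg int bump h)
  show "ramp a h t \<le> 1"
  proof (cases "t \<le> a + h")
    case True
    have "ramp a h t \<le> ramp a h (a + h)" unfolding ramp_def
      by (rule integral_subset_le) (use True int bump(2)[OF h] in auto)
    then show ?thesis using one by simp
  qed (use one in simp)
  \<comment> \<open>The base point of the integral is moved to the left of both \<open>a\<close> and
    \<open>t\<close>, so that the derivative of the integral is available at every
    \<open>t\<close>.\<close>
  have eq: "ramp a h s = integral {c..s} (bump a h)" if "c \<le> a" "c \<le> s" for c s
  proof (cases "a \<le> s")
    case True
    have "(bump a h has_integral 0) {c..a}"
      by (rule has_integral_is_0) (auto simp: bump_def bump0_def poly_exp_def)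
    from has_integral_combine[OF that(1) True this integrable_integral[OF int]]
    show ?thesis unfolding ramp_def by (simp add: integral_unique)
  next
    case False
    have "(bump a h has_integral 0) {c..s}"
      by (rule has_integral_is_0) (use False in \<open>auto simp: bump_def bump0_def poly_exp_def\<close>)
    then show ?thesis using z[of s] False by (simp add: integral_unique)
  qed
  define c where "c = min a t - 1"
  have "((\<lambda>s. integral {c..s} (bump a h)) has_real_derivative bump a h t) (at t within {c..t+1})"
    by (rule integral_has_real_derivative) (use bump(4)[OF h] in \<open>auto simp: c_def\<close>)
  then have "((\<lambda>s. integral {c..s} (bump a h)) has_real_derivative bump a h t) (at t within {c<..<t+1})"
    by (rule DERIV_subset) auto
  then have "((\<lambda>s. integral {c..s} (bump a h)) has_real_derivative bump a h t) (at t)"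
    by (subst (asm) at_within_open) (auto simp: c_def)
  then show "(ramp a h has_real_derivative bump a h t) (at t)"
    by (rule has_field_derivative_transform_within_open[where S = "{c<..}"])
      (use eq[of c, symmetric] in \<open>auto simp: c_def\<close>)
qed

text \<open>Its derivative is the difference of two bumps of mass 1, so testing a weak derivative
  with it compares the averages of the path just after \<open>a\<close> and just after
  \<open>b\<close>.\<close>

definition plateau :: "real \<Rightarrow> real \<Rightarrow> real \<Rightarrow> real \<Rightarrow> real" where
  "plateau a b h t = ramp a h t - ramp b h t"

lemma plateau:
  assumes h: "h > 0" and ab: "0 < a" "a + h \<le> b"
  shows "test_function (plateau a b h)" "deriv (plateau a b h) t = bump a h t - bump b h t"
    "0 \<le> plateau a b h t" "plateau a b h t \<le> 1" "t \<notin> {a..b+h} \<Longrightarrow> plateau a b h t = 0"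
    "t \<in> {a+h..b} \<Longrightarrow> plateau a b h t = 1" "continuous_on S (plateau a b h)"
proof -
  note r = ramp[OF h]
  have D: "(plateau a b h has_real_derivative bump a h t - bump b h t) (at t)" for t
    unfolding plateau_def by (intro DERIV_diff r)
  then show "deriv (plateau a b h) t = bump a h t - bump b h t" for t
    by (rule DERIV_imp_deriv)
  show "continuous_on S (plateau a b h)"
    using D by (meson DERIV_isCont continuous_at_imp_continuous_on)
  show supp: "t \<notin> {a..b+h} \<Longrightarrow> plateau a b h t = 0" for t
    using r(1)[of t a] r(1)[of t b] r(2)[of a t] r(2)[of b t] ab h by (auto simp: plateau_def)
  show "t \<in> {a+h..b} \<Longrightarrow> plateau a b h t = 1"
    using r(1)[of t b] r(2)[of a t] by (auto simp: plateau_def)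
  show "0 \<le> plateau a b h t" "plateau a b h t \<le> 1"
    using r(3,4)[of a t] r(3,4)[of b t] r(1)[of t b] r(2)[of a t] ab
    by (cases "t \<le> b"; force simp: plateau_def)+
  have "smooth_upto (Suc n) (plateau a b h)" for n
  proof (rule smooth_uptoI_DERIV[OF D])
    have "smooth_upto n (\<lambda>t. bump a h t + (-1) * bump b h t)"
      by (intro smooth_upto_add smooth_upto_mult smooth_upto_const bump h)
    then show "smooth_upto n (\<lambda>t. bump a h t - bump b h t)" by simp
  qed
  then have "smooth_upto n (plateau a b h)" for n by (rule smooth_upto_Suc_imp)
  then show "test_function (plateau a b h)"
    unfolding test_function_def using ab(1) supp smooth_upto_iterate by blast
qed

section \<open>Averages and increments of paths\<close>

lemma integrable_lebesgue_continuous_supported: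
  fixes f :: "real \<Rightarrow> 'a :: euclidean_space"
  assumes "continuous_on {c..d} f"
  shows "integrable lebesgue (\<lambda>x. indicator {c..d} x *\<^sub>R f x)"
  using borel_integrable_compact[of "{c..d}" f] assms
  by (subst integrable_completion) (auto dest: borel_measurable_integrable)

lemma bump_average:
  fixes gam :: "real \<Rightarrow> 'a :: euclidean_space"
  assumes h: "h > 0" and a: "a > 0" and cont: "continuous_on {0..} gam"
    and close: "\<And>t. t \<in> {a..a+h} \<Longrightarrow> norm (gam t - gam a) \<le> e"
  shows "norm ((LINT t:{0..}|lebesgue. bump a h t *\<^sub>R gam t) - gam a) \<le> e"
    "set_integrable lebesgue {0..} (\<lambda>t. bump a h t *\<^sub>R gam t)"
proof -
  let ?i = "indicator {a..a+h} :: real \<Rightarrow> real"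
  have c: "continuous_on {a..a+h} gam" by (rule continuous_on_subset[OF cont]) (use a in auto)
  have eq: "indicator {0..} t *\<^sub>R (bump a h t *\<^sub>R gam t) = ?i t *\<^sub>R (bump a h t *\<^sub>R gam t)" for t
    using bump(3)[OF h, of t a] a by (auto simp: indicator_def)
  have i1: "integrable lebesgue (\<lambda>t. ?i t *\<^sub>R (bump a h t *\<^sub>R gam t))"
    by (intro integrable_lebesgue_continuous_supported continuous_intros bump h c)
  then show "set_integrable lebesgue {0..} (\<lambda>t. bump a h t *\<^sub>R gam t)"
    unfolding set_integrable_def eq .
  have i2: "integrable lebesgue (\<lambda>t. ?i t *\<^sub>R bump a h t)"
    by (intro integrable_lebesgue_continuous_supported bump h)
  have one: "(LINT t|lebesgue. ?i t *\<^sub>R bump a h t) = 1"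
  proof -
    have "((bump a h) has_integral (LINT t:{a..a+h}|lebesgue. bump a h t)) {a..a+h}"
      using i2 by (intro has_integral_set_lebesgue) (simp add: set_integrable_def)
    then show ?thesis using bump(5)[OF h, of a] has_integral_unique
      unfolding set_lebesgue_integral_def by blast
  qed
  have i3: "integrable lebesgue (\<lambda>t. (?i t *\<^sub>R bump a h t) *\<^sub>R gam a)"
    using i2 by (rule integrable_scaleR_left)
  have eq': "(LINT t:{0..}|lebesgue. bump a h t *\<^sub>R gam t) - gam a
      = (LINT t|lebesgue. ?i t *\<^sub>R (bump a h t *\<^sub>R gam t)) - (LINT t|lebesgue. (?i t *\<^sub>R bump a h t) *\<^sub>R gam a)"
    using one i2 unfolding set_lebesgue_integral_def eq by simp
  have "norm ((LINT t:{0..}|lebesgue. bump a h t *\<^sub>R gam t) - gam a) \<le> (LINT t|lebesgue. norm (?i t *\<^sub>R (bump a h t *\<^sub>R gam t) - (?i t *\<^sub>R bump a h t) *\<^sub>R gam a))"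
    unfolding eq' Bochner_Integration.integral_diff[OF i1 i3, symmetric]
    by (rule integral_norm_bound)
  also have "\<dots> \<le> (LINT t|lebesgue. e * (?i t *\<^sub>R bump a h t))"
  proof (rule integral_mono)
    show "integrable lebesgue (\<lambda>t. norm (?i t *\<^sub>R (bump a h t *\<^sub>R gam t) - (?i t *\<^sub>R bump a h t) *\<^sub>R gam a))"
      by (rule Bochner_Integration.integrable_norm[OF Bochner_Integration.integrable_diff[OF i1 i3]])
    show "integrable lebesgue (\<lambda>t. e * (?i t *\<^sub>R bump a h t))"
      by (rule Bochner_Integration.integrable_mult_right[OF i2])
    show "norm (?i t *\<^sub>R (bump a h t *\<^sub>R gam t) - (?i t *\<^sub>R bump a h t) *\<^sub>R gam a) \<le> e * (?i t *\<^sub>R bump a h t)" for t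
      using mult_left_mono[OF close[of t] bump(2)[OF h, of a t]] bump(2)[OF h, of a t]
      by (auto simp: indicator_def mult.commute scaleR_diff_right[symmetric])
  qed
  also have "\<dots> = e" using one by simp
  finally show "norm ((LINT t:{0..}|lebesgue. bump a h t *\<^sub>R gam t) - gam a) \<le> e" .
qed

lemma L2_loc_integrable:
  fixes g :: "real \<Rightarrow> real ^ 'n"
  assumes "L2_loc g" "T > 0"
  shows "set_integrable lebesgue {0..T} g"
proof -
  have 1: "integrable lebesgue (\<lambda>t. indicator {0..T} t * (1 + (norm (g t))\<^sup>2))"
  proof -
    have "integrable lebesgue (\<lambda>t. indicator {0..T} t *\<^sub>R (1::real))"
      by (intro integrable_lebesgue_continuous_supported continuous_intros)
    moreover have "integrable lebesgue (\<lambda>t. indicator {0..T} t *\<^sub>R (norm (g t))\<^sup>2)"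
      using assms unfolding L2_loc_def set_integrable_def by auto
    ultimately show ?thesis
      using Bochner_Integration.integrable_add by (fastforce simp: distrib_left)
  qed
  have 2: "(\<lambda>t. indicator {0..T} t *\<^sub>R g t) \<in> borel_measurable lebesgue"
  proof -
    have "(\<lambda>t. indicator {0..} t *\<^sub>R g t) \<in> borel_measurable lebesgue"
      using assms unfolding L2_loc_def set_borel_measurable_def by auto
    then have "(\<lambda>t. indicator {0..T} t *\<^sub>R (indicator {0..} t *\<^sub>R g t)) \<in> borel_measurable lebesgue"
      by (rule borel_measurable_scaleR[rotated]) (rule borel_measurable_indicator, simp)
    then show ?thesis by (rule measurable_cong[THEN iffD1, rotated]) (auto simp: indicator_def)
  qed
  have 3: "norm (indicator {0..T} t *\<^sub>R g t) \<le> norm (indicator {0..T} t * (1 + (norm (g t))\<^sup>2))" for t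
  proof -
    have "2 * norm (g t) \<le> 1 + (norm (g t))\<^sup>2" using zero_le_power2[of "norm (g t) - 1"]
      by (simp add: power2_diff)
    then have "norm (g t) \<le> 1 + (norm (g t))\<^sup>2" using norm_ge_zero[of "g t"] by linarith
    then show ?thesis by (auto simp: indicator_def)
  qed
  show ?thesis unfolding set_integrable_def
    by (rule Bochner_Integration.integrable_bound[OF 1 2 AE_I2[OF 3]])
qed

text \<open>The weak identity is tested with plateaus of shrinking flanks: one side tends to the
  difference of the end values by continuity, the other to the integral by dominated convergence.
  \<open>0 < a\<close> keeps the supports away from 0, as \<open>test_function\<close>
  demands.\<close>

lemma H1_loc_path_increment:
  assumes H: "H1_loc_path gam g" and ab: "0 < a" "a < b"
  shows "gam b - gam a = (LINT t:{a..b}|lebesgue. g t)"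
proof -
  have cont: "continuous_on {0..} gam" and L2: "L2_loc g" using H unfolding H1_loc_path_def by auto
  \<comment> \<open>At most b - a, so the two flanks do not overlap.\<close>
  define h where "h n = (b - a) / (real n + 1)" for n
  have h: "h n > 0" "a + h n \<le> b" for n
    using ab divide_left_mono[of 1 "real n + 1" "b - a"] by (auto simp: h_def)
  have hlim: "h \<longlonglongrightarrow> 0"
    using tendsto_mult_right_zero[OF LIMSEQ_inverse_real_of_nat, of "b - a"]
    by (simp add: h_def[abs_def] divide_inverse add.commute)
  have avg: "(\<lambda>n. LINT t:{0..}|lebesgue. bump c (h n) t *\<^sub>R gam t) \<longlonglongrightarrow> gam c" if "c > 0" for c
  proof (rule metric_LIMSEQ_I)
    fix e :: real assume "e > 0"
    have "continuous_on {0<..} gam" by (rule continuous_on_subset[OF cont]) auto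
    then have "isCont gam c" using that by (simp add: continuous_on_eq_continuous_at)
    then obtain d where d: "d > 0" "\<And>t. dist t c < d \<Longrightarrow> dist (gam t) (gam c) < e / 2"
      unfolding continuous_at_eps_delta using \<open>e > 0\<close> by (metis half_gt_zero)
    obtain N where N: "\<And>n. n \<ge> N \<Longrightarrow> h n < d"
      using LIMSEQ_D[OF hlim d(1)] h(1) by (auto simp: abs_of_pos)
    show "\<exists>N. \<forall>n\<ge>N. dist (LINT t:{0..}|lebesgue. bump c (h n) t *\<^sub>R gam t) (gam c) < e"
    proof (intro exI[of _ N] allI impI)
      fix n assume "n \<ge> N"
      have "norm ((LINT t:{0..}|lebesgue. bump c (h n) t *\<^sub>R gam t) - gam c) \<le> e / 2"
      proof (rule bump_average(1)[OF h(1) that cont])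
        fix t assume "t \<in> {c..c + h n}"
        then show "norm (gam t - gam c) \<le> e / 2"
          using d(2)[of t] N[OF \<open>n \<ge> N\<close>] by (auto simp: dist_norm less_imp_le)
      qed
      then show "dist (LINT t:{0..}|lebesgue. bump c (h n) t *\<^sub>R gam t) (gam c) < e"
        using \<open>e > 0\<close> by (simp add: dist_norm)
    qed
  qed
  have si: "set_integrable lebesgue {0..} (\<lambda>t. bump c (h n) t *\<^sub>R gam t)" if "c > 0" for c n
  proof -
    have "compact (gam ` {c..c + h n})"
      by (intro compact_continuous_image continuous_on_subset[OF cont]) (use that in auto)
    then obtain B where B: "\<forall>t\<in>{c..c + h n}. norm (gam t) \<le> B"
      using compact_imp_bounded[OF \<open>compact _\<close>] unfolding bounded_iff by auto
    show ?thesis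
      by (rule bump_average(2)[OF h(1) that cont, of n "B + norm (gam c)"])
        (rule order_trans[OF norm_triangle_ineq4 add_right_mono[OF B[rule_format]]])
  qed
  have weak: "(LINT t:{0..}|lebesgue. bump a (h n) t *\<^sub>R gam t) - (LINT t:{0..}|lebesgue. bump b (h n) t *\<^sub>R gam t)
     = - (LINT t:{0..}|lebesgue. plateau a b (h n) t *\<^sub>R g t)" for n
  proof -
    have "(LINT t:{0..}|lebesgue. bump a (h n) t *\<^sub>R gam t) - (LINT t:{0..}|lebesgue. bump b (h n) t *\<^sub>R gam t)
      = (LINT t:{0..}|lebesgue. deriv (plateau a b (h n)) t *\<^sub>R gam t)"
      unfolding plateau(2)[OF h(1) ab(1) h(2)] scaleR_diff_left
      by (rule set_integral_diff(2)[symmetric]) (rule si, use ab in linarith)+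
    also have "\<dots> = - (LINT t:{0..}|lebesgue. plateau a b (h n) t *\<^sub>R g t)"
      using H plateau(1)[OF h(1) ab(1) h(2)] unfolding H1_loc_path_def by blast
    finally show ?thesis .
  qed
  have gi: "set_integrable lebesgue {0..2*b} g" using L2_loc_integrable[OF L2] ab by simp
  have "(\<lambda>n. LINT t|lebesgue. indicator {0..} t *\<^sub>R (plateau a b (h n) t *\<^sub>R g t)) \<longlonglongrightarrow>
      (LINT t|lebesgue. indicator {a..b} t *\<^sub>R g t)"
  proof (rule integral_dominated_convergence[where w = "\<lambda>t. norm (indicator {0..2*b} t *\<^sub>R g t)"])
    have meas: "(\<lambda>t. indicator {0..} t *\<^sub>R g t) \<in> borel_measurable lebesgue"
      using L2 unfolding L2_loc_def set_borel_measurable_def by auto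
    then have "(\<lambda>t. indicator {a..b} t *\<^sub>R (indicator {0..} t *\<^sub>R g t)) \<in> borel_measurable lebesgue"
      by (rule borel_measurable_scaleR[rotated]) (rule borel_measurable_indicator, simp)
    then show "(\<lambda>t. indicator {a..b} t *\<^sub>R g t) \<in> borel_measurable lebesgue"
      by (rule measurable_cong[THEN iffD1, rotated]) (use ab in \<open>auto simp: indicator_def\<close>)
    show "(\<lambda>t. indicator {0..} t *\<^sub>R (plateau a b (h n) t *\<^sub>R g t)) \<in> borel_measurable lebesgue" for n
    proof -
      have "plateau a b (h n) \<in> borel_measurable borel"
        using plateau(7)[OF h(1) ab(1) h(2)] by (rule borel_measurable_continuous_onI)
      then have "plateau a b (h n) \<in> borel_measurable lebesgue" by (simp add: measurable_completion)
      from borel_measurable_scaleR[OF this meas] show ?thesis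
        by (simp add: mult.commute)
    qed
    show "integrable lebesgue (\<lambda>t. norm (indicator {0..2*b} t *\<^sub>R g t))"
      using gi unfolding set_integrable_def by (rule integrable_norm)
    show "AE t in lebesgue. norm (indicator {0..} t *\<^sub>R (plateau a b (h n) t *\<^sub>R g t)) \<le> norm (indicator {0..2*b} t *\<^sub>R g t)" for n
    proof (rule AE_I2)
      fix t
      have "b + h n \<le> 2 * b" using h(2)[of n] ab by linarith
      then show "norm (indicator {0..} t *\<^sub>R (plateau a b (h n) t *\<^sub>R g t)) \<le> norm (indicator {0..2*b} t *\<^sub>R g t)"
        using plateau(3,4,5)[OF h(1)[of n] ab(1) h(2)[of n], where t = t] 
        by (cases "t \<in> {0..2*b}") (auto simp: indicator_def mult_left_le_one_le)
    qed
    show "AE t in lebesgue. (\<lambda>n. indicator {0..} t *\<^sub>R (plateau a b (h n) t *\<^sub>R g t)) \<longlonglongrightarrow> indicator {a..b} t *\<^sub>R g t"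
    proof -
      \<comment> \<open>At \<open>t = a\<close> every plateau vanishes while the indicator is 1, so
        this point is discarded.\<close>
      have "AE t in lebesgue. t \<noteq> a" by (rule AE_completion, rule AE_lborel_singleton)
      then show ?thesis
      proof (rule AE_mp, intro AE_I2 impI)
        fix t assume "t \<noteq> a"
        consider "t < a" | "a < t" "t \<le> b" | "t > b" using \<open>t \<noteq> a\<close> by linarith
        then have "\<forall>\<^sub>F n in sequentially. plateau a b (h n) t = indicator {a..b} t"
        proof cases
          case 1
          then show ?thesis using plateau(5)[OF h(1) ab(1) h(2), where t = t] by (auto simp: indicator_def)
        next
          case 2
          have "\<forall>\<^sub>F n in sequentially. h n < t - a" using hlim 2 by (simp add: order_tendstoD)
          then show ?thesis by eventually_elim (use 2 plateau(6)[OF h(1) ab(1) h(2), where t = t] in auto)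
        next
          case 3
          have "\<forall>\<^sub>F n in sequentially. h n < t - b" using hlim 3 by (simp add: order_tendstoD)
          then show ?thesis by eventually_elim (use 3 plateau(5)[OF h(1) ab(1) h(2), where t = t] in auto)
        qed
        then have "\<forall>\<^sub>F n in sequentially. indicator {a..b} t *\<^sub>R g t = indicator {0..} t *\<^sub>R (plateau a b (h n) t *\<^sub>R g t)"
          by eventually_elim (use ab in \<open>auto simp: indicator_def\<close>)
        then show "(\<lambda>n. indicator {0..} t *\<^sub>R (plateau a b (h n) t *\<^sub>R g t)) \<longlonglongrightarrow> indicator {a..b} t *\<^sub>R g t"
          by (rule Lim_transform_eventually[OF tendsto_const])
      qed
    qed
  qed
  then have "(\<lambda>n. - (LINT t:{0..}|lebesgue. plateau a b (h n) t *\<^sub>R g t)) \<longlonglongrightarrow> - (LINT t:{a..b}|lebesgue. g t)"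
    unfolding set_lebesgue_integral_def by (rule tendsto_minus)
  moreover have "(\<lambda>n. - (LINT t:{0..}|lebesgue. plateau a b (h n) t *\<^sub>R g t)) \<longlonglongrightarrow> gam a - gam b"
    unfolding weak[symmetric] by (intro tendsto_diff avg) (use ab in auto)
  ultimately have "- (LINT t:{a..b}|lebesgue. g t) = gam a - gam b"
    by (rule LIMSEQ_unique)
  then show ?thesis by (simp add: algebra_simps)
qed

locale elliptic_domain = elliptic_coefficients A for A :: "real ^ 'n \<Rightarrow> real ^ 'n ^ 'n" +
  fixes \<Omega> :: "(real ^ 'n) set"
  assumes open_dom: "open \<Omega>" and connected_dom: "connected \<Omega>" and nonempty_dom: "\<Omega> \<noteq> {}"
    and bounded_dom: "bounded \<Omega>" and boundary: "C11_boundary \<Omega>"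
begin

lemma compact_closure_dom: "compact (closure \<Omega>)"
  using bounded_dom by (simp add: compact_closure)

lemma frontier_dom: "x \<in> frontier \<Omega> \<longleftrightarrow> x \<in> closure \<Omega> \<and> x \<notin> \<Omega>"
  using open_dom by (auto simp: frontier_def interior_open)

subsection \<open>The interior cone condition\<close>

lemma graph_chart:
  assumes "p \<in> frontier \<Omega>"
  obtains r \<nu> \<phi> G L where "r > 0" "norm \<nu> = 1"
    "\<And>y. (\<phi> has_derivative (\<lambda>h. G y \<bullet> h)) (at y)" "L-lipschitz_on UNIV (G :: real ^ 'n \<Rightarrow> real ^ 'n)"
    "\<And>y. y \<in> ball p r \<Longrightarrow> y \<in> \<Omega> \<longleftrightarrow> y \<bullet> \<nu> > \<phi> (y - (y \<bullet> \<nu>) *\<^sub>R \<nu>)"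
    "\<And>y. y \<in> ball p r \<Longrightarrow> y \<in> closure \<Omega> \<Longrightarrow> y \<bullet> \<nu> \<ge> \<phi> (y - (y \<bullet> \<nu>) *\<^sub>R \<nu>)"
proof -
  from boundary assms obtain r \<nu> \<phi> where 1: "r > 0" "norm \<nu> = 1" "C11_function \<phi>"
    "\<Omega> \<inter> ball p r = {y \<in> ball p r. y \<bullet> \<nu> > \<phi> (y - (y \<bullet> \<nu>) *\<^sub>R \<nu>)}"
    unfolding C11_boundary_def by fast
  from 1(3) obtain G L where 2: "\<And>y. (\<phi> has_derivative (\<lambda>h. G y \<bullet> h)) (at y)" "L-lipschitz_on UNIV G"
    unfolding C11_function_def by auto
  have "continuous_on UNIV \<phi>"
    by (intro continuous_at_imp_continuous_on ballI has_derivative_continuous[OF 2(1)])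
  then have "closed {y. y \<bullet> \<nu> \<ge> \<phi> (y - (y \<bullet> \<nu>) *\<^sub>R \<nu>)}"
    by (intro closed_Collect_le continuous_on_compose2[OF \<open>continuous_on UNIV \<phi>\<close> _ subset_UNIV] continuous_intros)
  moreover have "ball p r \<inter> \<Omega> \<subseteq> {y. y \<bullet> \<nu> \<ge> \<phi> (y - (y \<bullet> \<nu>) *\<^sub>R \<nu>)}"
    using 1(4) by (auto intro: less_imp_le)
  ultimately have cl: "closure (ball p r \<inter> \<Omega>) \<subseteq> {y. y \<bullet> \<nu> \<ge> \<phi> (y - (y \<bullet> \<nu>) *\<^sub>R \<nu>)}"
    by (rule closure_minimal[rotated])
  have "y \<bullet> \<nu> \<ge> \<phi> (y - (y \<bullet> \<nu>) *\<^sub>R \<nu>)" if "y \<in> ball p r" "y \<in> closure \<Omega>" for y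
    using cl open_Int_closure_subset[of "ball p r" \<Omega>] that by auto
  moreover have "y \<in> \<Omega> \<longleftrightarrow> y \<bullet> \<nu> > \<phi> (y - (y \<bullet> \<nu>) *\<^sub>R \<nu>)" if "y \<in> ball p r" for y
    using 1(4) that by blast
  ultimately show thesis by (intro that[OF 1(1,2) 2]) auto
qed

lemma norm_projection_le:
  assumes "norm (\<nu> :: real ^ 'n) = 1"
  shows "norm (w - (w \<bullet> \<nu>) *\<^sub>R \<nu>) \<le> norm w"
proof -
  have "(norm (w - (w \<bullet> \<nu>) *\<^sub>R \<nu>))\<^sup>2 = (norm w)\<^sup>2 - (w \<bullet> \<nu>)\<^sup>2"
    using assms unfolding power2_norm_eq_inner norm_eq_1
    by (simp add: inner_diff_left inner_diff_right inner_commute power2_eq_square)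
  then have "(norm (w - (w \<bullet> \<nu>) *\<^sub>R \<nu>))\<^sup>2 \<le> (norm w)\<^sup>2" by simp
  then show ?thesis by (rule power2_le_imp_le) simp
qed

lemma C11_local_lipschitz:
  fixes \<phi> :: "real ^ 'n \<Rightarrow> real"
  assumes "\<And>y. (\<phi> has_derivative (\<lambda>h. G y \<bullet> h)) (at y)" "L-lipschitz_on UNIV G" "r > 0"
  obtains M where "M \<ge> 0" "\<forall>y\<in>cball a r. \<forall>z\<in>cball a r. \<bar>\<phi> y - \<phi> z\<bar> \<le> M * norm (y - z)"
    "\<forall>y\<in>cball a r. norm (G y) \<le> M"
proof -
  define M where "M = norm (G a) + L * r"
  have L: "L \<ge> 0" using assms(2) by (rule lipschitz_on_nonneg)
  have M: "norm (G y) \<le> M" if "y \<in> cball a r" for y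
  proof -
    have "norm (G y) \<le> norm (G a) + norm (G y - G a)" by (metis add.commute diff_add_cancel norm_triangle_ineq)
    also have "norm (G y - G a) \<le> L * norm (y - a)" using lipschitz_onD[OF assms(2), of y a] by (simp add: dist_norm)
    also have "\<dots> \<le> L * r" using that L by (intro mult_left_mono) (auto simp: dist_norm norm_minus_commute)
    finally show ?thesis by (simp add: M_def)
  qed
  have "\<bar>\<phi> y - \<phi> z\<bar> \<le> M * norm (y - z)" if "y \<in> cball a r" "z \<in> cball a r" for y z
  proof -
    have "norm (\<phi> y - \<phi> z) \<le> M * norm (y - z)"
    proof (rule differentiable_bound[of "cball a r"])
      show "(\<phi> has_derivative (\<lambda>h. G y \<bullet> h)) (at y within cball a r)" for y
        using assms(1) by (rule has_derivative_at_withinI)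
      show "onorm (\<lambda>h. G y \<bullet> h) \<le> M" if "y \<in> cball a r" for y
      proof (rule onorm_le)
        fix h
        have "norm (G y \<bullet> h) \<le> norm (G y) * norm h" using Cauchy_Schwarz_ineq2[of "G y" h] by simp
        also have "\<dots> \<le> M * norm h" by (intro mult_right_mono M that) simp
        finally show "norm (G y \<bullet> h) \<le> M * norm h" .
      qed
    qed (use that in auto)
    then show ?thesis by simp
  qed
  moreover have "M \<ge> 0" using L assms(3) by (simp add: M_def)
  ultimately show thesis using M that by blast
qed

text \<open>A uniform interior cone condition: one axis and one aperture serve all points of the
  closure near \<open>a\<close>. The norm of \<nu> is only bounded by 1, so that \<nu> = 0 covers
  interior points.\<close>

definition cone_at :: "real ^ 'n \<Rightarrow> real \<Rightarrow> real ^ 'n \<Rightarrow> real \<Rightarrow> real \<Rightarrow> bool" where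
  "cone_at a r \<nu> c s0 \<longleftrightarrow> r > 0 \<and> norm \<nu> \<le> 1 \<and> 0 < c \<and> c \<le> 1 \<and> 0 < s0 \<and>
     (\<forall>x\<in>closure \<Omega> \<inter> cball a r. \<forall>s. 0 < s \<longrightarrow> s < s0 \<longrightarrow> ball (x + s *\<^sub>R \<nu>) (c * s) \<subseteq> \<Omega>)"

lemma cone_ex:
  assumes "a \<in> closure \<Omega>"
  shows "\<exists>r \<nu> c s0. cone_at a r \<nu> c s0"
proof (cases "a \<in> \<Omega>")
  case True
  then obtain e where e: "e > 0" "ball a e \<subseteq> \<Omega>" using open_dom openE by blast
  have "cone_at a (e/2) 0 1 (e/2)" unfolding cone_at_def
  proof (safe)
    fix x s y assume "x \<in> cball a (e/2)" "0 < s" "s < e/2" "y \<in> ball (x + s *\<^sub>R 0) (1 * s)"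
    then have "dist a y < e" using dist_triangle[of a y x] by auto
    then show "y \<in> \<Omega>" using e by auto
  qed (use e in auto)
  then show ?thesis by blast
next
  case False
  then have "a \<in> frontier \<Omega>" using assms frontier_dom by simp
  from graph_chart[OF this] obtain r \<nu> \<phi> G L where ch: "r > 0" "norm \<nu> = 1"
    "\<And>y. (\<phi> has_derivative (\<lambda>h. G y \<bullet> h)) (at y)" "L-lipschitz_on UNIV (G :: real ^ 'n \<Rightarrow> real ^ 'n)"
    "\<And>y. y \<in> ball a r \<Longrightarrow> y \<in> \<Omega> \<longleftrightarrow> y \<bullet> \<nu> > \<phi> (y - (y \<bullet> \<nu>) *\<^sub>R \<nu>)"
    "\<And>y. y \<in> ball a r \<Longrightarrow> y \<in> closure \<Omega> \<Longrightarrow> y \<bullet> \<nu> \<ge> \<phi> (y - (y \<bullet> \<nu>) *\<^sub>R \<nu>)" by blast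
  define pr where "pr w = w - (w \<bullet> \<nu>) *\<^sub>R \<nu>" for w :: "real ^ 'n"
  have pr_diff: "pr v - pr w = pr (v - w)" for v w
    by (simp add: pr_def inner_diff_left algebra_simps)
  have pr_le: "norm (pr w) \<le> norm w" for w unfolding pr_def by (rule norm_projection_le[OF ch(2)])
  obtain M where M: "M \<ge> 0" "\<forall>y\<in>cball (pr a) r. \<forall>z\<in>cball (pr a) r. \<bar>\<phi> y - \<phi> z\<bar> \<le> M * norm (y - z)"
    "\<forall>y\<in>cball (pr a) r. norm (G y) \<le> M"
    by (rule C11_local_lipschitz[OF ch(3,4,1), where a = "pr a"])
  \<comment> \<open>A displacement \<open>w\<close> changes the height by at most its norm and the
    graph function by at most \<open>M\<close> times its norm, so
    \<open>norm w * (1 + M) < s\<close> keeps the point above the graph.\<close>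
  define c where "c = 1 / (1 + M)"
  have c: "0 < c" "c \<le> 1" "c * (1 + M) = 1" using M(1) by (auto simp: c_def)
  have nn: "\<nu> \<bullet> \<nu> = 1" using ch(2) by (simp add: norm_eq_1)
  have "cone_at a (r/4) \<nu> c (r/4)" unfolding cone_at_def
  proof (intro conjI ballI allI impI subsetI)
    fix x s y assume x: "x \<in> closure \<Omega> \<inter> cball a (r/4)" and s: "0 < s" "s < r/4" and y: "y \<in> ball (x + s *\<^sub>R \<nu>) (c * s)"
    define w where "w = y - x - s *\<^sub>R \<nu>"
    have w: "norm w < c * s" using y by (simp add: w_def dist_norm norm_minus_commute algebra_simps)
    have "c * s \<le> 1 * s" using c s by (intro mult_right_mono) auto
    then have ws: "norm w < s" using w by simp
    have yx: "y = x + s *\<^sub>R \<nu> + w" by (simp add: w_def)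
    have xa: "norm (x - a) \<le> r/4" using x by (simp add: dist_norm norm_minus_commute)
    have "norm (y - a) \<le> norm (x - a) + norm (s *\<^sub>R \<nu>) + norm w"
      using norm_triangle_ineq[of "(x - a) + s *\<^sub>R \<nu>" w] norm_triangle_ineq[of "x - a" "s *\<^sub>R \<nu>"]
      unfolding yx by (simp add: algebra_simps)
    also have "\<dots> < r" using xa ws s ch(2) by simp
    finally have ya: "norm (y - a) < r" .
    have xr: "x \<in> ball a r" using xa ch(1) by (simp add: dist_norm norm_minus_commute)
    have "\<bar>\<phi> (pr y) - \<phi> (pr x)\<bar> \<le> M * norm (pr y - pr x)"
      using pr_le[of "y - a"] pr_le[of "x - a"] ya xa ch(1)
      by (intro M(2)[rule_format]) (auto simp: dist_norm norm_minus_commute pr_diff[symmetric])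
    also have "pr y - pr x = pr w"
      unfolding pr_diff yx by (simp add: pr_def inner_add_left nn algebra_simps)
    finally have p: "\<bar>\<phi> (pr y) - \<phi> (pr x)\<bar> \<le> M * norm w"
      using M(1) pr_le[of w] by (meson mult_left_mono order_trans)
    have "\<bar>w \<bullet> \<nu>\<bar> \<le> norm w" using Cauchy_Schwarz_ineq2[of w \<nu>] ch(2) by simp
    moreover have "x \<bullet> \<nu> \<ge> \<phi> (pr x)" using ch(6)[OF xr] x by (simp add: pr_def)
    moreover have "y \<bullet> \<nu> = x \<bullet> \<nu> + s + w \<bullet> \<nu>" unfolding yx by (simp add: inner_add_left nn)
    moreover have "norm w * (1 + M) < s"
    proof -
      have "norm w * (1 + M) < c * s * (1 + M)" using w M(1) by (intro mult_strict_right_mono) auto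
      also have "\<dots> = (c * (1 + M)) * s" by (simp only: mult_ac)
      finally show ?thesis using c(3) by simp
    qed
    ultimately have "y \<bullet> \<nu> > \<phi> (pr y)" using p by (simp add: algebra_simps)
    then show "y \<in> \<Omega>" using ch(5)[of y] ya by (simp add: pr_def dist_norm norm_minus_commute)
  qed (use ch c in auto)
  then show ?thesis by blast
qed

text \<open>Compactness gives common constants \<open>c\<close> and \<open>s0\<close>. Balls of
  radius r/4 already cover, which leaves the shell between r/4 and r/2 for a penalty that favours
  points deep inside a chart.\<close>

lemma cone_cover:
  obtains J c s0 where "finite J" "0 < c" "0 < s0" "\<forall>(a, r, \<nu>)\<in>J. cone_at a r \<nu> c s0"
    "closure \<Omega> \<subseteq> (\<Union>(a, r, \<nu>)\<in>J. ball a (r/4))" "c \<le> 1" "J \<noteq> {}"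
proof -
  obtain r \<nu> c s0 where rc: "\<And>a. a \<in> closure \<Omega> \<Longrightarrow> cone_at a (r a) (\<nu> a) (c a) (s0 a)"
    using cone_ex by metis
  have "closure \<Omega> \<subseteq> (\<Union>a\<in>closure \<Omega>. ball a (r a / 4))" using rc by (fastforce simp: cone_at_def)
  then obtain K where K: "K \<subseteq> closure \<Omega>" "finite K" "closure \<Omega> \<subseteq> (\<Union>a\<in>K. ball a (r a / 4))"
    using compactE_image[OF compact_closure_dom, of "closure \<Omega>" "\<lambda>a. ball a (r a / 4)"] by auto
  have Kne: "K \<noteq> {}" using K(3) nonempty_dom closure_subset by fastforce
  define c' s' where "c' = Min (c ` K)" and "s' = Min (s0 ` K)"
  have fin: "finite (c ` K)" "finite (s0 ` K)" "c ` K \<noteq> {}" "s0 ` K \<noteq> {}" using K(2) Kne by auto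
  have c': "c' \<le> c a" "s' \<le> s0 a" if "a \<in> K" for a using that fin by (auto simp: c'_def s'_def)
  have pos: "0 < c'" "0 < s'" using fin K(1) rc unfolding c'_def s'_def
    by (subst Min_gr_iff; fastforce simp: cone_at_def)+
  have cone: "cone_at a (r a) (\<nu> a) c' s'" if "a \<in> K" for a
  proof -
    note R = rc[of a, unfolded cone_at_def]
    have aK: "a \<in> closure \<Omega>" using K(1) that by auto
    have "ball (x + s *\<^sub>R \<nu> a) (c' * s) \<subseteq> \<Omega>" if "x \<in> closure \<Omega> \<inter> cball a (r a)" "0 < s" "s < s'" for x s
    proof -
      have "c' * s \<le> c a * s" using c'[OF \<open>a \<in> K\<close>] that by (intro mult_right_mono) auto
      then have "ball (x + s *\<^sub>R \<nu> a) (c' * s) \<subseteq> ball (x + s *\<^sub>R \<nu> a) (c a * s)" by (rule subset_ball)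
      also have "\<dots> \<subseteq> \<Omega>" using R[OF aK] that c'[OF \<open>a \<in> K\<close>] by auto
      finally show ?thesis .
    qed
    then show ?thesis using R[OF aK] pos c'[OF that] unfolding cone_at_def by auto
  qed
  obtain a0 where a0: "a0 \<in> K" using Kne by blast
  have c1: "c' \<le> 1" using cone[OF a0] unfolding cone_at_def by blast
  show thesis
  proof (rule that[of "(\<lambda>a. (a, r a, \<nu> a)) ` K" c' s'])
    show "closure \<Omega> \<subseteq> (\<Union>(a, r, \<nu>)\<in>(\<lambda>a. (a, r a, \<nu> a)) ` K. ball a (r / 4))" using K(3) by auto
  qed (use K(2) pos cone c1 Kne in auto)
qed

text \<open>Supplies a Gaussian centre with a neighbourhood that misses the domain, as used in
  \<open>Hlow_start\<close>. The point is found by stepping from \<open>p\<close> against the axis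
  of the chart.\<close>

lemma exterior_point:
  assumes "p \<in> frontier \<Omega>" "e > 0"
  obtains z \<sigma> where "norm (z - p) < e" "\<sigma> > 0" "ball z \<sigma> \<inter> closure \<Omega> = {}"
proof -
  from graph_chart[OF assms(1)] obtain r \<nu> \<phi> G L where ch: "r > 0" "norm \<nu> = 1"
    "\<And>y. (\<phi> has_derivative (\<lambda>h. G y \<bullet> h)) (at y)" "L-lipschitz_on UNIV (G :: real ^ 'n \<Rightarrow> real ^ 'n)"
    "\<And>y. y \<in> ball p r \<Longrightarrow> y \<in> \<Omega> \<longleftrightarrow> y \<bullet> \<nu> > \<phi> (y - (y \<bullet> \<nu>) *\<^sub>R \<nu>)"
    "\<And>y. y \<in> ball p r \<Longrightarrow> y \<in> closure \<Omega> \<Longrightarrow> y \<bullet> \<nu> \<ge> \<phi> (y - (y \<bullet> \<nu>) *\<^sub>R \<nu>)" by blast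
  define s where "s = min e r / 2"
  have s: "0 < s" "s < e" "s < r" using assms(2) ch(1) by (auto simp: s_def)
  define z where "z = p - s *\<^sub>R \<nu>"
  have zp: "norm (z - p) = s" using s ch(2) by (simp add: z_def)
  have nn: "\<nu> \<bullet> \<nu> = 1" using ch(2) by (simp add: norm_eq_1)
  have "p \<notin> \<Omega>" using assms(1) frontier_dom by blast
  then have "p \<bullet> \<nu> \<le> \<phi> (p - (p \<bullet> \<nu>) *\<^sub>R \<nu>)" using ch(5)[of p] ch(1) by simp
  moreover have "z - (z \<bullet> \<nu>) *\<^sub>R \<nu> = p - (p \<bullet> \<nu>) *\<^sub>R \<nu>" "z \<bullet> \<nu> = p \<bullet> \<nu> - s"
    by (simp_all add: z_def inner_diff_left nn algebra_simps)
  ultimately have "\<not> z \<bullet> \<nu> \<ge> \<phi> (z - (z \<bullet> \<nu>) *\<^sub>R \<nu>)" using s by simp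
  then have "z \<notin> closure \<Omega>" using ch(6)[of z] zp s by (auto simp: dist_norm norm_minus_commute)
  then have "z \<in> - closure \<Omega>" "open (- closure \<Omega>)" by auto
  then obtain \<sigma> where "\<sigma> > 0" "ball z \<sigma> \<subseteq> - closure \<Omega>" using openE by blast
  then show thesis using that[of z \<sigma>] zp s by blast
qed

subsection \<open>The polygonal distance\<close>

definition cost :: "real ^ 'n \<Rightarrow> real ^ 'n \<Rightarrow> real" where
  "cost y z = (SUP p\<in>closed_segment y z. A_norm A p (y - z))"

lemma cost_bdd: "bdd_above ((\<lambda>p. A_norm A p (y - z)) ` closed_segment y z)"
  by (rule bdd_aboveI2[where M = "Cn * norm (y - z)"]) (rule A_norm_le)

lemma cost_ge: "p \<in> closed_segment y z \<Longrightarrow> A_norm A p (y - z) \<le> cost y z"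
  unfolding cost_def by (rule cSUP_upper[OF _ cost_bdd])

lemma cost_leI: "(\<And>p. p \<in> closed_segment y z \<Longrightarrow> A_norm A p (y - z) \<le> c) \<Longrightarrow> cost y z \<le> c"
  unfolding cost_def by (rule cSUP_least) auto

lemma cost_le: "cost y z \<le> Cn * norm (y - z)"
  by (rule cost_leI, rule A_norm_le)

lemma cost_nonneg: "cost y z \<ge> 0"
  by (rule order_trans[OF _ cost_ge[of y]]) auto

text \<open>Only the last segment may touch the complement, and only at its end point. A polygon
  thus leaves the domain exactly at the target, as the exit time in \<open>A_dist\<close>
  requires.\<close>

inductive reach :: "(real ^ 'n) set \<Rightarrow> real ^ 'n \<Rightarrow> real \<Rightarrow> bool" for T where
  last: "y \<in> \<Omega> \<Longrightarrow> p \<in> T \<Longrightarrow> closed_segment y p - {p} \<subseteq> \<Omega> \<Longrightarrow> reach T y (cost y p)"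
| step: "closed_segment y z \<subseteq> \<Omega> \<Longrightarrow> reach T z c \<Longrightarrow> reach T y (cost y z + c)"

lemma reach_nonneg: "reach T y c \<Longrightarrow> c \<ge> 0"
  by (induction rule: reach.induct) (auto simp: cost_nonneg)

lemma reach_dom: "reach T y c \<Longrightarrow> y \<in> \<Omega>"
  by (induction rule: reach.induct) auto

text \<open>At parameter \<theta> the segment passes through the cone section of height \<theta> s,
  whose radius shrinks by the same factor.\<close>

lemma cone_segment_dom:
  assumes cone: "cone_at a r \<nu> c s0" and x: "x \<in> closure \<Omega>" "x \<in> cball a r" and s: "0 < s" "s < s0"
    and y: "y \<in> ball (x + s *\<^sub>R \<nu>) (c * s)"
  shows "closed_segment y x - {x} \<subseteq> \<Omega>"
proof
  fix w assume w: "w \<in> closed_segment y x - {x}"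
  then obtain \<theta> where \<theta>: "0 \<le> \<theta>" "\<theta> \<le> 1" "w = (1 - \<theta>) *\<^sub>R x + \<theta> *\<^sub>R y"
    by (metis Diff_iff closed_segment_commute in_segment(1))
  then have t0: "0 < \<theta>" using w by (cases "\<theta> = 0") auto
  have "w - (x + (\<theta> * s) *\<^sub>R \<nu>) = \<theta> *\<^sub>R (y - (x + s *\<^sub>R \<nu>))" using \<theta>(3) by (simp add: algebra_simps)
  then have "norm (w - (x + (\<theta> * s) *\<^sub>R \<nu>)) = \<theta> * norm (y - (x + s *\<^sub>R \<nu>))" using \<theta>(1) by simp
  also have "\<dots> < \<theta> * (c * s)" using y t0 by (simp add: dist_norm norm_minus_commute)
  finally have "w \<in> ball (x + (\<theta> * s) *\<^sub>R \<nu>) (c * (\<theta> * s))" by (simp add: dist_norm norm_minus_commute mult_ac)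
  moreover have "0 < \<theta> * s" using t0 s by simp
  moreover have "\<theta> * s < s0" using \<theta>(2) s by (smt (verit) mult_left_le_one_le \<theta>(1))
  ultimately show "w \<in> \<Omega>" using cone x unfolding cone_at_def by blast
qed

lemma cone_segment_dom':
  assumes cone: "cone_at a r \<nu> c s0" and x: "x \<in> \<Omega>" "x \<in> cball a r" and s: "0 < s" "s < s0"
    and y: "y \<in> ball (x + s *\<^sub>R \<nu>) (c * s)"
  shows "closed_segment y x \<subseteq> \<Omega>" "closed_segment x y \<subseteq> \<Omega>"
proof -
  show "closed_segment y x \<subseteq> \<Omega>"
    using cone_segment_dom[OF cone _ x(2) s y] x(1) closure_subset by blast
  then show "closed_segment x y \<subseteq> \<Omega>" by (simp add: closed_segment_commute)
qed

text \<open>Near a target point one first moves along the axis of the cone and then straight to the target.\<close>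

lemma reach_near_target:
  assumes "p \<in> T" "T \<subseteq> frontier \<Omega>" "e > 0"
  obtains \<rho> where "\<rho> > 0" "\<And>q. q \<in> \<Omega> \<Longrightarrow> q \<in> ball p \<rho> \<Longrightarrow> \<exists>c<e. reach T q c"
proof -
  have p: "p \<in> closure \<Omega>" using assms frontier_dom by blast
  obtain r \<nu> c s0 where cone: "cone_at p r \<nu> c s0" using cone_ex[OF p] by blast
  note C = cone[unfolded cone_at_def]
  define s where "s = min (s0 / 2) (e / (4 * Cn))"
  have s: "0 < s" "s < s0" "Cn * s \<le> e / 4" using C assms(3) Cn_pos by (auto simp: s_def min_def field_simps)
  define \<rho> where "\<rho> = min r (c * s)"
  show thesis
  proof (rule that)
    show "\<rho> > 0" using C s by (auto simp: \<rho>_def)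
    fix q assume q: "q \<in> \<Omega>" "q \<in> ball p \<rho>"
    define z where "z = q + s *\<^sub>R \<nu>"
    have qr: "q \<in> cball p r" using q by (auto simp: \<rho>_def)
    have 1: "closed_segment q z \<subseteq> \<Omega>"
      by (rule cone_segment_dom'(2)[OF cone q(1) qr s(1,2)]) (use C s in \<open>auto simp: z_def\<close>)
    have zb: "z \<in> ball (p + s *\<^sub>R \<nu>) (c * s)" using q by (auto simp: z_def \<rho>_def dist_norm)
    have 2: "closed_segment z p - {p} \<subseteq> \<Omega>"
      by (rule cone_segment_dom[OF cone p _ s(1,2) zb]) (use C in auto)
    have zd: "z \<in> \<Omega>" using 1 by auto
    have "reach T q (cost q z + cost z p)" by (rule reach.step[OF 1 reach.last[OF zd assms(1) 2]])
    moreover have "cost q z + cost z p < e"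
    proof -
      have sn: "norm (s *\<^sub>R \<nu>) \<le> s" using C s by (simp add: mult_left_le)
      have cs: "c * s \<le> s" using C s by (simp add: mult_left_le_one_le)
      have "norm (q - p) < s" using q cs by (auto simp: \<rho>_def dist_norm norm_minus_commute)
      then have "norm (z - p) < 2 * s" using norm_triangle_ineq[of "q - p" "s *\<^sub>R \<nu>"] sn by (simp add: z_def algebra_simps)
      moreover have "norm (q - z) \<le> s" using sn by (simp add: z_def)
      ultimately have "norm (q - z) + norm (z - p) < 3 * s" by simp
      then have "Cn * (norm (q - z) + norm (z - p)) < Cn * (3 * s)" using Cn_pos by simp
      then show ?thesis using cost_le[of q z] cost_le[of z p] s(3) assms(3) by (simp add: distrib_left)
    qed
    ultimately show "\<exists>c<e. reach T q c" by blast
  qed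
qed

text \<open>The points joined to the target form a set that is open and closed in the connected
  domain, and \<open>reach_near_target\<close> makes it nonempty.\<close>

lemma reach_ex:
  assumes "T \<noteq> {}" "T \<subseteq> frontier \<Omega>" "y \<in> \<Omega>"
  shows "\<exists>c. reach T y c"
proof -
  define S where "S = {y. \<exists>c. reach T y c}"
  have nb: "\<exists>e>0. \<forall>z\<in>ball y e. z \<in> \<Omega> \<and> (y \<in> S \<longleftrightarrow> z \<in> S)" if y: "y \<in> \<Omega>" for y
  proof -
    obtain e where e: "e > 0" "ball y e \<subseteq> \<Omega>" using open_dom y openE by blast
    have seg: "closed_segment z z' \<subseteq> \<Omega>" if "z \<in> ball y e" "z' \<in> ball y e" for z z'
      using closed_segment_subset[OF that] e by auto
    have "z \<in> S" if "z' \<in> S" "z \<in> ball y e" "z' \<in> ball y e" for z z'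
      using that reach.step[OF seg[OF that(2,3)]] unfolding S_def by blast
    then show ?thesis using e by (intro exI[of _ e]) auto
  qed
  have "open S"
    unfolding open_contains_ball
  proof
    fix y assume "y \<in> S"
    then have "y \<in> \<Omega>" using reach_dom unfolding S_def by blast
    from nb[OF this] \<open>y \<in> S\<close> show "\<exists>e>0. ball y e \<subseteq> S" by blast
  qed
  moreover have "open (\<Omega> - S)"
    unfolding open_contains_ball
  proof
    fix y assume "y \<in> \<Omega> - S"
    with nb[of y] show "\<exists>e>0. ball y e \<subseteq> \<Omega> - S" by blast
  qed
  moreover obtain p where p: "p \<in> T" using assms by blast
  have "S \<inter> \<Omega> \<noteq> {}"
  proof -
    obtain \<rho> where r: "\<rho> > 0" "\<And>q. q \<in> \<Omega> \<Longrightarrow> q \<in> ball p \<rho> \<Longrightarrow> \<exists>c<1. reach T q c"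
      using reach_near_target[OF p assms(2), of 1] by auto
    have "p \<in> closure \<Omega>" using p assms frontier_dom by blast
    then obtain q where "q \<in> \<Omega>" "dist q p < \<rho>" using r(1) closure_approachable by metis
    then show ?thesis using r(2)[of q] unfolding S_def by (auto simp: dist_commute)
  qed
  ultimately have "\<Omega> - S = {}"
    using connectedD[OF connected_dom, of S "\<Omega> - S"] by blast
  then show ?thesis using assms(3) unfolding S_def by blast
qed

definition dst :: "(real ^ 'n) set \<Rightarrow> real ^ 'n \<Rightarrow> real" where
  "dst T y = Inf {c. reach T y c}"

lemma dst_bdd: "bdd_below {c. reach T y c}"
  by (rule bdd_belowI[of _ 0]) (auto dest: reach_nonneg)

lemma dst_le: "reach T y c \<Longrightarrow> dst T y \<le> c"
  unfolding dst_def by (rule cInf_lower[OF _ dst_bdd]) simp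

lemma dst_lessE:
  assumes "T \<noteq> {}" "T \<subseteq> frontier \<Omega>" "y \<in> \<Omega>" "dst T y < c"
  obtains c' where "c' < c" "reach T y c'"
  using cInf_lessD[of "{c. reach T y c}" c] reach_ex[OF assms(1-3)] assms(4) that unfolding dst_def by blast

lemma dst_nonneg:
  assumes "T \<noteq> {}" "T \<subseteq> frontier \<Omega>" "y \<in> \<Omega>"
  shows "dst T y \<ge> 0"
  unfolding dst_def by (rule cInf_greatest) (use reach_ex[OF assms] reach_nonneg in auto)

lemma dst_le_cost:
  assumes "T \<noteq> {}" "T \<subseteq> frontier \<Omega>" "closed_segment y z \<subseteq> \<Omega>"
  shows "dst T y \<le> cost y z + dst T z"
proof -
  have z: "z \<in> \<Omega>" using assms(3) by auto
  have "dst T y - cost y z \<le> dst T z"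
    unfolding dst_def[of T z]
  proof (rule cInf_greatest)
    show "{c. reach T z c} \<noteq> {}" using reach_ex[OF assms(1,2) z] by auto
    fix c assume "c \<in> {c. reach T z c}"
    then show "dst T y - cost y z \<le> c" using dst_le[OF reach.step[OF assms(3), of T c]] by simp
  qed
  then show ?thesis by simp
qed

lemma dst_lipschitz:
  assumes "T \<noteq> {}" "T \<subseteq> frontier \<Omega>" "closed_segment y z \<subseteq> \<Omega>"
  shows "dst T y \<le> dst T z + Cn * norm (y - z)"
  using dst_le_cost[OF assms] cost_le[of y z] by simp

lemma dst_near_target:
  assumes "p \<in> T" "T \<subseteq> frontier \<Omega>" "e > 0"
  obtains \<rho> where "\<rho> > 0" "\<And>q. q \<in> \<Omega> \<Longrightarrow> q \<in> ball p \<rho> \<Longrightarrow> dst T q < e"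
proof -
  obtain \<rho> where "\<rho> > 0" "\<And>q. q \<in> \<Omega> \<Longrightarrow> q \<in> ball p \<rho> \<Longrightarrow> \<exists>c<e. reach T q c"
    using reach_near_target[OF assms] by blast
  with that[of \<rho>] dst_le show thesis by (meson le_less_trans)
qed

lemma continuous_dst:
  assumes "T \<noteq> {}" "T \<subseteq> frontier \<Omega>"
  shows "continuous_on \<Omega> (dst T)"
proof (rule continuous_at_imp_continuous_on, rule ballI)
  fix y assume "y \<in> \<Omega>"
  then obtain e where e: "e > 0" "ball y e \<subseteq> \<Omega>" using open_dom openE by blast
  have "\<bar>dst T z - dst T y\<bar> \<le> Cn * norm (z - y)" if "z \<in> ball y e" for z
  proof -
    have "closed_segment z y \<subseteq> \<Omega>" "closed_segment y z \<subseteq> \<Omega>"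
      using closed_segment_subset[of z "ball y e" y] closed_segment_subset[of y "ball y e" z] that e by auto
    from dst_lipschitz[OF assms this(1)] dst_lipschitz[OF assms this(2)] show ?thesis
      by (simp add: norm_minus_commute)
  qed
  then have "\<forall>\<^sub>F z in at y. norm (dst T z - dst T y) \<le> Cn * norm (z - y)"
    using e(1) by (intro eventually_at_ball'[THEN eventually_mono, OF e(1)]) auto
  moreover have "((\<lambda>z. Cn * norm (z - y)) \<longlongrightarrow> 0) (at y)"
    by (auto intro!: tendsto_eq_intros)
  ultimately have "((\<lambda>z. dst T z - dst T y) \<longlongrightarrow> 0) (at y)" by (rule Lim_null_comparison)
  then show "isCont (dst T) y" by (simp add: isCont_def LIM_zero_iff)
qed

text \<open>The Lipschitz bound holds only along segments inside the domain, so boundedness up to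
  the boundary goes through the cones: a point near \<open>a\<close> moves along the axis and then
  across to the fixed point \<open>a + s *\<^sub>R \<nu>\<close>. Compactness does the rest.\<close>

lemma dst_bounded:
  assumes "T \<noteq> {}" "T \<subseteq> frontier \<Omega>"
  obtains B where "B > 0" "\<And>y. y \<in> \<Omega> \<Longrightarrow> dst T y \<le> B"
proof -
  have "\<exists>e>0. \<exists>B. \<forall>y\<in>\<Omega> \<inter> ball a e. dst T y \<le> B" if a: "a \<in> closure \<Omega>" for a
  proof -
    obtain r \<nu> c s0 where cone: "cone_at a r \<nu> c s0" using cone_ex[OF a] by blast
    note C = cone[unfolded cone_at_def]
    define s where "s = s0 / 2"
    have s: "0 < s" "s < s0" using C by (auto simp: s_def)
    show ?thesis
    proof (intro exI conjI ballI)
      show "min r (c * s) > 0" using C s by auto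
      fix y assume y: "y \<in> \<Omega> \<inter> ball a (min r (c * s))"
      have 1: "closed_segment y (y + s *\<^sub>R \<nu>) \<subseteq> \<Omega>"
        by (rule cone_segment_dom'(2)[OF cone _ _ s]) (use y C s in auto)
      have sub: "ball (a + s *\<^sub>R \<nu>) (c * s) \<subseteq> \<Omega>" using C a s by auto
      have 2: "closed_segment (y + s *\<^sub>R \<nu>) (a + s *\<^sub>R \<nu>) \<subseteq> \<Omega>"
        by (rule order_trans[OF closed_segment_subset[OF _ _ convex_ball] sub]) (use y C s in \<open>auto simp: dist_norm\<close>)
      have "norm (y - a) < c * s" using y by (auto simp: dist_norm norm_minus_commute)
      then have "Cn * norm (y - a) \<le> Cn * (c * s)" using Cn_pos by simp
      then show "dst T y \<le> Cn * norm (s *\<^sub>R \<nu>) + Cn * (c * s) + dst T (a + s *\<^sub>R \<nu>)"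
        using dst_lipschitz[OF assms 1] dst_lipschitz[OF assms 2] by simp
    qed
  qed
  then obtain e B where eB: "\<And>a. a \<in> closure \<Omega> \<Longrightarrow> e a > 0 \<and> (\<forall>y\<in>\<Omega> \<inter> ball a (e a). dst T y \<le> B a)"
    by metis
  have "closure \<Omega> \<subseteq> (\<Union>a\<in>closure \<Omega>. ball a (e a))" using eB by fastforce
  then obtain K where K: "K \<subseteq> closure \<Omega>" "finite K" "closure \<Omega> \<subseteq> (\<Union>a\<in>K. ball a (e a))"
    using compactE_image[OF compact_closure_dom, of "closure \<Omega>" "\<lambda>a. ball a (e a)"] by auto
  show thesis
  proof (rule that[of "Max (insert 1 (B ` K))"])
    show "Max (insert 1 (B ` K)) > 0" using K(2) by (subst Max_gr_iff) auto
    fix y assume y: "y \<in> \<Omega>"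
    then obtain a where a: "a \<in> K" "y \<in> ball a (e a)" using K(3) closure_subset by blast
    then have "dst T y \<le> B a" using eB[of a] K(1) y by blast
    also have "\<dots> \<le> Max (insert 1 (B ` K))" using K(2) a by (intro Max_ge) auto
    finally show "dst T y \<le> Max (insert 1 (B ` K))" .
  qed
qed

end

section \<open>Exit times and piecewise smooth paths\<close>

lemma exit_time_eq:
  assumes "T \<ge> 0" "\<And>t. 0 < t \<Longrightarrow> t < T \<Longrightarrow> gam t \<in> \<Omega>" "T > 0 \<Longrightarrow> gam T \<notin> \<Omega>"
    "T = 0 \<Longrightarrow> (\<And>e. e > 0 \<Longrightarrow> \<exists>t. 0 < t \<and> t < e \<and> gam t \<notin> \<Omega>)"
  shows "exit_time \<Omega> gam = ereal T"
  unfolding exit_time_def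
proof (rule antisym)
  show "(INF \<tau>\<in>{\<tau>. \<tau> > 0 \<and> gam \<tau> \<notin> \<Omega>}. ereal \<tau>) \<le> ereal T"
  proof (cases "T = 0")
    case True
    show ?thesis
    proof (rule ereal_le_epsilon2)
      fix e :: real assume "e > 0"
      then obtain t where t: "0 < t" "t < e" "gam t \<notin> \<Omega>" using assms(4)[OF True] by blast
      then have "(INF \<tau>\<in>{\<tau>. \<tau> > 0 \<and> gam \<tau> \<notin> \<Omega>}. ereal \<tau>) \<le> ereal t" by (intro INF_lower) auto
      also have "\<dots> \<le> ereal T + ereal e" using True t by simp
      finally show "(INF \<tau>\<in>{\<tau>. \<tau> > 0 \<and> gam \<tau> \<notin> \<Omega>}. ereal \<tau>) \<le> ereal T + ereal e" .
    qed
  qed (use assms in \<open>auto intro!: INF_lower\<close>)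
  show "ereal T \<le> (INF \<tau>\<in>{\<tau>. \<tau> > 0 \<and> gam \<tau> \<notin> \<Omega>}. ereal \<tau>)"
    by (rule INF_greatest) (use assms(2) in \<open>force simp: not_less\<close>)
qed

definition pw_path :: "(real \<Rightarrow> real ^ 'n) \<Rightarrow> (real \<Rightarrow> real ^ 'n) \<Rightarrow> bool" where
  "pw_path gam g \<longleftrightarrow> continuous_on {0..} gam \<and> g \<in> borel_measurable borel \<and> (\<exists>B. \<forall>t. norm (g t) \<le> B) \<and>
     (\<exists>F. finite F \<and> (\<forall>t>0. t \<notin> F \<longrightarrow> (gam has_vector_derivative g t) (at t)))"

lemma set_integrable_bounded:
  fixes f :: "real \<Rightarrow> 'a::euclidean_space"
  assumes "f \<in> borel_measurable borel" "\<And>t. norm (f t) \<le> C"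
  shows "set_integrable lebesgue {0..T} f"
proof -
  have 1: "integrable lebesgue (\<lambda>t. indicator {0..T} t *\<^sub>R (1 + \<bar>C\<bar>))"
    by (intro integrable_lebesgue_continuous_supported continuous_intros)
  have 2: "(\<lambda>t. indicator {0..T} t *\<^sub>R f t) \<in> borel_measurable lebesgue"
    by (intro measurable_completion borel_measurable_scaleR) (use assms(1) in simp_all)
  have 3: "norm (indicator {0..T} t *\<^sub>R f t) \<le> norm (indicator {0..T} t *\<^sub>R (1 + \<bar>C\<bar>))" for t
    using assms(2)[of t] by (auto simp: indicator_def)
  show ?thesis unfolding set_integrable_def
    by (rule Bochner_Integration.integrable_bound[OF 1 2 AE_I2[OF 3]])
qed

text \<open>Integration by parts from the fundamental theorem with finitely many exceptional points;
  the boundary terms vanish because a test function is 0 at time 0 and beyond its support.\<close>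

lemma H1_pw_path:
  fixes gam :: "real \<Rightarrow> real ^ 'n"
  assumes "pw_path gam g"
  shows "H1_loc_path gam g"
proof -
  from assms obtain B F where cont: "continuous_on {0..} gam" and meas: "g \<in> borel_measurable borel"
    and B: "\<And>t. norm (g t) \<le> B" and F: "finite F" "\<And>t. t > 0 \<Longrightarrow> t \<notin> F \<Longrightarrow> (gam has_vector_derivative g t) (at t)"
    unfolding pw_path_def by blast
  have "L2_loc gam" unfolding L2_loc_def
  proof (intro conjI allI impI)
    have "(\<lambda>t. indicator {0..} t *\<^sub>R gam t) \<in> borel_measurable borel"
      by (rule borel_measurable_continuous_on_indicator[OF _ cont]) simp
    then show "set_borel_measurable lebesgue {0..} gam"
      unfolding set_borel_measurable_def by (simp add: measurable_completion)
    show "set_integrable lebesgue {0..T} (\<lambda>t. (norm (gam t))\<^sup>2)" for T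
      unfolding set_integrable_def
      by (intro integrable_lebesgue_continuous_supported continuous_intros continuous_on_subset[OF cont]) auto
  qed
  moreover have "L2_loc g" unfolding L2_loc_def
  proof (intro conjI allI impI)
    show "set_borel_measurable lebesgue {0..} g"
      unfolding set_borel_measurable_def by (intro measurable_completion borel_measurable_scaleR) (use meas in simp_all)
    show "set_integrable lebesgue {0..T} (\<lambda>t. (norm (g t))\<^sup>2)" for T
    proof (rule set_integrable_bounded[where C = "B\<^sup>2"])
      show "(\<lambda>t. (norm (g t))\<^sup>2) \<in> borel_measurable borel" using meas by measurable
      show "norm ((norm (g t))\<^sup>2) \<le> B\<^sup>2" for t using B[of t] by (simp add: power_mono)
    qed
  qed
  moreover have "(LINT t:{0..}|lebesgue. deriv \<phi> t *\<^sub>R gam t) = - (LINT t:{0..}|lebesgue. \<phi> t *\<^sub>R g t)"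
    if "test_function \<phi>" for \<phi>
  proof -
    from that obtain a b where ab: "0 < a" "\<And>t. t \<notin> {a..b} \<Longrightarrow> \<phi> t = 0" unfolding test_function_def by blast
    have "((deriv ^^ k) \<phi>) differentiable (at t)" for k t using that unfolding test_function_def by blast
    from this[of 0] this[of 1] have d1: "\<phi> differentiable (at t)" "deriv \<phi> differentiable (at t)" for t by auto
    then have D: "(\<phi> has_real_derivative deriv \<phi> t) (at t)" for t
      by (simp add: DERIV_deriv_iff_real_differentiable)
    have c\<phi>: "continuous_on S \<phi>" "continuous_on S (deriv \<phi>)" for S
      using d1 by (auto intro!: continuous_at_imp_continuous_on intro: differentiable_imp_continuous_within)
    define M where "M = \<bar>b\<bar> + 1"
    have M: "M > 0" "M > b" by (auto simp: M_def)
    have dz: "deriv \<phi> t = 0" if "t > b" for t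
    proof (rule DERIV_unique[OF D])
      have "((\<lambda>t. 0) has_real_derivative 0) (at t)" by simp
      then show "(\<phi> has_real_derivative 0) (at t)"
        by (rule has_field_derivative_transform_within_open[where S = "{b<..}"]) (use that ab in auto)
    qed
    have hi: "((\<lambda>t. \<phi> t *\<^sub>R g t + deriv \<phi> t *\<^sub>R gam t) has_integral (\<phi> M *\<^sub>R gam M - \<phi> 0 *\<^sub>R gam 0)) {0..M}"
    proof (rule fundamental_theorem_of_calculus_interior_strong[OF F(1)])
      fix t assume t: "t \<in> {0<..<M} - F"
      show "((\<lambda>t. \<phi> t *\<^sub>R gam t) has_vector_derivative (\<phi> t *\<^sub>R g t + deriv \<phi> t *\<^sub>R gam t)) (at t)"
        by (rule has_vector_derivative_scaleR[OF D F(2)]) (use t in auto)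
    next
      show "continuous_on {0..M} (\<lambda>t. \<phi> t *\<^sub>R gam t)"
        by (intro continuous_intros c\<phi> continuous_on_subset[OF cont]) auto
    qed (use M in \<open>auto intro!: continuous_intros c\<phi> continuous_on_subset[OF cont]\<close>)
    have i1: "set_integrable lebesgue {0..M} (\<lambda>t. deriv \<phi> t *\<^sub>R gam t)"
      unfolding set_integrable_def
      by (intro integrable_lebesgue_continuous_supported continuous_intros c\<phi> continuous_on_subset[OF cont]) auto
    have i2: "set_integrable lebesgue {0..M} (\<lambda>t. \<phi> t *\<^sub>R g t)"
    proof -
      have "compact (\<phi> ` {0..M})" by (intro compact_continuous_image c\<phi>) simp
      then have "bounded (\<phi> ` {0..M})" by (rule compact_imp_bounded)
      then obtain C where C: "\<forall>t\<in>{0..M}. \<bar>\<phi> t\<bar> \<le> C" unfolding bounded_iff by auto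
      have C0: "\<bar>\<phi> t\<bar> \<le> \<bar>C\<bar>" for t
        using C ab M by (cases "t \<in> {0..M}") force+
      show ?thesis
      proof (rule set_integrable_bounded[where C = "\<bar>C\<bar> * \<bar>B\<bar>"])
        have "\<phi> \<in> borel_measurable borel" by (rule borel_measurable_continuous_onI[OF c\<phi>(1)])
        then show "(\<lambda>t. \<phi> t *\<^sub>R g t) \<in> borel_measurable borel" using meas by measurable
        show "norm (\<phi> t *\<^sub>R g t) \<le> \<bar>C\<bar> * \<bar>B\<bar>" for t
          unfolding norm_scaleR by (intro mult_mono C0) (use B[of t] in auto)
      qed
    qed
    have "(LINT t:{0..M}|lebesgue. \<phi> t *\<^sub>R g t) + (LINT t:{0..M}|lebesgue. deriv \<phi> t *\<^sub>R gam t) = 0"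
    proof -
      have "((\<lambda>t. \<phi> t *\<^sub>R g t + deriv \<phi> t *\<^sub>R gam t) has_integral
          (LINT t:{0..M}|lebesgue. \<phi> t *\<^sub>R g t) + (LINT t:{0..M}|lebesgue. deriv \<phi> t *\<^sub>R gam t)) {0..M}"
        by (intro has_integral_add has_integral_set_lebesgue i1 i2)
      then show ?thesis using has_integral_unique[OF hi] ab M by force
    qed
    moreover have "(LINT t:{0..}|lebesgue. \<phi> t *\<^sub>R g t) = (LINT t:{0..M}|lebesgue. \<phi> t *\<^sub>R g t)"
      unfolding set_lebesgue_integral_def
      by (rule Bochner_Integration.integral_cong) (use ab M in \<open>auto simp: indicator_def\<close>)
    moreover have "(LINT t:{0..}|lebesgue. deriv \<phi> t *\<^sub>R gam t) = (LINT t:{0..M}|lebesgue. deriv \<phi> t *\<^sub>R gam t)"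
      unfolding set_lebesgue_integral_def
      by (rule Bochner_Integration.integral_cong) (use dz M in \<open>auto simp: indicator_def\<close>)
    ultimately show ?thesis by (simp add: eq_neg_iff_add_eq_0 add.commute)
  qed
  ultimately show ?thesis using cont unfolding H1_loc_path_def by blast
qed

context elliptic_domain
begin

subsection \<open>The distance of the statement is the polygonal distance\<close>

lemma A_dist_le:
  assumes "H1_loc_path gam g" "exit_time \<Omega> gam = ereal T" "gam 0 = x" "gam T \<in> S"
  shows "A_dist A \<Omega> S x \<le> (\<integral>\<^sup>+t\<in>{0..T}. ennreal (A_norm A (gam t) (g t)) \<partial>lebesgue)"
  unfolding A_dist_def by (rule Inf_lower) (use assms in \<open>force\<close>)

text \<open>\<open>h\<close> majorises the length density and integrates exactly to the cost of the
  polygon, so the length is bounded without evaluating the density.\<close>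

definition good_path :: "(real ^ 'n) set \<Rightarrow> real ^ 'n \<Rightarrow> real \<Rightarrow> (real \<Rightarrow> real ^ 'n) \<Rightarrow> (real \<Rightarrow> real ^ 'n) \<Rightarrow>
    (real \<Rightarrow> real) \<Rightarrow> real \<Rightarrow> bool" where
  "good_path S y c gam g h T \<longleftrightarrow> T > 0 \<and> gam 0 = y \<and> pw_path gam g \<and> (\<forall>t. 0 \<le> t \<longrightarrow> t < T \<longrightarrow> gam t \<in> \<Omega>) \<and>
     gam T \<in> S \<and> (h has_integral c) {0..T} \<and> (\<forall>t\<in>{0..T}. 0 \<le> h t \<and> A_norm A (gam t) (g t) \<le> h t)"

lemma segment_param: "0 \<le> t \<Longrightarrow> t \<le> 1 \<Longrightarrow> y + t *\<^sub>R (z - y) \<in> closed_segment y (z :: real ^ 'n)"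
  unfolding in_segment by (intro exI[of _ t]) (simp add: algebra_simps)

text \<open>Each segment is traversed in unit time. After arrival the path rests at the target,
  since an H^1 path has to be defined for all times.\<close>

lemma reach_good_path:
  assumes "reach S y c" "S \<subseteq> frontier \<Omega>"
  shows "\<exists>gam g h T. good_path S y c gam g h T"
  using assms(1)
proof induction
  case (last y p)
  define gam where "gam t = y + min t 1 *\<^sub>R (p - y)" for t :: real
  define g where "g t = (if t \<le> 1 then p - y else 0)" for t :: real
  have "pw_path gam g" unfolding pw_path_def
  proof (intro conjI exI allI impI)
    show "continuous_on {0..} gam" unfolding gam_def by (intro continuous_intros)
    show "g \<in> borel_measurable borel" unfolding g_def by measurable
    show "norm (g t) \<le> norm (p - y)" for t by (simp add: g_def)
    show "finite {1::real}" by simp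
    fix t :: real assume "t > 0" "t \<notin> {1}"
    then consider "t < 1" | "t > 1" by force
    then show "(gam has_vector_derivative g t) (at t)"
    proof cases
      case 1
      have "((\<lambda>t. y + t *\<^sub>R (p - y)) has_vector_derivative g t) (at t)"
        using 1 by (auto simp: g_def intro!: derivative_eq_intros)
      then show ?thesis
        by (rule has_vector_derivative_transform_within_open[where S = "{..<1}"]) (use 1 in \<open>auto simp: gam_def\<close>)
    next
      case 2
      have "((\<lambda>t. p) has_vector_derivative g t) (at t)"
        using 2 by (auto simp: g_def intro!: derivative_eq_intros)
      then show ?thesis
        by (rule has_vector_derivative_transform_within_open[where S = "{1<..}"]) (use 2 in \<open>auto simp: gam_def\<close>)
    qed
  qed
  moreover have "gam t \<in> \<Omega>" if "0 \<le> t" "t < 1" for t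
  proof -
    have "p \<notin> \<Omega>" using last assms(2) frontier_dom by blast
    then have "y \<noteq> p" using last by auto
    have "gam t = y + t *\<^sub>R (p - y)" using that by (simp add: gam_def)
    moreover have "gam t - p = (t - 1) *\<^sub>R (p - y)" using that by (simp add: gam_def algebra_simps)
    then have "gam t \<noteq> p" using \<open>y \<noteq> p\<close> that by auto
    ultimately show ?thesis using segment_param[of t y p] last(3) that by auto
  qed
  moreover have "((\<lambda>t::real. cost y p) has_integral cost y p) {0..1}"
    using has_integral_const_real[of "cost y p" 0 1] by simp
  moreover have "A_norm A (gam t) (g t) \<le> cost y p" if "t \<in> {0..1}" for t
    using cost_ge[OF segment_param[of t y p]] that by (auto simp: gam_def g_def min_def A_norm_minus_commute[of _ p y])
  ultimately have "good_path S y (cost y p) gam g (\<lambda>t. cost y p) 1"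
    unfolding good_path_def using last(2) by (auto simp: gam_def cost_nonneg)
  then show ?case by blast
next
  case (step y z c)
  then obtain gam g h T where "good_path S z c gam g h T" by blast
  then have P: "T > 0" "gam 0 = z" "pw_path gam g" "\<And>t. 0 \<le> t \<Longrightarrow> t < T \<Longrightarrow> gam t \<in> \<Omega>" "gam T \<in> S"
    "(h has_integral c) {0..T}" "\<And>t. t \<in> {0..T} \<Longrightarrow> 0 \<le> h t \<and> A_norm A (gam t) (g t) \<le> h t"
    unfolding good_path_def by auto
  define gam' where "gam' t = (if t \<le> 1 then y + t *\<^sub>R (z - y) else gam (t - 1))" for t
  define g' where "g' t = (if t \<le> 1 then z - y else g (t - 1))" for t
  define h' where "h' t = (if t \<le> 1 then cost y z else h (t - 1))" for t
  from P(3) obtain B F where cont: "continuous_on {0..} gam" and meas: "g \<in> borel_measurable borel"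
    and B: "\<And>t. norm (g t) \<le> B" and F: "finite F" "\<And>t. t > 0 \<Longrightarrow> t \<notin> F \<Longrightarrow> (gam has_vector_derivative g t) (at t)"
    unfolding pw_path_def by blast
  have "pw_path gam' g'" unfolding pw_path_def
  proof (intro conjI exI allI impI)
    have "continuous_on ({0..1} \<union> {1..}) gam'"
      unfolding gam'_def
    proof (rule continuous_on_If)
      show "continuous_on {1..} (\<lambda>t. gam (t - 1))"
        by (rule continuous_on_compose2[OF cont]) (auto intro!: continuous_intros)
    qed (use P(2) in \<open>auto intro!: continuous_intros\<close>)
    moreover have "{0..1} \<union> {1..} = {0::real..}" by auto
    ultimately show "continuous_on {0..} gam'" by simp
    show "g' \<in> borel_measurable borel" unfolding g'_def using meas by measurable
    show "norm (g' t) \<le> max (norm (z - y)) B" for t using B[of "t - 1"] by (auto simp: g'_def)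
    show "finite (insert 1 ((\<lambda>s. s + 1) ` F))" using F by simp
    fix t :: real assume t: "t > 0" "t \<notin> insert 1 ((\<lambda>s. s + 1) ` F)"
    then consider "t < 1" | "t > 1" by force
    then show "(gam' has_vector_derivative g' t) (at t)"
    proof cases
      case 1
      have "((\<lambda>t. y + t *\<^sub>R (z - y)) has_vector_derivative g' t) (at t)"
        using 1 by (auto simp: g'_def intro!: derivative_eq_intros)
      then show ?thesis
        by (rule has_vector_derivative_transform_within_open[where S = "{..<1}"]) (use 1 in \<open>auto simp: gam'_def\<close>)
    next
      case 2
      have "t - 1 \<notin> F" using t(2) by force
      then have "(gam has_vector_derivative g (t - 1)) (at (t - 1))" using 2 by (intro F) auto
      moreover have "((\<lambda>t. t - 1) has_vector_derivative 1) (at t)" by (auto intro!: derivative_eq_intros)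
      ultimately have "((gam \<circ> (\<lambda>t. t - 1)) has_vector_derivative 1 *\<^sub>R g (t - 1)) (at t)"
        by (intro vector_diff_chain_at) auto
      then have "((\<lambda>t. gam (t - 1)) has_vector_derivative g' t) (at t)" using 2 by (simp add: o_def g'_def)
      then show ?thesis
        by (rule has_vector_derivative_transform_within_open[where S = "{1<..}"]) (use 2 in \<open>auto simp: gam'_def\<close>)
    qed
  qed
  moreover have "gam' t \<in> \<Omega>" if "0 \<le> t" "t < T + 1" for t
    using that segment_param[of t y z] step(1) P(4)[of "t - 1"] by (auto simp: gam'_def)
  moreover have "(h' has_integral (cost y z + c)) {0..T+1}"
  proof (rule has_integral_combine[of 0 1])
    have "((\<lambda>t::real. cost y z) has_integral cost y z) {0..1}"
      using has_integral_const_real[of "cost y z" 0 1] by simp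
    then show "(h' has_integral cost y z) {0..1}"
      by (rule has_integral_eq[rotated]) (auto simp: h'_def)
    have "((\<lambda>t. h (1 *\<^sub>R t + (-1))) has_integral (c /\<^sub>R 1 ^ DIM(real))) (cbox ((0 - (-1)) /\<^sub>R 1) ((T - (-1)) /\<^sub>R 1))"
      by (rule has_integral_affinity') (use P(6) in \<open>auto simp: cbox_interval\<close>)
    then have "((\<lambda>t. h (t - 1)) has_integral c) {1..T+1}"
      by (simp add: cbox_interval add.commute)
    then show "(h' has_integral c) {1..T+1}"
      by (rule has_integral_spike_finite[where S = "{1}", rotated 2]) (auto simp: h'_def)
  qed (use P(1) in auto)
  moreover have "0 \<le> h' t \<and> A_norm A (gam' t) (g' t) \<le> h' t" if "t \<in> {0..T+1}" for t
  proof (cases "t \<le> 1")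
    case True
    then show ?thesis using cost_ge[OF segment_param[of t y z]] that
      by (auto simp: gam'_def g'_def h'_def cost_nonneg A_norm_minus_commute[of _ z y])
  next
    case False
    then show ?thesis using P(7)[of "t - 1"] that by (auto simp: gam'_def g'_def h'_def)
  qed
  ultimately have "good_path S y (cost y z + c) gam' g' h' (T + 1)"
    unfolding good_path_def using P by (auto simp: gam'_def)
  then show ?case by blast
qed

lemma A_dist_le_reach:
  assumes "reach S y c" "S \<subseteq> frontier \<Omega>"
  shows "A_dist A \<Omega> S y \<le> ennreal c"
proof -
  obtain gam g h T where "good_path S y c gam g h T" using reach_good_path[OF assms] by blast
  then have P: "T > 0" "gam 0 = y" "pw_path gam g" "\<And>t. 0 \<le> t \<Longrightarrow> t < T \<Longrightarrow> gam t \<in> \<Omega>" "gam T \<in> S"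
    "(h has_integral c) {0..T}" "\<And>t. t \<in> {0..T} \<Longrightarrow> 0 \<le> h t \<and> A_norm A (gam t) (g t) \<le> h t"
    unfolding good_path_def by auto
  have ex: "exit_time \<Omega> gam = ereal T"
    by (rule exit_time_eq) (use P assms(2) frontier_dom in auto)
  have "A_dist A \<Omega> S y \<le> (\<integral>\<^sup>+t\<in>{0..T}. ennreal (A_norm A (gam t) (g t)) \<partial>lebesgue)"
    by (rule A_dist_le[OF H1_pw_path[OF P(3)] ex P(2,5)])
  also have "\<dots> \<le> (\<integral>\<^sup>+t. ennreal (h t) * indicator {0..T} t \<partial>lebesgue)"
    by (rule nn_integral_mono) (use P(7) in \<open>auto simp: indicator_def intro!: ennreal_leI\<close>)
  also have "\<dots> = (\<integral>\<^sup>+t. ennreal (h t) * indicator {0..T} t \<partial>lborel)"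
    by (rule nn_integral_completion)
  also have "\<dots> = ennreal c"
    by (rule nn_integral_has_integral_lebesgue'[OF _ P(6)]) (use P(7) in auto)
  finally show ?thesis .
qed

lemma A_dist_le_dst:
  assumes "S \<noteq> {}" "S \<subseteq> frontier \<Omega>" "y \<in> \<Omega>"
  shows "A_dist A \<Omega> S y \<le> ennreal (dst S y)"
proof (rule ennreal_le_epsilon)
  fix e :: real assume "e > 0"
  then obtain c where c: "c < dst S y + e" "reach S y c"
    using dst_lessE[OF assms, of "dst S y + e"] by auto
  have "A_dist A \<Omega> S y \<le> ennreal c" by (rule A_dist_le_reach[OF c(2) assms(2)])
  also have "\<dots> \<le> ennreal (dst S y + e)" using c by (intro ennreal_leI) simp
  also have "\<dots> = ennreal (dst S y) + ennreal e" using dst_nonneg[OF assms] \<open>e > 0\<close> by simp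
  finally show "A_dist A \<Omega> S y \<le> ennreal (dst S y) + ennreal e" .
qed

section \<open>Length of weakly differentiable paths\<close>

lemma nn_integral_left_open:
  fixes f :: "real \<Rightarrow> ennreal"
  shows "(\<integral>\<^sup>+t\<in>{a..b}. f t \<partial>lebesgue) = (\<integral>\<^sup>+t\<in>{a<..b}. f t \<partial>lebesgue)"
proof (rule nn_integral_cong_AE)
  have "AE t in lebesgue. t \<noteq> a" by (rule AE_completion, rule AE_lborel_singleton)
  then show "AE t in lebesgue. f t * indicator {a..b} t = f t * indicator {a<..b} t"
    by eventually_elim (auto simp: indicator_def)
qed

text \<open>Triangle inequality for a vector integral in the norm frozen at \<open>q\<close>: the
  increment is paired with its own dual vector and Cauchy-Schwarz is applied under the integral.
  Half-open intervals let the pieces add up.\<close>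

lemma H1_increment_A_norm:
  fixes gam :: "real \<Rightarrow> real ^ 'n"
  assumes H: "H1_loc_path gam g" and ab: "0 < a" "a < b"
  shows "ennreal (A_norm A q (gam b - gam a)) \<le> (\<integral>\<^sup>+t\<in>{a<..b}. ennreal (A_norm A q (g t)) \<partial>lebesgue)"
proof -
  define k where "k t = indicator {a..b} t *\<^sub>R g t" for t
  have "L2_loc g" using H unfolding H1_loc_path_def by auto
  then have "set_integrable lebesgue {0..b} g" by (rule L2_loc_integrable) (use ab in simp)
  then have "set_integrable lebesgue {a..b} g" by (rule set_integrable_subset) (use ab in auto)
  then have ki: "integrable lebesgue k" unfolding set_integrable_def k_def .
  let ?D = "gam b - gam a"
  have D: "?D = (LINT t|lebesgue. k t)"
    using H1_loc_path_increment[OF H ab] unfolding set_lebesgue_integral_def k_def .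
  have meas: "(\<lambda>t. A_norm A q (k t)) \<in> borel_measurable lebesgue"
    by (rule borel_measurable_continuous_on[OF continuous_A_norm_right borel_measurable_integrable[OF ki]])
  have bd: "AE t in lebesgue. norm (A_norm A q (k t)) \<le> norm (Cn * norm (k t))"
    using A_norm_le[of q] Cn_pos by (intro AE_I2) simp
  have i1: "integrable lebesgue (\<lambda>t. Cn * norm (k t))"
    by (rule Bochner_Integration.integrable_mult_right[OF Bochner_Integration.integrable_norm[OF ki]])
  have Ni: "integrable lebesgue (\<lambda>t. A_norm A q (k t))"
    by (rule Bochner_Integration.integrable_bound[OF i1 meas bd])
  have "(A_norm A q ?D)\<^sup>2 = Ai q ?D \<bullet> ?D" by (rule A_norm_square)
  also have "\<dots> = Ai q ?D \<bullet> (LINT t|lebesgue. k t)" by (simp add: D)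
  also have "\<dots> = (LINT t|lebesgue. Ai q ?D \<bullet> k t)" using ki by simp
  also have "\<dots> \<le> (LINT t|lebesgue. A_norm A q ?D * A_norm A q (k t))"
  proof (rule integral_mono)
    show "integrable lebesgue (\<lambda>t. Ai q ?D \<bullet> k t)" using ki by simp
    show "integrable lebesgue (\<lambda>t. A_norm A q ?D * A_norm A q (k t))"
      by (rule Bochner_Integration.integrable_mult_right[OF Ni])
    show "Ai q ?D \<bullet> k t \<le> A_norm A q ?D * A_norm A q (k t)" for t
      using A_norm_Cauchy_Schwarz[of q ?D "k t"] by linarith
  qed
  also have "\<dots> = A_norm A q ?D * (LINT t|lebesgue. A_norm A q (k t))" by simp
  finally have sq: "A_norm A q ?D * A_norm A q ?D \<le> A_norm A q ?D * (LINT t|lebesgue. A_norm A q (k t))"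
    by (simp add: power2_eq_square)
  have I0: "0 \<le> (LINT t|lebesgue. A_norm A q (k t))" by (rule Bochner_Integration.integral_nonneg) simp
  have "A_norm A q ?D \<le> (LINT t|lebesgue. A_norm A q (k t))"
  proof (cases "A_norm A q ?D = 0")
    case False
    then have "0 < A_norm A q ?D" using A_norm_nonneg[of q ?D] by linarith
    with sq show ?thesis by simp
  qed (use I0 in simp)
  then have "ennreal (A_norm A q ?D) \<le> ennreal (LINT t|lebesgue. A_norm A q (k t))" by (rule ennreal_leI)
  also have "\<dots> = (\<integral>\<^sup>+t. ennreal (A_norm A q (k t)) \<partial>lebesgue)"
    by (rule nn_integral_eq_integral[symmetric, OF Ni]) simp
  also have "\<dots> = (\<integral>\<^sup>+t\<in>{a..b}. ennreal (A_norm A q (g t)) \<partial>lebesgue)"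
    by (rule nn_integral_cong) (auto simp: k_def indicator_def)
  finally show ?thesis by (simp add: nn_integral_left_open)
qed

lemma H1_A_norm_measurable:
  fixes gam :: "real \<Rightarrow> real ^ 'n"
  assumes H: "H1_loc_path gam g" and "0 \<le> a"
  shows "(\<lambda>t. ennreal (A_norm A (gam t) (g t)) * indicator {a<..b} t) \<in> borel_measurable lebesgue"
proof -
  have "(\<lambda>t. indicator {0..} t *\<^sub>R gam t) \<in> borel_measurable lebesgue" "(\<lambda>t. indicator {0..} t *\<^sub>R g t) \<in> borel_measurable lebesgue"
    using H unfolding H1_loc_path_def L2_loc_def set_borel_measurable_def by auto
  then have "(\<lambda>t. (indicator {0..} t *\<^sub>R gam t, indicator {0..} t *\<^sub>R g t)) \<in> borel_measurable lebesgue"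
    by (rule borel_measurable_Pair)
  from borel_measurable_continuous_on[OF continuous_A_norm this]
  have "(\<lambda>t. A_norm A (indicator {0..} t *\<^sub>R gam t) (indicator {0..} t *\<^sub>R g t)) \<in> borel_measurable lebesgue" by simp
  then have "(\<lambda>t. ennreal (A_norm A (indicator {0..} t *\<^sub>R gam t) (indicator {0..} t *\<^sub>R g t)) * indicator {a<..b} t) \<in> borel_measurable lebesgue"
    by (intro borel_measurable_times_ennreal measurable_compose[OF _ measurable_ennreal] borel_measurable_indicator) simp_all
  then show ?thesis
    by (rule measurable_cong[THEN iffD1, rotated]) (use \<open>0 \<le> a\<close> in \<open>auto simp: indicator_def\<close>)
qed

text \<open>The path is cut so finely that each chord stays in the domain and the norms at nearby
  points agree up to \<kappa>. One factor \<kappa> passes from \<open>cost\<close> to the norm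
  frozen at the start of the chord, the second from that norm to the norm along the path.\<close>

lemma dst_le_H1_interior:
  fixes gam :: "real \<Rightarrow> real ^ 'n"
  assumes S: "S \<noteq> {}" "S \<subseteq> frontier \<Omega>" and H: "H1_loc_path gam g" and ab: "0 < a" "a < b"
    and inside: "gam ` {a..b} \<subseteq> \<Omega>" and kap: "\<kappa> > 1"
  shows "ennreal (dst S (gam a)) \<le> ennreal (\<kappa>\<^sup>2) * (\<integral>\<^sup>+t\<in>{a<..b}. ennreal (A_norm A (gam t) (g t)) \<partial>lebesgue)
     + ennreal (dst S (gam b))"
proof -
  let ?I = "\<lambda>s t. (\<integral>\<^sup>+r\<in>{s<..t}. ennreal (A_norm A (gam r) (g r)) \<partial>lebesgue)"
  have cont: "continuous_on {a..b} gam"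
    by (rule continuous_on_subset[of "{0..}"]) (use H ab in \<open>auto simp: H1_loc_path_def\<close>)
  have "compact (gam ` {a..b})" by (intro compact_continuous_image cont) simp
  from compact_subset_open_imp_ball_epsilon_subset[OF this open_dom inside]
  obtain \<epsilon> where eps: "\<epsilon> > 0" "(\<Union>x\<in>gam ` {a..b}. ball x \<epsilon>) \<subseteq> \<Omega>" by blast
  obtain \<rho> where rho: "\<rho> > 0" "\<And>p q w. p \<in> closure \<Omega> \<Longrightarrow> q \<in> closure \<Omega> \<Longrightarrow> norm (p - q) < \<rho> \<Longrightarrow> A_norm A p w \<le> \<kappa> * A_norm A q w"
    using A_norm_near[OF compact_closure_dom kap] by blast
  define d where "d = min \<epsilon> (\<rho> / 2)"
  have d: "d > 0" "d \<le> \<epsilon>" "2 * d \<le> \<rho>" using eps rho by (auto simp: d_def)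
  have "uniformly_continuous_on {a..b} gam" by (rule compact_uniformly_continuous[OF cont]) simp
  then obtain \<eta> where eta: "\<eta> > 0" "\<And>s t. s \<in> {a..b} \<Longrightarrow> t \<in> {a..b} \<Longrightarrow> \<bar>t - s\<bar> < \<eta> \<Longrightarrow> norm (gam t - gam s) < d"
    unfolding uniformly_continuous_on_def using d(1) by (metis dist_norm dist_real_def)
  have stp: "ennreal (dst S (gam s)) \<le> ennreal (\<kappa>\<^sup>2) * ?I s t + ennreal (dst S (gam t))"
    if st: "a \<le> s" "s < t" "t \<le> b" "t - s < \<eta>" for s t
  proof -
    have sd: "gam s \<in> gam ` {a..b}" using st by auto
    have seg: "closed_segment (gam s) (gam t) \<subseteq> ball (gam s) d"
      by (rule closed_segment_subset) (use d eta(2)[of s t] st in \<open>auto simp: dist_norm norm_minus_commute\<close>)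
    have "ball (gam s) d \<subseteq> \<Omega>" using eps(2) sd subset_ball[OF d(2)] by blast
    then have segO: "closed_segment (gam s) (gam t) \<subseteq> \<Omega>" using seg by blast
    have cl: "x \<in> closure \<Omega>" if "x \<in> \<Omega>" for x using that closure_subset by blast
    have gs: "gam s \<in> closure \<Omega>" using cl segO by auto
    have c: "cost (gam s) (gam t) \<le> \<kappa> * A_norm A (gam s) (gam t - gam s)"
    proof (rule cost_leI)
      fix p assume p: "p \<in> closed_segment (gam s) (gam t)"
      then have "dist (gam s) p < d" using seg by auto
      then have "norm (p - gam s) < \<rho>" using d by (auto simp: dist_norm norm_minus_commute)
      then show "A_norm A p (gam s - gam t) \<le> \<kappa> * A_norm A (gam s) (gam t - gam s)"
        using rho(2)[of p "gam s" "gam s - gam t"] cl p segO gs A_norm_minus_commute[of "gam s" "gam s" "gam t"] by auto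
    qed
    have "ennreal (cost (gam s) (gam t)) \<le> ennreal (\<kappa> * A_norm A (gam s) (gam t - gam s))"
      by (rule ennreal_leI[OF c])
    also have "\<dots> = ennreal \<kappa> * ennreal (A_norm A (gam s) (gam t - gam s))" using kap by (simp add: ennreal_mult)
    also have "\<dots> \<le> ennreal \<kappa> * (\<integral>\<^sup>+r\<in>{s<..t}. ennreal (A_norm A (gam s) (g r)) \<partial>lebesgue)"
      by (intro mult_left_mono H1_increment_A_norm[OF H]) (use st ab in auto)
    also have "\<dots> \<le> ennreal \<kappa> * (\<integral>\<^sup>+r. ennreal \<kappa> * (ennreal (A_norm A (gam r) (g r)) * indicator {s<..t} r) \<partial>lebesgue)"
    proof (intro mult_left_mono nn_integral_mono)
      fix r
      show "ennreal (A_norm A (gam s) (g r)) * indicator {s<..t} r \<le> ennreal \<kappa> * (ennreal (A_norm A (gam r) (g r)) * indicator {s<..t} r)"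
      proof (cases "r \<in> {s<..t}")
        case True
        have "gam r \<in> \<Omega>" using inside True st by auto
        then have "A_norm A (gam s) (g r) \<le> \<kappa> * A_norm A (gam r) (g r)"
          using True st d eta(2)[of r s] by (intro rho gs cl) auto
        then show ?thesis using True kap by (simp flip: ennreal_mult add: ennreal_leI)
      qed simp
    qed simp
    also have "\<dots> = ennreal \<kappa> * (ennreal \<kappa> * ?I s t)"
      by (subst nn_integral_cmult) (use H1_A_norm_measurable[OF H, of s t] st ab in auto)
    also have "\<dots> = ennreal (\<kappa>\<^sup>2) * ?I s t"
      using kap by (simp add: power2_eq_square ennreal_mult mult.assoc)
    finally have c2: "ennreal (cost (gam s) (gam t)) \<le> ennreal (\<kappa>\<^sup>2) * ?I s t" .
    have "ennreal (dst S (gam s)) \<le> ennreal (cost (gam s) (gam t) + dst S (gam t))"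
      by (intro ennreal_leI dst_le_cost S segO)
    also have "\<dots> = ennreal (cost (gam s) (gam t)) + ennreal (dst S (gam t))"
      using segO by (intro ennreal_plus cost_nonneg dst_nonneg S) auto
    finally show ?thesis using c2 by (meson add_right_mono order_trans)
  qed
  obtain n :: nat where n: "n > 0" "(b - a) / real n < \<eta>"
  proof -
    obtain n :: nat where "(b - a) / \<eta> < real n" using reals_Archimedean2 by blast
    moreover have "0 < (b - a) / \<eta>" using ab eta by simp
    ultimately have "0 < real n" by linarith
    then show thesis using \<open>(b - a) / \<eta> < real n\<close> eta by (intro that[of n]) (auto simp: field_simps)
  qed
  define h where "h = (b - a) / real n"
  have h: "h > 0" "h < \<eta>" "a + real n * h = b" using n ab by (auto simp: h_def)
  have "m \<le> n \<Longrightarrow> ennreal (dst S (gam a)) \<le> ennreal (\<kappa>\<^sup>2) * ?I a (a + real m * h) + ennreal (dst S (gam (a + real m * h)))" for m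
  proof (induction m)
    case (Suc m)
    let ?c = "a + real m * h" and ?d = "a + real (Suc m) * h"
    have "real (Suc m) * h \<le> real n * h" using Suc.prems h(1) by (intro mult_right_mono) auto
    then have db: "?d \<le> b" using h(3) by linarith
    have ac: "a \<le> ?c" using h(1) by simp
    have cd: "?c < ?d" "?d - ?c < \<eta>" using h by (auto simp: distrib_right)
    have "ennreal (dst S (gam a)) \<le> ennreal (\<kappa>\<^sup>2) * ?I a ?c + (ennreal (\<kappa>\<^sup>2) * ?I ?c ?d + ennreal (dst S (gam ?d)))"
      using Suc.IH Suc.prems stp[OF ac cd(1) db cd(2)] by (meson Suc_leD add_left_mono order_trans)
    also have "\<dots> = ennreal (\<kappa>\<^sup>2) * (?I a ?c + ?I ?c ?d) + ennreal (dst S (gam ?d))"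
      by (simp add: distrib_left add.assoc)
    also have "?I a ?c + ?I ?c ?d = ?I a ?d"
    proof -
      have "?I a ?c + ?I ?c ?d = (\<integral>\<^sup>+r. ennreal (A_norm A (gam r) (g r)) * indicator {a<..?c} r + ennreal (A_norm A (gam r) (g r)) * indicator {?c<..?d} r \<partial>lebesgue)"
        by (rule nn_integral_add[symmetric]; rule H1_A_norm_measurable[OF H]) (use ab ac in auto)
      also have "\<dots> = ?I a ?d"
        by (rule nn_integral_cong) (use ac cd in \<open>auto simp: indicator_def\<close>)
      finally show ?thesis .
    qed
    finally show ?case .
  qed simp
  from this[of n] show ?thesis using h(3) by simp
qed

lemma exit_timeD:
  assumes "exit_time \<Omega>' gam = ereal T" "0 < t" "t < T"
  shows "gam t \<in> \<Omega>'"
proof (rule ccontr)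
  assume "gam t \<notin> \<Omega>'"
  then have "exit_time \<Omega>' gam \<le> ereal t" unfolding exit_time_def using assms by (intro INF_lower) auto
  then show False using assms by simp
qed

lemma exit_time_pos:
  assumes "exit_time \<Omega> gam = ereal T" "continuous_on {0..} gam" "gam 0 \<in> \<Omega>"
  shows "T > 0"
proof -
  obtain e where e: "e > 0" "ball (gam 0) e \<subseteq> \<Omega>" using open_dom assms(3) openE by blast
  from assms(2) have "continuous (at 0 within {0..}) gam" by (auto simp: continuous_on_eq_continuous_within)
  then obtain d where d: "d > 0" "\<And>t. t \<in> {0..} \<Longrightarrow> dist t 0 < d \<Longrightarrow> dist (gam t) (gam 0) < e"
    unfolding continuous_within_eps_delta using e(1) by blast
  have "ereal d \<le> exit_time \<Omega> gam"
    unfolding exit_time_def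
  proof (rule INF_greatest)
    fix \<tau> assume t: "\<tau> \<in> {\<tau>. \<tau> > 0 \<and> gam \<tau> \<notin> \<Omega>}"
    show "ereal d \<le> ereal \<tau>"
    proof (rule ccontr)
      assume "\<not> ereal d \<le> ereal \<tau>"
      then have "dist (gam \<tau>) (gam 0) < e" using d(2)[of \<tau>] t by auto
      then have "gam \<tau> \<in> ball (gam 0) e" by (simp add: dist_commute)
      then show False using e(2) t by blast
    qed
  qed
  then show ?thesis using assms(1) d(1) by simp
qed

text \<open>Increments are controlled only strictly between time 0 and the exit time. The two ends
  are closed by continuity of \<open>dst\<close> at the start and by \<open>dst_near_target\<close>
  at the exit point.\<close>

lemma dst_le_H1:
  assumes S: "S \<noteq> {}" "S \<subseteq> frontier \<Omega>" and H: "H1_loc_path gam g" and T: "exit_time \<Omega> gam = ereal T"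
    and x: "gam 0 \<in> \<Omega>" and gT: "gam T \<in> S"
  shows "ennreal (dst S (gam 0)) \<le> (\<integral>\<^sup>+t\<in>{0..T}. ennreal (A_norm A (gam t) (g t)) \<partial>lebesgue)"
    (is "_ \<le> ?I")
proof -
  have cont: "continuous_on {0..} gam" using H unfolding H1_loc_path_def by auto
  have T0: "T > 0" by (rule exit_time_pos[OF T cont x])
  have ins: "gam t \<in> \<Omega>" if "0 \<le> t" "t < T" for t
    using exit_timeD[OF T, of t] that x by (cases "t = 0") auto
  have main: "ennreal (dst S (gam 0)) \<le> ennreal (1 + e) * ?I + ennreal e" if e: "e > 0" for e :: real
  proof -
    have "continuous_on {0..<T} (\<lambda>t. dst S (gam t))"
      by (rule continuous_on_compose2[OF continuous_dst[OF S] continuous_on_subset[OF cont]]) (use ins in auto)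
    then have "continuous (at 0 within {0..<T}) (\<lambda>t. dst S (gam t))"
      using T0 by (auto simp: continuous_on_eq_continuous_within)
    then obtain d where d: "d > 0" "\<And>t. t \<in> {0..<T} \<Longrightarrow> dist t 0 < d \<Longrightarrow> dist (dst S (gam t)) (dst S (gam 0)) < e / 2"
      unfolding continuous_within_eps_delta using e by (meson half_gt_zero)
    define a where "a = min d T / 3"
    have a: "0 < a" "a < d" "a < T / 2" using d T0 by (auto simp: a_def)
    obtain \<rho> where rho: "\<rho> > 0" "\<And>q. q \<in> \<Omega> \<Longrightarrow> q \<in> ball (gam T) \<rho> \<Longrightarrow> dst S q < e / 2"
      using dst_near_target[OF gT S(2), of "e / 2"] e by auto
    from cont T0 have "continuous (at T within {0..}) gam" by (auto simp: continuous_on_eq_continuous_within)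
    then obtain d' where d': "d' > 0" "\<And>t. t \<in> {0..} \<Longrightarrow> dist t T < d' \<Longrightarrow> dist (gam t) (gam T) < \<rho>"
      unfolding continuous_within_eps_delta using rho(1) by blast
    define b where "b = T - min d' T / 3"
    have b: "a < b" "b < T" "T - b < d'" using d' T0 a by (auto simp: b_def)
    have db: "dst S (gam b) < e / 2"
      using rho(2)[of "gam b"] ins[of b] d'(2)[of b] a b by (auto simp: dist_commute dist_real_def)
    have da: "dst S (gam 0) \<le> dst S (gam a) + e / 2"
    proof -
      have "dist (dst S (gam a)) (dst S (gam 0)) < e / 2" using d(2)[of a] a by simp
      then show ?thesis unfolding dist_real_def by linarith
    qed
    \<comment> \<open>The interior estimate costs the square of \<kappa>, hence the square
      root.\<close>
    have k: "sqrt (1 + e) > 1" "(sqrt (1 + e))\<^sup>2 = 1 + e" using e by auto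
    have "ennreal (dst S (gam a)) \<le> ennreal ((sqrt (1 + e))\<^sup>2) * (\<integral>\<^sup>+t\<in>{a<..b}. ennreal (A_norm A (gam t) (g t)) \<partial>lebesgue) + ennreal (dst S (gam b))"
      by (rule dst_le_H1_interior[OF S H a(1) b(1) _ k(1)]) (use ins a b in auto)
    also have "\<dots> \<le> ennreal (1 + e) * ?I + ennreal (e / 2)"
      unfolding k(2) using db a b
      by (intro add_mono mult_left_mono nn_integral_mono ennreal_leI) (auto simp: indicator_def)
    finally have 1: "ennreal (dst S (gam a)) \<le> ennreal (1 + e) * ?I + ennreal (e / 2)" .
    have "ennreal (dst S (gam 0)) \<le> ennreal (dst S (gam a)) + ennreal (e / 2)"
      using da dst_nonneg[OF S, of "gam a"] ins[of a] a e by (simp flip: ennreal_plus add: ennreal_leI)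
    also have "\<dots> \<le> ennreal (1 + e) * ?I + ennreal (e / 2) + ennreal (e / 2)" by (intro add_right_mono 1)
    also have "\<dots> = ennreal (1 + e) * ?I + ennreal e" using e by (simp add: add.assoc flip: ennreal_plus)
    finally show ?thesis .
  qed
  show ?thesis
  proof (cases "?I = \<infinity>")
    case False
    then obtain r where r: "r \<ge> 0" "?I = ennreal r" by (cases ?I) auto
    have "dst S (gam 0) \<le> (1 + e) * r + e" if "e > 0" for e
      using main[OF that] that r by (simp flip: ennreal_mult ennreal_plus)
    then have "dst S (gam 0) \<le> r + e * (r + 1)" if "e > 0" for e using that by (simp add: algebra_simps)
    from this[of "e / (r + 1)" for e] have "dst S (gam 0) \<le> r + e" if "e > 0" for e
      using that r(1) by simp
    then have "dst S (gam 0) \<le> r" by (rule field_le_epsilon)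
    then show ?thesis unfolding r(2) by (rule ennreal_leI)
  qed simp
qed

lemma A_dist_eq_dst:
  assumes S: "S \<noteq> {}" "S \<subseteq> frontier \<Omega>" and "y \<in> \<Omega>"
  shows "A_dist A \<Omega> S y = ennreal (dst S y)"
proof (rule antisym[OF A_dist_le_dst[OF assms]])
  show "ennreal (dst S y) \<le> A_dist A \<Omega> S y"
    unfolding A_dist_def
  proof (rule Inf_greatest, clarify)
    fix gam g assume H: "H1_loc_path gam g" and y: "y = gam 0" and fin: "exit_time \<Omega> gam < \<infinity>"
      and gS: "gam (real_of_ereal (exit_time \<Omega> gam)) \<in> S"
    have "0 \<le> exit_time \<Omega> gam" unfolding exit_time_def by (rule INF_greatest) auto
    then obtain T where T: "exit_time \<Omega> gam = ereal T" using fin by (cases "exit_time \<Omega> gam") auto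
    show "ennreal (dst S (gam 0)) \<le> (\<integral>\<^sup>+t\<in>{0..real_of_ereal (exit_time \<Omega> gam)}. ennreal (A_norm A (gam t) (g t)) \<partial>lebesgue)"
      using dst_le_H1[OF S H T] gS assms(3) y T by simp
  qed
qed

text \<open>The constant path at a boundary point has exit time 0, because the infimum runs over
  positive times arbitrarily close to 0.\<close>

lemma A_dist_target:
  assumes "y \<in> S" "S \<subseteq> frontier \<Omega>"
  shows "A_dist A \<Omega> S y = 0"
proof -
  have "pw_path (\<lambda>t. y) (\<lambda>t. 0)" unfolding pw_path_def
    by (intro conjI exI[of _ "{}"] exI[of _ 0]) (auto intro!: derivative_eq_intros)
  then have H: "H1_loc_path (\<lambda>t. y) (\<lambda>t. 0)" by (rule H1_pw_path)
  have "y \<notin> \<Omega>" using assms frontier_dom by blast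
  then have "exit_time \<Omega> (\<lambda>t. y) = ereal 0"
    by (intro exit_time_eq) (auto intro: exI[of _ "e / 2" for e :: real])
  from A_dist_le[OF H this refl assms(1)] show ?thesis by simp
qed

text \<open>Every admissible path ends in one of the two targets. This identity also yields the case
  distinction of the theorem.\<close>

lemma A_dist_union: "A_dist A \<Omega> (S \<union> S') y = min (A_dist A \<Omega> S y) (A_dist A \<Omega> S' y)"
proof (rule antisym)
  have "A_dist A \<Omega> (S \<union> S') y \<le> A_dist A \<Omega> S y" "A_dist A \<Omega> (S \<union> S') y \<le> A_dist A \<Omega> S' y"
    unfolding A_dist_def by (rule Inf_superset_mono, blast)+
  then show "A_dist A \<Omega> (S \<union> S') y \<le> min (A_dist A \<Omega> S y) (A_dist A \<Omega> S' y)" by simp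
  show "min (A_dist A \<Omega> S y) (A_dist A \<Omega> S' y) \<le> A_dist A \<Omega> (S \<union> S') y"
    unfolding A_dist_def[of _ _ "S \<union> S'"]
  proof (rule Inf_greatest, clarify)
    fix gam g assume H: "H1_loc_path gam g" "y = gam 0" "exit_time \<Omega> gam < \<infinity>"
      and U: "gam (real_of_ereal (exit_time \<Omega> gam)) \<in> S \<union> S'"
    have "A_dist A \<Omega> R (gam 0) \<le> (\<integral>\<^sup>+t\<in>{0..real_of_ereal (exit_time \<Omega> gam)}. ennreal (A_norm A (gam t) (g t)) \<partial>lebesgue)"
      if "gam (real_of_ereal (exit_time \<Omega> gam)) \<in> R" for R
      unfolding A_dist_def by (rule Inf_lower) (use H that in blast)
    with U show "min (A_dist A \<Omega> S (gam 0)) (A_dist A \<Omega> S' (gam 0)) \<le>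
        (\<integral>\<^sup>+t\<in>{0..real_of_ereal (exit_time \<Omega> gam)}. ennreal (A_norm A (gam t) (g t)) \<partial>lebesgue)"
      by (auto intro: order_trans[OF min.cobounded1] order_trans[OF min.cobounded2])
  qed
qed

subsection \<open>Semiconvex strict subsolutions of the eikonal equation\<close>

lemma dst_superjet:
  assumes T: "T \<noteq> {}" "T \<subseteq> frontier \<Omega>" and y: "y \<in> \<Omega>" and d: "d > 0" and \<sigma>: "\<sigma> > 0" and \<theta>: "\<theta> \<ge> 0"
    and max: "\<And>z. z \<in> ball y d \<Longrightarrow> \<theta> * dst T z - (norm (z - w))\<^sup>2 / (2 * \<sigma>) \<le> \<theta> * dst T y - (norm (y - w))\<^sup>2 / (2 * \<sigma>)"
    and p: "p = (1 / \<sigma>) *\<^sub>R (y - w)"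
  shows "(A y *v p) \<bullet> p \<le> \<theta>\<^sup>2"
proof -
  define v where "v = A y *v p"
  define X where "X = v \<bullet> p"
  have X0: "X \<ge> 0" unfolding X_def v_def by (rule A_psd)
  have "(A_norm A y v)\<^sup>2 = X" unfolding A_norm_square v_def by (simp add: X_def v_def inner_commute)
  then have Nv: "A_norm A y v = sqrt X" by (simp add: real_sqrt_unique)
  have step: "X \<le> \<theta> * (\<kappa> * sqrt X)" if k: "\<kappa> > 1" for \<kappa>
  proof -
    obtain e where e: "e > 0" "ball y e \<subseteq> \<Omega>" using open_dom y openE by blast
    obtain \<rho> where rho: "\<rho> > 0" "\<And>p q w. p \<in> closure \<Omega> \<Longrightarrow> q \<in> closure \<Omega> \<Longrightarrow> norm (p - q) < \<rho> \<Longrightarrow> A_norm A p w \<le> \<kappa> * A_norm A q w"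
      using A_norm_near[OF compact_closure_dom k] by blast
    define m where "m = min d (min e \<rho>) / (1 + norm v)"
    have m: "m > 0" using d e rho by (simp add: m_def add_pos_nonneg)
    have tau: "X \<le> \<theta> * (\<kappa> * sqrt X) + \<tau> * ((norm v)\<^sup>2 / (2 * \<sigma>))" if t: "0 < \<tau>" "\<tau> < m" for \<tau>
    proof -
      define z where "z = y - \<tau> *\<^sub>R v"
      have "norm (z - y) = \<tau> * norm v" using t by (simp add: z_def)
      also have "\<dots> \<le> \<tau> * (1 + norm v)" using t by simp
      also have "\<dots> < m * (1 + norm v)" using t by (intro mult_strict_right_mono) (auto intro: add_pos_nonneg)
      also have "\<dots> = min d (min e \<rho>)"
      proof -
        have "1 + norm v \<noteq> 0" using norm_ge_zero[of v] by linarith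
        then show ?thesis by (simp add: m_def)
      qed
      finally have zn: "norm (z - y) < min d (min e \<rho>)" .
      have zb: "z \<in> ball y d" using zn by (simp add: dist_norm norm_minus_commute)
      have segb: "closed_segment y z \<subseteq> ball y (min e \<rho>)"
        by (rule closed_segment_subset) (use zn e rho in \<open>auto simp: dist_norm norm_minus_commute\<close>)
      have "ball y (min e \<rho>) \<subseteq> ball y e" by (rule subset_ball) simp
      then have seg: "closed_segment y z \<subseteq> \<Omega>" using segb e(2) by blast
      have "cost y z \<le> \<tau> * (\<kappa> * sqrt X)"
      proof (rule cost_leI)
        fix q assume q: "q \<in> closed_segment y z"
        then have "q \<in> closure \<Omega>" "norm (q - y) < \<rho>" "y \<in> closure \<Omega>"
          using seg segb y closure_subset by (auto simp: dist_norm norm_minus_commute)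
        then have "A_norm A q (y - z) \<le> \<kappa> * A_norm A y (y - z)" by (intro rho(2))
        also have "A_norm A y (y - z) = \<tau> * sqrt X" using t by (simp add: z_def A_norm_scale Nv)
        finally show "A_norm A q (y - z) \<le> \<tau> * (\<kappa> * sqrt X)" by (simp add: mult_ac)
      qed
      then have D: "dst T y - dst T z \<le> \<tau> * (\<kappa> * sqrt X)" using dst_le_cost[OF T seg] by simp
      have yw: "y - w = \<sigma> *\<^sub>R p" using p \<sigma> by simp
      have zw: "z - w = (y - w) - \<tau> *\<^sub>R v" by (simp add: z_def)
      have "(norm (z - w))\<^sup>2 = (norm (y - w))\<^sup>2 - 2 * \<tau> * ((y - w) \<bullet> v) + \<tau>\<^sup>2 * (norm v)\<^sup>2"
        unfolding zw power2_norm_eq_inner inner_diff_left[of "y - w"] inner_diff_right[of _ "y - w"]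
        by (simp add: inner_commute[of v "y - w"] power2_eq_square)
      also have "(y - w) \<bullet> v = \<sigma> * X" unfolding yw X_def by (simp add: inner_commute)
      finally have "((norm (z - w))\<^sup>2 - (norm (y - w))\<^sup>2) / (2 * \<sigma>) = - \<tau> * X + \<tau>\<^sup>2 * ((norm v)\<^sup>2 / (2 * \<sigma>))"
        using \<sigma> by (simp add: field_simps)
      with max[OF zb] have "\<tau> * X \<le> \<theta> * (dst T y - dst T z) + \<tau>\<^sup>2 * ((norm v)\<^sup>2 / (2 * \<sigma>))"
        by (simp add: diff_divide_distrib algebra_simps)
      also have "\<dots> \<le> \<theta> * (\<tau> * (\<kappa> * sqrt X)) + \<tau>\<^sup>2 * ((norm v)\<^sup>2 / (2 * \<sigma>))"
        using D \<theta> by (intro add_right_mono mult_left_mono)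
      finally have "\<tau> * X \<le> \<tau> * (\<theta> * (\<kappa> * sqrt X) + \<tau> * ((norm v)\<^sup>2 / (2 * \<sigma>)))"
        by (simp add: power2_eq_square algebra_simps)
      then show ?thesis using t by simp
    qed
    show ?thesis
    proof (rule field_le_epsilon)
      fix e :: real assume e: "e > 0"
      define c where "c = (norm v)\<^sup>2 / (2 * \<sigma>)"
      have c: "c \<ge> 0" using \<sigma> by (simp add: c_def)
      define \<tau> where "\<tau> = min (m / 2) (e / (c + 1))"
      have t: "0 < \<tau>" "\<tau> < m" "\<tau> \<le> e / (c + 1)" using m e c by (auto simp: \<tau>_def)
      have "\<tau> * c \<le> e / (c + 1) * (c + 1)" using t c e by (intro mult_mono) auto
      also have "\<dots> = e" using c by simp
      finally show "X \<le> \<theta> * (\<kappa> * sqrt X) + e" using tau[OF t(1,2)] by (simp add: c_def)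
    qed
  qed
  have "X \<le> \<theta> * sqrt X"
  proof (rule field_le_epsilon)
    fix e :: real assume e: "e > 0"
    define b where "b = \<theta> * sqrt X"
    have b: "b \<ge> 0" using \<theta> X0 by (simp add: b_def)
    have "X \<le> \<theta> * ((1 + e / (b + 1)) * sqrt X)" using b e by (intro step) (simp add: add_nonneg_pos)
    also have "\<dots> = b + e * (b / (b + 1))" by (simp add: b_def algebra_simps)
    also have "\<dots> \<le> b + e * 1" using b e by (intro add_left_mono mult_left_mono) auto
    finally show "X \<le> \<theta> * sqrt X + e" by (simp add: b_def)
  qed
  then have "sqrt X * sqrt X \<le> \<theta> * sqrt X" using X0 by simp
  then have "sqrt X \<le> \<theta>" using X0 \<theta> mult_right_le_imp_le[of "sqrt X" "sqrt X" \<theta>] by (cases "X = 0") auto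
  then have "(sqrt X)\<^sup>2 \<le> \<theta>\<^sup>2" using X0 by (intro power_mono) auto
  then show ?thesis using X0 by (simp add: X_def v_def)
qed

text \<open>\<open>E\<close> is the graph of a multivalued function whose upper envelope is a semiconvex strict
  subsolution of \<open>\<langle>A \<nabla>v, \<nabla>v\<rangle> = 1\<close>. Compactness of \<open>E\<close> stands in for continuity of the envelope.\<close>

definition eikonal_minorant :: "(real ^ 'n) set \<Rightarrow> real \<Rightarrow> ((real ^ 'n) \<times> real) set \<Rightarrow> real \<Rightarrow> real \<Rightarrow> bool" where
  "eikonal_minorant T \<delta> E \<eta> K \<longleftrightarrow> compact E \<and> E \<subseteq> closure \<Omega> \<times> UNIV \<and> \<eta> > 0 \<and> K > 0 \<and>
     (\<forall>x\<in>closure \<Omega>. \<exists>v. (x, v) \<in> E) \<and>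
     (\<forall>x\<in>\<Omega>. \<exists>v. (x, v) \<in> E \<and> v \<ge> dst T x - \<delta>) \<and>
     (\<forall>x v. (x, v) \<in> E \<longrightarrow> x \<in> closure T \<longrightarrow> v \<le> 0) \<and>
     (\<forall>x v. (x, v) \<in> E \<longrightarrow> x \<in> \<Omega> \<longrightarrow> (\<forall>v'. (x, v') \<in> E \<longrightarrow> v' \<le> v) \<longrightarrow>
        (\<exists>b. (A x *v b) \<bullet> b \<le> 1 - \<eta> \<and>
           (\<forall>\<^sub>F x' in nhds x. \<exists>v'. (x', v') \<in> E \<and> v' \<ge> v + b \<bullet> (x' - x) - K * (norm (x' - x))\<^sup>2)))"

text \<open>Sup-convolution of the distance, with centres shifted into the domain along the cone axes,
  localised to finitely many charts by a small quadratic penalty.\<close>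

lemma eikonal_minorant_ex:
  assumes T: "T \<noteq> {}" "T \<subseteq> frontier \<Omega>" and \<delta>: "\<delta> > 0"
  shows "\<exists>E \<eta> K. eikonal_minorant T \<delta> E \<eta> K"
proof -
  obtain J c s0 where J': "finite J" "0 < c" "0 < s0" "\<forall>(a, r, \<nu>)\<in>J. cone_at a r \<nu> c s0"
    "closure \<Omega> \<subseteq> (\<Union>(a, r, \<nu>)\<in>J. ball a (r/4))" "c \<le> 1" "J \<noteq> {}"
    by (rule cone_cover)
  have J4: "cone_at a r \<nu> c s0" if "(a, r, \<nu>) \<in> J" for a r \<nu> using J'(4) that by auto
  note J = J'(1-3) J4 J'(5-)
  obtain B where B: "B > 0" "\<And>y. y \<in> \<Omega> \<Longrightarrow> dst T y \<le> B" using dst_bounded[OF T] by blast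
  obtain \<Lambda> where \<Lambda>': "\<Lambda> > 0" "\<forall>x\<in>\<Omega>. trace (A x) \<le> \<Lambda>" "\<forall>x\<in>\<Omega>. norm (A x) \<le> \<Lambda>"
    by (rule trace_bound[OF bounded_dom])
  note \<Lambda> = \<Lambda>'(1) \<Lambda>'(3)[rule_format]
  \<comment> \<open>Shrinking the distance by 1 - \<eta> makes the subsolution strict: (1 -
    \<eta>)^2 \<le> 1 - 3 \<eta>/2 leaves \<eta>/2 for perturbations. The second bound keeps the
    loss \<eta> B at most \<delta>/4.\<close>
  define \<eta> where "\<eta> = min (1/2) (\<delta> / (4 * (B + 1)))"
  have \<eta>: "0 < \<eta>" "\<eta> \<le> 1/2" unfolding \<eta>_def using \<delta> B(1) by (simp_all only: min.cobounded1) simp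
  have \<eta>B: "\<eta> * B \<le> \<delta> / 4"
  proof -
    have "\<eta> * B \<le> \<delta> / (4 * (B + 1)) * (B + 1)" using \<delta> B by (intro mult_mono) (auto simp: \<eta>_def)
    also have "\<dots> = \<delta> / 4" using B(1) by (simp add: field_simps)
    finally show ?thesis .
  qed
  define \<theta> where "\<theta> = 1 - \<eta>"
  have \<theta>: "0 \<le> \<theta>" "\<theta> \<le> 1" using \<eta> by (auto simp: \<theta>_def)
  define rm where "rm = Min ((\<lambda>(a, r, \<nu>). r) ` J)"
  have fJ: "finite ((\<lambda>(a, r, \<nu>). r) ` J)" "(\<lambda>(a, r, \<nu>). r) ` J \<noteq> {}" using J by auto
  have rm_le: "rm \<le> r" if "(a, r, \<nu>) \<in> J" for a r \<nu>
    unfolding rm_def by (rule Min_le[OF fJ(1)]) (use that in force)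
  have rm: "rm > 0"
  proof -
    have "rm \<in> (\<lambda>(a, r, \<nu>). r) ` J" unfolding rm_def by (rule Min_in[OF fJ])
    then obtain a r \<nu> where "(a, r, \<nu>) \<in> J" "rm = r" by auto
    then show ?thesis using J(4)[of a r \<nu>] by (simp add: cone_at_def)
  qed
  \<comment> \<open>Bound for the gradient of the chart penalty. Against a gradient of norm at most
    2 Cn it changes the quadratic form by at most \<eta>/4.\<close>
  define g0 where "g0 = min 1 (\<eta> / (4 * (5 * Cn * \<Lambda> + \<Lambda>)))"
  have CL: "5 * Cn * \<Lambda> + \<Lambda> > 0" using Cn_pos \<Lambda> by (simp add: add_pos_pos)
  have g0: "0 < g0" "g0 \<le> 1" "4 * Cn * \<Lambda> * g0 + \<Lambda> * g0\<^sup>2 \<le> \<eta> / 4"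
  proof -
    show "0 < g0" "g0 \<le> 1" using \<eta> CL by (auto simp: g0_def)
    then have "g0\<^sup>2 \<le> g0 * 1" unfolding power2_eq_square by (intro mult_left_mono) auto
    then have "4 * Cn * \<Lambda> * g0 + \<Lambda> * g0\<^sup>2 \<le> (4 * Cn * \<Lambda>) * g0 + \<Lambda> * g0" using \<Lambda> by simp
    also have "\<dots> \<le> (5 * Cn * \<Lambda> + \<Lambda>) * g0" using Cn_pos \<Lambda> \<open>0 < g0\<close> by (simp add: algebra_simps)
    also have "\<dots> \<le> (5 * Cn * \<Lambda> + \<Lambda>) * (\<eta> / (4 * (5 * Cn * \<Lambda> + \<Lambda>)))"
      using CL by (intro mult_left_mono) (auto simp: g0_def)
    also have "\<dots> = \<eta> / 4" using CL by (simp add: field_simps)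
    finally show "4 * Cn * \<Lambda> * g0 + \<Lambda> * g0\<^sup>2 \<le> \<eta> / 4" .
  qed
  \<comment> \<open>Height of the penalty: at most k0/4 on the ball of radius r/4, equal to k0 on
    the rim of the ball of radius r/2, with gradient at most 4 k0 / r in between.\<close>
  define k0 where "k0 = min (\<delta> / 8) (rm * g0 / 4)"
  have k0: "0 < k0" "k0 \<le> \<delta> / 8" "4 * k0 / rm \<le> g0" using \<delta> rm g0 by (auto simp: k0_def min_def field_simps)
  \<comment> \<open>Permitted variation of \<open>A\<close> between a point and its shifted partner;
    the form at a gradient of norm at most 2 Cn then changes by at most \<eta>/4.\<close>
  define \<omega> where "\<omega> = \<eta> / (16 * Cn\<^sup>2)"
  have \<omega>: "\<omega> > 0" "4 * Cn\<^sup>2 * \<omega> = \<eta> / 4" using \<eta> Cn_pos by (auto simp: \<omega>_def field_simps)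
  obtain \<rho> where rho: "\<rho> > 0" "\<And>p q. p \<in> closure \<Omega> \<Longrightarrow> q \<in> closure \<Omega> \<Longrightarrow> norm (p - q) < \<rho> \<Longrightarrow> norm (A p - A q) < \<omega>"
    using A_near[OF compact_closure_dom \<omega>(1)] by blast
  define s where "s = min (s0 / 2) (min (\<rho> / 3) (k0 / (8 * Cn)))"
  have s: "0 < s" "s < s0" "2 * s < \<rho>" "8 * (Cn * s) \<le> k0"
  proof -
    have 1: "s \<le> s0 / 2" "s \<le> \<rho> / 3" "s \<le> k0 / (8 * Cn)" by (auto simp: s_def)
    show "0 < s" using J(3) rho k0 Cn_pos by (auto simp: s_def)
    show "s < s0" "2 * s < \<rho>" using 1 J(3) rho(1) by linarith+
    show "8 * (Cn * s) \<le> k0" using 1(3) Cn_pos by (simp add: field_simps)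
  qed
  define Cs where "Cs = Cn * s"
  have Cs: "0 < Cs" "8 * Cs \<le> k0" using s Cn_pos by (auto simp: Cs_def)
  \<comment> \<open>Displacements \<open>h\<close> up to \<open>R\<close> stay in the cone section,
    and \<sigma> forces the optimal ones to satisfy norm h \<le> 2 Cn \<sigma> = R/2, strictly
    inside.\<close>
  define R where "R = c * s / 2"
  define \<sigma> where "\<sigma> = c * s / (8 * Cn)"
  have cs: "0 < c * s" "c * s \<le> s" using J s by (auto simp: mult_left_le_one_le)
  have R: "0 < R" "R < c * s" "R \<le> s" unfolding R_def using cs by linarith+
  have \<sigma>: "0 < \<sigma>" "2 * Cn * \<sigma> < R" using cs Cn_pos by (auto simp: \<sigma>_def R_def)
  \<comment> \<open>The constant 2 Cs lowers every piece enough to be nonpositive at target points,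
    where the shifted point may still have distance up to 2 Cs.\<close>
  define q where "q = (\<lambda>(a, r, \<nu>) (x, h). \<theta> * dst T (x + s *\<^sub>R \<nu> + h) - (norm h)\<^sup>2 / (2 * \<sigma>)
      - 4 * k0 * (norm (x - a))\<^sup>2 / r\<^sup>2 - 2 * Cs)"
  define Q where "Q = (\<lambda>(a :: real ^ 'n, r :: real, \<nu> :: real ^ 'n). (closure \<Omega> \<inter> cball a (r/2)) \<times> cball (0 :: real ^ 'n) R)"
  \<comment> \<open>All displacements are kept, not only the maximising ones; this makes
    \<open>E\<close> a finite union of continuous images of compact sets.\<close>
  define E where "E = (\<Union>j\<in>J. (\<lambda>z. (fst z, q j z)) ` Q j)"
  have shift: "x + s *\<^sub>R \<nu> + h \<in> ball (x + s *\<^sub>R \<nu>) (c * s)" if "norm h \<le> R" for x \<nu> h :: "real ^ 'n"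
    using that R by (simp add: dist_norm)
  have chart: "r > 0" "norm \<nu> \<le> 1" "\<And>x s. x \<in> closure \<Omega> \<Longrightarrow> x \<in> cball a r \<Longrightarrow> 0 < s \<Longrightarrow> s < s0 \<Longrightarrow> ball (x + s *\<^sub>R \<nu>) (c * s) \<subseteq> \<Omega>"
    if "(a, r, \<nu>) \<in> J" for a r \<nu> using J(4)[OF that] unfolding cone_at_def by auto
  have half: "x \<in> cball a r" if "x \<in> cball a (r/2)" "(a, r, \<nu>) \<in> J" for x a r \<nu>
    using that chart(1)[OF that(2)] by auto
  have shift_dom: "x + s *\<^sub>R \<nu> + h \<in> \<Omega>" if "(a, r, \<nu>) \<in> J" "x \<in> closure \<Omega>" "x \<in> cball a (r/2)" "norm h \<le> R" for a r \<nu> x h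
    using chart(3)[OF that(1) that(2) half[OF that(3,1)] s(1,2)] shift[OF that(4)] by blast
  have Eiff: "(x, v) \<in> E \<longleftrightarrow> (\<exists>a r \<nu> h. (a, r, \<nu>) \<in> J \<and> x \<in> closure \<Omega> \<and> x \<in> cball a (r/2) \<and> norm h \<le> R \<and> v = q (a, r, \<nu>) (x, h))" for x v
    unfolding E_def Q_def by (force simp: image_iff)
  have lip: "\<bar>dst T x - dst T (x + s *\<^sub>R \<nu> + h)\<bar> \<le> 2 * Cs" "dst T x \<le> dst T (x + s *\<^sub>R \<nu>) + Cs"
    if "(a, r, \<nu>) \<in> J" "x \<in> \<Omega>" "x \<in> cball a (r/2)" "norm h \<le> R" for a r \<nu> x h
  proof -
    let ?y = "x + s *\<^sub>R \<nu> + h"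
    note seg = cone_segment_dom'[OF J(4)[OF that(1)] that(2) half[OF that(3,1)] s(1,2)]
    note L = dst_lipschitz[OF T seg(1)[OF shift[OF that(4)]]] dst_lipschitz[OF T seg(2)[OF shift[OF that(4)]]]
    have nn: "norm (s *\<^sub>R \<nu>) \<le> s" using chart(2)[OF that(1)] s by (simp add: mult_left_le)
    have yx: "?y - x = s *\<^sub>R \<nu> + h" by simp
    have "norm (?y - x) \<le> 2 * s" unfolding yx using norm_triangle_ineq[of "s *\<^sub>R \<nu>" h] nn that(4) R(3) by linarith
    then have "Cn * norm (?y - x) \<le> Cn * (2 * s)" using Cn_pos by (intro mult_left_mono) auto
    then show "\<bar>dst T x - dst T ?y\<bar> \<le> 2 * Cs"
      using L unfolding norm_minus_commute[of x ?y] Cs_def abs_le_iff by linarith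
    have "dst T x \<le> dst T (x + s *\<^sub>R \<nu>) + Cn * norm (x - (x + s *\<^sub>R \<nu>))"
      by (rule dst_lipschitz[OF T seg(2)]) (use cs in simp)
    also have "Cn * norm (x - (x + s *\<^sub>R \<nu>)) \<le> Cn * s" using nn Cn_pos by (intro mult_left_mono) auto
    finally show "dst T x \<le> dst T (x + s *\<^sub>R \<nu>) + Cs" by (simp add: Cs_def)
  qed
  have good_chart: "\<exists>a r \<nu>. (a, r, \<nu>) \<in> J \<and> x \<in> ball a (r/4) \<and> x \<in> cball a (r/2) \<and> 4 * k0 * (norm (x - a))\<^sup>2 / r\<^sup>2 \<le> k0 / 4"
    if "x \<in> closure \<Omega>" for x
  proof -
    obtain a r \<nu> where j: "(a, r, \<nu>) \<in> J" "x \<in> ball a (r/4)" using J(5) \<open>x \<in> closure \<Omega>\<close> by auto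
    have r: "r > 0" using chart(1)[OF j(1)] .
    have "norm (x - a) \<le> r / 4" using j(2) by (simp add: dist_norm norm_minus_commute)
    then have "(norm (x - a))\<^sup>2 \<le> (r / 4)\<^sup>2" by (intro power_mono) auto
    then have "4 * k0 * (norm (x - a))\<^sup>2 \<le> 4 * k0 * (r / 4)\<^sup>2" using k0 by (intro mult_left_mono) auto
    also have "\<dots> = k0 / 4 * r\<^sup>2" by (simp add: power2_eq_square)
    finally have "4 * k0 * (norm (x - a))\<^sup>2 / r\<^sup>2 \<le> k0 / 4" using r by (simp add: field_simps)
    moreover have "x \<in> cball a (r/2)" using j(2) r by auto
    ultimately show ?thesis using j by blast
  qed
  have lower: "\<exists>v. (x, v) \<in> E \<and> v \<ge> \<theta> * (dst T x - Cs) - k0 / 4 - 2 * Cs" if "x \<in> \<Omega>" for x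
  proof -
    have xc: "x \<in> closure \<Omega>" using that closure_subset by blast
    obtain a r \<nu> where j: "(a, r, \<nu>) \<in> J" "x \<in> cball a (r/2)" "4 * k0 * (norm (x - a))\<^sup>2 / r\<^sup>2 \<le> k0 / 4"
      using good_chart[OF xc] by blast
    have "dst T x - Cs \<le> dst T (x + s *\<^sub>R \<nu>)" using lip(2)[OF j(1) that j(2), of 0] R by simp
    then have "\<theta> * (dst T x - Cs) \<le> \<theta> * dst T (x + s *\<^sub>R \<nu>)" using \<theta> by (intro mult_left_mono)
    then have "q (a, r, \<nu>) (x, 0) \<ge> \<theta> * (dst T x - Cs) - k0 / 4 - 2 * Cs"
      using j(3) by (simp add: q_def)
    moreover have "(x, q (a, r, \<nu>) (x, 0)) \<in> E" unfolding Eiff using j xc R by force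
    ultimately show ?thesis by blast
  qed
  \<comment> \<open>Sum of the coefficients of the two quadratic terms, with the smallest chart
    radius in the second.\<close>
  define K where "K = 1 / (2 * \<sigma>) + 4 * k0 / rm\<^sup>2"
  have "eikonal_minorant T \<delta> E \<eta> K"
    unfolding eikonal_minorant_def
  proof (intro conjI ballI allI impI)
    show "compact E"
      unfolding E_def
    proof (intro compact_UN J(1) compact_continuous_image)
      fix j assume "j \<in> J"
      obtain a r \<nu> where j: "j = (a, r, \<nu>)" by (cases j)
      have "continuous_on (Q j) (\<lambda>z. dst T (fst z + s *\<^sub>R \<nu> + snd z))"
        by (rule continuous_on_compose2[OF continuous_dst[OF T]])
          (use shift_dom \<open>j \<in> J\<close> in \<open>auto simp: Q_def j intro!: continuous_intros\<close>)
      then show "continuous_on (Q j) (\<lambda>z. (fst z, q j z))"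
        unfolding q_def j using \<sigma>(1) chart(1)[of a r \<nu>] \<open>j \<in> J\<close> j
        by (auto simp: split_beta intro!: continuous_intros)
      show "compact (Q j)" unfolding Q_def j
        by (auto intro!: compact_Times compact_Int compact_closure_dom)
    qed
    show "E \<subseteq> closure \<Omega> \<times> UNIV" using Eiff by auto
    show "\<eta> > 0" by (rule \<eta>)
    show "K > 0" unfolding K_def using \<sigma> k0 rm by (simp add: add_pos_pos)
    show "\<exists>v. (x, v) \<in> E" if "x \<in> closure \<Omega>" for x
      using good_chart[OF that] that R Eiff by (metis less_imp_le norm_zero)
    show "\<exists>v. (x, v) \<in> E \<and> dst T x - \<delta> \<le> v" if x: "x \<in> \<Omega>" for x
    proof -
      obtain v where v: "(x, v) \<in> E" "v \<ge> \<theta> * (dst T x - Cs) - k0 / 4 - 2 * Cs" using lower[OF x] by blast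
      have "\<eta> * dst T x \<le> \<eta> * B" using B(2)[OF x] \<eta> by (intro mult_left_mono) auto
      then have "\<theta> * dst T x \<ge> dst T x - \<delta> / 4" using \<eta>B by (simp add: \<theta>_def algebra_simps)
      moreover have "\<theta> * Cs \<le> Cs" using \<theta> Cs by (simp add: mult_left_le_one_le)
      ultimately have "v \<ge> dst T x - \<delta>" using v(2) Cs k0(1,2) unfolding right_diff_distrib by linarith
      then show ?thesis using v(1) by blast
    qed
    show "v \<le> 0" if xv: "(x, v) \<in> E" and xT: "x \<in> closure T" for x v
    proof -
      obtain a r \<nu> h where j: "(a, r, \<nu>) \<in> J" "x \<in> cball a (r/2)" "norm h \<le> R" "v = q (a, r, \<nu>) (x, h)"
        using xv unfolding Eiff by blast
      let ?y = "x + s *\<^sub>R \<nu> + h"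
      have r: "r > 0" using chart(1)[OF j(1)] .
      \<comment> \<open>\<open>T\<close> may fail to be closed, so a nearby point of
        \<open>T\<close> replaces \<open>x\<close>; the room between \<open>R\<close> and
        \<open>c * s\<close> absorbs the difference.\<close>
      obtain x' where x': "x' \<in> T" "dist x' x < min (c * s / 2) (r / 2)"
        using xT cs r closure_approachable[of x T] by (metis half_gt_zero min_less_iff_conj)
      have x'f: "x' \<in> closure \<Omega>" using x'(1) T(2) frontier_dom by blast
      have x'b: "x' \<in> cball a r" using j(2) x'(2) dist_triangle[of a x' x] by (simp add: dist_commute)
      have nx: "norm (x - x') < c * s / 2" using x'(2) by (simp add: dist_norm norm_minus_commute)
      have yb: "?y \<in> ball (x' + s *\<^sub>R \<nu>) (c * s)"
      proof -
        have "?y - (x' + s *\<^sub>R \<nu>) = (x - x') + h" by simp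
        then have "norm (?y - (x' + s *\<^sub>R \<nu>)) \<le> norm (x - x') + norm h"
          using norm_triangle_ineq[of "x - x'" h] by metis
        also have "\<dots> < c * s" using nx j(3) unfolding R_def by linarith
        finally show ?thesis unfolding mem_ball dist_norm by (simp only: norm_minus_commute)
      qed
      have seg: "closed_segment ?y x' - {x'} \<subseteq> \<Omega>"
        by (rule cone_segment_dom[OF J(4)[OF j(1)] x'f x'b s(1,2) yb])
      have yO: "?y \<in> \<Omega>" using chart(3)[OF j(1) x'f x'b s(1,2)] yb by blast
      have "dst T ?y \<le> cost ?y x'" by (rule dst_le[OF reach.last[OF yO x'(1) seg]])
      also have "\<dots> \<le> Cn * norm (?y - x')" by (rule cost_le)
      also have "\<dots> \<le> Cn * (2 * s)"
      proof (rule mult_left_mono)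
        have "norm (?y - x') \<le> norm (x - x') + norm (s *\<^sub>R \<nu>) + norm h"
          using norm_triangle_ineq[of "(x - x') + s *\<^sub>R \<nu>" h] norm_triangle_ineq[of "x - x'" "s *\<^sub>R \<nu>"]
          by (simp add: algebra_simps)
        also have "norm (s *\<^sub>R \<nu>) \<le> s" using chart(2)[OF j(1)] s by (simp add: mult_left_le)
        finally show "norm (?y - x') \<le> 2 * s" using nx j(3) cs unfolding R_def by simp
      qed (use Cn_pos in simp)
      finally have Dy: "dst T ?y \<le> 2 * Cs" by (simp add: Cs_def)
      have "\<theta> * dst T ?y \<le> dst T ?y" using \<theta> dst_nonneg[OF T yO] by (simp add: mult_left_le_one_le)
      moreover have "(norm h)\<^sup>2 / (2 * \<sigma>) \<ge> 0" "4 * k0 * (norm (x - a))\<^sup>2 / r\<^sup>2 \<ge> 0" using \<sigma> k0 by auto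
      ultimately show ?thesis unfolding j(4) q_def using Dy by simp
    qed
    show "\<exists>b. (A x *v b) \<bullet> b \<le> 1 - \<eta> \<and> (\<forall>\<^sub>F x' in nhds x. \<exists>v'. (x', v') \<in> E \<and> v + b \<bullet> (x' - x) - K * (norm (x' - x))\<^sup>2 \<le> v')"
      if xv: "(x, v) \<in> E" and xO: "x \<in> \<Omega>" and mx: "\<forall>v'. (x, v') \<in> E \<longrightarrow> v' \<le> v" for x v
    proof -
      have xc: "x \<in> closure \<Omega>" using xO closure_subset by blast
      obtain a r \<nu> h where j: "(a, r, \<nu>) \<in> J" "x \<in> cball a (r/2)" "norm h \<le> R" "v = q (a, r, \<nu>) (x, h)"
        using xv unfolding Eiff by blast
      have r: "r > 0" "rm \<le> r" using chart(1)[OF j(1)] rm_le[OF j(1)] by auto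
      let ?y = "x + s *\<^sub>R \<nu> + h"
      have yO: "?y \<in> \<Omega>" by (rule shift_dom[OF j(1) xc j(2,3)])
      have qmax: "q (a, r, \<nu>) (x, h') \<le> v" if "norm h' \<le> R" for h'
        using mx that j xc unfolding Eiff by blast
      \<comment> \<open>On the rim the penalty exceeds that of a good chart by at least 3 k0 / 4,
        while all other differences amount to at most 3 Cs. So the top of a fibre never comes from
        the rim.\<close>
      have inner: "x \<in> ball a (r/2)"
      proof (rule ccontr)
        assume "x \<notin> ball a (r/2)"
        then have "norm (x - a) = r / 2" using j(2) by (auto simp: dist_norm norm_minus_commute)
        then have "4 * k0 * (norm (x - a))\<^sup>2 / r\<^sup>2 = 4 * k0 * (r / 2)\<^sup>2 / r\<^sup>2" by (simp only:)
        also have "\<dots> = k0" using r by (simp add: power2_eq_square)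
        finally have "4 * k0 * (norm (x - a))\<^sup>2 / r\<^sup>2 = k0" .
        then have "v \<le> \<theta> * dst T ?y - k0 - 2 * Cs" using \<sigma> by (simp add: j(4) q_def)
        also have "\<theta> * dst T ?y \<le> \<theta> * (dst T x + 2 * Cs)"
          using lip(1)[OF j(1) xO j(2,3)] \<theta> by (intro mult_left_mono) auto
        finally have 1: "v \<le> \<theta> * (dst T x + 2 * Cs) - k0 - 2 * Cs" by simp
        obtain v' where "(x, v') \<in> E" "v' \<ge> \<theta> * (dst T x - Cs) - k0 / 4 - 2 * Cs" using lower[OF xO] by blast
        then have "v \<ge> \<theta> * (dst T x - Cs) - k0 / 4 - 2 * Cs" using mx by force
        with 1 have "3 * k0 / 4 \<le> \<theta> * (3 * Cs)" by (simp add: algebra_simps)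
        also have "\<dots> \<le> 3 * Cs" using \<theta> Cs by (simp add: mult_left_le_one_le)
        finally show False using Cs k0 by linarith
      qed
      \<comment> \<open>Replacing \<open>h\<close> by 0 changes the distance by at most
        \<open>Cn * norm h\<close> and saves the quadratic term, so a maximising \<open>h\<close> is
        short.\<close>
      have hC: "norm h \<le> 2 * Cn * \<sigma>"
      proof (rule ccontr)
        assume "\<not> norm h \<le> 2 * Cn * \<sigma>"
        then have hn: "norm h > 2 * Cn * \<sigma>" by simp
        let ?z = "x + s *\<^sub>R \<nu>"
        have "ball ?z (c * s) \<subseteq> \<Omega>" by (rule chart(3)[OF j(1) xc half[OF j(2,1)] s(1,2)])
        moreover have "closed_segment ?y ?z \<subseteq> ball ?z (c * s)"
          by (rule closed_segment_subset) (use shift[OF j(3), of x \<nu>] cs in auto)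
        ultimately have "closed_segment ?y ?z \<subseteq> \<Omega>" by blast
        from dst_lipschitz[OF T this] have "dst T ?y \<le> dst T ?z + Cn * norm h" by simp
        then have "\<theta> * dst T ?y \<le> \<theta> * (dst T ?z + Cn * norm h)" using \<theta> by (intro mult_left_mono)
        also have "\<dots> \<le> \<theta> * dst T ?z + Cn * norm h"
          using \<theta> Cn_pos mult_right_mono[of \<theta> 1 "Cn * norm h"] by (simp add: distrib_left)
        finally have "(norm h)\<^sup>2 / (2 * \<sigma>) \<le> Cn * norm h"
          using qmax[of 0] R by (simp add: j(4) q_def)
        then have "norm h * norm h \<le> norm h * (2 * Cn * \<sigma>)" using \<sigma> by (simp add: field_simps power2_eq_square)
        moreover have "norm h > 0" using hn mult_pos_pos[of "2 * Cn" \<sigma>] Cn_pos \<sigma>(1) by linarith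
        ultimately show False using hn by simp
      qed
      then have hR: "norm h < R" using \<sigma> by linarith
      define p where "p = (1 / \<sigma>) *\<^sub>R h"
      have pn: "norm p \<le> 2 * Cn" using hC \<sigma> by (simp add: p_def field_simps)
      have eik: "(A ?y *v p) \<bullet> p \<le> \<theta>\<^sup>2"
      proof (rule dst_superjet[OF T yO _ \<sigma>(1) \<theta>(1), where w = "x + s *\<^sub>R \<nu>" and d = "R - norm h"])
        show "R - norm h > 0" using hR by simp
        show "p = (1 / \<sigma>) *\<^sub>R (?y - (x + s *\<^sub>R \<nu>))" by (simp add: p_def)
        fix z assume z: "z \<in> ball ?y (R - norm h)"
        define h' where "h' = z - (x + s *\<^sub>R \<nu>)"
        have "h' = h + (z - ?y)" by (simp add: h'_def)
        then have "norm h' \<le> norm h + norm (z - ?y)" using norm_triangle_ineq by metis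
        also have "norm (z - ?y) < R - norm h" using z by (simp add: dist_norm norm_minus_commute)
        finally have "norm h' \<le> R" by simp
        from qmax[OF this] show "\<theta> * dst T z - (norm (z - (x + s *\<^sub>R \<nu>)))\<^sup>2 / (2 * \<sigma>)
            \<le> \<theta> * dst T ?y - (norm (?y - (x + s *\<^sub>R \<nu>)))\<^sup>2 / (2 * \<sigma>)"
          by (simp add: j(4) q_def h'_def)
      qed
      define e where "e = (8 * k0 / r\<^sup>2) *\<^sub>R (x - a)"
      have en: "norm e \<le> g0"
      proof -
        have "norm (x - a) \<le> r / 2" using j(2) by (simp add: dist_norm norm_minus_commute)
        moreover have "norm e = 8 * k0 / r\<^sup>2 * norm (x - a)" unfolding e_def using k0(1) by simp
        moreover have "0 \<le> 8 * k0 / r\<^sup>2" using k0(1) by simp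
        ultimately have "norm e \<le> 8 * k0 / r\<^sup>2 * (r / 2)" by (metis mult_left_mono)
        also have "\<dots> = 4 * k0 / r" using r by (simp add: power2_eq_square)
        also have "\<dots> \<le> 4 * k0 / rm" using r rm k0 by (intro divide_left_mono) auto
        finally show ?thesis using k0 by simp
      qed
      define b where "b = p - e"
      have "(A x *v b) \<bullet> b \<le> 1 - \<eta>"
      proof -
        have "norm (s *\<^sub>R \<nu>) \<le> s" using chart(2)[OF j(1)] s by (simp add: mult_left_le)
        moreover have yx: "?y - x = s *\<^sub>R \<nu> + h" by simp
        ultimately have "norm (?y - x) \<le> 2 * s"
          unfolding yx using norm_triangle_ineq[of "s *\<^sub>R \<nu>" h] j(3) R(3) by linarith
        then have "norm (x - ?y) < \<rho>" using s(3) unfolding norm_minus_commute[of x ?y] by linarith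
        then have "norm (A x - A ?y) < \<omega>" using rho(2)[OF xc] yO closure_subset by blast
        then have "norm (A x - A ?y) * (norm p)\<^sup>2 \<le> \<omega> * (2 * Cn)\<^sup>2"
          using pn \<omega>(1) by (intro mult_mono power_mono) auto
        also have "\<dots> = \<eta> / 4" using \<omega>(2) by (simp add: power2_eq_square mult_ac)
        finally have 1: "(A x *v p) \<bullet> p \<le> \<theta>\<^sup>2 + \<eta> / 4" using form_diff[of x p ?y] eik by linarith
        have "(A x *v b) \<bullet> b = (A x *v p) \<bullet> p - 2 * ((A x *v p) \<bullet> e) + (A x *v e) \<bullet> e"
          unfolding b_def by (simp add: matrix_vector_mult_diff_distrib inner_diff_left inner_diff_right A_sym_inner[of x e p] inner_commute[of e])
        moreover have "\<bar>(A x *v p) \<bullet> e\<bar> \<le> \<Lambda> * (2 * Cn) * g0"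
        proof -
          have "\<bar>(A x *v p) \<bullet> e\<bar> \<le> norm (A x *v p) * norm e" by (rule Cauchy_Schwarz_ineq2)
          also have "\<dots> \<le> (norm (A x) * norm p) * norm e" by (intro mult_right_mono norm_matrix_vector_le) simp
          also have "\<dots> \<le> (\<Lambda> * (2 * Cn)) * g0"
            using \<Lambda>(1) \<Lambda>(2)[OF xO] pn en Cn_pos by (intro mult_mono) auto
          finally show ?thesis .
        qed
        moreover have "(A x *v e) \<bullet> e \<le> \<Lambda> * g0\<^sup>2"
          by (rule order_trans[OF form_le]) (use \<Lambda> xO en in \<open>intro mult_mono power_mono; auto\<close>)
        ultimately have "(A x *v b) \<bullet> b \<le> \<theta>\<^sup>2 + \<eta> / 4 + \<eta> / 4"
          using 1 g0(3) by (simp add: mult_ac)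
        also have "\<theta>\<^sup>2 = 1 - 2 * \<eta> + \<eta> * \<eta>" by (simp add: \<theta>_def power2_eq_square algebra_simps)
        also have "\<eta> * \<eta> \<le> (1/2) * \<eta>" using \<eta> by (intro mult_right_mono) auto
        finally show ?thesis by simp
      qed
      moreover have "\<forall>\<^sub>F x' in nhds x. \<exists>v'. (x', v') \<in> E \<and> v + b \<bullet> (x' - x) - K * (norm (x' - x))\<^sup>2 \<le> v'"
      proof -
        have "\<forall>\<^sub>F x' in nhds x. x' \<in> \<Omega> \<inter> ball a (r/2) \<inter> ball x (R - norm h)"
          by (rule eventually_nhds_in_open) (use open_dom xO inner hR in auto)
        then show ?thesis
        proof eventually_elim
          case (elim x')
          define d where "d = x' - x"
          \<comment> \<open>The shifted point is kept fixed while \<open>x\<close> moves, so the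
            distance term is unchanged and only the two quadratic terms vary. This is the source of
            semiconvexity.\<close>
          define h' where "h' = h - d"
          have "norm d < R - norm h" using elim by (simp add: d_def dist_norm norm_minus_commute)
          then have h'R: "norm h' \<le> R" unfolding h'_def using norm_triangle_ineq4[of h d] by linarith
          have "(x', q (a, r, \<nu>) (x', h')) \<in> E"
            unfolding Eiff using elim j(1) h'R closure_subset[of \<Omega>] by (intro exI[of _ a] exI[of _ r] exI[of _ \<nu>] exI[of _ h']) auto
          moreover have "v + b \<bullet> (x' - x) - K * (norm (x' - x))\<^sup>2 \<le> q (a, r, \<nu>) (x', h')"
          proof -
            have yy: "x' + s *\<^sub>R \<nu> + h' = ?y" by (simp add: h'_def d_def)
            have n1: "(norm h')\<^sup>2 = (norm h)\<^sup>2 - 2 * (h \<bullet> d) + (norm d)\<^sup>2"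
              unfolding h'_def power2_norm_eq_inner by (simp add: inner_diff_left inner_diff_right inner_commute)
            have xa: "x' - a = (x - a) + d" by (simp add: d_def)
            have n2: "(norm (x' - a))\<^sup>2 = (norm (x - a))\<^sup>2 + 2 * ((x - a) \<bullet> d) + (norm d)\<^sup>2"
              unfolding xa power2_norm_eq_inner inner_add_left[of "x - a"] inner_add_right[of _ "x - a"]
              by (simp add: inner_commute[of d "x - a"])
            have "q (a, r, \<nu>) (x', h') = v + (h \<bullet> d) / \<sigma> - (norm d)\<^sup>2 / (2 * \<sigma>)
                - 4 * k0 * (2 * ((x - a) \<bullet> d) + (norm d)\<^sup>2) / r\<^sup>2"
              unfolding j(4) q_def prod.case yy n1 n2 using \<sigma>(1) r(1)
              by (simp add: add_divide_distrib diff_divide_distrib distrib_left)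
            also have "\<dots> = v + b \<bullet> d - (1 / (2 * \<sigma>) + 4 * k0 / r\<^sup>2) * (norm d)\<^sup>2"
              unfolding b_def p_def e_def by (simp add: inner_diff_left add_divide_distrib distrib_left distrib_right)
            also have "\<dots> \<ge> v + b \<bullet> d - K * (norm d)\<^sup>2"
            proof -
              have "4 * k0 / r\<^sup>2 \<le> 4 * k0 / rm\<^sup>2" using r rm k0 by (intro divide_left_mono power_mono) auto
              then have "(1 / (2 * \<sigma>) + 4 * k0 / r\<^sup>2) * (norm d)\<^sup>2 \<le> K * (norm d)\<^sup>2"
                unfolding K_def by (intro mult_right_mono) auto
              then show ?thesis by simp
            qed
            finally show ?thesis by (simp add: d_def)
          qed
          ultimately show ?case by blast
        qed
      qed
      ultimately show ?thesis by blast
    qed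
  qed
  then show ?thesis by blast
qed

end

text \<open>A finite subcover turns locally uniform small times into a single one. It serves the
  initial conditions of the comparison arguments and the final uniformity on compact sets.\<close>

lemma compact_uniform_time:
  fixes E :: "'a::metric_space set"
  assumes "compact E"
    and "\<And>z. z \<in> E \<Longrightarrow> \<exists>\<rho>>0. \<exists>\<tau>>0::real. \<forall>z'\<in>E \<inter> ball z \<rho>. \<forall>t. 0 < t \<longrightarrow> t < \<tau> \<longrightarrow> P z' t"
  shows "\<exists>\<tau>>0. \<forall>z\<in>E. \<forall>t. 0 < t \<longrightarrow> t < \<tau> \<longrightarrow> P z t"
proof -
  from assms(2) obtain \<rho> \<tau> where rt: "\<And>z. z \<in> E \<Longrightarrow> \<rho> z > 0 \<and> \<tau> z > (0::real) \<and> (\<forall>z'\<in>E \<inter> ball z (\<rho> z). \<forall>t. 0 < t \<longrightarrow> t < \<tau> z \<longrightarrow> P z' t)"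
    by metis
  have "E \<subseteq> (\<Union>z\<in>E. ball z (\<rho> z))" using rt by fastforce
  then obtain F where F: "F \<subseteq> E" "finite F" "E \<subseteq> (\<Union>z\<in>F. ball z (\<rho> z))"
    using compactE_image[OF assms(1), of E "\<lambda>z. ball z (\<rho> z)"] by auto
  define \<tau>0 where "\<tau>0 = Min (insert 1 (\<tau> ` F))"
  have "\<tau>0 > 0" unfolding \<tau>0_def using F rt by (subst Min_gr_iff) auto
  moreover have "P z t" if "z \<in> E" "0 < t" "t < \<tau>0" for z t
  proof -
    from F(3) \<open>z \<in> E\<close> obtain y where y: "y \<in> F" "z \<in> ball y (\<rho> y)" by blast
    have "\<tau>0 \<le> \<tau> y" unfolding \<tau>0_def using F y by (intro Min_le) auto
    then show ?thesis using rt[of y] y F that by auto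
  qed
  ultimately show ?thesis by blast
qed

context elliptic_domain
begin

subsection \<open>Parabolic comparison by test functions\<close>

text \<open>Subsolutions of the parabolic equation in the viscosity sense, tested only from the past.\<close>

definition psub :: "(real ^ 'n \<Rightarrow> real \<Rightarrow> real) \<Rightarrow> bool" where
  "psub Z \<longleftrightarrow> (\<forall>x\<in>\<Omega>. \<forall>t>0. \<forall>w wt b W. (w x has_real_derivative wt) (at t) \<longrightarrow> jet2 (\<lambda>y. w y t) x b W \<longrightarrow>
     (\<forall>\<^sub>F y in nhds x. Z y t - w y t \<le> Z x t - w x t) \<longrightarrow>
     (\<forall>\<^sub>F s in nhds t. s \<le> t \<longrightarrow> Z x s - w x s \<le> Z x t - w x t) \<longrightarrow> wt \<le> (\<Sum>k\<in>UNIV. W (dir x k)))"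

lemma psubD:
  assumes "psub Z" "x \<in> \<Omega>" "t > 0" "(w x has_real_derivative wt) (at t)" "jet2 (\<lambda>y. w y t) x b W"
    "\<forall>\<^sub>F y in nhds x. Z y t - w y t \<le> Z x t - w x t"
    "\<forall>\<^sub>F s in nhds t. s \<le> t \<longrightarrow> Z x s - w x s \<le> Z x t - w x t"
  shows "wt \<le> (\<Sum>k\<in>UNIV. W (dir x k))"
  using assms unfolding psub_def by blast

lemma psub_classical:
  assumes "\<And>x t. x \<in> \<Omega> \<Longrightarrow> t > 0 \<Longrightarrow> \<exists>ut b H. (u x has_real_derivative ut) (at t) \<and> jet2 (\<lambda>y. u y t) x b H \<and> ut = (\<Sum>k\<in>UNIV. H (dir x k))"
  shows "psub u" "psub (\<lambda>x t. - u x t)"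
proof -
  have *: "psub z" if z: "\<And>x t. x \<in> \<Omega> \<Longrightarrow> t > 0 \<Longrightarrow> \<exists>ut b H. (z x has_real_derivative ut) (at t) \<and> jet2 (\<lambda>y. z y t) x b H \<and> ut = (\<Sum>k\<in>UNIV. H (dir x k))" for z
    unfolding psub_def
  proof (intro ballI allI impI)
    fix x t w wt b W
    assume x: "x \<in> \<Omega>" and t: "(0::real) < t" and wt: "(w x has_real_derivative wt) (at t)"
      and j: "jet2 (\<lambda>y. w y t) x b W" and mx: "\<forall>\<^sub>F y in nhds x. z y t - w y t \<le> z x t - w x t"
      and mt: "\<forall>\<^sub>F s in nhds t. s \<le> t \<longrightarrow> z x s - w x s \<le> z x t - w x t"
    obtain ut bu H where u: "(z x has_real_derivative ut) (at t)" "jet2 (\<lambda>y. z y t) x bu H" "ut = (\<Sum>k\<in>UNIV. H (dir x k))"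
      using z[OF x t] by blast
    have "wt \<le> ut" by (rule deriv_backward_local_max[OF u(1) wt mt])
    also have "\<dots> \<le> (\<Sum>k\<in>UNIV. W (dir x k))"
      unfolding u(3) by (intro sum_mono jet2_local_max[OF u(2) j mx])
    finally show "wt \<le> (\<Sum>k\<in>UNIV. W (dir x k))" .
  qed
  show "psub u" by (rule *[OF assms])
  show "psub (\<lambda>x t. - u x t)"
  proof (rule *)
    fix x and t :: real assume "x \<in> \<Omega>" "t > 0"
    then obtain ut b H where u: "(u x has_real_derivative ut) (at t)" "jet2 (\<lambda>y. u y t) x b H" "ut = (\<Sum>k\<in>UNIV. H (dir x k))"
      using assms by blast
    then show "\<exists>ut b H. ((\<lambda>t. - u x t) has_real_derivative ut) (at t) \<and> jet2 (\<lambda>y. - u y t) x b H \<and> ut = (\<Sum>k\<in>UNIV. H (dir x k))"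
      by (intro exI[of _ "- ut"] exI[of _ "\<lambda>\<xi>. - b \<xi>"] exI[of _ "\<lambda>\<xi>. - H \<xi>"])
        (auto intro!: DERIV_minus jet2_minus simp: sum_negf)
  qed
qed

lemma psub_parabolic_solution:
  assumes "parabolic_solution A \<Omega> f u"
  shows "psub u" "psub (\<lambda>x t. - u x t)"
proof -
  have "\<exists>ut b H. (u x has_real_derivative ut) (at t) \<and> jet2 (\<lambda>y. u y t) x b H \<and> ut = (\<Sum>k\<in>UNIV. H (dir x k))"
    if "x \<in> \<Omega>" "t > 0" for x t
  proof -
    have "twice_differentiable_in (\<lambda>y. u y t) \<Omega>" "u x differentiable (at t)"
      and eq: "deriv (\<lambda>s. u x s) t - trace (A x ** hessian (\<lambda>y. u y t) x) = 0"
      using assms that unfolding parabolic_solution_def by auto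
    from this(2) have "(u x has_real_derivative deriv (u x) t) (at t)"
      by (simp add: DERIV_deriv_iff_real_differentiable)
    moreover have "jet2 (\<lambda>y. u y t) x (\<lambda>\<xi>. grad (\<lambda>y. u y t) x \<bullet> \<xi>) (\<lambda>\<xi>. (hessian (\<lambda>y. u y t) x *v \<xi>) \<bullet> \<xi>)"
      by (rule jet2_classical[OF _ open_dom that(1)]) fact
    ultimately show ?thesis using eq unfolding trace_dir by (intro exI conjI) auto
  qed
  from psub_classical[of u, OF this] show "psub u" "psub (\<lambda>x t. - u x t)" by auto
qed

lemma psub_elliptic_solution:
  assumes "elliptic_solution A \<Omega> f \<epsilon> U" "\<epsilon> > 0"
  shows "psub (\<lambda>x t. exp (t / \<epsilon>\<^sup>2) * U x)" "psub (\<lambda>x t. - (exp (t / \<epsilon>\<^sup>2) * U x))"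
proof -
  have "\<exists>ut b H. ((\<lambda>t. exp (t / \<epsilon>\<^sup>2) * U x) has_real_derivative ut) (at t) \<and> jet2 (\<lambda>y. exp (t / \<epsilon>\<^sup>2) * U y) x b H \<and> ut = (\<Sum>k\<in>UNIV. H (dir x k))"
    if "x \<in> \<Omega>" "t > 0" for x t
  proof (intro exI conjI)
    have tw: "twice_differentiable_in U \<Omega>" and eq: "\<epsilon>\<^sup>2 * trace (A x ** hessian U x) - U x = 0"
      using assms that unfolding elliptic_solution_def by auto
    show "((\<lambda>t. exp (t / \<epsilon>\<^sup>2) * U x) has_real_derivative exp (t / \<epsilon>\<^sup>2) * (1 / \<epsilon>\<^sup>2) * U x) (at t)"
    proof -
      define k where "k = 1 / \<epsilon>\<^sup>2"
      have "((\<lambda>t. exp (k * t) * U x) has_real_derivative exp (k * t) * k * U x) (at t)"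
        by (auto intro!: derivative_eq_intros)
      then show ?thesis by (simp add: k_def)
    qed
    show "jet2 (\<lambda>y. exp (t / \<epsilon>\<^sup>2) * U y) x (\<lambda>\<xi>. exp (t / \<epsilon>\<^sup>2) * (grad U x \<bullet> \<xi>)) (\<lambda>\<xi>. exp (t / \<epsilon>\<^sup>2) * ((hessian U x *v \<xi>) \<bullet> \<xi>))"
      by (rule jet2_cmult[OF jet2_classical[OF tw open_dom that(1)]])
    have "U x = \<epsilon>\<^sup>2 * (\<Sum>k\<in>UNIV. (hessian U x *v dir x k) \<bullet> dir x k)" using eq unfolding trace_dir by simp
    then show "exp (t / \<epsilon>\<^sup>2) * (1 / \<epsilon>\<^sup>2) * U x = (\<Sum>k\<in>UNIV. exp (t / \<epsilon>\<^sup>2) * ((hessian U x *v dir x k) \<bullet> dir x k))"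
      using assms(2) by (simp add: sum_distrib_left)
  qed
  from psub_classical[of "\<lambda>x t. exp (t / \<epsilon>\<^sup>2) * U x", OF this]
  show "psub (\<lambda>x t. exp (t / \<epsilon>\<^sup>2) * U x)" "psub (\<lambda>x t. - (exp (t / \<epsilon>\<^sup>2) * U x))" by auto
qed

section \<open>Exponential barriers from above\<close>

definition trb :: real where
  "trb = (SOME C. C > 0 \<and> (\<forall>x\<in>\<Omega>. trace (A x) \<le> C) \<and> (\<forall>x\<in>\<Omega>. norm (A x) \<le> C))"

lemma trb: "trb > 0" "x \<in> \<Omega> \<Longrightarrow> trace (A x) \<le> trb" "x \<in> \<Omega> \<Longrightarrow> norm (A x) \<le> trb"
proof -
  obtain C where "C > 0" "\<forall>x\<in>\<Omega>. trace (A x) \<le> C" "\<forall>x\<in>\<Omega>. norm (A x) \<le> C"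
    by (rule trace_bound[OF bounded_dom])
  then have "\<exists>C. C > 0 \<and> (\<forall>x\<in>\<Omega>. trace (A x) \<le> C) \<and> (\<forall>x\<in>\<Omega>. norm (A x) \<le> C)" by blast
  from someI_ex[OF this, folded trb_def]
  show "trb > 0" "x \<in> \<Omega> \<Longrightarrow> trace (A x) \<le> trb" "x \<in> \<Omega> \<Longrightarrow> norm (A x) \<le> trb" by auto
qed

text \<open>The barrier built from the envelope is not smooth. Near \<open>x\<close> it lies below
  the function \<open>w\<close>, which uses the quadratic minorant of the envelope and agrees with
  the barrier at \<open>x\<close>; so \<open>w\<close> can serve as a test function in its
  place.\<close>

lemma exp_barrier_jet:
  fixes b x :: "real ^ 'n" and M v K :: real
  assumes \<epsilon>: "\<epsilon> > 0"
  defines "w \<equiv> \<lambda>y t. M * exp (t / \<epsilon>\<^sup>2 - (v + b \<bullet> (y - x) - K * (norm (y - x))\<^sup>2) / \<epsilon>)"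
  shows "(w x has_real_derivative w x t / \<epsilon>\<^sup>2) (at t)"
    "\<exists>b'. jet2 (\<lambda>y. w y t) x b' (\<lambda>\<xi>. w x t / \<epsilon>\<^sup>2 * ((b \<bullet> \<xi>)\<^sup>2 + 2 * K * \<epsilon> * (norm \<xi>)\<^sup>2))"
proof -
  show "(w x has_real_derivative w x t / \<epsilon>\<^sup>2) (at t)"
  proof -
    define k where "k = 1 / \<epsilon>\<^sup>2"
    have "((\<lambda>t. M * exp (k * t - v / \<epsilon>)) has_real_derivative M * exp (k * t - v / \<epsilon>) * k) (at t)"
      by (auto intro!: derivative_eq_intros)
    then show ?thesis by (simp add: w_def k_def)
  qed
  define p where "p y = t / \<epsilon>\<^sup>2 - (v + b \<bullet> (y - x) - K * (norm (y - x))\<^sup>2) / \<epsilon>" for y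
  have "jet2 p x (\<lambda>\<xi>. - (b \<bullet> \<xi>) / \<epsilon>) (\<lambda>\<xi>. 2 * K * (norm \<xi>)\<^sup>2 / \<epsilon>)"
    by (rule jet2_quadratic) (use \<epsilon> in \<open>simp add: p_def power_mult_distrib field_simps\<close>)
  from jet2_cmult[OF jet2_exp[OF this], of M]
  have "jet2 (\<lambda>y. w y t) x (\<lambda>\<xi>. M * (exp (p x) * (- (b \<bullet> \<xi>) / \<epsilon>)))
     (\<lambda>\<xi>. M * (exp (p x) * ((- (b \<bullet> \<xi>) / \<epsilon>)\<^sup>2 + 2 * K * (norm \<xi>)\<^sup>2 / \<epsilon>)))"
    unfolding w_def p_def by simp
  moreover have "M * (exp (p x) * ((- (b \<bullet> \<xi>) / \<epsilon>)\<^sup>2 + 2 * K * (norm \<xi>)\<^sup>2 / \<epsilon>))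
     = w x t / \<epsilon>\<^sup>2 * ((b \<bullet> \<xi>)\<^sup>2 + 2 * K * \<epsilon> * (norm \<xi>)\<^sup>2)" for \<xi>
    unfolding w_def p_def using \<epsilon> by (simp add: field_simps power2_eq_square)
  ultimately show "\<exists>b'. jet2 (\<lambda>y. w y t) x b' (\<lambda>\<xi>. w x t / \<epsilon>\<^sup>2 * ((b \<bullet> \<xi>)\<^sup>2 + 2 * K * \<epsilon> * (norm \<xi>)\<^sup>2))" by auto
qed

text \<open>With \<open>c\<close> the time derivative of the barrier, the second order part is c
  times \<langle>A b, b\<rangle> + 2 K \<epsilon> tr A. The first summand is at most 1 - \<eta> and
  the second is less than \<eta>.\<close>

lemma exp_barrier_strict:
  assumes "x \<in> \<Omega>" "(A x *v b) \<bullet> b \<le> 1 - \<eta>" "\<epsilon> > 0" "\<epsilon> * (2 * K * trb) < \<eta>" "c > 0" "K > 0"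
  shows "(\<Sum>k\<in>UNIV. c * ((b \<bullet> dir x k)\<^sup>2 + 2 * K * \<epsilon> * (norm (dir x k))\<^sup>2)) < c"
proof -
  have "(\<Sum>k\<in>UNIV. c * ((b \<bullet> dir x k)\<^sup>2 + 2 * K * \<epsilon> * (norm (dir x k))\<^sup>2))
     = c * ((A x *v b) \<bullet> b + 2 * K * \<epsilon> * trace (A x))"
    by (simp add: form_dir sum_norm_dir[symmetric] sum_distrib_left[symmetric] sum.distrib)
  also have "\<dots> < c * 1"
  proof (rule mult_strict_left_mono)
    have "2 * K * \<epsilon> * trace (A x) \<le> 2 * K * \<epsilon> * trb"
      using trb(2)[OF assms(1)] assms(3,6) by (intro mult_left_mono) auto
    also have "\<dots> = \<epsilon> * (2 * K * trb)" by (simp only: mult_ac)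
    finally show "(A x *v b) \<bullet> b + 2 * K * \<epsilon> * trace (A x) < 1" using assms(2,4) by linarith
  qed (rule assms(5))
  finally show ?thesis by simp
qed

lemma upper_barrier_no_touch:
  assumes g: "psub g" and E: "eikonal_minorant T \<delta> E \<eta> K" and \<epsilon>: "\<epsilon> > 0" "\<epsilon> * (2 * K * trb) < \<eta>" and M: "M > 0"
    and x: "x \<in> \<Omega>" and t: "t > 0" and xv: "(x, v) \<in> E"
    and mx: "\<And>x' v'. (x', v') \<in> E \<Longrightarrow> g x' t - M * exp (t / \<epsilon>\<^sup>2 - v' / \<epsilon>) \<le> g x t - M * exp (t / \<epsilon>\<^sup>2 - v / \<epsilon>)"
    and mt: "\<forall>\<^sub>F s in nhds t. s \<le> t \<longrightarrow> g x s - M * exp (s / \<epsilon>\<^sup>2 - v / \<epsilon>) \<le> g x t - M * exp (t / \<epsilon>\<^sup>2 - v / \<epsilon>)"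
  shows False
proof -
  have K: "K > 0" using E unfolding eikonal_minorant_def by blast
  \<comment> \<open>The barrier decreases in \<open>v\<close>, so maximising over \<open>E\<close>
    selects the top of the fibre over \<open>x\<close>, where \<open>eikonal_minorant\<close>
    provides the quadratic minorant.\<close>
  have fib: "v' \<le> v" if "(x, v') \<in> E" for v'
    using mx[OF that] M \<epsilon> by (simp add: divide_le_cancel)
  obtain b where b: "(A x *v b) \<bullet> b \<le> 1 - \<eta>"
    "\<forall>\<^sub>F x' in nhds x. \<exists>v'. (x', v') \<in> E \<and> v' \<ge> v + b \<bullet> (x' - x) - K * (norm (x' - x))\<^sup>2"
    using E xv x fib unfolding eikonal_minorant_def by blast
  define w where "w y t = M * exp (t / \<epsilon>\<^sup>2 - (v + b \<bullet> (y - x) - K * (norm (y - x))\<^sup>2) / \<epsilon>)" for y t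
  note J = exp_barrier_jet[OF \<epsilon>(1), where M = M and v = v and b = b and x = x and K = K, folded w_def]
  have wx: "w x s = M * exp (s / \<epsilon>\<^sup>2 - v / \<epsilon>)" for s by (simp add: w_def)
  obtain b' where J2: "jet2 (\<lambda>y. w y t) x b' (\<lambda>\<xi>. w x t / \<epsilon>\<^sup>2 * ((b \<bullet> \<xi>)\<^sup>2 + 2 * K * \<epsilon> * (norm \<xi>)\<^sup>2))"
    using J(2) by blast
  have "w x t / \<epsilon>\<^sup>2 \<le> (\<Sum>k\<in>UNIV. w x t / \<epsilon>\<^sup>2 * ((b \<bullet> dir x k)\<^sup>2 + 2 * K * \<epsilon> * (norm (dir x k))\<^sup>2))"
  proof (rule psubD[OF g x t J(1) J2])
    show "\<forall>\<^sub>F y in nhds x. g y t - w y t \<le> g x t - w x t"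
      using b(2)
    proof eventually_elim
      case (elim y)
      then obtain v' where v': "(y, v') \<in> E" "v' \<ge> v + b \<bullet> (y - x) - K * (norm (y - x))\<^sup>2" by blast
      have "M * exp (t / \<epsilon>\<^sup>2 - v' / \<epsilon>) \<le> w y t"
        unfolding w_def using M v'(2) \<epsilon>(1) by (simp add: divide_right_mono)
      then show ?case using mx[OF v'(1)] wx by simp
    qed
    show "\<forall>\<^sub>F s in nhds t. s \<le> t \<longrightarrow> g x s - w x s \<le> g x t - w x t" using mt unfolding wx .
  qed
  moreover have "w x t / \<epsilon>\<^sup>2 > 0" using M \<epsilon> by (simp add: w_def)
  ultimately show False using exp_barrier_strict[OF x b(1) \<epsilon> _ K] by force
qed

text \<open>The difference is maximised over graph points and times. A positive excess can sit
  neither at small times, nor on the lateral boundary, nor inside, where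
  \<open>upper_barrier_no_touch\<close> applies. \<open>init\<close> takes the place of continuity
  at the initial corner.\<close>

lemma upper_barrier_parabolic:
  assumes g: "psub g" and E: "eikonal_minorant T \<delta> E \<eta> K" and \<epsilon>: "\<epsilon> > 0" "\<epsilon> * (2 * K * trb) < \<eta>" and M: "M > 0"
    and cont: "continuous_on (closure \<Omega> \<times> {0<..}) (\<lambda>(x, t). g x t)"
    and gM: "\<And>x t. x \<in> closure \<Omega> \<Longrightarrow> t > 0 \<Longrightarrow> g x t \<le> M"
    and g0: "\<And>x t. x \<in> frontier \<Omega> \<Longrightarrow> x \<notin> T \<Longrightarrow> t > 0 \<Longrightarrow> g x t \<le> 0"
    and init: "\<And>p e. p \<in> closure \<Omega> \<Longrightarrow> p \<notin> closure T \<Longrightarrow> e > 0 \<Longrightarrow>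
       \<exists>\<rho>>0. \<exists>\<tau>>0. \<forall>x\<in>closure \<Omega> \<inter> ball p \<rho>. \<forall>t. 0 < t \<longrightarrow> t < \<tau> \<longrightarrow> g x t \<le> e"
    and xv: "(x1, v1) \<in> E" and t1: "t1 > 0"
  shows "g x1 t1 \<le> M * exp (t1 / \<epsilon>\<^sup>2 - v1 / \<epsilon>)"
proof (rule ccontr)
  have Ec: "compact E" and Ecl: "\<And>x v. (x, v) \<in> E \<Longrightarrow> x \<in> closure \<Omega>"
    and ET: "\<And>x v. (x, v) \<in> E \<Longrightarrow> x \<in> closure T \<Longrightarrow> v \<le> 0"
    using E unfolding eikonal_minorant_def by auto
  assume neg: "\<not> ?thesis"
  \<comment> \<open>Half of the excess: at small times the difference is at most \<open>e\<close>,
    so the maximum is attained after \<tau>0.\<close>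
  define e where "e = (g x1 t1 - M * exp (t1 / \<epsilon>\<^sup>2 - v1 / \<epsilon>)) / 2"
  have e: "e > 0" using neg by (simp add: e_def)
  have "\<exists>\<tau>>0. \<forall>z\<in>E. \<forall>t. 0 < t \<longrightarrow> t < \<tau> \<longrightarrow> g (fst z) t - M * exp (t / \<epsilon>\<^sup>2 - snd z / \<epsilon>) \<le> e"
  proof (rule compact_uniform_time[OF Ec])
    fix z assume z: "z \<in> E"
    obtain p v where zpv: "z = (p, v)" by (cases z)
    show "\<exists>\<rho>>0. \<exists>\<tau>>0. \<forall>z'\<in>E \<inter> ball z \<rho>. \<forall>t. 0 < t \<longrightarrow> t < \<tau> \<longrightarrow> g (fst z') t - M * exp (t / \<epsilon>\<^sup>2 - snd z' / \<epsilon>) \<le> e"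
    \<comment> \<open>Over the closure of the target the barrier starts near \<open>M\<close> or
      above it; elsewhere \<open>g\<close> itself is small by \<open>init\<close>.\<close>
    proof (cases "p \<in> closure T")
      case True
      then have v: "v \<le> 0" using ET z zpv by blast
      have "isCont (\<lambda>r. M * exp (- r / \<epsilon>)) v" by (intro continuous_intros) (use \<epsilon> in auto)
      then obtain d where d: "d > 0" "\<And>r. dist r v < d \<Longrightarrow> dist (M * exp (- r / \<epsilon>)) (M * exp (- v / \<epsilon>)) < e"
        unfolding continuous_at_eps_delta using e by blast
      have "g (fst z') t - M * exp (t / \<epsilon>\<^sup>2 - snd z' / \<epsilon>) \<le> e" if z': "z' \<in> E \<inter> ball z d" and t: "0 < t" for z' t
      proof -
        have "dist (snd z') v < d" using z' zpv dist_snd_le[of z' z] by (auto simp: dist_commute)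
        then have "M * exp (- snd z' / \<epsilon>) > M * exp (- v / \<epsilon>) - e" using d(2) by (force simp: dist_real_def)
        moreover have "M * exp (- v / \<epsilon>) \<ge> M * 1" using M v \<epsilon> by (intro mult_left_mono) (auto simp: divide_nonpos_pos)
        moreover have "M * exp (t / \<epsilon>\<^sup>2 - snd z' / \<epsilon>) \<ge> M * exp (- snd z' / \<epsilon>)" using M t by simp
        moreover have "g (fst z') t \<le> M" using gM[of "fst z'" t] Ecl[of "fst z'" "snd z'"] z' t by auto
        ultimately show ?thesis by linarith
      qed
      then show ?thesis using d(1) by (intro exI[of _ d] exI[of _ 1] conjI) auto
    next
      case False
      from init[OF Ecl[of p v] False e] z zpv obtain \<rho> \<tau> where rt: "\<rho> > 0" "\<tau> > 0"
        "\<And>x t. x \<in> closure \<Omega> \<inter> ball p \<rho> \<Longrightarrow> 0 < t \<Longrightarrow> t < \<tau> \<Longrightarrow> g x t \<le> e" by blast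
      have "g (fst z') t - M * exp (t / \<epsilon>\<^sup>2 - snd z' / \<epsilon>) \<le> e" if z': "z' \<in> E \<inter> ball z \<rho>" and t: "0 < t" "t < \<tau>" for z' t
      proof -
        have "dist (fst z') p < \<rho>" using z' zpv dist_fst_le[of z' z] by (auto simp: dist_commute)
        then have "g (fst z') t \<le> e" using rt(3)[of "fst z'" t] Ecl[of "fst z'" "snd z'"] z' t by (auto simp: dist_commute)
        moreover have "M * exp (t / \<epsilon>\<^sup>2 - snd z' / \<epsilon>) \<ge> 0" using M by simp
        ultimately show ?thesis by linarith
      qed
      then show ?thesis using rt by blast
    qed
  qed
  then obtain \<tau> where \<tau>: "\<tau> > 0" "\<And>x v t. (x, v) \<in> E \<Longrightarrow> 0 < t \<Longrightarrow> t < \<tau> \<Longrightarrow> g x t - M * exp (t / \<epsilon>\<^sup>2 - v / \<epsilon>) \<le> e" by force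
  define \<tau>0 where "\<tau>0 = min (\<tau> / 2) (t1 / 2)"
  have \<tau>0: "0 < \<tau>0" "\<tau>0 < \<tau>" "\<tau>0 < t1" using \<tau>(1) t1 by (auto simp: \<tau>0_def)
  define F where "F = (\<lambda>(z, t). g (fst z) t - M * exp (t / \<epsilon>\<^sup>2 - snd z / \<epsilon>))"
  have "continuous_on (E \<times> {\<tau>0..t1}) (\<lambda>y. (\<lambda>(x, t). g x t) (fst (fst y), snd y))"
    by (rule continuous_on_compose2[OF cont]) (use Ecl \<tau>0 in \<open>auto intro!: continuous_intros\<close>)
  then have "continuous_on (E \<times> {\<tau>0..t1}) F"
    unfolding F_def split_beta by (intro continuous_intros) (use \<epsilon> in auto)
  moreover have "compact (E \<times> {\<tau>0..t1})" by (intro compact_Times Ec) simp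
  moreover have ne: "((x1, v1), t1) \<in> E \<times> {\<tau>0..t1}" using xv \<tau>0 by auto
  ultimately obtain z where z: "z \<in> E \<times> {\<tau>0..t1}" "\<And>y. y \<in> E \<times> {\<tau>0..t1} \<Longrightarrow> F y \<le> F z"
    using continuous_attains_sup[of "E \<times> {\<tau>0..t1}" F] by blast
  obtain x v t where zt: "z = ((x, v), t)" by (metis prod.collapse)
  have xvE: "(x, v) \<in> E" and tt: "\<tau>0 \<le> t" "t \<le> t1" using z zt by auto
  have "F z > e" using z(2)[OF ne] e unfolding F_def by (simp add: e_def)
  then have big': "g x t - M * exp (t / \<epsilon>\<^sup>2 - v / \<epsilon>) > e" unfolding zt F_def by simp
  have t0: "t > \<tau>0" using \<tau>(2)[OF xvE, of \<tau>0] \<tau>0 big' tt by (cases "t = \<tau>0") auto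
  have tp: "t > 0" using t0 \<tau>0 by linarith
  have pos: "M * exp (t / \<epsilon>\<^sup>2 - v / \<epsilon>) > 0" using M by simp
  have xO: "x \<in> \<Omega>"
  proof (rule ccontr)
    assume "x \<notin> \<Omega>"
    then have xf: "x \<in> frontier \<Omega>" using Ecl[OF xvE] frontier_dom by blast
    show False
    proof (cases "x \<in> T")
      case True
      then have "v \<le> 0" using ET[OF xvE] closure_subset by blast
      then have "v / \<epsilon> \<le> 0" using \<epsilon>(1) by (simp add: divide_nonpos_pos)
      moreover have "0 \<le> t / \<epsilon>\<^sup>2" using tp by simp
      ultimately have "0 \<le> t / \<epsilon>\<^sup>2 - v / \<epsilon>" by linarith
      then have "M * exp (t / \<epsilon>\<^sup>2 - v / \<epsilon>) \<ge> M * 1" using M by (intro mult_left_mono) auto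
      then show False using gM[OF Ecl[OF xvE] tp] big' e by linarith
    next
      case False
      then show False using g0[OF xf False tp] pos big' e by linarith
    qed
  qed
  show False
  proof (rule upper_barrier_no_touch[OF g E \<epsilon> M xO tp xvE])
    fix x' v' assume "(x', v') \<in> E"
    then show "g x' t - M * exp (t / \<epsilon>\<^sup>2 - v' / \<epsilon>) \<le> g x t - M * exp (t / \<epsilon>\<^sup>2 - v / \<epsilon>)"
      using z(2)[of "((x', v'), t)"] tt unfolding zt F_def by auto
  next
    have "\<forall>\<^sub>F s in nhds t. s > \<tau>0" using t0 by (rule eventually_nhds_in_open[OF open_greaterThan, simplified])
    then show "\<forall>\<^sub>F s in nhds t. s \<le> t \<longrightarrow> g x s - M * exp (s / \<epsilon>\<^sup>2 - v / \<epsilon>) \<le> g x t - M * exp (t / \<epsilon>\<^sup>2 - v / \<epsilon>)"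
    proof eventually_elim
      case (elim s)
      then show ?case using z(2)[of "((x, v), s)"] tt xvE unfolding zt F_def by auto
    qed
  qed
qed

text \<open>The test is made at time 1. A positive maximum \<open>m\<close> of \<open>U\<close>
  minus the barrier turns into exp(t/\<epsilon>^2) m, which increases in time, so the comparison
  with earlier times holds by itself.\<close>

lemma upper_barrier_elliptic:
  assumes U: "psub (\<lambda>x t. exp (t / \<epsilon>\<^sup>2) * U x)" and E: "eikonal_minorant T \<delta> E \<eta> K" and \<epsilon>: "\<epsilon> > 0" "\<epsilon> * (2 * K * trb) < \<eta>" and M: "M > 0"
    and cont: "continuous_on (closure \<Omega>) U"
    and UM: "\<And>x. x \<in> frontier \<Omega> \<Longrightarrow> U x \<le> M"
    and U0: "\<And>x. x \<in> frontier \<Omega> \<Longrightarrow> x \<notin> T \<Longrightarrow> U x \<le> 0"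
    and xv: "(x1, v1) \<in> E"
  shows "U x1 \<le> M * exp (- v1 / \<epsilon>)"
proof (rule ccontr)
  have Ec: "compact E" and Ecl: "\<And>x v. (x, v) \<in> E \<Longrightarrow> x \<in> closure \<Omega>"
    and ET: "\<And>x v. (x, v) \<in> E \<Longrightarrow> x \<in> closure T \<Longrightarrow> v \<le> 0"
    using E unfolding eikonal_minorant_def by auto
  assume neg: "\<not> ?thesis"
  define F where "F = (\<lambda>(x, v). U x - M * exp (- v / \<epsilon>))"
  have "continuous_on E (\<lambda>z. U (fst z))"
    by (rule continuous_on_compose2[OF cont]) (use Ecl in \<open>auto intro!: continuous_intros\<close>)
  then have "continuous_on E F" unfolding F_def split_beta by (intro continuous_intros) (use \<epsilon> in auto)
  then obtain z where z: "z \<in> E" "\<And>y. y \<in> E \<Longrightarrow> F y \<le> F z"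
    using continuous_attains_sup[OF Ec] xv by blast
  obtain x v where zt: "z = (x, v)" by (cases z)
  have xvE: "(x, v) \<in> E" using z zt by auto
  define m where "m = U x - M * exp (- v / \<epsilon>)"
  have m: "m > 0" using z(2)[OF xv] neg unfolding F_def zt m_def by simp
  have mmax: "U x' - M * exp (- v' / \<epsilon>) \<le> m" if "(x', v') \<in> E" for x' v'
    using z(2)[OF that] unfolding F_def zt m_def by simp
  have pos: "M * exp (- v / \<epsilon>) > 0" using M by simp
  have xO: "x \<in> \<Omega>"
  proof (rule ccontr)
    assume "x \<notin> \<Omega>"
    then have xf: "x \<in> frontier \<Omega>" using Ecl[OF xvE] frontier_dom by blast
    show False
    proof (cases "x \<in> T")
      case True
      then have "v \<le> 0" using ET[OF xvE] closure_subset by blast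
      then have "0 \<le> - v / \<epsilon>" using \<epsilon> by (simp add: divide_nonpos_pos)
      then have "M * exp (- v / \<epsilon>) \<ge> M * 1" using M by (intro mult_left_mono) auto
      then show False using UM[OF xf] m unfolding m_def by linarith
    next
      case False
      then show False using U0[OF xf False] pos m unfolding m_def by linarith
    qed
  qed
  have split: "exp (t / \<epsilon>\<^sup>2) * U x' - M * exp (t / \<epsilon>\<^sup>2 - v' / \<epsilon>) = exp (t / \<epsilon>\<^sup>2) * (U x' - M * exp (- v' / \<epsilon>))" for t x' v'
    by (simp add: exp_diff exp_minus algebra_simps divide_inverse)
  show False
  proof (rule upper_barrier_no_touch[OF U E \<epsilon> M xO zero_less_one xvE])
    fix x' v' assume "(x', v') \<in> E"
    then show "exp (1 / \<epsilon>\<^sup>2) * U x' - M * exp (1 / \<epsilon>\<^sup>2 - v' / \<epsilon>) \<le> exp (1 / \<epsilon>\<^sup>2) * U x - M * exp (1 / \<epsilon>\<^sup>2 - v / \<epsilon>)"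
      unfolding split using mmax unfolding m_def by (intro mult_left_mono) auto
  next
    show "\<forall>\<^sub>F s in nhds 1. s \<le> 1 \<longrightarrow> exp (s / \<epsilon>\<^sup>2) * U x - M * exp (s / \<epsilon>\<^sup>2 - v / \<epsilon>) \<le> exp (1 / \<epsilon>\<^sup>2) * U x - M * exp (1 / \<epsilon>\<^sup>2 - v / \<epsilon>)"
      unfolding split using m unfolding m_def[symmetric] by (intro always_eventually) (auto simp: divide_right_mono)
  qed
qed

end

lemma C11_taylor:
  fixes \<phi> :: "real ^ 'n \<Rightarrow> real"
  assumes "\<And>y. (\<phi> has_derivative (\<lambda>h. G y \<bullet> h)) (at y)" "L-lipschitz_on UNIV G"
  shows "\<phi> z \<le> \<phi> z0 + G z0 \<bullet> (z - z0) + L * (norm (z - z0))\<^sup>2"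
proof -
  let ?B = "cball z0 (norm (z - z0))"
  have "norm ((\<phi> z - G z0 \<bullet> z) - (\<phi> z0 - G z0 \<bullet> z0)) \<le> (L * norm (z - z0)) * norm (z - z0)"
  proof (rule differentiable_bound[of ?B])
    fix y assume y: "y \<in> ?B"
    show "((\<lambda>y. \<phi> y - G z0 \<bullet> y) has_derivative (\<lambda>h. G y \<bullet> h - G z0 \<bullet> h)) (at y within ?B)"
      by (intro has_derivative_diff has_derivative_at_withinI[OF assms(1)] has_derivative_inner_right has_derivative_ident)
    have "norm (G y - G z0) \<le> L * norm (y - z0)" using lipschitz_onD[OF assms(2), of y z0] by (simp add: dist_norm)
    also have "\<dots> \<le> L * norm (z - z0)"
      using y lipschitz_on_nonneg[OF assms(2)] by (intro mult_left_mono) (auto simp: dist_norm norm_minus_commute)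
    finally have n: "norm (G y - G z0) \<le> L * norm (z - z0)" .
    show "onorm (\<lambda>h. G y \<bullet> h - G z0 \<bullet> h) \<le> L * norm (z - z0)"
    proof (rule onorm_le)
      fix h
      have "norm (G y \<bullet> h - G z0 \<bullet> h) \<le> norm (G y - G z0) * norm h"
        using Cauchy_Schwarz_ineq2[of "G y - G z0" h] by (simp add: inner_diff_left)
      also have "\<dots> \<le> L * norm (z - z0) * norm h" using n by (intro mult_right_mono) auto
      finally show "norm (G y \<bullet> h - G z0 \<bullet> h) \<le> L * norm (z - z0) * norm h" .
    qed
  qed (auto simp: dist_norm norm_minus_commute)
  then show ?thesis by (simp add: inner_diff_right power2_eq_square abs_le_iff)
qed

context elliptic_domain
begin

subsection \<open>Behaviour at the initial boundary\<close>

text \<open>The barrier is a one dimensional heat kernel in the boundary distance \<open>F\<close>, started at time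
  \<open>- q\<^sup>2\<close> and normalised to exceed \<open>1\<close> where \<open>F < q\<close> and \<open>t < q\<^sup>2\<close>. It tends to \<open>0\<close> with
  \<open>q\<close>. As \<open>F\<close> is only \<open>C\<^sup>1\<^sup>,\<^sup>1\<close>, it is replaced at the touching point by a quadratic polynomial
  below it.\<close>

lemma corner_jet:
  fixes x p b :: "real ^ 'n" and F0 L \<kappa> \<alpha> q Mc M K1 r0 t :: real and R :: "real ^ 'n \<Rightarrow> real ^ 'n"
  assumes q: "q > 0" and t: "t > 0" and R: "linear R"
  defines "P \<equiv> \<lambda>y. F0 + b \<bullet> (y - x) - L * (norm (R (y - x)))\<^sup>2"
  defines "w \<equiv> \<lambda>y s. Mc * exp (- \<alpha> * ln ((s + q\<^sup>2) / q\<^sup>2) - \<kappa> * (P y)\<^sup>2 / (s + q\<^sup>2)) + M * ((norm (y - p))\<^sup>2 + K1 * s) / r0\<^sup>2"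
  defines "E \<equiv> Mc * exp (- \<alpha> * ln ((t + q\<^sup>2) / q\<^sup>2) - \<kappa> * F0\<^sup>2 / (t + q\<^sup>2))"
  defines "\<tau> \<equiv> t + q\<^sup>2"
  shows "(w x has_real_derivative E * (\<kappa> * F0\<^sup>2 / \<tau>\<^sup>2 - \<alpha> / \<tau>) + M * K1 / r0\<^sup>2) (at t)"
    "\<exists>b'. jet2 (\<lambda>y. w y t) x b' (\<lambda>\<xi>. E * (4 * \<kappa>\<^sup>2 * F0\<^sup>2 / \<tau>\<^sup>2 * (b \<bullet> \<xi>)\<^sup>2
        - 2 * \<kappa> / \<tau> * ((b \<bullet> \<xi>)\<^sup>2 - 2 * F0 * L * (norm (R \<xi>))\<^sup>2)) + 2 * M / r0\<^sup>2 * (norm \<xi>)\<^sup>2)"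
proof -
  have tau: "\<tau> > 0" using t q by (simp add: \<tau>_def add_pos_pos)
  have Px: "P x = F0" using R by (simp add: P_def linear_0)
  have "((\<lambda>s. - \<alpha> * ln ((s + q\<^sup>2) / q\<^sup>2) - \<kappa> * F0\<^sup>2 / (s + q\<^sup>2)) has_real_derivative
      (\<kappa> * F0\<^sup>2 / \<tau>\<^sup>2 - \<alpha> / \<tau>)) (at t)"
  proof -
    have "((\<lambda>s. - \<alpha> * ln ((s + q\<^sup>2) / q\<^sup>2) - \<kappa> * F0\<^sup>2 / (s + q\<^sup>2)) has_real_derivative
      (- \<alpha> * (1 / ((t + q\<^sup>2) / q\<^sup>2) * (1 / q\<^sup>2)) - (0 * (t + q\<^sup>2) - \<kappa> * F0\<^sup>2 * 1) / ((t + q\<^sup>2) * (t + q\<^sup>2)))) (at t)"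
      using tau q unfolding \<tau>_def
      by (auto intro!: derivative_eq_intros simp: power2_eq_square)
    moreover have "(- \<alpha> * (1 / ((t + q\<^sup>2) / q\<^sup>2) * (1 / q\<^sup>2)) - (0 * (t + q\<^sup>2) - \<kappa> * F0\<^sup>2 * 1) / ((t + q\<^sup>2) * (t + q\<^sup>2)))
       = \<kappa> * F0\<^sup>2 / \<tau>\<^sup>2 - \<alpha> / \<tau>"
      using tau q unfolding \<tau>_def[symmetric] by (simp add: power2_eq_square)
    ultimately show ?thesis by simp
  qed
  from DERIV_chain2[OF DERIV_exp this]
  have "((\<lambda>s. Mc * exp (- \<alpha> * ln ((s + q\<^sup>2) / q\<^sup>2) - \<kappa> * F0\<^sup>2 / (s + q\<^sup>2))) has_real_derivative
      E * (\<kappa> * F0\<^sup>2 / \<tau>\<^sup>2 - \<alpha> / \<tau>)) (at t)"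
    unfolding E_def by (auto dest: DERIV_cmult[where c = Mc] simp: mult.assoc)
  moreover have "((\<lambda>s. M * ((norm (x - p))\<^sup>2 + K1 * s) / r0\<^sup>2) has_real_derivative M * K1 / r0\<^sup>2) (at t)"
  proof -
    define k where "k = M / r0\<^sup>2"
    have "((\<lambda>s. k * ((norm (x - p))\<^sup>2 + K1 * s)) has_real_derivative k * K1) (at t)"
      by (auto intro!: derivative_eq_intros)
    then show ?thesis by (simp add: k_def)
  qed
  ultimately show "(w x has_real_derivative E * (\<kappa> * F0\<^sup>2 / \<tau>\<^sup>2 - \<alpha> / \<tau>) + M * K1 / r0\<^sup>2) (at t)"
    unfolding w_def Px by (rule DERIV_add)
  have RR: "R (s *\<^sub>R \<xi>) = s *\<^sub>R R \<xi>" for s \<xi> using R by (rule linear_scale)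
  have "jet2 P x (\<lambda>\<xi>. b \<bullet> \<xi>) (\<lambda>\<xi>. - 2 * L * (norm (R \<xi>))\<^sup>2)"
    by (rule jet2_quadratic) (simp add: P_def RR linear_0[OF R] power_mult_distrib)
  from jet2_power2[OF this]
  have "jet2 (\<lambda>y. (P y)\<^sup>2) x (\<lambda>\<xi>. 2 * F0 * (b \<bullet> \<xi>)) (\<lambda>\<xi>. 2 * (b \<bullet> \<xi>)\<^sup>2 + 2 * F0 * (- 2 * L * (norm (R \<xi>))\<^sup>2))"
    unfolding Px .
  from jet2_cmult[OF this, of "- \<kappa> / \<tau>"]
  have "jet2 (\<lambda>y. - \<kappa> / \<tau> * (P y)\<^sup>2) x (\<lambda>\<xi>. - \<kappa> / \<tau> * (2 * F0 * (b \<bullet> \<xi>)))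
     (\<lambda>\<xi>. - \<kappa> / \<tau> * (2 * (b \<bullet> \<xi>)\<^sup>2 + 2 * F0 * (- 2 * L * (norm (R \<xi>))\<^sup>2)))" .
  from jet2_exp[OF jet2_add[OF jet2_const[of "- \<alpha> * ln (\<tau> / q\<^sup>2)"] this]]
  have J1: "jet2 (\<lambda>y. exp (- \<alpha> * ln (\<tau> / q\<^sup>2) + - \<kappa> / \<tau> * (P y)\<^sup>2)) x
     (\<lambda>\<xi>. exp (- \<alpha> * ln (\<tau> / q\<^sup>2) + - \<kappa> / \<tau> * F0\<^sup>2) * (0 + - \<kappa> / \<tau> * (2 * F0 * (b \<bullet> \<xi>))))
     (\<lambda>\<xi>. exp (- \<alpha> * ln (\<tau> / q\<^sup>2) + - \<kappa> / \<tau> * F0\<^sup>2) * ((0 + - \<kappa> / \<tau> * (2 * F0 * (b \<bullet> \<xi>)))\<^sup>2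
        + (0 + - \<kappa> / \<tau> * (2 * (b \<bullet> \<xi>)\<^sup>2 + 2 * F0 * (- 2 * L * (norm (R \<xi>))\<^sup>2)))))"
    unfolding Px .
  have J2: "jet2 (\<lambda>y. (norm (y - p))\<^sup>2 + K1 * t) x (\<lambda>\<xi>. 2 * ((x - p) \<bullet> \<xi>)) (\<lambda>\<xi>. 2 * (norm \<xi>)\<^sup>2)"
  proof (rule jet2_quadratic)
    fix s \<xi>
    have e: "x + s *\<^sub>R \<xi> - p = (x - p) + s *\<^sub>R \<xi>" by simp
    show "(norm (x + s *\<^sub>R \<xi> - p))\<^sup>2 + K1 * t = (norm (x - p))\<^sup>2 + K1 * t + s * (2 * ((x - p) \<bullet> \<xi>)) + s\<^sup>2 * (2 * (norm \<xi>)\<^sup>2) / 2"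
      unfolding e power2_norm_eq_inner inner_add_left[of "x - p"] inner_add_right[of _ "x - p"]
      by (simp add: inner_commute[of \<xi> "x - p"] power2_eq_square)
  qed
  have weq: "w y t = Mc * exp (- \<alpha> * ln (\<tau> / q\<^sup>2) + - \<kappa> / \<tau> * (P y)\<^sup>2) + M / r0\<^sup>2 * ((norm (y - p))\<^sup>2 + K1 * t)" for y
    by (simp add: w_def \<tau>_def)
  have Eeq: "E = Mc * exp (- \<alpha> * ln (\<tau> / q\<^sup>2) + - \<kappa> / \<tau> * F0\<^sup>2)" by (simp add: E_def \<tau>_def)
  define ee where "ee = exp (- \<alpha> * ln (\<tau> / q\<^sup>2) + - \<kappa> / \<tau> * F0\<^sup>2)"
  have hess: "Mc * (ee * ((0 + - \<kappa> / \<tau> * (2 * F0 * (b \<bullet> \<xi>)))\<^sup>2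
        + (0 + - \<kappa> / \<tau> * (2 * (b \<bullet> \<xi>)\<^sup>2 + 2 * F0 * (- 2 * L * (norm (R \<xi>))\<^sup>2))))) + M / r0\<^sup>2 * (2 * (norm \<xi>)\<^sup>2)
     = E * (4 * \<kappa>\<^sup>2 * F0\<^sup>2 / \<tau>\<^sup>2 * (b \<bullet> \<xi>)\<^sup>2
        - 2 * \<kappa> / \<tau> * ((b \<bullet> \<xi>)\<^sup>2 - 2 * F0 * L * (norm (R \<xi>))\<^sup>2)) + 2 * M / r0\<^sup>2 * (norm \<xi>)\<^sup>2" for \<xi>
    unfolding Eeq ee_def[symmetric] using tau by (simp add: power2_eq_square field_simps)
  from jet2_add[OF jet2_cmult[OF J1, of Mc] jet2_cmult[OF J2, of "M / r0\<^sup>2"]]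
  show "\<exists>b'. jet2 (\<lambda>y. w y t) x b' (\<lambda>\<xi>. E * (4 * \<kappa>\<^sup>2 * F0\<^sup>2 / \<tau>\<^sup>2 * (b \<bullet> \<xi>)\<^sup>2
        - 2 * \<kappa> / \<tau> * ((b \<bullet> \<xi>)\<^sup>2 - 2 * F0 * L * (norm (R \<xi>))\<^sup>2)) + 2 * M / r0\<^sup>2 * (norm \<xi>)\<^sup>2)"
    unfolding weq[symmetric] ee_def[symmetric] hess by blast
qed

text \<open>The choice of \<kappa> gives 4 \<kappa> \<langle>A b, b\<rangle> \<le> 1, so the square
  of the first derivative is absorbed by the time derivative of the Gaussian. The value \<alpha> =
  \<kappa> lam is what the second derivative leaves, since \<langle>A b, b\<rangle> \<ge> lam and
  the curvature error is at most lam/2. Strictness comes from the summand with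
  \<open>M\<close>.\<close>

lemma corner_strict:
  fixes b :: "real ^ 'n"
  assumes x: "x \<in> \<Omega>" and b: "norm b \<ge> 1" "norm b \<le> Cb" and F0: "0 \<le> F0" "4 * L * trb * F0 \<le> lam" and L: "L \<ge> 0"
    and R: "\<And>\<xi>. norm (R \<xi>) \<le> norm \<xi>" and \<tau>: "\<tau> > 0" and E: "E \<ge> 0" and M: "M > 0" and r0: "r0 > 0"
    and \<kappa>: "\<kappa> = 1 / (4 * trb * Cb\<^sup>2)" and \<alpha>: "\<alpha> = \<kappa> * lam"
  shows "(\<Sum>k\<in>UNIV. E * (4 * \<kappa>\<^sup>2 * F0\<^sup>2 / \<tau>\<^sup>2 * (b \<bullet> dir x k)\<^sup>2
        - 2 * \<kappa> / \<tau> * ((b \<bullet> dir x k)\<^sup>2 - 2 * F0 * L * (norm (R (dir x k)))\<^sup>2)) + 2 * M / r0\<^sup>2 * (norm (dir x k))\<^sup>2)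
     < E * (\<kappa> * F0\<^sup>2 / \<tau>\<^sup>2 - \<alpha> / \<tau>) + M * (2 * trb + 1) / r0\<^sup>2"
proof -
  define B where "B = (A x *v b) \<bullet> b"
  define \<Gamma> where "\<Gamma> = (\<Sum>k\<in>UNIV. (norm (R (dir x k)))\<^sup>2)"
  have Cb: "Cb > 0" using b by linarith
  have kp: "\<kappa> > 0" unfolding \<kappa> using trb(1) Cb by simp
  have B1: "B \<ge> lam"
  proof -
    have "lam * 1 \<le> lam * (norm b)\<^sup>2" using lam(1) b(1) by (intro mult_left_mono) auto
    then show ?thesis using lam(2)[of b x] by (simp add: B_def)
  qed
  have B2: "4 * \<kappa> * B \<le> 1"
  proof -
    have "B \<le> norm (A x) * (norm b)\<^sup>2" unfolding B_def by (rule form_le)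
    also have "\<dots> \<le> trb * Cb\<^sup>2" using trb(1) trb(3)[OF x] b by (intro mult_mono power_mono) auto
    finally have "4 * \<kappa> * B \<le> 4 * \<kappa> * (trb * Cb\<^sup>2)" using kp by simp
    also have "\<dots> = 1" unfolding \<kappa> using trb(1) Cb by simp
    finally show ?thesis .
  qed
  have G: "0 \<le> \<Gamma>" "\<Gamma> \<le> trb"
  proof -
    show "0 \<le> \<Gamma>" unfolding \<Gamma>_def by (intro sum_nonneg) simp
    have "\<Gamma> \<le> (\<Sum>k\<in>UNIV. (norm (dir x k))\<^sup>2)" unfolding \<Gamma>_def by (intro sum_mono power_mono R) simp
    then show "\<Gamma> \<le> trb" using trb(2)[OF x] by (simp add: sum_norm_dir)
  qed
  have "(\<Sum>k\<in>UNIV. E * (4 * \<kappa>\<^sup>2 * F0\<^sup>2 / \<tau>\<^sup>2 * (b \<bullet> dir x k)\<^sup>2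
        - 2 * \<kappa> / \<tau> * ((b \<bullet> dir x k)\<^sup>2 - 2 * F0 * L * (norm (R (dir x k)))\<^sup>2)) + 2 * M / r0\<^sup>2 * (norm (dir x k))\<^sup>2)
    = E * (4 * \<kappa>\<^sup>2 * F0\<^sup>2 / \<tau>\<^sup>2 * B - 2 * \<kappa> / \<tau> * (B - 2 * F0 * L * \<Gamma>)) + 2 * M / r0\<^sup>2 * trace (A x)"
  proof -
    have "(\<Sum>k\<in>UNIV. E * (a * X k - c * (X k - 2 * F0 * L * Y k)) + m * Z k)
       = E * (a * sum X UNIV - c * (sum X UNIV - 2 * F0 * L * sum Y UNIV)) + m * sum Z UNIV"
      for a c m and X Y Z :: "'n \<Rightarrow> real"
      by (simp add: sum.distrib sum_subtractf sum_distrib_left sum_distrib_right algebra_simps)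
    then show ?thesis unfolding B_def \<Gamma>_def form_dir sum_norm_dir[symmetric] .
  qed
  also have "\<dots> < E * (\<kappa> * F0\<^sup>2 / \<tau>\<^sup>2 - \<alpha> / \<tau>) + M * (2 * trb + 1) / r0\<^sup>2"
  proof (rule add_le_less_mono)
    have "4 * \<kappa>\<^sup>2 * F0\<^sup>2 / \<tau>\<^sup>2 * B = (\<kappa> * F0\<^sup>2 / \<tau>\<^sup>2) * (4 * \<kappa> * B)" by (simp add: power2_eq_square)
    also have "\<dots> \<le> (\<kappa> * F0\<^sup>2 / \<tau>\<^sup>2) * 1" using B2 kp by (intro mult_left_mono) auto
    finally have 1: "4 * \<kappa>\<^sup>2 * F0\<^sup>2 / \<tau>\<^sup>2 * B \<le> \<kappa> * F0\<^sup>2 / \<tau>\<^sup>2" by simp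
    have "4 * F0 * L * \<Gamma> \<le> 4 * F0 * L * trb" using G F0 L by (intro mult_left_mono) auto
    also have "\<dots> \<le> lam" using F0(2) by (simp add: mult_ac)
    finally have "lam \<le> 2 * B - 4 * F0 * L * \<Gamma>" using B1 by linarith
    also have "\<dots> = 2 * (B - 2 * F0 * L * \<Gamma>)" by simp
    finally have "lam \<le> 2 * (B - 2 * F0 * L * \<Gamma>)" .
    then have "\<kappa> / \<tau> * lam \<le> \<kappa> / \<tau> * (2 * (B - 2 * F0 * L * \<Gamma>))" using kp \<tau> by (intro mult_left_mono) auto
    then have 2: "\<alpha> / \<tau> \<le> 2 * \<kappa> / \<tau> * (B - 2 * F0 * L * \<Gamma>)" unfolding \<alpha> by (simp add: mult_ac)
    show "E * (4 * \<kappa>\<^sup>2 * F0\<^sup>2 / \<tau>\<^sup>2 * B - 2 * \<kappa> / \<tau> * (B - 2 * F0 * L * \<Gamma>)) \<le> E * (\<kappa> * F0\<^sup>2 / \<tau>\<^sup>2 - \<alpha> / \<tau>)"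
      using 1 2 E by (intro mult_left_mono) linarith+
    have "2 * M / r0\<^sup>2 * trace (A x) \<le> 2 * M / r0\<^sup>2 * trb" using M r0 trb(2)[OF x] by (intro mult_left_mono) auto
    also have "\<dots> < M * (2 * trb + 1) / r0\<^sup>2"
    proof -
      have "M * (2 * trb + 1) / r0\<^sup>2 = 2 * M / r0\<^sup>2 * trb + M / r0\<^sup>2"
        by (simp add: distrib_left add_divide_distrib)
      moreover have "M / r0\<^sup>2 > 0" using M r0 by simp
      ultimately show ?thesis by linarith
    qed
    finally show "2 * M / r0\<^sup>2 * trace (A x) < M * (2 * trb + 1) / r0\<^sup>2" .
  qed
  finally show ?thesis .
qed

text \<open>No continuity is assumed where the initial and the lateral boundary meet, so smallness
  of \<open>g\<close> near a boundary point with nonpositive data has to be derived. The quadratic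
  term of the barrier dominates \<open>M\<close> on the edge of a small ball around
  \<open>p\<close>; the heat kernel dominates \<open>M\<close> in the thin layer along the boundary
  where the initial values are not under control.\<close>

lemma corner_decay:
  assumes g: "psub g"
    and cont: "continuous_on (closure \<Omega> \<times> {0..} - frontier \<Omega> \<times> {0}) (\<lambda>(x, t). g x t)"
    and M: "M > 0" and gM: "\<And>x t. x \<in> closure \<Omega> \<Longrightarrow> t > 0 \<Longrightarrow> g x t \<le> M"
    and init: "\<And>x. x \<in> \<Omega> \<Longrightarrow> g x 0 = 0"
    and p: "p \<in> frontier \<Omega>" and \<rho>: "\<rho> > 0"
    and g0: "\<And>x t. x \<in> frontier \<Omega> \<Longrightarrow> x \<in> ball p \<rho> \<Longrightarrow> t > 0 \<Longrightarrow> g x t \<le> 0" and e: "e > 0"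
  shows "\<exists>\<rho>>0. \<exists>\<tau>>0. \<forall>x\<in>closure \<Omega> \<inter> ball p \<rho>. \<forall>t. 0 < t \<longrightarrow> t < \<tau> \<longrightarrow> g x t \<le> e"
proof -
  from graph_chart[OF p] obtain r \<nu> \<phi> G L where ch: "r > 0" "norm \<nu> = 1"
    "\<And>y. (\<phi> has_derivative (\<lambda>h. G y \<bullet> h)) (at y)" "L-lipschitz_on UNIV (G :: real ^ 'n \<Rightarrow> real ^ 'n)"
    "\<And>y. y \<in> ball p r \<Longrightarrow> y \<in> \<Omega> \<longleftrightarrow> y \<bullet> \<nu> > \<phi> (y - (y \<bullet> \<nu>) *\<^sub>R \<nu>)"
    "\<And>y. y \<in> ball p r \<Longrightarrow> y \<in> closure \<Omega> \<Longrightarrow> y \<bullet> \<nu> \<ge> \<phi> (y - (y \<bullet> \<nu>) *\<^sub>R \<nu>)" by blast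
  define pr where "pr w = w - (w \<bullet> \<nu>) *\<^sub>R \<nu>" for w :: "real ^ 'n"
  have pr_diff: "pr v - pr w = pr (v - w)" for v w
    by (simp add: pr_def inner_diff_left algebra_simps)
  have pr_le: "norm (pr w) \<le> norm w" for w unfolding pr_def by (rule norm_projection_le[OF ch(2)])
  have pr_lin: "linear pr" unfolding pr_def by (rule linearI) (auto simp: inner_add_left algebra_simps)
  have nn: "\<nu> \<bullet> \<nu> = 1" using ch(2) by (simp add: norm_eq_1)
  have L0: "L \<ge> 0" using ch(4) by (rule lipschitz_on_nonneg)
  obtain CG where CG: "CG \<ge> 0" "\<forall>y\<in>cball (pr p) r. \<forall>z\<in>cball (pr p) r. \<bar>\<phi> y - \<phi> z\<bar> \<le> CG * norm (y - z)"
    "\<forall>y\<in>cball (pr p) r. norm (G y) \<le> CG"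
    by (rule C11_local_lipschitz[OF ch(3,4,1), where a = "pr p"])
  define Cb where "Cb = 1 + CG"
  have Cb: "Cb > 0" using CG(1) by (simp add: Cb_def)
  define F where "F y = y \<bullet> \<nu> - \<phi> (pr y)" for y
  have prB: "pr y \<in> cball (pr p) r" if "y \<in> ball p r" for y
    using that pr_le[of "p - y"] by (simp add: dist_norm pr_diff)
  have Fp: "F p = 0"
  proof -
    have "p \<in> closure \<Omega>" "p \<notin> \<Omega>" using p frontier_dom by auto
    then show ?thesis using ch(5)[of p] ch(6)[of p] ch(1) unfolding F_def pr_def by force
  qed
  have F_le: "F y \<le> Cb * norm (y - p)" if "y \<in> ball p r" for y
  proof -
    have "\<bar>\<phi> (pr y) - \<phi> (pr p)\<bar> \<le> CG * norm (pr y - pr p)"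
      using CG(2)[rule_format, of "pr y" "pr p"] prB[OF that] prB[of p] ch(1) by simp
    also have "\<dots> \<le> CG * norm (y - p)" using pr_le[of "y - p"] CG(1) by (intro mult_left_mono) (auto simp: pr_diff)
    finally have "\<bar>\<phi> (pr y) - \<phi> (pr p)\<bar> \<le> CG * norm (y - p)" .
    moreover have "\<bar>(y - p) \<bullet> \<nu>\<bar> \<le> norm (y - p)" using Cauchy_Schwarz_ineq2[of "y - p" \<nu>] ch(2) by simp
    moreover have "F y = F y - F p" using Fp by simp
    ultimately show ?thesis unfolding F_def Cb_def by (simp add: inner_diff_left distrib_right abs_le_iff)
  qed
  have contF: "continuous_on S F" for S
  proof -
    have c: "continuous_on UNIV \<phi>"
      by (intro continuous_at_imp_continuous_on ballI has_derivative_continuous[OF ch(3)])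
    show ?thesis unfolding F_def pr_def
      by (intro continuous_intros continuous_on_compose2[OF c _ subset_UNIV])
  qed
  \<comment> \<open>Small enough that F \<le> Cb r0 meets the curvature condition of
    \<open>corner_strict\<close>; \<open>L + 1\<close> avoids division by zero.\<close>
  define r0 where "r0 = min (min (r / 2) (\<rho> / 2)) (lam / (4 * (L + 1) * trb * Cb))"
  have D: "4 * (L + 1) * trb * Cb > 0" using L0 trb(1) Cb by simp
  have r0: "r0 > 0" "r0 < r" "r0 < \<rho>"
  proof -
    show "r0 > 0" unfolding r0_def using ch(1) \<rho> lam(1) D by simp
    have "r0 \<le> r / 2" "r0 \<le> \<rho> / 2" unfolding r0_def by (meson min.cobounded1 min.cobounded2 order_trans)+
    then show "r0 < r" "r0 < \<rho>" using ch(1) \<rho> by linarith+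
  qed
  have r0D: "4 * (L + 1) * trb * (Cb * r0) \<le> lam"
  proof -
    have "r0 \<le> lam / (4 * (L + 1) * trb * Cb)" by (simp add: r0_def)
    then have "r0 * (4 * (L + 1) * trb * Cb) \<le> lam" using D by (simp add: pos_le_divide_eq)
    then show ?thesis by (simp only: mult_ac)
  qed
  define \<kappa> where "\<kappa> = 1 / (4 * trb * Cb\<^sup>2)"
  define \<alpha> where "\<alpha> = \<kappa> * lam"
  define K1 where "K1 = 2 * trb + 1"
  have kp: "\<kappa> > 0" "\<alpha> > 0" "K1 > 0" unfolding \<alpha>_def \<kappa>_def K1_def using trb(1) Cb lam(1) by auto
  \<comment> \<open>The factor offsets the worst decay of the kernel for F \<le> q and t \<le> q^2,
    so the barrier is at least \<open>M\<close> in that layer.\<close>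
  define Mc where "Mc = M * exp (\<alpha> * ln 2 + \<kappa>)"
  have Mc: "Mc > 0" using M by (simp add: Mc_def)
  define C where "C = closure \<Omega> \<inter> cball p r0"
  have Cc: "compact C" unfolding C_def by (intro compact_Int compact_closure_dom compact_cball)
  have Cr: "y \<in> ball p r" "y \<in> ball p \<rho>" "y \<in> closure \<Omega>" if "y \<in> C" for y using that r0 by (auto simp: C_def)
  have main: "g x1 t1 \<le> Mc * exp (- \<alpha> * ln ((t1 + q\<^sup>2) / q\<^sup>2)) + M * ((norm (x1 - p))\<^sup>2 + K1 * t1) / r0\<^sup>2"
    if x1: "x1 \<in> C" and t1: "t1 > 0" and q: "q > 0" for x1 t1 q
  proof -
    define w where "w y s = Mc * exp (- \<alpha> * ln ((s + q\<^sup>2) / q\<^sup>2) - \<kappa> * (F y)\<^sup>2 / (s + q\<^sup>2)) + M * ((norm (y - p))\<^sup>2 + K1 * s) / r0\<^sup>2" for y s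
    have w1: "w y s \<ge> 0" if "s > 0" for y s
      unfolding w_def using Mc M that kp by (intro add_nonneg_nonneg mult_nonneg_nonneg divide_nonneg_nonneg) auto
    have "g x1 t1 \<le> w x1 t1"
    proof (rule ccontr)
      assume neg: "\<not> g x1 t1 \<le> w x1 t1"
      define d where "d = (g x1 t1 - w x1 t1) / 2"
      have d: "d > 0" using neg by (simp add: d_def)
      \<comment> \<open>Where F \<ge> q the set is compact inside the domain, and there
        \<open>g\<close> is continuous down to time 0.\<close>
      define C' where "C' = {y \<in> C. F y \<ge> q}"
      have "C' = C \<inter> {y. q \<le> F y}" by (auto simp: C'_def)
      then have C'c: "compact C'" using compact_Int_closed[OF Cc closed_Collect_le[OF continuous_on_const contF]] by simp
      have C'O: "y \<in> \<Omega>" if "y \<in> C'" for y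
        using that q ch(5)[of y] Cr[of y] unfolding C'_def F_def pr_def by auto
      have "\<exists>\<tau>>0. \<forall>y\<in>C'. \<forall>t. 0 < t \<longrightarrow> t < \<tau> \<longrightarrow> g y t \<le> d"
      proof (rule compact_uniform_time[OF C'c])
        fix z assume "z \<in> C'"
        then have zO: "z \<in> \<Omega>" by (rule C'O)
        have zD: "(z, 0::real) \<in> closure \<Omega> \<times> {0..} - frontier \<Omega> \<times> {0}"
          using zO closure_subset[of \<Omega>] frontier_dom by auto
        have "continuous (at (z, 0) within closure \<Omega> \<times> {0..} - frontier \<Omega> \<times> {0}) (\<lambda>(x, t). g x t)"
          by (rule cont[unfolded continuous_on_eq_continuous_within, rule_format, OF zD])
        then obtain \<delta> where \<delta>: "\<delta> > 0" "\<And>y. y \<in> closure \<Omega> \<times> {0..} - frontier \<Omega> \<times> {0} \<Longrightarrow> dist y (z, 0) < \<delta> \<Longrightarrow>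
            dist (case y of (x, t) \<Rightarrow> g x t) (g z 0) < d"
          unfolding continuous_within_eps_delta using d by fastforce
        have "g y t \<le> d" if y: "y \<in> C' \<inter> ball z (\<delta> / 2)" and t: "0 < t" "t < \<delta> / 2" for y t
        proof -
          have "dist (y, t) (z, 0) \<le> dist y z + dist t 0"
            unfolding dist_Pair_Pair by (rule sqrt_sum_squares_le_sum) auto
          also have "\<dots> < \<delta>" using y t by (auto simp: dist_commute)
          finally have "dist (g y t) (g z 0) < d"
            using \<delta>(2)[of "(y, t)"] y t Cr[of y] by (auto simp: C'_def)
          then show ?thesis using init[OF zO] by (simp add: dist_real_def)
        qed
        then show "\<exists>\<rho>>0. \<exists>\<tau>>0. \<forall>z'\<in>C' \<inter> ball z \<rho>. \<forall>t. 0 < t \<longrightarrow> t < \<tau> \<longrightarrow> g z' t \<le> d"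
          using \<delta>(1) by (intro exI[of _ "\<delta> / 2"] conjI) auto
      qed
      then obtain \<tau> where \<tau>: "\<tau> > 0" "\<And>y t. y \<in> C' \<Longrightarrow> 0 < t \<Longrightarrow> t < \<tau> \<Longrightarrow> g y t \<le> d" by blast
      define \<tau>0 where "\<tau>0 = min (min (\<tau> / 2) (t1 / 2)) (q\<^sup>2 / 2)"
      have q2: "q\<^sup>2 > 0" using q by simp
      have "\<tau>0 \<le> \<tau> / 2" "\<tau>0 \<le> t1 / 2" "\<tau>0 \<le> q\<^sup>2 / 2" "0 < \<tau>0"
        using \<tau>(1) t1 q by (auto simp: \<tau>0_def)
      then have \<tau>0: "0 < \<tau>0" "\<tau>0 < \<tau>" "\<tau>0 < t1" "\<tau>0 < q\<^sup>2"
        using \<tau>(1) t1 q2 by linarith+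
      have start: "g y \<tau>0 - w y \<tau>0 \<le> d" if y: "y \<in> C" for y
      proof (cases "F y \<ge> q")
        case True
        then have "y \<in> C'" using y by (simp add: C'_def)
        then show ?thesis using \<tau>(2)[of y \<tau>0] \<tau>0 w1[of \<tau>0 y] by simp
      next
        case False
        have F0: "0 \<le> F y" using ch(6)[of y] Cr[OF y] by (simp add: F_def pr_def)
        have "(\<tau>0 + q\<^sup>2) / q\<^sup>2 \<le> 2" using \<tau>0 q2 by (simp add: field_simps)
        moreover have "(\<tau>0 + q\<^sup>2) / q\<^sup>2 > 0" using \<tau>0 q2 by (simp add: add_pos_pos)
        ultimately have "ln ((\<tau>0 + q\<^sup>2) / q\<^sup>2) \<le> ln 2" by simp
        then have l: "\<alpha> * ln ((\<tau>0 + q\<^sup>2) / q\<^sup>2) \<le> \<alpha> * ln 2" using kp by simp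
        have "(F y)\<^sup>2 \<le> q\<^sup>2" using False F0 by (intro power_mono) auto
        then have "(F y)\<^sup>2 / (\<tau>0 + q\<^sup>2) \<le> 1" using \<tau>0 q2 by (simp add: pos_divide_le_eq add_pos_pos)
        then have "\<kappa> * ((F y)\<^sup>2 / (\<tau>0 + q\<^sup>2)) \<le> \<kappa> * 1" using kp by (intro mult_left_mono) auto
        then have "- (\<alpha> * ln 2 + \<kappa>) \<le> - \<alpha> * ln ((\<tau>0 + q\<^sup>2) / q\<^sup>2) - \<kappa> * (F y)\<^sup>2 / (\<tau>0 + q\<^sup>2)" using l by simp
        then have "Mc * exp (- (\<alpha> * ln 2 + \<kappa>)) \<le> Mc * exp (- \<alpha> * ln ((\<tau>0 + q\<^sup>2) / q\<^sup>2) - \<kappa> * (F y)\<^sup>2 / (\<tau>0 + q\<^sup>2))"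
          using Mc by (intro mult_left_mono) auto
        moreover have "Mc * exp (- (\<alpha> * ln 2 + \<kappa>)) = M"
          unfolding Mc_def mult.assoc exp_minus_inverse by simp
        moreover have "M * ((norm (y - p))\<^sup>2 + K1 * \<tau>0) / r0\<^sup>2 \<ge> 0"
          using M kp \<tau>0 by (intro divide_nonneg_nonneg mult_nonneg_nonneg add_nonneg_nonneg) auto
        ultimately have "w y \<tau>0 \<ge> M" unfolding w_def by linarith
        then show ?thesis using gM[of y \<tau>0] Cr[OF y] \<tau>0 d by simp
      qed
      define H where "H = (\<lambda>(y, s). g y s - w y s)"
      have "continuous_on (C \<times> {\<tau>0..t1}) (\<lambda>(x, t). g x t)"
        by (rule continuous_on_subset[OF cont]) (use Cr \<tau>0 in auto)
      moreover have "continuous_on (C \<times> {\<tau>0..t1}) (\<lambda>z. F (fst z))"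
        by (rule continuous_on_compose2[OF contF _ subset_UNIV]) (intro continuous_intros)
      moreover have "s + q\<^sup>2 \<noteq> 0" "(s + q\<^sup>2) / q\<^sup>2 > 0" if "s \<in> {\<tau>0..t1}" for s
        using that \<tau>0 q2 by (auto simp: add_pos_pos add_nonneg_eq_0_iff)
      ultimately have "continuous_on (C \<times> {\<tau>0..t1}) H"
        unfolding H_def w_def split_beta using q r0(1)
        by (intro continuous_intros) (auto simp: mem_Times_iff)
      moreover have "compact (C \<times> {\<tau>0..t1})" by (intro compact_Times Cc) simp
      moreover have ne: "(x1, t1) \<in> C \<times> {\<tau>0..t1}" using x1 \<tau>0 by auto
      ultimately obtain z where z: "z \<in> C \<times> {\<tau>0..t1}" "\<And>y. y \<in> C \<times> {\<tau>0..t1} \<Longrightarrow> H y \<le> H z"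
        using continuous_attains_sup[of "C \<times> {\<tau>0..t1}" H] by blast
      obtain x t where zt: "z = (x, t)" by (cases z)
      have xC: "x \<in> C" and tt: "\<tau>0 \<le> t" "t \<le> t1" using z zt by auto
      have big: "g x t - w x t > d" using z(2)[OF ne] d unfolding zt H_def by (simp add: d_def)
      have t0: "t > \<tau>0" using start[OF xC] big tt by (cases "t = \<tau>0") auto
      have tp: "t > 0" using t0 \<tau>0 by linarith
      have xb: "x \<in> ball p r0"
      proof (rule ccontr)
        assume "x \<notin> ball p r0"
        then have "norm (x - p) = r0" using xC by (auto simp: C_def dist_norm norm_minus_commute)
        then have "M * ((norm (x - p))\<^sup>2 + K1 * t) / r0\<^sup>2 = M + M * (K1 * t) / r0\<^sup>2"
          using r0(1) by (simp add: distrib_left add_divide_distrib)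
        moreover have "M * (K1 * t) / r0\<^sup>2 \<ge> 0" using M kp tp by simp
        moreover have "Mc * exp (- \<alpha> * ln ((t + q\<^sup>2) / q\<^sup>2) - \<kappa> * (F x)\<^sup>2 / (t + q\<^sup>2)) \<ge> 0" using Mc by simp
        ultimately have "w x t \<ge> M" unfolding w_def by linarith
        then show False using gM[OF Cr(3)[OF xC] tp] big d by linarith
      qed
      have xO: "x \<in> \<Omega>"
      proof (rule ccontr)
        assume "x \<notin> \<Omega>"
        then have "x \<in> frontier \<Omega>" using Cr(3)[OF xC] frontier_dom by blast
        then show False using g0[OF _ Cr(2)[OF xC] tp] w1[OF tp, of x] big d by force
      qed
      have Fx: "F x > 0" using ch(5)[OF Cr(1)[OF xC]] xO by (simp add: F_def pr_def)
      define G0 where "G0 = G (pr x)"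
      define b where "b = \<nu> - pr G0"
      have prn: "pr v \<bullet> \<nu> = 0" for v by (simp add: pr_def inner_diff_left nn)
      have pr_sym: "pr v \<bullet> u = v \<bullet> pr u" for v u
        by (simp add: pr_def inner_diff_left inner_diff_right inner_commute)
      have b1: "norm b \<ge> 1"
      proof -
        have "b \<bullet> \<nu> = 1" by (simp add: b_def inner_diff_left nn prn)
        then show ?thesis using norm_cauchy_schwarz[of b \<nu>] ch(2) by simp
      qed
      have b2: "norm b \<le> Cb"
      proof -
        have "norm b \<le> norm \<nu> + norm (pr G0)" unfolding b_def by (rule norm_triangle_ineq4)
        also have "norm (pr G0) \<le> CG" using pr_le[of G0] CG(3)[rule_format, OF prB[OF Cr(1)[OF xC]]] by (simp add: G0_def)
        finally show ?thesis using ch(2) by (simp add: Cb_def)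
      qed
      \<comment> \<open>Quadratic minorant of \<open>F\<close> touching at \<open>x\<close>. As the
        square of \<open>F\<close> enters the exponent with a negative sign, the barrier built from
        \<open>P\<close> lies above the true one wherever \<open>P\<close> is positive, and agrees
        with it at \<open>x\<close>.\<close>
      define P where "P y = F x + b \<bullet> (y - x) - L * (norm (pr (y - x)))\<^sup>2" for y
      have PF: "P y \<le> F y" for y
      proof -
        have "\<phi> (pr y) \<le> \<phi> (pr x) + G0 \<bullet> (pr y - pr x) + L * (norm (pr y - pr x))\<^sup>2"
          unfolding G0_def by (rule C11_taylor[OF ch(3,4)])
        moreover have "pr G0 \<bullet> (y - x) = G0 \<bullet> (pr y - pr x)" by (simp add: pr_sym pr_diff)
        moreover have "\<nu> \<bullet> (y - x) = y \<bullet> \<nu> - x \<bullet> \<nu>" by (simp add: inner_diff_right inner_commute)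
        ultimately show ?thesis unfolding P_def F_def b_def inner_diff_left[of \<nu>] pr_diff[of y x, symmetric] by linarith
      qed
      have Px: "P x = F x" by (simp add: P_def pr_def)
      have contP: "isCont P x"
        unfolding P_def pr_def by (intro continuous_intros)
      define v where "v y s = Mc * exp (- \<alpha> * ln ((s + q\<^sup>2) / q\<^sup>2) - \<kappa> * (P y)\<^sup>2 / (s + q\<^sup>2)) + M * ((norm (y - p))\<^sup>2 + K1 * s) / r0\<^sup>2" for y s
      define E where "E = Mc * exp (- \<alpha> * ln ((t + q\<^sup>2) / q\<^sup>2) - \<kappa> * (F x)\<^sup>2 / (t + q\<^sup>2))"
      note J = corner_jet[OF q tp pr_lin, where x = x and p = p and b = b and ?F0.0 = "F x" and L = L and \<kappa> = \<kappa> and \<alpha> = \<alpha> and Mc = Mc and M = M and ?K1.0 = K1 and ?r0.0 = r0,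
          folded P_def, folded v_def, folded E_def]
      have vx: "v x s = w x s" for s by (simp add: v_def w_def Px)
      obtain b' where J2: "jet2 (\<lambda>y. v y t) x b' (\<lambda>\<xi>. E * (4 * \<kappa>\<^sup>2 * (F x)\<^sup>2 / (t + q\<^sup>2)\<^sup>2 * (b \<bullet> \<xi>)\<^sup>2
        - 2 * \<kappa> / (t + q\<^sup>2) * ((b \<bullet> \<xi>)\<^sup>2 - 2 * F x * L * (norm (pr \<xi>))\<^sup>2)) + 2 * M / r0\<^sup>2 * (norm \<xi>)\<^sup>2)"
        using J(2) by blast
      have "E * (\<kappa> * (F x)\<^sup>2 / (t + q\<^sup>2)\<^sup>2 - \<alpha> / (t + q\<^sup>2)) + M * K1 / r0\<^sup>2 \<le> (\<Sum>k\<in>UNIV. E * (4 * \<kappa>\<^sup>2 * (F x)\<^sup>2 / (t + q\<^sup>2)\<^sup>2 * (b \<bullet> dir x k)\<^sup>2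
        - 2 * \<kappa> / (t + q\<^sup>2) * ((b \<bullet> dir x k)\<^sup>2 - 2 * F x * L * (norm (pr (dir x k)))\<^sup>2)) + 2 * M / r0\<^sup>2 * (norm (dir x k))\<^sup>2)"
      proof (rule psubD[OF g xO tp J(1) J2])
        have "\<forall>\<^sub>F y in nhds x. y \<in> \<Omega> \<inter> ball p r0"
          by (rule eventually_nhds_in_open) (use open_dom xO xb in auto)
        moreover have "\<forall>\<^sub>F y in nhds x. P y > 0"
        proof -
          have "(P \<longlongrightarrow> P x) (nhds x)" using contP unfolding isCont_def tendsto_at_iff_tendsto_nhds .
          then show ?thesis by (rule order_tendstoD(1)) (simp add: Px Fx)
        qed
        ultimately show "\<forall>\<^sub>F y in nhds x. g y t - v y t \<le> g x t - v x t"
        proof eventually_elim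
          case (elim y)
          then have yC: "y \<in> C" using closure_subset[of \<Omega>] by (auto simp: C_def)
          have "(P y)\<^sup>2 \<le> (F y)\<^sup>2" using PF[of y] elim by (intro power_mono) auto
          then have "\<kappa> * (P y)\<^sup>2 / (t + q\<^sup>2) \<le> \<kappa> * (F y)\<^sup>2 / (t + q\<^sup>2)"
            using kp tp q2 by (intro divide_right_mono mult_left_mono) auto
          then have "w y t \<le> v y t" unfolding w_def v_def using Mc by (intro add_right_mono mult_left_mono) auto
          moreover have "g y t - w y t \<le> g x t - w x t"
            using z(2)[of "(y, t)"] yC tt unfolding zt H_def by auto
          ultimately show ?case unfolding vx by linarith
        qed
        have "\<forall>\<^sub>F s in nhds t. s > \<tau>0" using t0 by (rule eventually_nhds_in_open[OF open_greaterThan, simplified])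
        then show "\<forall>\<^sub>F s in nhds t. s \<le> t \<longrightarrow> g x s - v x s \<le> g x t - v x t"
        proof eventually_elim
          case (elim s)
          then show ?case using z(2)[of "(x, s)"] xC tt unfolding zt H_def vx by auto
        qed
      qed
      moreover have "4 * L * trb * F x \<le> lam"
      proof -
        have "F x \<le> Cb * norm (x - p)" by (rule F_le[OF Cr(1)[OF xC]])
        also have "\<dots> \<le> Cb * r0" using xb Cb by (intro mult_left_mono) (auto simp: dist_norm norm_minus_commute)
        finally have "4 * L * trb * F x \<le> 4 * L * trb * (Cb * r0)" using L0 trb(1) by (intro mult_left_mono) auto
        also have "\<dots> \<le> 4 * (L + 1) * trb * (Cb * r0)" using trb(1) Cb r0(1) by (intro mult_right_mono) auto
        finally show ?thesis using r0D by linarith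
      qed
      ultimately show False
        using corner_strict[OF xO b1 b2 less_imp_le[OF Fx] _ L0 pr_le, of "t + q\<^sup>2" E M r0 \<kappa> \<alpha>]
          \<kappa>_def \<alpha>_def M r0(1) Mc tp q2 unfolding K1_def E_def[symmetric] by (auto simp: add_pos_pos E_def)
    qed
    moreover have "w x1 t1 \<le> Mc * exp (- \<alpha> * ln ((t1 + q\<^sup>2) / q\<^sup>2)) + M * ((norm (x1 - p))\<^sup>2 + K1 * t1) / r0\<^sup>2"
      unfolding w_def using Mc kp t1 by (intro add_right_mono mult_left_mono) auto
    ultimately show ?thesis by linarith
  qed
  have bound: "g x t \<le> M * ((norm (x - p))\<^sup>2 + K1 * t) / r0\<^sup>2" if x: "x \<in> C" and t: "t > 0" for x t
  proof (rule field_le_epsilon)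
    fix e' :: real assume e': "e' > 0"
    \<comment> \<open>With the \<open>q\<close> below, (t + q^2)/q^2 exceeds exp Y, which brings the
      kernel term down to \<open>e'\<close>. Letting \<open>q\<close> shrink in this way leaves only
      the quadratic term.\<close>
    define Y where "Y = ln (Mc / e') / \<alpha>"
    define q where "q = sqrt (t * exp (- Y))"
    have q: "q > 0" "q\<^sup>2 = t * exp (- Y)" using t by (auto simp: q_def)
    have "t / q\<^sup>2 = exp Y" using t by (simp add: q exp_minus field_simps)
    then have "(t + q\<^sup>2) / q\<^sup>2 \<ge> exp Y" using q by (simp add: add_divide_distrib)
    then have "ln ((t + q\<^sup>2) / q\<^sup>2) \<ge> Y" using ln_mono[of "exp Y" "(t + q\<^sup>2) / q\<^sup>2"] by (smt (verit) exp_gt_zero ln_exp)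
    then have "- \<alpha> * ln ((t + q\<^sup>2) / q\<^sup>2) \<le> - ln (Mc / e')"
      using kp mult_left_mono[of Y "ln ((t + q\<^sup>2) / q\<^sup>2)" \<alpha>] by (simp add: Y_def)
    then have "exp (- \<alpha> * ln ((t + q\<^sup>2) / q\<^sup>2)) \<le> exp (- ln (Mc / e'))" by simp
    also have "\<dots> = e' / Mc" using Mc e' by (simp add: exp_minus)
    finally have "Mc * exp (- \<alpha> * ln ((t + q\<^sup>2) / q\<^sup>2)) \<le> e'" using Mc by (simp add: field_simps)
    then show "g x t \<le> M * ((norm (x - p))\<^sup>2 + K1 * t) / r0\<^sup>2 + e'" using main[OF x t q(1)] by linarith
  qed
  \<comment> \<open>Splits \<open>e\<close> evenly between the spatial and the temporal part of the
    quadratic term.\<close>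
  define m where "m = e * r0\<^sup>2 / (2 * M)"
  have m: "m > 0" using e r0 M by (simp add: m_def)
  show ?thesis
  proof (intro exI conjI ballI allI impI)
    show "min r0 (sqrt m) > 0" "m / K1 > 0" using r0 m kp by auto
    fix x and t :: real assume x: "x \<in> closure \<Omega> \<inter> ball p (min r0 (sqrt m))" and t: "0 < t" "t < m / K1"
    then have "x \<in> C" by (auto simp: C_def)
    from bound[OF this t(1)] have "g x t \<le> M * ((norm (x - p))\<^sup>2 + K1 * t) / r0\<^sup>2" .
    also have "\<dots> \<le> M * (m + m) / r0\<^sup>2"
    proof -
      have "norm (x - p) \<le> sqrt m" using x by (auto simp: dist_norm norm_minus_commute)
      then have "(norm (x - p))\<^sup>2 \<le> (sqrt m)\<^sup>2" by (intro power_mono) auto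
      moreover have "K1 * t \<le> m" using t kp by (simp add: field_simps)
      ultimately show ?thesis using M m by (intro divide_right_mono mult_left_mono) auto
    qed
    also have "\<dots> = e" using M r0 by (simp add: m_def)
    finally show "g x t \<le> e" .
  qed
qed

subsection \<open>Lower bounds for nonnegative supersolutions\<close>

lemma A_norm_pos: "w \<noteq> 0 \<Longrightarrow> A_norm A p w > 0"
  using norm_le_A_norm[of w p] A_norm_nonneg[of p w] by (cases "A_norm A p w = 0") (auto simp: less_le)

lemma A_norm_line:
  "(A_norm A z (x + s *\<^sub>R \<xi> - z))\<^sup>2 = (A_norm A z (x - z))\<^sup>2 + s * (2 * (Ai z (x - z) \<bullet> \<xi>)) + s\<^sup>2 * (A_norm A z \<xi>)\<^sup>2"
proof -
  have e: "x + s *\<^sub>R \<xi> - z = (x - z) + s *\<^sub>R \<xi>" by simp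
  have "Ai z \<xi> \<bullet> (x - z) = Ai z (x - z) \<bullet> \<xi>" by (metis Ai_sym inner_commute)
  then show ?thesis
    unfolding e A_norm_square matrix_vector_right_distrib inner_add_left[of "Ai z (x - z)"] inner_add_right[of _ "x - z"]
    by (simp add: matrix_vector_mult_scaleR power2_eq_square)
qed

text \<open>The norm N in the Gaussian is replaced by (N^2/n + n)/2 with n = N(x), which is
  quadratic along lines and, by the arithmetic-geometric mean inequality, at least N with equality
  at \<open>x\<close>. This lowers the comparison function away from \<open>x\<close>, so a minimum
  of the difference at \<open>x\<close> persists.\<close>

lemma lower_jet:
  fixes z x :: "real ^ 'n" and a m \<kappa> c t :: real
  assumes t: "t > 0" and xz: "x \<noteq> z"
  defines "n \<equiv> A_norm A z (x - z)"
  defines "P \<equiv> \<lambda>y. a + \<kappa> * ((A_norm A z (y - z))\<^sup>2 / n + n) / 2"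
  defines "w \<equiv> \<lambda>y s. m * (exp (- (P y)\<^sup>2 / (4 * s)) - exp (- c\<^sup>2 / (4 * s)))"
  defines "\<psi> \<equiv> a + \<kappa> * n"
  defines "e \<equiv> exp (- \<psi>\<^sup>2 / (4 * t))"
  shows "(w x has_real_derivative m * (e * \<psi>\<^sup>2 / (4 * t\<^sup>2) - exp (- c\<^sup>2 / (4 * t)) * c\<^sup>2 / (4 * t\<^sup>2))) (at t)"
    "\<exists>b'. jet2 (\<lambda>y. w y t) x b' (\<lambda>\<xi>. m * e * (\<psi>\<^sup>2 / (4 * t\<^sup>2) * (\<kappa> / n * (Ai z (x - z) \<bullet> \<xi>))\<^sup>2
        - ((\<kappa> / n * (Ai z (x - z) \<bullet> \<xi>))\<^sup>2 + \<psi> * (\<kappa> / n * (A_norm A z \<xi>)\<^sup>2)) / (2 * t)))"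
proof -
  have n: "n > 0" using A_norm_pos[of "x - z" z] xz by (simp add: n_def)
  have Px: "P x = \<psi>" using n unfolding P_def \<psi>_def n_def[symmetric] by (simp add: power2_eq_square)
  have D: "((\<lambda>s. exp (- k / (4 * s))) has_real_derivative exp (- k / (4 * t)) * k / (4 * t\<^sup>2)) (at t)" for k :: real
    using t by (auto intro!: derivative_eq_intros simp: power2_eq_square field_simps)
  show "(w x has_real_derivative m * (e * \<psi>\<^sup>2 / (4 * t\<^sup>2) - exp (- c\<^sup>2 / (4 * t)) * c\<^sup>2 / (4 * t\<^sup>2))) (at t)"
    unfolding w_def Px e_def by (intro DERIV_cmult DERIV_diff D)
  have "jet2 P x (\<lambda>\<xi>. \<kappa> / n * (Ai z (x - z) \<bullet> \<xi>)) (\<lambda>\<xi>. \<kappa> / n * (A_norm A z \<xi>)\<^sup>2)"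
    by (rule jet2_quadratic) (simp add: P_def A_norm_line add_divide_distrib distrib_left mult_ac)
  from jet2_cmult[OF jet2_power2[OF this], of "- 1 / (4 * t)"]
  have "jet2 (\<lambda>y. - 1 / (4 * t) * (P y)\<^sup>2) x (\<lambda>\<xi>. - 1 / (4 * t) * (2 * \<psi> * (\<kappa> / n * (Ai z (x - z) \<bullet> \<xi>))))
    (\<lambda>\<xi>. - 1 / (4 * t) * (2 * (\<kappa> / n * (Ai z (x - z) \<bullet> \<xi>))\<^sup>2 + 2 * \<psi> * (\<kappa> / n * (A_norm A z \<xi>)\<^sup>2)))"
    unfolding Px .
  from jet2_exp[OF this]
  have "jet2 (\<lambda>y. exp (- 1 / (4 * t) * (P y)\<^sup>2)) x (\<lambda>\<xi>. exp (- 1 / (4 * t) * \<psi>\<^sup>2) * (- 1 / (4 * t) * (2 * \<psi> * (\<kappa> / n * (Ai z (x - z) \<bullet> \<xi>)))))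
    (\<lambda>\<xi>. exp (- 1 / (4 * t) * \<psi>\<^sup>2) * ((- 1 / (4 * t) * (2 * \<psi> * (\<kappa> / n * (Ai z (x - z) \<bullet> \<xi>))))\<^sup>2
       + - 1 / (4 * t) * (2 * (\<kappa> / n * (Ai z (x - z) \<bullet> \<xi>))\<^sup>2 + 2 * \<psi> * (\<kappa> / n * (A_norm A z \<xi>)\<^sup>2))))"
    unfolding Px .
  from jet2_cmult[OF jet2_add[OF this jet2_const[of "- exp (- c\<^sup>2 / (4 * t))"]], of m]
  have J: "jet2 (\<lambda>y. m * (exp (- 1 / (4 * t) * (P y)\<^sup>2) + - exp (- c\<^sup>2 / (4 * t)))) x
      (\<lambda>\<xi>. m * (exp (- 1 / (4 * t) * \<psi>\<^sup>2) * (- 1 / (4 * t) * (2 * \<psi> * (\<kappa> / n * (Ai z (x - z) \<bullet> \<xi>)))) + 0))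
    (\<lambda>\<xi>. m * (exp (- 1 / (4 * t) * \<psi>\<^sup>2) * ((- 1 / (4 * t) * (2 * \<psi> * (\<kappa> / n * (Ai z (x - z) \<bullet> \<xi>))))\<^sup>2
       + - 1 / (4 * t) * (2 * (\<kappa> / n * (Ai z (x - z) \<bullet> \<xi>))\<^sup>2 + 2 * \<psi> * (\<kappa> / n * (A_norm A z \<xi>)\<^sup>2))) + 0))"
    (is "jet2 _ _ ?b ?W") .
  have weq: "w y t = m * (exp (- 1 / (4 * t) * (P y)\<^sup>2) + - exp (- c\<^sup>2 / (4 * t)))" for y
    by (simp add: w_def)
  have Weq: "?W = (\<lambda>\<xi>. m * e * (\<psi>\<^sup>2 / (4 * t\<^sup>2) * (\<kappa> / n * (Ai z (x - z) \<bullet> \<xi>))\<^sup>2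
        - ((\<kappa> / n * (Ai z (x - z) \<bullet> \<xi>))\<^sup>2 + \<psi> * (\<kappa> / n * (A_norm A z \<xi>)\<^sup>2)) / (2 * t)))"
  proof
    fix \<xi>
    define X where "X = \<kappa> / n * (Ai z (x - z) \<bullet> \<xi>)"
    define Y where "Y = \<kappa> / n * (A_norm A z \<xi>)\<^sup>2"
    have e1: "exp (- 1 / (4 * t) * \<psi>\<^sup>2) = e" by (simp add: e_def)
    show "?W \<xi> = m * e * (\<psi>\<^sup>2 / (4 * t\<^sup>2) * (\<kappa> / n * (Ai z (x - z) \<bullet> \<xi>))\<^sup>2
        - ((\<kappa> / n * (Ai z (x - z) \<bullet> \<xi>))\<^sup>2 + \<psi> * (\<kappa> / n * (A_norm A z \<xi>)\<^sup>2)) / (2 * t))"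
      unfolding X_def[symmetric] Y_def[symmetric] e1 using t by (simp add: power2_eq_square field_simps)
  qed
  show "\<exists>b'. jet2 (\<lambda>y. w y t) x b' (\<lambda>\<xi>. m * e * (\<psi>\<^sup>2 / (4 * t\<^sup>2) * (\<kappa> / n * (Ai z (x - z) \<bullet> \<xi>))\<^sup>2
        - ((\<kappa> / n * (Ai z (x - z) \<bullet> \<xi>))\<^sup>2 + \<psi> * (\<kappa> / n * (A_norm A z \<xi>)\<^sup>2)) / (2 * t)))"
    unfolding weq[symmetric] using J[unfolded Weq] unfolding weq[symmetric] by blast
qed

text \<open>The terms of order 1/t^2 win: inflating by \<kappa> makes the sum \<open>B\<close> of
  squared first derivatives at least \<kappa>, so they leave a surplus of at least (\<kappa> - 1)
  a^2/(4 t^2). The curvature terms are of order 1/t and are absorbed for small t, because a >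
  0.\<close>

lemma lower_strict:
  fixes z x :: "real ^ 'n"
  assumes x: "x \<in> \<Omega>" and t: "t > 0" and m: "m > 0" and a: "a > 0" and \<kappa>: "\<kappa> > 1" and \<sigma>: "\<sigma> > 0"
    and n: "\<sigma> \<le> n" "n = A_norm A z (x - z)" and c: "a + \<kappa> * n \<le> c"
    and ell: "\<kappa>\<^sup>2 * ((A x *v Ai z (x - z)) \<bullet> Ai z (x - z)) \<ge> \<kappa> * n\<^sup>2"
    and small: "2 * t * (\<kappa>\<^sup>2 * trb / lam + c * (\<kappa> * Cn\<^sup>2 * trb / \<sigma>)) < (\<kappa> - 1) * a\<^sup>2"
    and \<psi>: "\<psi> = a + \<kappa> * n" and e: "e > 0" and ec: "ec \<ge> 0"
  shows "m * (e * \<psi>\<^sup>2 / (4 * t\<^sup>2) - ec * c\<^sup>2 / (4 * t\<^sup>2)) < (\<Sum>k\<in>UNIV. m * e * (\<psi>\<^sup>2 / (4 * t\<^sup>2) * (\<kappa> / n * (Ai z (x - z) \<bullet> dir x k))\<^sup>2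
        - ((\<kappa> / n * (Ai z (x - z) \<bullet> dir x k))\<^sup>2 + \<psi> * (\<kappa> / n * (A_norm A z (dir x k))\<^sup>2)) / (2 * t)))"
proof -
  define \<zeta> where "\<zeta> = Ai z (x - z)"
  define B where "B = (\<Sum>k\<in>UNIV. (\<kappa> / n * (\<zeta> \<bullet> dir x k))\<^sup>2)"
  define \<Gamma> where "\<Gamma> = (\<Sum>k\<in>UNIV. \<kappa> / n * (A_norm A z (dir x k))\<^sup>2)"
  have n0: "n > 0" using n \<sigma> by linarith
  have Beq: "B = \<kappa>\<^sup>2 / n\<^sup>2 * ((A x *v \<zeta>) \<bullet> \<zeta>)"
    unfolding B_def form_dir by (simp add: power_mult_distrib power_divide sum_distrib_left)
  have B1: "B \<ge> \<kappa>"
    unfolding Beq using ell n0 by (simp add: \<zeta>_def field_simps)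
  have B2: "B \<le> \<kappa>\<^sup>2 * trb / lam"
  proof -
    have "(A x *v \<zeta>) \<bullet> \<zeta> \<le> norm (A x) * (norm \<zeta>)\<^sup>2" by (rule form_le)
    also have "\<dots> \<le> trb * (n\<^sup>2 / lam)"
      using A_norm_Ai[of z "x - z"] lam(1) trb(1) trb(3)[OF x] n(2)
      by (intro mult_mono) (auto simp: \<zeta>_def field_simps)
    finally have "B \<le> \<kappa>\<^sup>2 / n\<^sup>2 * (trb * (n\<^sup>2 / lam))" unfolding Beq by (intro mult_left_mono) auto
    then show ?thesis using n0 by simp
  qed
  have G: "\<Gamma> \<le> \<kappa> * Cn\<^sup>2 * trb / \<sigma>" "\<Gamma> \<ge> 0"
  proof -
    show "\<Gamma> \<ge> 0" unfolding \<Gamma>_def using \<kappa> n0 by (intro sum_nonneg) auto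
    have "\<Gamma> \<le> (\<Sum>k\<in>UNIV. \<kappa> / n * (Cn * norm (dir x k))\<^sup>2)"
      unfolding \<Gamma>_def using \<kappa> n0 by (intro sum_mono mult_left_mono power_mono A_norm_le) auto
    also have "\<dots> = \<kappa> / n * Cn\<^sup>2 * trace (A x)"
      unfolding sum_norm_dir[symmetric] by (simp add: power_mult_distrib sum_distrib_left mult_ac)
    also have "\<dots> \<le> \<kappa> / n * Cn\<^sup>2 * trb" using trb(2)[OF x] \<kappa> n0 by (intro mult_left_mono) auto
    also have "\<dots> = \<kappa> * Cn\<^sup>2 * trb / n" by simp
    also have "\<dots> \<le> \<kappa> * Cn\<^sup>2 * trb / \<sigma>" using n \<sigma> \<kappa> trb(1) by (intro divide_left_mono) auto
    finally show "\<Gamma> \<le> \<kappa> * Cn\<^sup>2 * trb / \<sigma>" .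
  qed
  have psi: "a \<le> \<psi>" "\<psi> \<le> c" using \<psi> \<kappa> n0 c by auto
  have sum_eq: "(\<Sum>k\<in>UNIV. m * e * (\<psi>\<^sup>2 / (4 * t\<^sup>2) * (\<kappa> / n * (Ai z (x - z) \<bullet> dir x k))\<^sup>2
        - ((\<kappa> / n * (Ai z (x - z) \<bullet> dir x k))\<^sup>2 + \<psi> * (\<kappa> / n * (A_norm A z (dir x k))\<^sup>2)) / (2 * t)))
     = m * e * (\<psi>\<^sup>2 / (4 * t\<^sup>2) * B - (B + \<psi> * \<Gamma>) / (2 * t))"
  proof -
    have "(\<Sum>k\<in>UNIV. m * e * (p * X k - (X k + q * Y k) * r)) = m * e * (p * sum X UNIV - (sum X UNIV + q * sum Y UNIV) * r)"
      for p q r and X Y :: "'n \<Rightarrow> real"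
      by (simp add: sum.distrib sum_subtractf sum_distrib_left sum_distrib_right algebra_simps)
    from this[of "\<psi>\<^sup>2 / (4 * t\<^sup>2)" "\<lambda>k. (\<kappa> / n * (\<zeta> \<bullet> dir x k))\<^sup>2" \<psi> "\<lambda>k. \<kappa> / n * (A_norm A z (dir x k))\<^sup>2" "1 / (2 * t)"]
    show ?thesis unfolding B_def \<Gamma>_def \<zeta>_def by simp
  qed
  have "2 * t * (B + \<psi> * \<Gamma>) \<le> 2 * t * (\<kappa>\<^sup>2 * trb / lam + c * (\<kappa> * Cn\<^sup>2 * trb / \<sigma>))"
    using t B2 G psi a by (intro mult_left_mono add_mono mult_mono) auto
  also note small
  also have "(\<kappa> - 1) * a\<^sup>2 \<le> (B - 1) * \<psi>\<^sup>2" using B1 \<kappa> psi a by (intro mult_mono power_mono) auto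
  finally have "2 * t * (B + \<psi> * \<Gamma>) < (B - 1) * \<psi>\<^sup>2" .
  then have "2 * t * (B + \<psi> * \<Gamma>) / (4 * t\<^sup>2) < (B - 1) * \<psi>\<^sup>2 / (4 * t\<^sup>2)"
    using t by (intro divide_strict_right_mono) auto
  moreover have "2 * t * (B + \<psi> * \<Gamma>) / (4 * t\<^sup>2) = (B + \<psi> * \<Gamma>) / (2 * t)"
    using t by (simp add: power2_eq_square field_simps)
  moreover have "(B - 1) * \<psi>\<^sup>2 / (4 * t\<^sup>2) = \<psi>\<^sup>2 / (4 * t\<^sup>2) * B - \<psi>\<^sup>2 / (4 * t\<^sup>2)"
    by (simp add: left_diff_distrib diff_divide_distrib)
  ultimately have "\<psi>\<^sup>2 / (4 * t\<^sup>2) < \<psi>\<^sup>2 / (4 * t\<^sup>2) * B - (B + \<psi> * \<Gamma>) / (2 * t)" by linarith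
  then have "m * e * (\<psi>\<^sup>2 / (4 * t\<^sup>2)) < m * e * (\<psi>\<^sup>2 / (4 * t\<^sup>2) * B - (B + \<psi> * \<Gamma>) / (2 * t))"
    using m e by (intro mult_strict_left_mono) auto
  moreover have "m * (e * \<psi>\<^sup>2 / (4 * t\<^sup>2) - ec * c\<^sup>2 / (4 * t\<^sup>2)) \<le> m * e * (\<psi>\<^sup>2 / (4 * t\<^sup>2))"
  proof -
    have "m * (ec * c\<^sup>2 / (4 * t\<^sup>2)) \<ge> 0" using m ec by simp
    then show ?thesis unfolding right_diff_distrib by simp
  qed
  ultimately show ?thesis unfolding sum_eq by linarith
qed

text \<open>The last condition stands in for lower semicontinuity of \<open>Z\<close>.\<close>

definition good_super :: "(real ^ 'n \<Rightarrow> real) \<Rightarrow> (real ^ 'n) set \<Rightarrow> (real ^ 'n \<Rightarrow> real \<Rightarrow> real) \<Rightarrow> bool" where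
  "good_super f S Z \<longleftrightarrow> psub (\<lambda>x t. - Z x t) \<and> (\<forall>x\<in>closure \<Omega>. \<forall>t>0. 0 \<le> Z x t) \<and> (\<forall>x\<in>S. \<forall>t>0. f x \<le> Z x t) \<and>
     (\<forall>C w. compact C \<longrightarrow> C \<noteq> {} \<longrightarrow> C \<subseteq> closure \<Omega> \<times> {0<..} \<longrightarrow> continuous_on C w \<longrightarrow>
        (\<exists>z\<in>C. \<forall>z'\<in>C. Z (fst z) (snd z) - w z \<le> Z (fst z') (snd z') - w z'))"

lemma lower_step:
  assumes Z: "good_super f S Z" and m: "m > 0" and a: "a > 0" and \<kappa>: "\<kappa> > 1" and \<sigma>: "\<sigma> > 0"
    and ell: "\<And>x. x \<in> \<Omega> \<Longrightarrow> A_norm A z (x - z) \<le> R \<Longrightarrow> \<kappa>\<^sup>2 * ((A x *v Ai z (x - z)) \<bullet> Ai z (x - z)) \<ge> \<kappa> * (A_norm A z (x - z))\<^sup>2"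
    and inner: "\<And>x t. x \<in> \<Omega> \<Longrightarrow> A_norm A z (x - z) \<le> \<sigma> \<Longrightarrow> 0 < t \<Longrightarrow> t < t0 \<Longrightarrow> Z x t \<ge> m * exp (- a\<^sup>2 / (4 * t))"
    and bdry: "\<And>x t. x \<in> frontier \<Omega> \<Longrightarrow> A_norm A z (x - z) < R \<Longrightarrow> 0 < t \<Longrightarrow> Z x t \<ge> m"
    and c: "c = a + \<kappa> * R" and R: "R > 0"
    and small: "2 * t0 * (\<kappa>\<^sup>2 * trb / lam + c * (\<kappa> * Cn\<^sup>2 * trb / \<sigma>)) \<le> (\<kappa> - 1) * a\<^sup>2"
    and x1: "x1 \<in> \<Omega>" "A_norm A z (x1 - z) < R" and t1: "0 < t1" "t1 < t0"
  shows "Z x1 t1 \<ge> m * (exp (- (a + \<kappa> * A_norm A z (x1 - z))\<^sup>2 / (4 * t1)) - exp (- c\<^sup>2 / (4 * t1)))"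
proof (rule ccontr)
  assume neg: "\<not> ?thesis"
  have Zsub: "psub (\<lambda>x t. - Z x t)" and Z0: "\<And>x t. x \<in> closure \<Omega> \<Longrightarrow> t > 0 \<Longrightarrow> 0 \<le> Z x t"
    using Z unfolding good_super_def by auto
  define \<psi> where "\<psi> x = a + \<kappa> * A_norm A z (x - z)" for x
  define w where "w x t = m * (exp (- (\<psi> x)\<^sup>2 / (4 * t)) - exp (- c\<^sup>2 / (4 * t)))" for x t
  define d where "d = (w x1 t1 - Z x1 t1) / 2"
  have d: "d > 0" using neg by (simp add: d_def w_def \<psi>_def)
  have psi_ge: "\<psi> x \<ge> a" for x using \<kappa> by (simp add: \<psi>_def)
  have w_le1: "w x t \<le> m * exp (- a\<^sup>2 / (4 * t))" if "t > 0" for x t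
  proof -
    have "a\<^sup>2 \<le> (\<psi> x)\<^sup>2" using psi_ge a by (intro power_mono) auto
    then have "exp (- (\<psi> x)\<^sup>2 / (4 * t)) \<le> exp (- a\<^sup>2 / (4 * t))" using that by (simp add: divide_right_mono)
    moreover have "exp (- c\<^sup>2 / (4 * t)) \<ge> 0" by simp
    ultimately have "exp (- (\<psi> x)\<^sup>2 / (4 * t)) - exp (- c\<^sup>2 / (4 * t)) \<le> exp (- a\<^sup>2 / (4 * t))" by linarith
    then show ?thesis unfolding w_def using m by (intro mult_left_mono) auto
  qed
  have ea: "m * exp (- a\<^sup>2 / (4 * t)) \<le> m" if "t > 0" for t using m that by simp
  \<comment> \<open>From exp(-y) \<le> 1/y the barrier at time \<tau> is at most 4 m \<tau> / a^2,
    hence at most \<open>d\<close>.\<close>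
  define \<tau> where "\<tau> = min (t1 / 2) (d * a\<^sup>2 / (4 * m))"
  have tau: "0 < \<tau>" "\<tau> < t1" using t1 d a m by (auto simp: \<tau>_def)
  have start: "w x \<tau> \<le> d" for x
  proof -
    define y where "y = a\<^sup>2 / (4 * \<tau>)"
    have y: "y > 0" using a tau by (simp add: y_def)
    have "y \<le> exp y" using exp_ge_add_one_self[of y] by linarith
    then have "exp (- y) \<le> 1 / y" using y by (simp add: exp_minus field_simps)
    then have "m * exp (- y) \<le> m * (1 / y)" using m by (intro mult_left_mono) auto
    then have "m * exp (- a\<^sup>2 / (4 * \<tau>)) \<le> m * (1 / y)" unfolding y_def minus_divide_left .
    also have "\<dots> = 4 * m * \<tau> / a\<^sup>2" by (simp add: y_def)
    also have "\<dots> \<le> d"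
    proof -
      have "\<tau> \<le> d * a\<^sup>2 / (4 * m)" by (simp add: \<tau>_def)
      then show ?thesis using m a by (simp add: field_simps)
    qed
    finally show ?thesis using w_le1[OF tau(1), of x] by linarith
  qed
  define C where "C = {x \<in> closure \<Omega>. A_norm A z (x - z) \<le> R} \<times> {\<tau>..t1}"
  have cN: "continuous_on T (\<lambda>x. A_norm A z (x - z))" for T
    by (rule continuous_on_compose2[OF continuous_A_norm_right[of UNIV] _ subset_UNIV]) (intro continuous_intros)
  have "{x \<in> closure \<Omega>. A_norm A z (x - z) \<le> R} = closure \<Omega> \<inter> {x. A_norm A z (x - z) \<le> R}" by auto
  then have "compact {x \<in> closure \<Omega>. A_norm A z (x - z) \<le> R}"
    using compact_Int_closed[OF compact_closure_dom closed_Collect_le[OF cN continuous_on_const]] by simp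
  then have Cc: "compact C" unfolding C_def by (intro compact_Times) auto
  have x1C: "(x1, t1) \<in> C" using x1 tau closure_subset[of \<Omega>] by (auto simp: C_def)
  have "continuous_on C (\<lambda>y. A_norm A z (fst y - z))"
    by (rule continuous_on_compose2[OF cN _ subset_UNIV]) (intro continuous_intros)
  then have contw: "continuous_on C (\<lambda>y. w (fst y) (snd y))"
    unfolding w_def \<psi>_def by (intro continuous_intros) (use tau in \<open>auto simp: C_def\<close>)
  have "\<exists>y\<in>C. \<forall>y'\<in>C. Z (fst y) (snd y) - w (fst y) (snd y) \<le> Z (fst y') (snd y') - w (fst y') (snd y')"
  proof -
    have "C \<subseteq> closure \<Omega> \<times> {0<..}" using tau by (auto simp: C_def)
    moreover have "C \<noteq> {}" using x1C by auto
    ultimately show ?thesis using Z Cc contw unfolding good_super_def by blast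
  qed
  then obtain x t where xt: "(x, t) \<in> C" and mn: "\<And>x' t'. (x', t') \<in> C \<Longrightarrow> Z x t - w x t \<le> Z x' t' - w x' t'"
    by force
  have xcl: "x \<in> closure \<Omega>" and tt: "\<tau> \<le> t" "t \<le> t1" and xR: "A_norm A z (x - z) \<le> R" using xt by (auto simp: C_def)
  have tp: "t > 0" using tau tt by linarith
  have big: "Z x t - w x t < - d" proof -
    have "2 * d = w x1 t1 - Z x1 t1" by (simp add: d_def)
    then show ?thesis using mn[OF x1C] d by linarith
  qed
  have t_gt: "t > \<tau>"
  proof (rule ccontr)
    assume "\<not> t > \<tau>"
    then have "t = \<tau>" using tt by simp
    then show False using start[of x] Z0[OF xcl tp] big by simp
  qed
  have xR': "A_norm A z (x - z) < R"
  proof (rule ccontr)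
    assume "\<not> A_norm A z (x - z) < R"
    then have "\<psi> x = c" using xR by (simp add: \<psi>_def c)
    then have "w x t = 0" by (simp add: w_def)
    then show False using Z0[OF xcl tp] big d by simp
  qed
  have xO: "x \<in> \<Omega>"
  proof (rule ccontr)
    assume "x \<notin> \<Omega>"
    then have "x \<in> frontier \<Omega>" using xcl frontier_dom by blast
    from bdry[OF this xR' tp] show False using w_le1[OF tp, of x] ea[OF tp] big d by linarith
  qed
  have xs: "A_norm A z (x - z) > \<sigma>"
  proof (rule ccontr)
    assume "\<not> A_norm A z (x - z) > \<sigma>"
    then have "Z x t \<ge> m * exp (- a\<^sup>2 / (4 * t))" using inner[OF xO _ tp] tt t1 by simp
    then show False using w_le1[OF tp, of x] big d by linarith
  qed
  have xz: "x \<noteq> z" using xs \<sigma> by auto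
  define n where "n = A_norm A z (x - z)"
  have n: "n > 0" "n \<le> R" "\<sigma> \<le> n" using xs \<sigma> xR by (auto simp: n_def)
  define P where "P y = a + \<kappa> * ((A_norm A z (y - z))\<^sup>2 / n + n) / 2" for y
  have Pge: "\<psi> y \<le> P y" for y
  proof -
    define h where "h = A_norm A z (y - z)"
    have "0 \<le> (h - n)\<^sup>2" by simp
    then have "2 * h * n \<le> h\<^sup>2 + n\<^sup>2" by (simp add: power2_diff)
    then have "2 * h \<le> h\<^sup>2 / n + n" using n by (simp add: field_simps power2_eq_square)
    then have "\<kappa> * (2 * h) \<le> \<kappa> * (h\<^sup>2 / n + n)" using \<kappa> by (intro mult_left_mono) auto
    then show ?thesis unfolding P_def \<psi>_def h_def by simp
  qed
  have Px: "P x = \<psi> x" using n unfolding P_def \<psi>_def n_def[symmetric] by (simp add: power2_eq_square)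
  define v where "v y s = m * (exp (- (P y)\<^sup>2 / (4 * s)) - exp (- c\<^sup>2 / (4 * s)))" for y s
  have vx: "v x s = w x s" for s by (simp add: v_def w_def Px)
  note J = lower_jet[OF tp xz, where a = a and \<kappa> = \<kappa> and m = m and c = c, folded n_def, folded P_def, folded v_def]
  define e where "e = exp (- (a + \<kappa> * n)\<^sup>2 / (4 * t))"
  obtain b' where J2: "jet2 (\<lambda>y. v y t) x b' (\<lambda>\<xi>. m * e * ((a + \<kappa> * n)\<^sup>2 / (4 * t\<^sup>2) * (\<kappa> / n * (Ai z (x - z) \<bullet> \<xi>))\<^sup>2
        - ((\<kappa> / n * (Ai z (x - z) \<bullet> \<xi>))\<^sup>2 + (a + \<kappa> * n) * (\<kappa> / n * (A_norm A z \<xi>)\<^sup>2)) / (2 * t)))"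
    using J(2)[folded e_def] by blast
  have "- (m * (e * (a + \<kappa> * n)\<^sup>2 / (4 * t\<^sup>2) - exp (- c\<^sup>2 / (4 * t)) * c\<^sup>2 / (4 * t\<^sup>2))) \<le>
     (\<Sum>k\<in>UNIV. - (m * e * ((a + \<kappa> * n)\<^sup>2 / (4 * t\<^sup>2) * (\<kappa> / n * (Ai z (x - z) \<bullet> dir x k))\<^sup>2
        - ((\<kappa> / n * (Ai z (x - z) \<bullet> dir x k))\<^sup>2 + (a + \<kappa> * n) * (\<kappa> / n * (A_norm A z (dir x k))\<^sup>2)) / (2 * t))))"
  proof (rule psubD[OF Zsub xO tp, where w = "\<lambda>y s. - v y s"])
    show "((\<lambda>s. - v x s) has_real_derivative - (m * (e * (a + \<kappa> * n)\<^sup>2 / (4 * t\<^sup>2) - exp (- c\<^sup>2 / (4 * t)) * c\<^sup>2 / (4 * t\<^sup>2)))) (at t)"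
      unfolding v_def P_def n_def[symmetric] using J(1)[folded e_def] by (rule DERIV_minus)
    show "jet2 (\<lambda>y. - v y t) x (\<lambda>\<xi>. - b' \<xi>) (\<lambda>\<xi>. - (m * e * ((a + \<kappa> * n)\<^sup>2 / (4 * t\<^sup>2) * (\<kappa> / n * (Ai z (x - z) \<bullet> \<xi>))\<^sup>2
        - ((\<kappa> / n * (Ai z (x - z) \<bullet> \<xi>))\<^sup>2 + (a + \<kappa> * n) * (\<kappa> / n * (A_norm A z \<xi>)\<^sup>2)) / (2 * t))))"
      by (rule jet2_minus[OF J2])
    have "open {y. A_norm A z (y - z) < R}" by (intro open_Collect_less cN continuous_on_const)
    then have "\<forall>\<^sub>F y in nhds x. y \<in> \<Omega> \<inter> {y. A_norm A z (y - z) < R}"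
      by (intro eventually_nhds_in_open) (use open_dom xO xR' in auto)
    then show "\<forall>\<^sub>F y in nhds x. - Z y t - - v y t \<le> - Z x t - - v x t"
    proof eventually_elim
      case (elim y)
      then have "(y, t) \<in> C" using closure_subset[of \<Omega>] tt by (auto simp: C_def)
      from mn[OF this] have "Z x t - w x t \<le> Z y t - w y t" .
      moreover have "v y t \<le> w y t"
      proof -
        have "(\<psi> y)\<^sup>2 \<le> (P y)\<^sup>2" using Pge[of y] psi_ge[of y] a by (intro power_mono) auto
        then have "exp (- (P y)\<^sup>2 / (4 * t)) \<le> exp (- (\<psi> y)\<^sup>2 / (4 * t))" using tp by (simp add: divide_right_mono)
        then show ?thesis unfolding v_def w_def using m by (intro mult_left_mono) auto
      qed
      ultimately show ?case unfolding vx by linarith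
    qed
    have "\<forall>\<^sub>F s in nhds t. s > \<tau>" using t_gt by (rule eventually_nhds_in_open[OF open_greaterThan, simplified])
    then show "\<forall>\<^sub>F s in nhds t. s \<le> t \<longrightarrow> - Z x s - - v x s \<le> - Z x t - - v x t"
    proof eventually_elim
      case (elim s)
      show ?case
      proof
        assume "s \<le> t"
        then have "(x, s) \<in> C" using elim xcl xR tt by (auto simp: C_def)
        from mn[OF this] show "- Z x s - - v x s \<le> - Z x t - - v x t" unfolding vx by linarith
      qed
    qed
  qed
  moreover have "m * (e * (a + \<kappa> * n)\<^sup>2 / (4 * t\<^sup>2) - exp (- c\<^sup>2 / (4 * t)) * c\<^sup>2 / (4 * t\<^sup>2)) <
     (\<Sum>k\<in>UNIV. m * e * ((a + \<kappa> * n)\<^sup>2 / (4 * t\<^sup>2) * (\<kappa> / n * (Ai z (x - z) \<bullet> dir x k))\<^sup>2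
        - ((\<kappa> / n * (Ai z (x - z) \<bullet> dir x k))\<^sup>2 + (a + \<kappa> * n) * (\<kappa> / n * (A_norm A z (dir x k))\<^sup>2)) / (2 * t)))"
  proof (rule lower_strict[OF xO tp m a \<kappa> \<sigma> n(3) n_def])
    show "a + \<kappa> * n \<le> c" using n \<kappa> by (simp add: c)
    show "\<kappa>\<^sup>2 * ((A x *v Ai z (x - z)) \<bullet> Ai z (x - z)) \<ge> \<kappa> * n\<^sup>2" unfolding n_def by (rule ell[OF xO xR])
    have "c > 0" using a \<kappa> R by (simp add: c add_pos_pos)
    then have pos: "\<kappa>\<^sup>2 * trb / lam + c * (\<kappa> * Cn\<^sup>2 * trb / \<sigma>) > 0"
      using \<kappa> trb(1) lam(1) \<sigma> by (intro add_pos_nonneg) auto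
    have "2 * t * (\<kappa>\<^sup>2 * trb / lam + c * (\<kappa> * Cn\<^sup>2 * trb / \<sigma>)) < 2 * t0 * (\<kappa>\<^sup>2 * trb / lam + c * (\<kappa> * Cn\<^sup>2 * trb / \<sigma>))"
      using pos tt t1 by (intro mult_strict_right_mono) auto
    then show "2 * t * (\<kappa>\<^sup>2 * trb / lam + c * (\<kappa> * Cn\<^sup>2 * trb / \<sigma>)) < (\<kappa> - 1) * a\<^sup>2" using small by linarith
  qed (auto simp: e_def)
  ultimately show False by (simp add: sum_negf)
qed

text \<open>The constants precede the quantifier over \<open>Z\<close>, since the supersolution used
  later varies with time. The factor \<open>m\<close> absorbs all losses of constants, so only the
  exponent is tracked along a polygon.\<close>

definition Hlow :: "(real ^ 'n \<Rightarrow> real) \<Rightarrow> (real ^ 'n) set \<Rightarrow> real \<Rightarrow> real ^ 'n \<Rightarrow> bool" where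
  "Hlow f S a y \<longleftrightarrow> (\<exists>r>0. \<exists>m>0. \<exists>t0>0. \<forall>Z. good_super f S Z \<longrightarrow>
     (\<forall>x\<in>\<Omega> \<inter> ball y r. \<forall>t. 0 < t \<longrightarrow> t < t0 \<longrightarrow> m * exp (- a\<^sup>2 / (4 * t)) \<le> Z x t))"

lemma Hlow_mono:
  assumes "Hlow f S a y" "0 \<le> a" "a \<le> b"
  shows "Hlow f S b y"
proof -
  from assms(1) obtain r m t0 where H0: "r > 0" "m > 0" "t0 > 0"
    "\<forall>Z. good_super f S Z \<longrightarrow> (\<forall>x\<in>\<Omega> \<inter> ball y r. \<forall>t. 0 < t \<longrightarrow> t < t0 \<longrightarrow> m * exp (- a\<^sup>2 / (4 * t)) \<le> Z x t)"
    unfolding Hlow_def by blast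
  note H = H0(1-3) H0(4)[rule_format]
  have "m * exp (- b\<^sup>2 / (4 * t)) \<le> Z x t" if "good_super f S Z" "x \<in> \<Omega> \<inter> ball y r" "0 < t" "t < t0" for Z x t
  proof -
    have "a\<^sup>2 \<le> b\<^sup>2" using assms by (intro power_mono) auto
    then have "m * exp (- b\<^sup>2 / (4 * t)) \<le> m * exp (- a\<^sup>2 / (4 * t))" using that(3) H(2) by (simp add: divide_right_mono)
    then show ?thesis using H(4)[OF that] by linarith
  qed
  then show ?thesis unfolding Hlow_def using H(1-3) by blast
qed

lemma Hlow_near:
  assumes "Hlow f S a p"
  shows "\<exists>r>0. \<forall>q\<in>ball p r. Hlow f S a q"
proof -
  from assms obtain r m t0 where H0: "r > 0" "m > 0" "t0 > 0"
    "\<forall>Z. good_super f S Z \<longrightarrow> (\<forall>x\<in>\<Omega> \<inter> ball p r. \<forall>t. 0 < t \<longrightarrow> t < t0 \<longrightarrow> m * exp (- a\<^sup>2 / (4 * t)) \<le> Z x t)"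
    unfolding Hlow_def by blast
  note H = H0(1-3) H0(4)[rule_format]
  have "Hlow f S a q" if q: "q \<in> ball p r" for q
  proof -
    obtain r' where r': "r' > 0" "ball q r' \<subseteq> ball p r" using q open_ball openE by blast
    then have "m * exp (- a\<^sup>2 / (4 * t)) \<le> Z x t" if "good_super f S Z" "x \<in> \<Omega> \<inter> ball q r'" "0 < t" "t < t0" for Z x t
      using H(4)[of Z x t] that by blast
    then show ?thesis unfolding Hlow_def using H(2,3) r'(1) by blast
  qed
  then show ?thesis using H(1) by blast
qed

text \<open>Removes the subtracted exponential of \<open>lower_step\<close>: for b < c and 4 t \<le>
  c^2 - b^2 it is at most half of exp(-b^2/(4 t)), at the price of halving \<open>m\<close>. The
  strict lower bound on \<open>b\<close> leaves room for a neighbourhood of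
  \<open>y\<close>.\<close>

lemma Hlow_from_step:
  assumes m: "m > 0" and a: "a > 0" and \<kappa>: "\<kappa> > 1" and \<sigma>: "\<sigma> > 0" and R: "R > 0" and t0: "t0 > 0"
    and ell: "\<And>x. x \<in> \<Omega> \<Longrightarrow> A_norm A z (x - z) \<le> R \<Longrightarrow> \<kappa>\<^sup>2 * ((A x *v Ai z (x - z)) \<bullet> Ai z (x - z)) \<ge> \<kappa> * (A_norm A z (x - z))\<^sup>2"
    and inner: "\<And>Z x t. good_super f S Z \<Longrightarrow> x \<in> \<Omega> \<Longrightarrow> A_norm A z (x - z) \<le> \<sigma> \<Longrightarrow> 0 < t \<Longrightarrow> t < t0 \<Longrightarrow> Z x t \<ge> m * exp (- a\<^sup>2 / (4 * t))"
    and bdry: "\<And>Z x t. good_super f S Z \<Longrightarrow> x \<in> frontier \<Omega> \<Longrightarrow> A_norm A z (x - z) < R \<Longrightarrow> 0 < t \<Longrightarrow> Z x t \<ge> m"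
    and b: "a + \<kappa> * A_norm A z (y - z) < b" "b < a + \<kappa> * R"
  shows "Hlow f S b y"
proof -
  define c where "c = a + \<kappa> * R"
  have c: "c > 0" "b < c" using a \<kappa> R b by (auto simp: c_def add_pos_pos)
  have b0: "b > 0" using b(1) a \<kappa> by (smt (verit) A_norm_nonneg mult_nonneg_nonneg)
  define D where "D = \<kappa>\<^sup>2 * trb / lam + c * (\<kappa> * Cn\<^sup>2 * trb / \<sigma>)"
  have D: "D > 0" unfolding D_def using \<kappa> trb(1) lam(1) \<sigma> c by (intro add_pos_nonneg) auto
  define t2 where "t2 = min t0 ((\<kappa> - 1) * a\<^sup>2 / (2 * D))"
  have t2: "t2 > 0" "t2 \<le> t0" "2 * t2 * D \<le> (\<kappa> - 1) * a\<^sup>2"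
  proof -
    show "t2 > 0" "t2 \<le> t0" using t0 \<kappa> a D by (auto simp: t2_def)
    have "t2 \<le> (\<kappa> - 1) * a\<^sup>2 / (2 * D)" by (simp add: t2_def)
    then show "2 * t2 * D \<le> (\<kappa> - 1) * a\<^sup>2" using D by (simp add: field_simps)
  qed
  have cb: "c\<^sup>2 - b\<^sup>2 > 0" using c b0 by (simp add: power_strict_mono)
  define t3 where "t3 = min t2 ((c\<^sup>2 - b\<^sup>2) / 4)"
  have t3: "t3 > 0" "t3 \<le> t2" "4 * t3 \<le> c\<^sup>2 - b\<^sup>2"
  proof -
    show "t3 > 0" "t3 \<le> t2" using t2 cb by (auto simp: t3_def)
    have "4 * u \<le> X" if "u \<le> X / 4" for u X :: real using that by linarith
    then show "4 * t3 \<le> c\<^sup>2 - b\<^sup>2" unfolding t3_def by (metis min.cobounded2)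
  qed
  have cN: "continuous_on UNIV (\<lambda>x. a + \<kappa> * A_norm A z (x - z))"
    by (intro continuous_intros continuous_on_compose2[OF continuous_A_norm_right[of UNIV] _ subset_UNIV])
  have "open {x. a + \<kappa> * A_norm A z (x - z) < b}" by (intro open_Collect_less cN continuous_on_const)
  then obtain r where r: "r > 0" "ball y r \<subseteq> {x. a + \<kappa> * A_norm A z (x - z) < b}"
    using b(1) open_contains_ball by blast
  have "m / 2 * exp (- b\<^sup>2 / (4 * t)) \<le> Z x t" if Z: "good_super f S Z" and x: "x \<in> \<Omega> \<inter> ball y r" and t: "0 < t" "t < t3" for Z x t
  proof -
    let ?p = "a + \<kappa> * A_norm A z (x - z)"
    have p: "?p < b" using r x by auto
    have p0: "0 \<le> ?p" using a \<kappa> by (simp add: add_nonneg_nonneg)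
    have "\<kappa> * A_norm A z (x - z) < \<kappa> * R" using p b(2) by linarith
    then have xR: "A_norm A z (x - z) < R" using \<kappa> by simp
    have "Z x t \<ge> m * (exp (- ?p\<^sup>2 / (4 * t)) - exp (- c\<^sup>2 / (4 * t)))"
    proof (rule lower_step[OF Z m a \<kappa> \<sigma> ell inner[OF Z] bdry[OF Z] c_def R, where ?t0.0 = t2])
      show "2 * t2 * (\<kappa>\<^sup>2 * trb / lam + c * (\<kappa> * Cn\<^sup>2 * trb / \<sigma>)) \<le> (\<kappa> - 1) * a\<^sup>2"
        using t2(3) unfolding D_def .
    qed (use x xR t t3 t2 in auto)
    moreover have "exp (- ?p\<^sup>2 / (4 * t)) \<ge> exp (- b\<^sup>2 / (4 * t))"
    proof -
      have "?p\<^sup>2 \<le> b\<^sup>2" using p p0 by (intro power_mono) auto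
      then show ?thesis using t by (simp add: divide_right_mono)
    qed
    moreover have "exp (- c\<^sup>2 / (4 * t)) \<le> exp (- b\<^sup>2 / (4 * t)) / 2"
    proof -
      have "(c\<^sup>2 - b\<^sup>2) / (4 * t) \<ge> 1" using t t3 by simp
      then have "- c\<^sup>2 / (4 * t) \<le> - b\<^sup>2 / (4 * t) - 1" by (simp add: diff_divide_distrib)
      then have "exp (- c\<^sup>2 / (4 * t)) \<le> exp (- b\<^sup>2 / (4 * t) - 1)" by simp
      also have "\<dots> = exp (- b\<^sup>2 / (4 * t)) / exp 1" by (rule exp_diff)
      also have "\<dots> \<le> exp (- b\<^sup>2 / (4 * t)) / 2"
        using exp_ge_add_one_self[of 1] by (intro divide_left_mono) auto
      finally show ?thesis .
    qed
    ultimately have "exp (- ?p\<^sup>2 / (4 * t)) - exp (- c\<^sup>2 / (4 * t)) \<ge> exp (- b\<^sup>2 / (4 * t)) / 2" by linarith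
    then have "m * (exp (- ?p\<^sup>2 / (4 * t)) - exp (- c\<^sup>2 / (4 * t))) \<ge> m * (exp (- b\<^sup>2 / (4 * t)) / 2)"
      using m by (intro mult_left_mono) auto
    then show ?thesis using \<open>Z x t \<ge> m * (exp (- ?p\<^sup>2 / (4 * t)) - exp (- c\<^sup>2 / (4 * t)))\<close> by simp
  qed
  then show ?thesis unfolding Hlow_def using r(1) m t3(1) by (intro exI[of _ r] conjI exI[of _ "m / 2"] exI[of _ t3]) auto
qed

lemma ell_close:
  assumes "\<kappa> > 1" "norm (A x - A z) \<le> lam * (1 - 1 / \<kappa>)"
  shows "\<kappa>\<^sup>2 * ((A x *v Ai z w) \<bullet> Ai z w) \<ge> \<kappa> * (A_norm A z w)\<^sup>2"
proof -
  let ?X = "(A z *v Ai z w) \<bullet> Ai z w" and ?Y = "(A x *v Ai z w) \<bullet> Ai z w"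
  have eq: "(A_norm A z w)\<^sup>2 = ?X" unfolding A_norm_square by (rule Ai_form)
  have "?X - ?Y \<le> norm (A x - A z) * (norm (Ai z w))\<^sup>2" using form_diff[of x "Ai z w" z] by linarith
  also have "\<dots> \<le> lam * (1 - 1 / \<kappa>) * (norm (Ai z w))\<^sup>2" using assms by (intro mult_right_mono) auto
  also have "\<dots> = (1 - 1 / \<kappa>) * (lam * (norm (Ai z w))\<^sup>2)" by simp
  also have "\<dots> \<le> (1 - 1 / \<kappa>) * ?X" using lam(2)[of "Ai z w" z] assms(1) by (intro mult_left_mono) auto
  finally have "?X / \<kappa> \<le> ?Y" by (simp add: left_diff_distrib)
  then have "?X \<le> \<kappa> * ?Y" using assms(1) by (simp add: field_simps)
  then have "\<kappa> * ?X \<le> \<kappa> * (\<kappa> * ?Y)" using assms(1) by (intro mult_left_mono) auto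
  then show ?thesis unfolding eq by (simp add: power2_eq_square mult.assoc)
qed

text \<open>The Gaussian is centred at a point outside the closure, so the core condition of
  \<open>Hlow_from_step\<close> is void and the boundary values near \<open>p\<close> supply the
  bound \<open>m\<close>. The centre is taken so close to \<open>p\<close> that arbitrarily small
  levels can be reached.\<close>

lemma Hlow_start:
  assumes f: "continuous_on (frontier \<Omega>) f" and S: "S = {x \<in> frontier \<Omega>. f x > 0}" and p: "p \<in> S" and a: "a > 0"
  shows "Hlow f S a p"
proof -
  have pf: "p \<in> frontier \<Omega>" and fp: "f p > 0" using p S by auto
  define m where "m = f p / 2"
  have m: "m > 0" using fp by (simp add: m_def)
  obtain r where r: "r > 0" "\<And>x. x \<in> frontier \<Omega> \<Longrightarrow> dist x p < r \<Longrightarrow> f x \<ge> m"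
  proof -
    from f pf have "continuous (at p within frontier \<Omega>) f" by (auto simp: continuous_on_eq_continuous_within)
    then obtain r where "r > 0" "\<And>x. x \<in> frontier \<Omega> \<Longrightarrow> dist x p < r \<Longrightarrow> dist (f x) (f p) < m"
      unfolding continuous_within_eps_delta using m by blast
    then show thesis by (intro that[of r]) (auto simp: m_def dist_real_def abs_less_iff, smt (verit) field_sum_of_halves)
  qed
  have "bounded (cball p 1)" by simp
  then obtain \<Lambda> where \<Lambda>: "\<Lambda> > 0" "\<forall>x\<in>cball p 1. trace (A x) \<le> \<Lambda>" "\<forall>x\<in>cball p 1. norm (A x) \<le> \<Lambda>"
    by (rule trace_bound)
  have "lam / 2 > 0" using lam(1) by simp
  from A_near[OF compact_cball[of p 1] this] obtain \<rho> where rho: "\<rho> > 0"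
    "\<And>x z. x \<in> cball p 1 \<Longrightarrow> z \<in> cball p 1 \<Longrightarrow> norm (x - z) < \<rho> \<Longrightarrow> norm (A x - A z) < lam / 2" by blast
  define s where "s = min r (min \<rho> 1) / 2"
  have s: "s > 0" "2 * s \<le> r" "2 * s \<le> \<rho>" "2 * s \<le> 1" using r rho by (auto simp: s_def)
  define R where "R = s / (2 * \<Lambda> * Cn)"
  have R: "R > 0" "\<Lambda> * Cn * R < s" using s \<Lambda>(1) Cn_pos by (auto simp: R_def)
  define b where "b = min a R"
  have b: "b > 0" "b \<le> a" "b \<le> R" using a R by (auto simp: b_def)
  define e where "e = min s (b / (8 * Cn))"
  have e: "e > 0" "e \<le> s" "8 * Cn * e \<le> b"
  proof -
    show "e > 0" "e \<le> s" using s b Cn_pos by (auto simp: e_def)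
    have "e \<le> b / (8 * Cn)" by (simp add: e_def)
    then show "8 * Cn * e \<le> b" using Cn_pos by (simp add: field_simps)
  qed
  obtain z \<sigma>' where z: "norm (z - p) < e" "\<sigma>' > 0" "ball z \<sigma>' \<inter> closure \<Omega> = {}"
    using exterior_point[OF pf e(1)] by blast
  have zb: "z \<in> cball p 1" using z(1) e s by (simp add: dist_norm norm_minus_commute)
  have nz: "norm (x - z) \<le> \<Lambda> * Cn * A_norm A z (x - z)" for x
  proof -
    have "norm (x - z) \<le> norm (A z) * Cn * A_norm A z (x - z)" by (rule norm_le_A_norm)
    also have "\<dots> \<le> \<Lambda> * Cn * A_norm A z (x - z)" using \<Lambda>(3) zb Cn_pos by (intro mult_right_mono) auto
    finally show ?thesis .
  qed
  have near: "norm (x - z) < s" if "A_norm A z (x - z) \<le> R" for x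
  proof -
    have "\<Lambda> * Cn * A_norm A z (x - z) \<le> \<Lambda> * Cn * R" using that \<Lambda>(1) Cn_pos by (intro mult_left_mono) auto
    then show ?thesis using nz[of x] R(2) by linarith
  qed
  have nearp: "norm (x - p) < 2 * s" if "A_norm A z (x - z) \<le> R" for x
    using norm_triangle_ineq[of "x - z" "z - p"] near[OF that] z(1) e(2) by simp
  define \<sigma> where "\<sigma> = \<sigma>' / (2 * \<Lambda> * Cn)"
  have \<sigma>: "\<sigma> > 0" "\<Lambda> * Cn * \<sigma> < \<sigma>'" using z \<Lambda>(1) Cn_pos by (auto simp: \<sigma>_def)
  have "Hlow f S b p"
  proof (rule Hlow_from_step[OF m _ _ \<sigma>(1) R(1), where a = "b / 2" and \<kappa> = 2 and z = z and ?t0.0 = 1])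
    show "2\<^sup>2 * ((A x *v Ai z (x - z)) \<bullet> Ai z (x - z)) \<ge> 2 * (A_norm A z (x - z))\<^sup>2"
      if "x \<in> \<Omega>" "A_norm A z (x - z) \<le> R" for x
    proof (rule ell_close)
      have "x \<in> cball p 1" using nearp[OF that(2)] s by (simp add: dist_norm norm_minus_commute)
      then have "norm (A x - A z) < lam / 2" using near[OF that(2)] s rho(1) by (intro rho(2) zb) auto
      then show "norm (A x - A z) \<le> lam * (1 - 1 / 2)" by simp
    qed simp
    show "Z x t \<ge> m * exp (- (b / 2)\<^sup>2 / (4 * t))" if "x \<in> \<Omega>" "A_norm A z (x - z) \<le> \<sigma>" for Z x t
    proof -
      have "\<Lambda> * Cn * A_norm A z (x - z) \<le> \<Lambda> * Cn * \<sigma>" using that \<Lambda>(1) Cn_pos by (intro mult_left_mono) auto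
      then have "x \<in> ball z \<sigma>'" using nz[of x] \<sigma>(2) by (simp add: dist_norm norm_minus_commute)
      then show ?thesis using z(3) that(1) closure_subset[of \<Omega>] by blast
    qed
    show "m \<le> Z x t" if "good_super f S Z" "x \<in> frontier \<Omega>" "A_norm A z (x - z) < R" "0 < t" for Z x t
    proof -
      have "dist x p < r" using nearp[of x] that(3) s by (simp add: dist_norm)
      then have "f x \<ge> m" using r(2) that by blast
      moreover from this have "x \<in> S" using S that m by simp
      ultimately show ?thesis using that unfolding good_super_def by (meson order_trans)
    qed
    have "A_norm A z (p - z) \<le> Cn * norm (p - z)" by (rule A_norm_le)
    also have "\<dots> \<le> Cn * e" using z(1) Cn_pos by (intro mult_left_mono) (auto simp: norm_minus_commute)
    finally show "b / 2 + 2 * A_norm A z (p - z) < b" using e(3) b(1) by linarith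
    show "b < b / 2 + 2 * R" using b R by linarith
  qed (use b in auto)
  then show ?thesis by (rule Hlow_mono) (use b in auto)
qed

text \<open>The segment is cut into N pieces, each raising the level by (b - a)/N, which exceeds the
  inflated frozen length of a piece. The steps are so short that their frozen balls miss the
  frontier, so no boundary values enter.\<close>

lemma Hlow_segment:
  assumes seg: "closed_segment y z \<subseteq> \<Omega>" and H: "Hlow f S a z" and a: "a > 0" and b: "a + cost y z < b"
  shows "Hlow f S b y"
proof -
  define c where "c = cost y z"
  have c: "c \<ge> 0" by (simp add: c_def cost_nonneg)
  define k where "k = (b - a - c) / (2 * (c + 1))"
  define \<kappa> where "\<kappa> = 1 + k"
  have gap: "b - a - c > 0" using b by (simp add: c_def)
  have \<kappa>: "\<kappa> > 1" "\<kappa> * c < b - a"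
  proof -
    show "\<kappa> > 1" using gap c by (simp add: \<kappa>_def k_def)
    have "(b - a - c) / (2 * (c + 1)) * c \<le> (b - a - c) / (2 * (c + 1)) * (c + 1)" using gap c by (intro mult_left_mono) auto
    also have "\<dots> = (b - a - c) / 2" using c by (simp add: field_simps)
    also have "\<dots> < b - a - c" using gap by simp
    finally have "k * c < b - a - c" unfolding k_def .
    moreover have "\<kappa> * c = c + k * c" unfolding \<kappa>_def distrib_right by simp
    ultimately show "\<kappa> * c < b - a" using gap by linarith
  qed
  have "compact (closed_segment y z)" by simp
  from compact_subset_open_imp_ball_epsilon_subset[OF this open_dom seg]
  obtain \<epsilon> where eps: "\<epsilon> > 0" "(\<Union>x\<in>closed_segment y z. ball x \<epsilon>) \<subseteq> \<Omega>" by blast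
  have "lam * (1 - 1 / \<kappa>) > 0" using lam(1) \<kappa> by simp
  from A_near[OF compact_closure_dom this] obtain \<rho> where rho: "\<rho> > 0"
    "\<And>p q. p \<in> closure \<Omega> \<Longrightarrow> q \<in> closure \<Omega> \<Longrightarrow> norm (p - q) < \<rho> \<Longrightarrow> norm (A p - A q) < lam * (1 - 1 / \<kappa>)" by blast
  \<comment> \<open>Frozen balls of this radius about points of the segment stay within both
    \<epsilon> and \<rho>: they lie in the domain and \<open>A\<close> hardly varies on them. The
    number of pieces below makes the level increment smaller than \<open>R\<close>.\<close>
  define R where "R = min \<epsilon> \<rho> / (2 * trb * Cn)"
  have R: "R > 0" "trb * Cn * R < min \<epsilon> \<rho>" using eps rho trb(1) Cn_pos by (auto simp: R_def)
  have near: "norm (x - w) < min \<epsilon> \<rho>" if "w \<in> closed_segment y z" "A_norm A w (x - w) \<le> R" for x w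
  proof -
    have "norm (x - w) \<le> norm (A w) * Cn * A_norm A w (x - w)" by (rule norm_le_A_norm)
    also have "\<dots> \<le> trb * Cn * R" using trb(1) trb(3)[of w] seg that Cn_pos by (intro mult_mono) auto
    finally show ?thesis using R(2) by linarith
  qed
  have step: "Hlow f S b' y'"
    if w: "w \<in> closed_segment y z" and Hw: "Hlow f S a' w" and a': "a' > 0" and b': "a' + \<kappa> * A_norm A w (y' - w) < b'" "b' < a' + \<kappa> * R"
    for w a' b' y'
  proof -
    from Hw obtain r m t0 where H0: "r > 0" "m > 0" "t0 > 0"
      "\<forall>Z. good_super f S Z \<longrightarrow> (\<forall>x\<in>\<Omega> \<inter> ball w r. \<forall>t. 0 < t \<longrightarrow> t < t0 \<longrightarrow> m * exp (- a'\<^sup>2 / (4 * t)) \<le> Z x t)"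
      unfolding Hlow_def by blast
    note Hr = H0(1-3) H0(4)[rule_format]
    define \<sigma> where "\<sigma> = r / (2 * trb * Cn)"
    have \<sigma>: "\<sigma> > 0" "trb * Cn * \<sigma> < r" using Hr trb(1) Cn_pos by (auto simp: \<sigma>_def)
    have wO: "w \<in> \<Omega>" using seg w by blast
    show ?thesis
    proof (rule Hlow_from_step[OF Hr(2) a' \<kappa>(1) \<sigma>(1) R(1) Hr(3) _ _ _ b'])
      show "\<kappa>\<^sup>2 * ((A x *v Ai w (x - w)) \<bullet> Ai w (x - w)) \<ge> \<kappa> * (A_norm A w (x - w))\<^sup>2"
        if "x \<in> \<Omega>" "A_norm A w (x - w) \<le> R" for x
      proof (rule ell_close[OF \<kappa>(1)])
        have "norm (x - w) < \<rho>" using near[OF w that(2)] by simp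
        then have "norm (A x - A w) < lam * (1 - 1 / \<kappa>)"
          using that(1) wO closure_subset[of \<Omega>] by (intro rho(2)) auto
        then show "norm (A x - A w) \<le> lam * (1 - 1 / \<kappa>)" by simp
      qed
      show "m * exp (- a'\<^sup>2 / (4 * t)) \<le> Z x t"
        if "good_super f S Z" "x \<in> \<Omega>" "A_norm A w (x - w) \<le> \<sigma>" "0 < t" "t < t0" for Z x t
      proof -
        have "norm (x - w) \<le> norm (A w) * Cn * A_norm A w (x - w)" by (rule norm_le_A_norm)
        also have "\<dots> \<le> trb * Cn * \<sigma>" using trb(1) trb(3)[OF wO] that Cn_pos by (intro mult_mono) auto
        finally have "x \<in> ball w r" using \<sigma>(2) by (simp add: dist_norm norm_minus_commute)
        then show ?thesis using Hr(4)[OF that(1), of x t] that by blast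
      qed
      show "m \<le> Z x t" if "x \<in> frontier \<Omega>" "A_norm A w (x - w) < R" for Z x t
      proof -
        have "norm (x - w) < \<epsilon>" using near[OF w, of x] that(2) by simp
        then have "x \<in> \<Omega>" using eps(2) w by (force simp: dist_norm norm_minus_commute)
        then show ?thesis using that(1) frontier_dom by blast
      qed
    qed
  qed
  obtain N :: nat where N: "N > 0" "(b - a) / real N < R"
  proof -
    obtain N :: nat where "(b - a) / R < real N" using reals_Archimedean2 by blast
    moreover have "0 < (b - a) / R" using gap c R by simp
    ultimately have "0 < real N" by linarith
    then show thesis using \<open>(b - a) / R < real N\<close> R by (intro that[of N]) (auto simp: field_simps)
  qed
  define pt where "pt j = z + (real j / real N) *\<^sub>R (y - z)" for j
  define h where "h = (b - a) / real N"
  define lv where "lv j = a + real j * h" for j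
  have lv_Suc: "lv (Suc j) = lv j + h" for j by (simp add: lv_def distrib_right)
  have ptS: "pt j \<in> closed_segment y z" if "j \<le> N" for j
    using segment_param[of "real j / real N" z y] that N(1) by (simp add: pt_def closed_segment_commute)
  have "j \<le> N \<Longrightarrow> Hlow f S (lv j) (pt j)" for j
  proof (induction j)
    case 0
    then show ?case using H by (simp add: pt_def lv_def)
  next
    case (Suc j)
    have ba: "b - a > 0" using gap c by linarith
    show ?case
    proof (rule step[OF ptS[of j] Suc.IH])
      show "lv j > 0" unfolding lv_def h_def using a ba N by (intro add_pos_nonneg) auto
      have "pt (Suc j) - pt j = (1 / real N) *\<^sub>R (y - z)" by (simp add: pt_def add_divide_distrib scaleR_add_left)
      then have "A_norm A (pt j) (pt (Suc j) - pt j) = A_norm A (pt j) (y - z) / real N" by (simp add: A_norm_scale)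
      also have "\<dots> \<le> c / real N" unfolding c_def using cost_ge[OF ptS[of j]] Suc.prems by (intro divide_right_mono) auto
      finally have "\<kappa> * A_norm A (pt j) (pt (Suc j) - pt j) \<le> \<kappa> * (c / real N)" using \<kappa> by (intro mult_left_mono) auto
      also have "\<dots> < h" unfolding h_def using \<kappa>(2) N by (simp add: divide_strict_right_mono)
      finally show "lv j + \<kappa> * A_norm A (pt j) (pt (Suc j) - pt j) < lv (Suc j)" unfolding lv_Suc by linarith
      have "R \<le> \<kappa> * R" using \<kappa> R by simp
      then show "lv (Suc j) < lv j + \<kappa> * R" using N(2) unfolding lv_Suc h_def by linarith
    qed (use Suc.prems in auto)
  qed
  from this[of N] show ?thesis using N(1) by (simp add: pt_def lv_def h_def)
qed

text \<open>Induction along the polygon, which is built backwards from the target. The last segment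
  is not contained in the domain, so it is cut at a point \<open>q\<close> close to
  \<open>p\<close>, to which \<open>Hlow_near\<close> extends the starting estimate.\<close>

lemma Hlow_reach:
  assumes f: "continuous_on (frontier \<Omega>) f" and S: "S = {x \<in> frontier \<Omega>. f x > 0}"
    and "reach S y c" "c < b"
  shows "Hlow f S b y"
  using assms(3,4)
proof (induction arbitrary: b)
  case (last y p)
  define a where "a = (b - cost y p) / 2"
  have a: "a > 0" "a + cost y p < b" using last.prems by (auto simp: a_def field_simps)
  obtain r where r: "r > 0" "\<And>q. q \<in> ball p r \<Longrightarrow> Hlow f S a q"
    using Hlow_near[OF Hlow_start[OF f S last.hyps(2) a(1)]] by blast
  define \<theta> where "\<theta> = min 1 (r / (2 * (norm (y - p) + 1)))"
  have np: "norm (y - p) + 1 > 0" by (simp add: add_nonneg_pos)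
  have \<theta>: "0 < \<theta>" "\<theta> \<le> 1" "\<theta> * norm (y - p) < r"
  proof -
    show "0 < \<theta>" "\<theta> \<le> 1" using r np by (auto simp: \<theta>_def)
    have "\<theta> * norm (y - p) \<le> r / (2 * (norm (y - p) + 1)) * (norm (y - p) + 1)"
      using r np by (intro mult_mono) (auto simp: \<theta>_def)
    also have "\<dots> = r / 2"
    proof -
      have "r / (2 * X) * X = r / 2" if "X > 0" for X using that by simp
      from this[OF np] show ?thesis .
    qed
    finally show "\<theta> * norm (y - p) < r" using r by linarith
  qed
  define q where "q = p + \<theta> *\<^sub>R (y - p)"
  have qb: "q \<in> ball p r" using \<theta> by (simp add: q_def dist_norm)
  have yp: "y \<noteq> p" using last.hyps S frontier_dom by blast
  have sub: "closed_segment y q \<subseteq> closed_segment y p - {p}"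
  proof
    fix w assume "w \<in> closed_segment y q"
    then obtain u where u: "0 \<le> u" "u \<le> 1" "w = (1 - u) *\<^sub>R y + u *\<^sub>R q" by (metis in_segment(1))
    have w1: "w = (1 - u * (1 - \<theta>)) *\<^sub>R y + (u * (1 - \<theta>)) *\<^sub>R p"
      unfolding u(3) q_def by (simp add: algebra_simps)
    have v: "0 \<le> u * (1 - \<theta>)" "u * (1 - \<theta>) < 1"
      using u \<theta> mult_left_le_one_le[of "1 - \<theta>" u] by auto
    have "w - p = (1 - u * (1 - \<theta>)) *\<^sub>R (y - p)" unfolding w1 by (simp add: algebra_simps)
    then have "w \<noteq> p" using v yp by auto
    moreover have "w \<in> closed_segment y p" unfolding in_segment using w1 v by (intro exI[of _ "u * (1 - \<theta>)"]) auto
    ultimately show "w \<in> closed_segment y p - {p}" by blast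
  qed
  have "cost y q \<le> cost y p"
  proof (rule cost_leI)
    fix w assume "w \<in> closed_segment y q"
    then have w: "w \<in> closed_segment y p" using sub by blast
    have "y - q = (1 - \<theta>) *\<^sub>R (y - p)" by (simp add: q_def algebra_simps)
    then have "A_norm A w (y - q) = (1 - \<theta>) * A_norm A w (y - p)" using \<theta> by (simp add: A_norm_scale)
    also have "\<dots> \<le> 1 * A_norm A w (y - p)" using \<theta> by (intro mult_right_mono) auto
    finally show "A_norm A w (y - q) \<le> cost y p" using cost_ge[OF w] by simp
  qed
  then have "a + cost y q < b" using a by linarith
  then show ?case using Hlow_segment[OF _ r(2)[OF qb] a(1)] sub last.hyps(3) by blast
next
  case (step y z c)
  define a where "a = c + (b - (cost y z + c)) / 2"
  have "c \<ge> 0" using step.hyps(2) by (rule reach_nonneg)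
  then have a: "a > 0" "c < a" "a + cost y z < b" using step.prems by (auto simp: a_def field_simps)
  show ?case by (rule Hlow_segment[OF step.hyps(1) step.IH[OF a(2)] a(1,3)])
qed

lemma Hlow_dst:
  assumes "continuous_on (frontier \<Omega>) f" "S = {x \<in> frontier \<Omega>. f x > 0}" "S \<noteq> {}" "y \<in> \<Omega>" "dst S y < b"
  shows "Hlow f S b y"
proof -
  have "S \<subseteq> frontier \<Omega>" using assms(2) by blast
  from dst_lessE[OF assms(3) this assms(4,5)] obtain c where "c < b" "reach S y c" by blast
  then show ?thesis using Hlow_reach[OF assms(1,2)] by blast
qed

section \<open>Supersolutions obtained by adding a barrier\<close>

lemma eikonal_envelope:
  assumes "eikonal_minorant T \<delta> E \<eta> K"
  obtains \<psi> where "\<And>x. x \<in> closure \<Omega> \<Longrightarrow> (x, \<psi> x) \<in> E" "\<And>x v. (x, v) \<in> E \<Longrightarrow> v \<le> \<psi> x"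
proof -
  have E: "compact E" "\<And>x v. (x, v) \<in> E \<Longrightarrow> x \<in> closure \<Omega>" "\<And>x. x \<in> closure \<Omega> \<Longrightarrow> \<exists>v. (x, v) \<in> E"
    using assms unfolding eikonal_minorant_def by auto
  have "\<exists>s. (x, s) \<in> E \<and> (\<forall>v. (x, v) \<in> E \<longrightarrow> v \<le> s)" if x: "x \<in> closure \<Omega>" for x
  proof -
    let ?F = "E \<inter> ({x} \<times> UNIV)"
    have "compact ?F" by (intro compact_Int_closed E(1) closed_Times) auto
    then have "compact (snd ` ?F)" by (intro compact_continuous_image continuous_intros)
    moreover have "snd ` ?F \<noteq> {}" using E(3)[OF x] by force
    ultimately obtain s where "s \<in> snd ` ?F" "\<forall>t\<in>snd ` ?F. t \<le> s" using compact_attains_sup by blast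
    then show ?thesis by (intro exI[of _ s]) force
  qed
  then obtain \<psi> where "\<And>x. x \<in> closure \<Omega> \<Longrightarrow> (x, \<psi> x) \<in> E \<and> (\<forall>v. (x, v) \<in> E \<longrightarrow> v \<le> \<psi> x)" by metis
  then show thesis using that E(2) by blast
qed

text \<open>Adding two viscosity supersolutions is delicate in general; here the barrier has, at any
  given point, a smooth majorant touching it, and this is added to the test function. Minima over
  \<open>C\<close> are attained because they can be sought on the lift of \<open>C\<close> to the
  graph \<open>E\<close>, where everything is continuous.\<close>

lemma good_super_sum:
  assumes g: "psub (\<lambda>x t. - g x t)" and E: "eikonal_minorant T \<delta> E \<eta> K" and \<epsilon>: "\<epsilon> > 0" "\<epsilon> * (2 * K * trb) < \<eta>" and M: "M > 0"
    and cont: "continuous_on (closure \<Omega> \<times> {0<..}) (\<lambda>(x, t). g x t)"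
    and le: "\<And>x v t. (x, v) \<in> E \<Longrightarrow> t > 0 \<Longrightarrow> - g x t \<le> M * exp (t / \<epsilon>\<^sup>2 - v / \<epsilon>)"
    and S: "\<And>x t. x \<in> S \<Longrightarrow> t > 0 \<Longrightarrow> f x \<le> g x t"
  shows "\<exists>Z. good_super f S Z \<and> (\<forall>x v t. (x, v) \<in> E \<longrightarrow> t > 0 \<longrightarrow> Z x t \<le> g x t + M * exp (t / \<epsilon>\<^sup>2 - v / \<epsilon>))"
proof -
  have Ec: "compact E" and Ecl: "\<And>x v. (x, v) \<in> E \<Longrightarrow> x \<in> closure \<Omega>" and K: "K > 0"
    using E unfolding eikonal_minorant_def by auto
  obtain \<psi> where \<psi>: "\<And>x. x \<in> closure \<Omega> \<Longrightarrow> (x, \<psi> x) \<in> E" "\<And>x v. (x, v) \<in> E \<Longrightarrow> v \<le> \<psi> x"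
    using eikonal_envelope[OF E] by blast
  define Z where "Z x t = g x t + M * exp (t / \<epsilon>\<^sup>2 - \<psi> x / \<epsilon>)" for x t
  have mono: "M * exp (t / \<epsilon>\<^sup>2 - v / \<epsilon>) \<le> M * exp (t / \<epsilon>\<^sup>2 - v' / \<epsilon>)" if "v' \<le> v" for t v v'
    using M that \<epsilon>(1) by (simp add: divide_right_mono)
  have "psub (\<lambda>x t. - Z x t)"
    unfolding psub_def
  proof (intro ballI allI impI)
    fix x t w wt b W
    assume x: "x \<in> \<Omega>" and t: "(0::real) < t" and wt: "(w x has_real_derivative wt) (at t)"
      and j: "jet2 (\<lambda>y. w y t) x b W" and mx: "\<forall>\<^sub>F y in nhds x. - Z y t - w y t \<le> - Z x t - w x t"
      and mt: "\<forall>\<^sub>F s in nhds t. s \<le> t \<longrightarrow> - Z x s - w x s \<le> - Z x t - w x t"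
    have xc: "x \<in> closure \<Omega>" using x closure_subset by blast
    have "\<forall>v'. (x, v') \<in> E \<longrightarrow> v' \<le> \<psi> x" using \<psi>(2) by blast
    then obtain b1 where b1: "(A x *v b1) \<bullet> b1 \<le> 1 - \<eta>"
      "\<forall>\<^sub>F x' in nhds x. \<exists>v'. (x', v') \<in> E \<and> v' \<ge> \<psi> x + b1 \<bullet> (x' - x) - K * (norm (x' - x))\<^sup>2"
      using E \<psi>(1)[OF xc] x unfolding eikonal_minorant_def by blast
    define v where "v y t = M * exp (t / \<epsilon>\<^sup>2 - (\<psi> x + b1 \<bullet> (y - x) - K * (norm (y - x))\<^sup>2) / \<epsilon>)" for y t
    note J = exp_barrier_jet[OF \<epsilon>(1), where M = M and v = "\<psi> x" and b = b1 and x = x and K = K, folded v_def]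
    have vx: "v x s = M * exp (s / \<epsilon>\<^sup>2 - \<psi> x / \<epsilon>)" for s by (simp add: v_def)
    obtain b' where J2: "jet2 (\<lambda>y. v y t) x b' (\<lambda>\<xi>. v x t / \<epsilon>\<^sup>2 * ((b1 \<bullet> \<xi>)\<^sup>2 + 2 * K * \<epsilon> * (norm \<xi>)\<^sup>2))"
      using J(2) by blast
    have "wt + v x t / \<epsilon>\<^sup>2 \<le> (\<Sum>k\<in>UNIV. W (dir x k) + v x t / \<epsilon>\<^sup>2 * ((b1 \<bullet> dir x k)\<^sup>2 + 2 * K * \<epsilon> * (norm (dir x k))\<^sup>2))"
    proof (rule psubD[OF g x t, where w = "\<lambda>y s. w y s + v y s"])
      show "((\<lambda>s. w x s + v x s) has_real_derivative wt + v x t / \<epsilon>\<^sup>2) (at t)" by (rule DERIV_add[OF wt J(1)])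
      show "jet2 (\<lambda>y. w y t + v y t) x (\<lambda>\<xi>. b \<xi> + b' \<xi>) (\<lambda>\<xi>. W \<xi> + v x t / \<epsilon>\<^sup>2 * ((b1 \<bullet> \<xi>)\<^sup>2 + 2 * K * \<epsilon> * (norm \<xi>)\<^sup>2))"
        by (rule jet2_add[OF j J2])
      show "\<forall>\<^sub>F y in nhds x. - g y t - (w y t + v y t) \<le> - g x t - (w x t + v x t)"
        using mx b1(2)
      proof eventually_elim
        case (elim y)
        then obtain v' where v': "(y, v') \<in> E" "v' \<ge> \<psi> x + b1 \<bullet> (y - x) - K * (norm (y - x))\<^sup>2" by blast
        have "\<psi> y \<ge> \<psi> x + b1 \<bullet> (y - x) - K * (norm (y - x))\<^sup>2" using v' \<psi>(2)[OF v'(1)] by linarith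
        from mono[OF this] have "M * exp (t / \<epsilon>\<^sup>2 - \<psi> y / \<epsilon>) \<le> v y t" unfolding v_def .
        then show ?case using elim(1) unfolding Z_def vx by linarith
      qed
      show "\<forall>\<^sub>F s in nhds t. s \<le> t \<longrightarrow> - g x s - (w x s + v x s) \<le> - g x t - (w x t + v x t)"
        using mt by eventually_elim (auto simp: Z_def vx)
    qed
    moreover have "(\<Sum>k\<in>UNIV. v x t / \<epsilon>\<^sup>2 * ((b1 \<bullet> dir x k)\<^sup>2 + 2 * K * \<epsilon> * (norm (dir x k))\<^sup>2)) < v x t / \<epsilon>\<^sup>2"
      by (rule exp_barrier_strict[OF x b1(1) \<epsilon> _ K]) (use M \<epsilon> in \<open>simp add: v_def\<close>)
    ultimately show "wt \<le> (\<Sum>k\<in>UNIV. W (dir x k))" by (simp add: sum.distrib)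
  qed
  moreover have "0 \<le> Z x t" if "x \<in> closure \<Omega>" "t > 0" for x t
    using le[OF \<psi>(1)[OF that(1)] that(2)] by (simp add: Z_def)
  moreover have "f x \<le> Z x t" if "x \<in> S" "t > 0" for x t
  proof -
    have "0 \<le> M * exp (t / \<epsilon>\<^sup>2 - \<psi> x / \<epsilon>)" using M by simp
    then show ?thesis using S[OF that] unfolding Z_def by linarith
  qed
  moreover have "\<exists>z\<in>C. \<forall>z'\<in>C. Z (fst z) (snd z) - w z \<le> Z (fst z') (snd z') - w z'"
    if C: "compact C" "C \<noteq> {}" "C \<subseteq> closure \<Omega> \<times> {0<..}" "continuous_on C w" for C w
  proof -
    define Q where "Q = (\<lambda>(z, t). (fst z, t)) -` C \<inter> (E \<times> snd ` C)"
    have ct: "continuous_on UNIV (\<lambda>(z :: (real ^ 'n) \<times> real, t :: real). (fst z, t))"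
      unfolding split_beta by (intro continuous_intros)
    have "compact (snd ` C)" by (intro compact_continuous_image continuous_intros C(1))
    then have "compact (E \<times> snd ` C)" by (intro compact_Times Ec)
    moreover have "closed ((\<lambda>(z :: (real ^ 'n) \<times> real, t :: real). (fst z, t)) -` C)"
      by (rule closed_vimage[OF compact_imp_closed[OF C(1)] ct])
    ultimately have Qc: "compact Q" unfolding Q_def using compact_Int_closed by (metis inf_commute)
    have inQ: "((x, v), t) \<in> Q \<longleftrightarrow> (x, t) \<in> C \<and> (x, v) \<in> E" for x v t
      unfolding Q_def by (force simp: image_iff)
    obtain x0 t0 where "(x0, t0) \<in> C" using C(2) by auto
    then have "((x0, \<psi> x0), t0) \<in> Q" unfolding inQ using C(3) \<psi>(1) by auto
    then have Qne: "Q \<noteq> {}" by blast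
    define F where "F = (\<lambda>q. g (fst (fst q)) (snd q) + M * exp (snd q / \<epsilon>\<^sup>2 - snd (fst q) / \<epsilon>) - w (fst (fst q), snd q))"
    have QC: "(fst (fst q), snd q) \<in> C" if "q \<in> Q" for q using inQ that by (metis prod.collapse)
    have "continuous_on Q (\<lambda>q. (\<lambda>(x, t). g x t) (fst (fst q), snd q))"
      by (rule continuous_on_compose2[OF cont]) (use QC C(3) in \<open>auto intro!: continuous_intros\<close>)
    moreover have "continuous_on Q (\<lambda>q. w (fst (fst q), snd q))"
      by (rule continuous_on_compose2[OF C(4)]) (use QC in \<open>auto intro!: continuous_intros\<close>)
    ultimately have "continuous_on Q F" unfolding F_def split_beta fst_conv snd_conv
      by (intro continuous_intros) (use \<epsilon> in auto)
    then obtain q where q: "q \<in> Q" "\<And>q'. q' \<in> Q \<Longrightarrow> F q \<le> F q'"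
      using continuous_attains_inf[OF Qc Qne] by blast
    obtain x v t where qe: "q = ((x, v), t)" by (metis prod.collapse)
    have xt: "(x, t) \<in> C" "(x, v) \<in> E" using q(1) inQ qe by auto
    have xc: "x \<in> closure \<Omega>" using xt(2) by (rule Ecl)
    have le1: "Z x t - w (x, t) \<le> F q"
      using mono[OF \<psi>(2)[OF xt(2)], of t] unfolding Z_def F_def qe by simp
    have "Z (fst (x, t)) (snd (x, t)) - w (x, t) \<le> Z (fst z') (snd z') - w z'" if "z' \<in> C" for z'
    proof -
      have "fst z' \<in> closure \<Omega>" using that C(3) by auto
      then have "((fst z', \<psi> (fst z')), snd z') \<in> Q" unfolding inQ using that \<psi>(1) by auto
      from q(2)[OF this] show ?thesis using le1 unfolding F_def Z_def by simp
    qed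
    then show ?thesis using xt(1) by blast
  qed
  ultimately have "good_super f S Z" unfolding good_super_def by blast
  moreover have "Z x t \<le> g x t + M * exp (t / \<epsilon>\<^sup>2 - v / \<epsilon>)" if "(x, v) \<in> E" "t > 0" for x v t
    using mono[OF \<psi>(2)[OF that(1)], of t] by (simp add: Z_def)
  ultimately show ?thesis by blast
qed

subsection \<open>Bounds for the two problems\<close>

definition pdata :: "(real ^ 'n \<Rightarrow> real) \<Rightarrow> (real ^ 'n \<Rightarrow> real \<Rightarrow> real) \<Rightarrow> real \<Rightarrow> bool" where
  "pdata f u M \<longleftrightarrow> psub u \<and> psub (\<lambda>x t. - u x t) \<and> M > 0 \<and>
     continuous_on (closure \<Omega> \<times> {0..} - frontier \<Omega> \<times> {0}) (\<lambda>(x, t). u x t) \<and>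
     (\<forall>x\<in>\<Omega>. u x 0 = 0) \<and> (\<forall>x\<in>frontier \<Omega>. \<forall>t>0. u x t = f x) \<and> (\<forall>x\<in>closure \<Omega>. \<forall>t>0. \<bar>u x t\<bar> \<le> M)"

definition edata :: "(real ^ 'n \<Rightarrow> real) \<Rightarrow> real \<Rightarrow> (real ^ 'n \<Rightarrow> real) \<Rightarrow> real \<Rightarrow> bool" where
  "edata f \<epsilon> U M \<longleftrightarrow> psub (\<lambda>x t. exp (t / \<epsilon>\<^sup>2) * U x) \<and> psub (\<lambda>x t. - (exp (t / \<epsilon>\<^sup>2) * U x)) \<and> M > 0 \<and>
     continuous_on (closure \<Omega>) U \<and> (\<forall>x\<in>frontier \<Omega>. U x = f x) \<and> (\<forall>x\<in>frontier \<Omega>. \<bar>f x\<bar> \<le> M)"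

text \<open>A change of sign exchanges the two targets, so only the case where the positive data are
  nearer has to be treated.\<close>

lemma pdata_uminus: "pdata f u M \<Longrightarrow> pdata (\<lambda>x. - f x) (\<lambda>x t. - u x t) M"
  unfolding pdata_def by (auto simp: split_beta intro!: continuous_on_minus)

lemma edata_uminus: "edata f \<epsilon> U M \<Longrightarrow> edata (\<lambda>x. - f x) \<epsilon> (\<lambda>x. - U x) M"
  unfolding edata_def by (auto intro!: continuous_on_minus)

text \<open>The initial condition of \<open>upper_barrier_parabolic\<close> holds by continuity at
  interior points and by \<open>corner_decay\<close> at boundary points away from the
  target.\<close>

lemma pdata_upper:
  assumes P: "pdata f u M" and T: "T = {x \<in> frontier \<Omega>. f x > 0}" and E: "eikonal_minorant T \<delta> E \<eta> K"
    and \<epsilon>: "\<epsilon> > 0" "\<epsilon> * (2 * K * trb) < \<eta>" and xv: "(x, v) \<in> E" and t: "t > 0"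
  shows "u x t \<le> M * exp (t / \<epsilon>\<^sup>2 - v / \<epsilon>)"
proof -
  have su: "psub u" and M: "M > 0" and cont: "continuous_on (closure \<Omega> \<times> {0..} - frontier \<Omega> \<times> {0}) (\<lambda>(x, t). u x t)"
    and u0: "\<And>x. x \<in> \<Omega> \<Longrightarrow> u x 0 = 0" and uf: "\<And>x t. x \<in> frontier \<Omega> \<Longrightarrow> t > 0 \<Longrightarrow> u x t = f x"
    and uM: "\<And>x t. x \<in> closure \<Omega> \<Longrightarrow> t > 0 \<Longrightarrow> \<bar>u x t\<bar> \<le> M"
    using P unfolding pdata_def by auto
  show ?thesis
  proof (rule upper_barrier_parabolic[OF su E \<epsilon> M _ _ _ _ xv t])
    show "continuous_on (closure \<Omega> \<times> {0<..}) (\<lambda>(x, t). u x t)"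
      by (rule continuous_on_subset[OF cont]) auto
    show "u x t \<le> M" if "x \<in> closure \<Omega>" "t > 0" for x t using uM[OF that] by linarith
    show "u x t \<le> 0" if "x \<in> frontier \<Omega>" "x \<notin> T" "t > 0" for x t using uf[of x t] that T by auto
    fix p e assume p: "p \<in> closure \<Omega>" "p \<notin> closure T" and e: "(0::real) < e"
    show "\<exists>\<rho>>0. \<exists>\<tau>>0. \<forall>x\<in>closure \<Omega> \<inter> ball p \<rho>. \<forall>t. 0 < t \<longrightarrow> t < \<tau> \<longrightarrow> u x t \<le> e"
    proof (cases "p \<in> \<Omega>")
      case True
      have pD: "(p, 0::real) \<in> closure \<Omega> \<times> {0..} - frontier \<Omega> \<times> {0}"
        using True p frontier_dom by auto
      have "continuous (at (p, 0) within closure \<Omega> \<times> {0..} - frontier \<Omega> \<times> {0}) (\<lambda>(x, t). u x t)"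
        by (rule cont[unfolded continuous_on_eq_continuous_within, rule_format, OF pD])
      then obtain \<delta> where \<delta>: "\<delta> > 0" "\<And>y. y \<in> closure \<Omega> \<times> {0..} - frontier \<Omega> \<times> {0} \<Longrightarrow> dist y (p, 0) < \<delta> \<Longrightarrow>
          dist (case y of (x, t) \<Rightarrow> u x t) (u p 0) < e"
        unfolding continuous_within_eps_delta using e by fastforce
      have "u y t \<le> e" if y: "y \<in> closure \<Omega> \<inter> ball p (\<delta> / 2)" and t: "0 < t" "t < \<delta> / 2" for y t
      proof -
        have "dist (y, t) (p, 0) \<le> dist y p + dist t 0"
          unfolding dist_Pair_Pair by (rule sqrt_sum_squares_le_sum) auto
        also have "\<dots> < \<delta>" using y t by (auto simp: dist_commute)
        finally have "dist (u y t) (u p 0) < e" using \<delta>(2)[of "(y, t)"] y t by auto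
        then show ?thesis using u0[OF True] by (simp add: dist_real_def)
      qed
      then show ?thesis using \<delta>(1) by (intro exI[of _ "\<delta> / 2"] conjI) auto
    next
      case False
      then have pf: "p \<in> frontier \<Omega>" using p frontier_dom by blast
      have "p \<in> - closure T" "open (- closure T)" using p by auto
      then obtain \<rho> where \<rho>: "\<rho> > 0" "ball p \<rho> \<subseteq> - closure T" using openE by blast
      show ?thesis
      proof (rule corner_decay[OF su cont M _ u0 pf \<rho>(1) _ e])
        show "u x t \<le> M" if "x \<in> closure \<Omega>" "t > 0" for x t using uM[OF that] by linarith
        show "u x t \<le> 0" if "x \<in> frontier \<Omega>" "x \<in> ball p \<rho>" "t > 0" for x t
        proof -
          have "x \<notin> T" using that(2) \<rho>(2) closure_subset[of T] by blast
          then show ?thesis using uf[OF that(1,3)] T that(1) by auto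
        qed
      qed
    qed
  qed
qed

lemma edata_upper:
  assumes P: "edata f \<epsilon> U M" and T: "T = {x \<in> frontier \<Omega>. f x > 0}" and E: "eikonal_minorant T \<delta> E \<eta> K"
    and \<epsilon>: "\<epsilon> > 0" "\<epsilon> * (2 * K * trb) < \<eta>" and xv: "(x, v) \<in> E"
  shows "U x \<le> M * exp (- v / \<epsilon>)"
proof -
  have su: "psub (\<lambda>x t. exp (t / \<epsilon>\<^sup>2) * U x)" and M: "M > 0" and cont: "continuous_on (closure \<Omega>) U"
    and uf: "\<And>x. x \<in> frontier \<Omega> \<Longrightarrow> U x = f x" and uM: "\<And>x. x \<in> frontier \<Omega> \<Longrightarrow> \<bar>f x\<bar> \<le> M"
    using P unfolding edata_def by auto
  show ?thesis
  proof (rule upper_barrier_elliptic[OF su E \<epsilon> M cont _ _ xv])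
    show "U x \<le> M" if "x \<in> frontier \<Omega>" for x using uM[OF that] uf[OF that] by linarith
    show "U x \<le> 0" if "x \<in> frontier \<Omega>" "x \<notin> T" for x using uf[of x] that T by auto
  qed
qed

text \<open>For every \<epsilon> below one threshold, the barrier for \<open>Sp\<close> bounds the
  solution from above, while the barrier for \<open>Sm\<close>, which bounds its negative part,
  turns the solution into a member of \<open>good_super\<close>. The threshold for the elliptic
  problems does not depend on \<open>U\<close>, so it can be used with \<open>U\<close> varying with
  \<epsilon>.\<close>

lemma pdata_bounds:
  assumes P: "pdata f u M" and Sp: "Sp = {x \<in> frontier \<Omega>. f x > 0}" "Sp \<noteq> {}" and Sm: "Sm = {x \<in> frontier \<Omega>. f x < 0}" "Sm \<noteq> {}"
    and \<delta>: "\<delta> > 0"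
  shows "\<exists>\<epsilon>0>0. \<forall>\<epsilon>. 0 < \<epsilon> \<longrightarrow> \<epsilon> < \<epsilon>0 \<longrightarrow>
     (\<forall>x\<in>\<Omega>. \<forall>t>0. u x t \<le> M * exp (t / \<epsilon>\<^sup>2 - (dst Sp x - \<delta>) / \<epsilon>)) \<and>
     (\<exists>Z. good_super f Sp Z \<and> (\<forall>x\<in>\<Omega>. \<forall>t>0. Z x t \<le> u x t + M * exp (t / \<epsilon>\<^sup>2 - (dst Sm x - \<delta>) / \<epsilon>)))"
    (is "\<exists>\<epsilon>0>0. \<forall>\<epsilon>. _ \<longrightarrow> _ \<longrightarrow> ?Q \<epsilon>")
    and "\<exists>\<epsilon>0>0. \<forall>\<epsilon> U. 0 < \<epsilon> \<longrightarrow> \<epsilon> < \<epsilon>0 \<longrightarrow> edata f \<epsilon> U M \<longrightarrow>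
     (\<forall>x\<in>\<Omega>. U x \<le> M * exp (- (dst Sp x - \<delta>) / \<epsilon>)) \<and>
     (\<exists>Z. good_super f Sp Z \<and> (\<forall>x\<in>\<Omega>. \<forall>t>0. Z x t \<le> exp (t / \<epsilon>\<^sup>2) * (U x + M * exp (- (dst Sm x - \<delta>) / \<epsilon>))))"
    (is "\<exists>\<epsilon>0>0. \<forall>\<epsilon> U. _ \<longrightarrow> _ \<longrightarrow> _ \<longrightarrow> ?R \<epsilon> U")
proof -
  have sub: "Sp \<subseteq> frontier \<Omega>" "Sm \<subseteq> frontier \<Omega>" using Sp Sm by auto
  have M: "M > 0" using P unfolding pdata_def by blast
  obtain E1 \<eta>1 K1 where E1: "eikonal_minorant Sp \<delta> E1 \<eta>1 K1" using eikonal_minorant_ex[OF Sp(2) sub(1) \<delta>] by blast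
  obtain E2 \<eta>2 K2 where E2: "eikonal_minorant Sm \<delta> E2 \<eta>2 K2" using eikonal_minorant_ex[OF Sm(2) sub(2) \<delta>] by blast
  have pos: "\<eta>1 > 0" "K1 > 0" "\<eta>2 > 0" "K2 > 0" using E1 E2 unfolding eikonal_minorant_def by auto
  define \<epsilon>0 where "\<epsilon>0 = min (\<eta>1 / (2 * K1 * trb)) (\<eta>2 / (2 * K2 * trb))"
  have \<epsilon>0: "\<epsilon>0 > 0" unfolding \<epsilon>0_def using pos trb(1) by simp
  have sm: "\<epsilon> * (2 * K1 * trb) < \<eta>1" "\<epsilon> * (2 * K2 * trb) < \<eta>2" if "\<epsilon> < \<epsilon>0" for \<epsilon>
    using that pos trb(1) unfolding \<epsilon>0_def by (auto simp: pos_less_divide_eq)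
  have Sm': "Sm = {x \<in> frontier \<Omega>. - f x > 0}" using Sm by auto
  have vle: "M * exp (s - v / \<epsilon>) \<le> M * exp (s - v' / \<epsilon>)" if "v' \<le> v" "\<epsilon> > 0" for s v v' \<epsilon>
    using M that by (simp add: divide_right_mono)
  have get1: "\<exists>v. (x, v) \<in> E1 \<and> v \<ge> dst Sp x - \<delta>" "\<exists>v. (x, v) \<in> E2 \<and> v \<ge> dst Sm x - \<delta>" if "x \<in> \<Omega>" for x
    using E1 E2 that unfolding eikonal_minorant_def by auto
  have "?Q \<epsilon>" if \<epsilon>: "0 < \<epsilon>" "\<epsilon> < \<epsilon>0" for \<epsilon>
  proof (intro conjI ballI allI impI)
    fix x t assume x: "x \<in> \<Omega>" and t: "(0::real) < t"
    obtain v where v: "(x, v) \<in> E1" "v \<ge> dst Sp x - \<delta>" using get1(1)[OF x] by blast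
    show "u x t \<le> M * exp (t / \<epsilon>\<^sup>2 - (dst Sp x - \<delta>) / \<epsilon>)"
      using pdata_upper[OF P Sp(1) E1 \<epsilon>(1) sm(1)[OF \<epsilon>(2)] v(1) t] vle[OF v(2) \<epsilon>(1), of "t / \<epsilon>\<^sup>2"] by linarith
  next
    have "\<exists>Z. good_super f Sp Z \<and> (\<forall>x v t. (x, v) \<in> E2 \<longrightarrow> t > 0 \<longrightarrow> Z x t \<le> u x t + M * exp (t / \<epsilon>\<^sup>2 - v / \<epsilon>))"
    proof (rule good_super_sum[OF _ E2 \<epsilon>(1) sm(2)[OF \<epsilon>(2)] M])
      show "psub (\<lambda>x t. - u x t)" using P unfolding pdata_def by blast
      have "continuous_on (closure \<Omega> \<times> {0..} - frontier \<Omega> \<times> {0}) (\<lambda>(x, t). u x t)" using P unfolding pdata_def by blast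
      then show "continuous_on (closure \<Omega> \<times> {0<..}) (\<lambda>(x, t). u x t)" by (rule continuous_on_subset) auto
      show "- u x t \<le> M * exp (t / \<epsilon>\<^sup>2 - v / \<epsilon>)" if "(x, v) \<in> E2" "t > 0" for x v t
        by (rule pdata_upper[OF pdata_uminus[OF P] Sm' E2 \<epsilon>(1) sm(2)[OF \<epsilon>(2)] that])
      show "f x \<le> u x t" if "x \<in> Sp" "t > 0" for x t using P that Sp unfolding pdata_def by auto
    qed
    then obtain Z where Z: "good_super f Sp Z" "\<And>x v t. (x, v) \<in> E2 \<Longrightarrow> t > 0 \<Longrightarrow> Z x t \<le> u x t + M * exp (t / \<epsilon>\<^sup>2 - v / \<epsilon>)" by blast
    have "Z x t \<le> u x t + M * exp (t / \<epsilon>\<^sup>2 - (dst Sm x - \<delta>) / \<epsilon>)" if x: "x \<in> \<Omega>" and t: "t > 0" for x t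
    proof -
      obtain v where v: "(x, v) \<in> E2" "v \<ge> dst Sm x - \<delta>" using get1(2)[OF x] by blast
      show ?thesis using Z(2)[OF v(1) t] vle[OF v(2) \<epsilon>(1), of "t / \<epsilon>\<^sup>2"] by linarith
    qed
    then show "\<exists>Z. good_super f Sp Z \<and> (\<forall>x\<in>\<Omega>. \<forall>t>0. Z x t \<le> u x t + M * exp (t / \<epsilon>\<^sup>2 - (dst Sm x - \<delta>) / \<epsilon>))"
      using Z(1) by blast
  qed
  then show "\<exists>\<epsilon>0>0. \<forall>\<epsilon>. 0 < \<epsilon> \<longrightarrow> \<epsilon> < \<epsilon>0 \<longrightarrow> ?Q \<epsilon>" using \<epsilon>0 by blast
  have "?R \<epsilon> U" if \<epsilon>: "0 < \<epsilon>" "\<epsilon> < \<epsilon>0" and Pe: "edata f \<epsilon> U M" for \<epsilon> U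
  proof (intro conjI ballI)
    fix x assume x: "x \<in> \<Omega>"
    obtain v where v: "(x, v) \<in> E1" "v \<ge> dst Sp x - \<delta>" using get1(1)[OF x] by blast
    have "U x \<le> M * exp (- v / \<epsilon>)" by (rule edata_upper[OF Pe Sp(1) E1 \<epsilon>(1) sm(1)[OF \<epsilon>(2)] v(1)])
    also have "\<dots> \<le> M * exp (- (dst Sp x - \<delta>) / \<epsilon>)" using vle[OF v(2) \<epsilon>(1), of 0] by (simp only: diff_0 minus_divide_left)
    finally show "U x \<le> M * exp (- (dst Sp x - \<delta>) / \<epsilon>)" .
  next
    have split: "exp (t / \<epsilon>\<^sup>2) * U x + M * exp (t / \<epsilon>\<^sup>2 - v / \<epsilon>) = exp (t / \<epsilon>\<^sup>2) * (U x + M * exp (- v / \<epsilon>))" for t x v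
      by (simp add: exp_diff exp_minus algebra_simps divide_inverse)
    have "\<exists>Z. good_super f Sp Z \<and> (\<forall>x v t. (x, v) \<in> E2 \<longrightarrow> t > 0 \<longrightarrow> Z x t \<le> exp (t / \<epsilon>\<^sup>2) * U x + M * exp (t / \<epsilon>\<^sup>2 - v / \<epsilon>))"
    proof (rule good_super_sum[OF _ E2 \<epsilon>(1) sm(2)[OF \<epsilon>(2)] M])
      show "psub (\<lambda>x t. - (exp (t / \<epsilon>\<^sup>2) * U x))" using Pe unfolding edata_def by blast
      have "continuous_on (closure \<Omega>) U" using Pe unfolding edata_def by blast
      then have "continuous_on (closure \<Omega> \<times> {0<..}) (\<lambda>z. U (fst z))"
        by (rule continuous_on_compose2) (auto intro!: continuous_intros)
      then show "continuous_on (closure \<Omega> \<times> {0<..}) (\<lambda>(x, t). exp (t / \<epsilon>\<^sup>2) * U x)"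
        unfolding split_beta by (intro continuous_intros) (use \<epsilon> in auto)
      show "- (exp (t / \<epsilon>\<^sup>2) * U x) \<le> M * exp (t / \<epsilon>\<^sup>2 - v / \<epsilon>)" if "(x, v) \<in> E2" "t > 0" for x v t
      proof -
        have "- U x \<le> M * exp (- v / \<epsilon>)"
          by (rule edata_upper[OF edata_uminus[OF Pe] Sm' E2 \<epsilon>(1) sm(2)[OF \<epsilon>(2)] that(1)])
        then have "0 \<le> exp (t / \<epsilon>\<^sup>2) * (U x + M * exp (- v / \<epsilon>))" by (intro mult_nonneg_nonneg) auto
        then show ?thesis unfolding split[symmetric] by linarith
      qed
      show "f x \<le> exp (t / \<epsilon>\<^sup>2) * U x" if "x \<in> Sp" "t > 0" for x t
      proof -
        have "U x = f x" "f x > 0" using Pe that Sp unfolding edata_def by auto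
        moreover have "exp (t / \<epsilon>\<^sup>2) \<ge> 1" using that by simp
        ultimately show ?thesis using mult_right_mono[of 1 "exp (t / \<epsilon>\<^sup>2)" "f x"] by simp
      qed
    qed
    then obtain Z where Z: "good_super f Sp Z" "\<And>x v t. (x, v) \<in> E2 \<Longrightarrow> t > 0 \<Longrightarrow> Z x t \<le> exp (t / \<epsilon>\<^sup>2) * U x + M * exp (t / \<epsilon>\<^sup>2 - v / \<epsilon>)" by blast
    have "Z x t \<le> exp (t / \<epsilon>\<^sup>2) * (U x + M * exp (- (dst Sm x - \<delta>) / \<epsilon>))" if x: "x \<in> \<Omega>" and t: "t > 0" for x t
    proof -
      obtain v where v: "(x, v) \<in> E2" "v \<ge> dst Sm x - \<delta>" using get1(2)[OF x] by blast
      show ?thesis using Z(2)[OF v(1) t] vle[OF v(2) \<epsilon>(1), of "t / \<epsilon>\<^sup>2"] unfolding split[symmetric] by linarith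
    qed
    then show "\<exists>Z. good_super f Sp Z \<and> (\<forall>x\<in>\<Omega>. \<forall>t>0. Z x t \<le> exp (t / \<epsilon>\<^sup>2) * (U x + M * exp (- (dst Sm x - \<delta>) / \<epsilon>)))"
      using Z(1) by blast
  qed
  then show "\<exists>\<epsilon>0>0. \<forall>\<epsilon> U. 0 < \<epsilon> \<longrightarrow> \<epsilon> < \<epsilon>0 \<longrightarrow> edata f \<epsilon> U M \<longrightarrow> ?R \<epsilon> U" using \<epsilon>0 by blast
qed

section \<open>Points where one distance is strictly smaller\<close>

lemma reach_far: "reach T x c \<Longrightarrow> \<exists>p\<in>T. norm (x - p) \<le> trb * Cn * c"
proof (induction rule: reach.induct)
  have *: "norm (y - z) \<le> trb * Cn * cost y z" if "y \<in> \<Omega>" for y z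
  proof -
    have "norm (y - z) \<le> norm (A y) * Cn * A_norm A y (y - z)" by (rule norm_le_A_norm)
    also have "\<dots> \<le> trb * Cn * cost y z"
      using trb(1) trb(3)[OF that] Cn_pos cost_ge[of y y z] by (intro mult_mono) auto
    finally show ?thesis .
  qed
  {
    case (last y p)
    then show ?case using * by blast
  next
    case (step y z c)
    then obtain p where p: "p \<in> T" "norm (z - p) \<le> trb * Cn * c" by blast
    have "y \<in> \<Omega>" using step by auto
    have "norm (y - p) \<le> norm (y - z) + norm (z - p)" using norm_triangle_ineq[of "y - z" "z - p"] by simp
    also have "\<dots> \<le> trb * Cn * (cost y z + c)" using *[OF \<open>y \<in> \<Omega>\<close>, of z] p(2) by (simp add: distrib_left)
    finally show ?case using p(1) by blast
  }
qed

text \<open>The cost of a polygon bounds the Euclidean distance of its ends up to a constant, so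
  \<open>dst\<close> stays away from 0 near a point at positive distance from the target.\<close>

lemma dst_far:
  assumes T: "T \<noteq> {}" "T \<subseteq> frontier \<Omega>" and r: "T \<inter> ball y r = {}" and x: "x \<in> \<Omega>" "x \<in> ball y (r / 2)"
  shows "r / (2 * trb * Cn) \<le> dst T x"
  unfolding dst_def
proof (rule cInf_greatest)
  show "{c. reach T x c} \<noteq> {}" using reach_ex[OF T x(1)] by auto
  fix c assume "c \<in> {c. reach T x c}"
  then obtain p where p: "p \<in> T" "norm (x - p) \<le> trb * Cn * c" using reach_far by blast
  have "dist y p \<ge> r" using r p(1) by (auto simp: not_less)
  moreover have "dist y x < r / 2" using x(2) by simp
  ultimately have "norm (x - p) \<ge> r / 2" using dist_triangle[of y p x] unfolding dist_norm by linarith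
  then have "r / 2 \<le> trb * Cn * c" using p(2) by linarith
  then show "r / (2 * trb * Cn) \<le> c" using trb(1) Cn_pos by (simp add: field_simps)
qed

text \<open>Describes \<open>y\<close> through nearby points of the domain only, so that interior
  points and target points, where \<open>d\<close> is 0, are treated alike; outside the domain
  \<open>dst\<close> is the infimum of the empty set.\<close>

definition separated :: "(real ^ 'n \<Rightarrow> real) \<Rightarrow> (real ^ 'n) set \<Rightarrow> (real ^ 'n) set \<Rightarrow> real ^ 'n \<Rightarrow> real \<Rightarrow> bool" where
  "separated f Sp Sm y d \<longleftrightarrow> 0 \<le> d \<and> (\<forall>a>d. Hlow f Sp a y) \<and>
     (\<forall>e>0. \<exists>r>0. \<forall>x\<in>\<Omega> \<inter> ball y r. \<bar>dst Sp x - d\<bar> < e) \<and>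
     (\<exists>b>d. \<exists>r>0. \<forall>x\<in>\<Omega> \<inter> ball y r. b \<le> dst Sm x)"

lemma separated_interior:
  assumes f: "continuous_on (frontier \<Omega>) f" and Sp: "Sp = {x \<in> frontier \<Omega>. f x > 0}" "Sp \<noteq> {}"
    and Sm: "Sm \<subseteq> frontier \<Omega>" "Sm \<noteq> {}" and y: "y \<in> \<Omega>" and lt: "dst Sp y < dst Sm y"
  shows "separated f Sp Sm y (dst Sp y)"
proof -
  have sub: "Sp \<subseteq> frontier \<Omega>" using Sp by auto
  have near: "\<exists>r>0. \<forall>x\<in>\<Omega> \<inter> ball y r. \<bar>dst T x - dst T y\<bar> < e" if T: "T \<noteq> {}" "T \<subseteq> frontier \<Omega>" and e: "e > 0" for T e
  proof -
    have "continuous (at y within \<Omega>) (dst T)" using continuous_dst[OF T] y by (auto simp: continuous_on_eq_continuous_within)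
    then obtain r where "r > 0" "\<And>x. x \<in> \<Omega> \<Longrightarrow> dist x y < r \<Longrightarrow> dist (dst T x) (dst T y) < e"
      unfolding continuous_within_eps_delta using e by blast
    then show ?thesis by (intro exI[of _ r]) (auto simp: dist_real_def dist_commute)
  qed
  have "\<exists>b>dst Sp y. \<exists>r>0. \<forall>x\<in>\<Omega> \<inter> ball y r. b \<le> dst Sm x"
  proof -
    define e where "e = (dst Sm y - dst Sp y) / 2"
    have e: "e > 0" using lt by (simp add: e_def)
    obtain r where r: "r > 0" "\<forall>x\<in>\<Omega> \<inter> ball y r. \<bar>dst Sm x - dst Sm y\<bar> < e" using near[OF Sm(2,1) e] by blast
    have ee: "2 * e = dst Sm y - dst Sp y" by (simp add: e_def)
    have "dst Sp y + e \<le> dst Sm x" if "x \<in> \<Omega> \<inter> ball y r" for x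
    proof -
      have "\<bar>dst Sm x - dst Sm y\<bar> < e" using r(2) that by blast
      then show ?thesis using ee by linarith
    qed
    then show ?thesis using e r(1) by (intro exI[of _ "dst Sp y + e"]) auto
  qed
  then show ?thesis unfolding separated_def
    using near[OF Sp(2) sub] Hlow_dst[OF f Sp y] dst_nonneg[OF Sp(2) sub y] by blast
qed

lemma separated_target:
  assumes f: "continuous_on (frontier \<Omega>) f" and Sp: "Sp = {x \<in> frontier \<Omega>. f x > 0}"
    and Sm: "Sm = {x \<in> frontier \<Omega>. f x < 0}" "Sm \<noteq> {}" and y: "y \<in> Sp"
  shows "separated f Sp Sm y 0" "\<exists>r>0. \<exists>c>0. \<forall>x\<in>frontier \<Omega> \<inter> ball y r. c \<le> f x"
proof -
  have sub: "Sp \<subseteq> frontier \<Omega>" "Sm \<subseteq> frontier \<Omega>" using Sp Sm by auto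
  have yf: "y \<in> frontier \<Omega>" "f y > 0" using y Sp by auto
  from f yf have "continuous (at y within frontier \<Omega>) f" by (auto simp: continuous_on_eq_continuous_within)
  then obtain r where r: "r > 0" "\<And>x. x \<in> frontier \<Omega> \<Longrightarrow> dist x y < r \<Longrightarrow> dist (f x) (f y) < f y / 2"
    unfolding continuous_within_eps_delta using yf(2) by (meson half_gt_zero)
  have rf: "f y / 2 \<le> f x" if "x \<in> frontier \<Omega> \<inter> ball y r" for x
  proof -
    have "\<bar>f x - f y\<bar> < f y / 2" using r(2)[of x] that by (auto simp: dist_real_def dist_commute)
    then show ?thesis by linarith
  qed
  then show "\<exists>r>0. \<exists>c>0. \<forall>x\<in>frontier \<Omega> \<inter> ball y r. c \<le> f x" using r(1) yf(2) by (meson half_gt_zero)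
  have "Sm \<inter> ball y r = {}"
  proof (rule ccontr)
    assume "Sm \<inter> ball y r \<noteq> {}"
    then obtain x where "x \<in> Sm" "x \<in> ball y r" by blast
    then show False using rf[of x] Sm yf(2) by auto
  qed
  note far = dst_far[OF Sm(2) sub(2) this]
  have "0 < r / (2 * trb * Cn)" using r trb(1) Cn_pos by simp
  then have 1: "\<exists>b>0. \<exists>r>0. \<forall>x\<in>\<Omega> \<inter> ball y r. b \<le> dst Sm x"
    using far r(1) by (intro exI[of _ "r / (2 * trb * Cn)"] conjI exI[of _ "r / 2"]) auto
  have Spne: "Sp \<noteq> {}" using y by auto
  have 2: "\<exists>r>0. \<forall>x\<in>\<Omega> \<inter> ball y r. \<bar>dst Sp x - 0\<bar> < e" if e: "e > 0" for e
  proof -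
    obtain \<rho> where "\<rho> > 0" "\<And>q. q \<in> \<Omega> \<Longrightarrow> q \<in> ball y \<rho> \<Longrightarrow> dst Sp q < e" using dst_near_target[OF y sub(1) e] by blast
    then show ?thesis using dst_nonneg[OF Spne sub(1)] by (intro exI[of _ \<rho>]) auto
  qed
  show "separated f Sp Sm y 0" unfolding separated_def using 1 2 Hlow_start[OF f Sp y] by auto
qed

lemma exp_gap:
  assumes "m > 0" "M > 0" "s > 0" "d > 0" "s * (\<bar>ln (2 * M / m)\<bar> + 1) < (d :: real)"
  shows "M * exp (- d / s) \<le> m / 2"
proof -
  have "s * ln (2 * M / m) \<le> s * (\<bar>ln (2 * M / m)\<bar> + 1)" using assms(3) by (intro mult_left_mono) auto
  then have "ln (2 * M / m) < d / s" using assms by (simp add: field_simps)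
  then have "exp (- (d / s)) \<le> exp (- ln (2 * M / m))" by simp
  also have "\<dots> = m / (2 * M)" using assms by (simp add: exp_minus)
  finally have "M * exp (- (d / s)) \<le> M * (m / (2 * M))" using assms by (intro mult_left_mono) auto
  then show ?thesis using assms by simp
qed

lemma local_parabolic:
  assumes P: "pdata f u M" and Sp: "Sp = {x \<in> frontier \<Omega>. f x > 0}" "Sp \<noteq> {}" and Sm: "Sm = {x \<in> frontier \<Omega>. f x < 0}" "Sm \<noteq> {}"
    and sep: "separated f Sp Sm y d" and \<delta>: "\<delta> > 0"
  shows "\<exists>r>0. \<exists>t0>0. \<forall>x\<in>\<Omega> \<inter> ball y r. dst Sp x \<le> dst Sm x \<and>
     (\<forall>t. 0 < t \<longrightarrow> t < t0 \<longrightarrow> u x t > 0 \<and> \<bar>- 4 * t * ln (u x t) - (dst Sp x)\<^sup>2\<bar> < \<delta>)"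
proof -
  have sub: "Sp \<subseteq> frontier \<Omega>" "Sm \<subseteq> frontier \<Omega>" using Sp Sm by auto
  have M: "M > 0" and uM: "\<And>x t. x \<in> closure \<Omega> \<Longrightarrow> t > 0 \<Longrightarrow> \<bar>u x t\<bar> \<le> M" using P unfolding pdata_def by auto
  obtain B where B: "B > 0" "\<And>x. x \<in> \<Omega> \<Longrightarrow> dst Sp x \<le> B" using dst_bounded[OF Sp(2) sub(1)] by blast
  have d0: "0 \<le> d" using sep unfolding separated_def by blast
  obtain b1 r1 where b1: "b1 > d" "r1 > 0" "\<And>x. x \<in> \<Omega> \<inter> ball y r1 \<Longrightarrow> b1 \<le> dst Sm x"
    using sep unfolding separated_def by blast
  define g where "g = b1 - d"
  have gd: "b1 = d + g" by (simp add: g_def)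
  have g: "g > 0" using b1 by (simp add: g_def)
  \<comment> \<open>Error allowed in the minorants; \<open>e\<close> below bounds the oscillation of
    \<open>dst Sp\<close> near \<open>y\<close>. Both are at most a quarter of the gap
    \<open>g\<close>, so that a = d + e lies below b0 = b1 - \<delta>1, and both are small enough to
    change squares of distances only by a fraction of \<delta>.\<close>
  define \<delta>1 where "\<delta>1 = min 1 (min (g / 4) (\<delta> / (4 * (2 * B + 4))))"
  have \<delta>1: "0 < \<delta>1" "\<delta>1 \<le> 1" "\<delta>1 \<le> g / 4" "\<delta>1 * (2 * B + 4) \<le> \<delta> / 4"
  proof -
    show "0 < \<delta>1" "\<delta>1 \<le> 1" using g \<delta> B by (auto simp: \<delta>1_def)
    show "\<delta>1 \<le> g / 4" unfolding \<delta>1_def by (meson min.cobounded1 min.cobounded2 order_trans)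
    have "\<delta>1 \<le> \<delta> / (4 * (2 * B + 4))" by (simp add: \<delta>1_def)
    then show "\<delta>1 * (2 * B + 4) \<le> \<delta> / 4" using B(1) by (simp add: field_simps)
  qed
  define e where "e = min 1 (min (g / 4) (\<delta> / (2 * (4 * B + 4))))"
  have e: "0 < e" "e \<le> 1" "e \<le> g / 4" "e * (4 * B + 4) \<le> \<delta> / 2"
  proof -
    show "0 < e" "e \<le> 1" using g \<delta> B by (auto simp: e_def)
    show "e \<le> g / 4" unfolding e_def by (meson min.cobounded1 min.cobounded2 order_trans)
    have "e \<le> \<delta> / (2 * (4 * B + 4))" by (simp add: e_def)
    then show "e * (4 * B + 4) \<le> \<delta> / 2" using B(1) by (simp add: field_simps)
  qed
  define a where "a = d + e"
  define b0 where "b0 = b1 - \<delta>1"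
  have ab: "0 < a" "a < b0" using d0 e(1,3) \<delta>1(3) g gd unfolding a_def b0_def by linarith+
  then have b0: "0 < b0" by linarith
  have sq: "b0\<^sup>2 - a\<^sup>2 > 0" using ab by (simp add: power_strict_mono)
  obtain r2 where r2: "r2 > 0" "\<And>x. x \<in> \<Omega> \<inter> ball y r2 \<Longrightarrow> \<bar>dst Sp x - d\<bar> < e"
    using sep e(1) unfolding separated_def by blast
  have "Hlow f Sp a y" using sep e(1) unfolding separated_def a_def by auto
  then obtain r3 m t1 where H0: "r3 > 0" "m > 0" "t1 > 0"
    "\<forall>Z. good_super f Sp Z \<longrightarrow> (\<forall>x\<in>\<Omega> \<inter> ball y r3. \<forall>t. 0 < t \<longrightarrow> t < t1 \<longrightarrow> m * exp (- a\<^sup>2 / (4 * t)) \<le> Z x t)"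
    unfolding Hlow_def by blast
  note H = H0(1-3) H0(4)[rule_format]
  obtain \<epsilon>0 where \<epsilon>0: "\<epsilon>0 > 0" "\<forall>\<epsilon>. 0 < \<epsilon> \<longrightarrow> \<epsilon> < \<epsilon>0 \<longrightarrow>
     (\<forall>x\<in>\<Omega>. \<forall>t>0. u x t \<le> M * exp (t / \<epsilon>\<^sup>2 - (dst Sp x - \<delta>1) / \<epsilon>)) \<and>
     (\<exists>Z. good_super f Sp Z \<and> (\<forall>x\<in>\<Omega>. \<forall>t>0. Z x t \<le> u x t + M * exp (t / \<epsilon>\<^sup>2 - (dst Sm x - \<delta>1) / \<epsilon>)))"
    using pdata_bounds(1)[OF P Sp Sm \<delta>1(1)] by blast
  define L1 where "L1 = \<bar>ln (2 * M / m)\<bar> + 1"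
  define L2 where "L2 = \<bar>ln (m / 2)\<bar> + 1"
  define L3 where "L3 = \<bar>ln M\<bar> + 1"
  have L: "L1 > 0" "L2 > 0" "L3 > 0" by (auto simp: L1_def L2_def L3_def)
  define t0 where "t0 = Min {t1, \<epsilon>0 * b0 / 2, (b0\<^sup>2 - a\<^sup>2) / (4 * L1), \<delta> / (8 * L2), \<delta> / (8 * L3), \<epsilon>0 * \<delta>1 / 2}"
  have t0: "t0 > 0" unfolding t0_def using H(3) \<epsilon>0(1) b0 sq L \<delta> \<delta>1(1) by (subst Min_gr_iff) auto
  have t0le: "t0 \<le> t1" "t0 \<le> \<epsilon>0 * b0 / 2" "t0 \<le> (b0\<^sup>2 - a\<^sup>2) / (4 * L1)" "t0 \<le> \<delta> / (8 * L2)" "t0 \<le> \<delta> / (8 * L3)" "t0 \<le> \<epsilon>0 * \<delta>1 / 2"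
    unfolding t0_def by (intro Min_le; simp)+
  \<comment> \<open>The minimum of t/\<epsilon>^2 - c/\<epsilon> over \<epsilon>, attained at
    \<epsilon> = 2 t / c.\<close>
  have quarter: "t / (2 * t / c)\<^sup>2 - c / (2 * t / c) = - c\<^sup>2 / (4 * t)" if "t > 0" "c > 0" for t c :: real
    using that by (simp add: field_simps power2_eq_square)
  have main: "dst Sp x \<le> dst Sm x" "0 < t \<Longrightarrow> t < t0 \<Longrightarrow> u x t > 0 \<and> \<bar>- 4 * t * ln (u x t) - (dst Sp x)\<^sup>2\<bar> < \<delta>"
    if x: "x \<in> \<Omega> \<inter> ball y (min r1 (min r2 r3))" for x t
  proof -
    let ?D = "dst Sp x"
    have xO: "x \<in> \<Omega>" and xc: "x \<in> closure \<Omega>" using x closure_subset by auto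
    have D: "0 \<le> ?D" "?D \<le> B" using dst_nonneg[OF Sp(2) sub(1) xO] B(2)[OF xO] by auto
    have De: "\<bar>?D - d\<bar> < e" using r2(2) x by auto
    have Dm: "b1 \<le> dst Sm x" using b1(3) x by auto
    show "?D \<le> dst Sm x" using De Dm e(3) g gd by linarith
    assume t: "0 < t" "t < t0"
    have lt: "t < t1" "t < \<epsilon>0 * b0 / 2" "t < (b0\<^sup>2 - a\<^sup>2) / (4 * L1)" "t < \<delta> / (8 * L2)" "t < \<delta> / (8 * L3)" "t < \<epsilon>0 * \<delta>1 / 2"
      using t(2) t0le by linarith+
    have aD: "a\<^sup>2 \<le> ?D\<^sup>2 + \<delta> / 2"
    proof -
      have "a \<le> ?D + 2 * e" using De unfolding a_def by linarith
      then have "a\<^sup>2 \<le> (?D + 2 * e)\<^sup>2" using ab by (intro power_mono) auto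
      also have "\<dots> = ?D\<^sup>2 + (4 * (e * ?D) + 4 * (e * e))" by (simp add: power2_eq_square algebra_simps)
      also have "e * ?D \<le> e * B" using D e by (intro mult_left_mono) auto
      also have "e * e \<le> e * 1" using e by (intro mult_left_mono) auto
      finally have "a\<^sup>2 \<le> ?D\<^sup>2 + e * (4 * B + 4)" by (simp add: algebra_simps)
      then show ?thesis using e(4) by linarith
    qed
    define Ea where "Ea = exp (- a\<^sup>2 / (4 * t))"
    have Ea: "Ea > 0" by (simp add: Ea_def)
    have low: "m / 2 * Ea \<le> u x t"
    proof -
      \<comment> \<open>\<epsilon> varies with \<open>t\<close>, hence so does \<open>Z\<close>;
        this is the reason for the order of quantifiers in \<open>Hlow\<close>. Using
        \<open>b0\<close> instead of the distance at \<open>x\<close> makes the choice uniform in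
        \<open>x\<close>.\<close>
      define \<epsilon> where "\<epsilon> = 2 * t / b0"
      have \<epsilon>: "0 < \<epsilon>" "\<epsilon> < \<epsilon>0" using t b0 lt(2) by (auto simp: \<epsilon>_def field_simps)
      obtain Z where Z: "good_super f Sp Z" "Z x t \<le> u x t + M * exp (t / \<epsilon>\<^sup>2 - (dst Sm x - \<delta>1) / \<epsilon>)"
        using \<epsilon>0(2) \<epsilon> xO t(1) by meson
      have "m * Ea \<le> Z x t" unfolding Ea_def using H(4)[OF Z(1), of x t] x t(1) lt(1) by auto
      moreover have "t / \<epsilon>\<^sup>2 - (dst Sm x - \<delta>1) / \<epsilon> \<le> - b0\<^sup>2 / (4 * t)"
      proof -
        have "b0 / \<epsilon> \<le> (dst Sm x - \<delta>1) / \<epsilon>" using Dm \<epsilon>(1) unfolding b0_def by (intro divide_right_mono) auto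
        then show ?thesis using quarter[OF t(1) b0] unfolding \<epsilon>_def by linarith
      qed
      then have "M * exp (t / \<epsilon>\<^sup>2 - (dst Sm x - \<delta>1) / \<epsilon>) \<le> M * exp (- b0\<^sup>2 / (4 * t))" using M by simp
      moreover have "M * exp (- b0\<^sup>2 / (4 * t)) \<le> m / 2 * Ea"
      proof -
        have "4 * t * (\<bar>ln (2 * M / m)\<bar> + 1) < b0\<^sup>2 - a\<^sup>2"
          using lt(3) L unfolding L1_def[symmetric] by (simp add: field_simps)
        then have "M * exp (- (b0\<^sup>2 - a\<^sup>2) / (4 * t)) \<le> m / 2" using H(2) M t(1) sq by (intro exp_gap) auto
        then have "M * exp (- (b0\<^sup>2 - a\<^sup>2) / (4 * t)) * Ea \<le> m / 2 * Ea" using Ea by (intro mult_right_mono) auto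
        moreover have eq: "exp (- (b0\<^sup>2 - a\<^sup>2) / (4 * t)) * Ea = exp (- b0\<^sup>2 / (4 * t))"
          unfolding Ea_def exp_add[symmetric] by (simp add: diff_divide_distrib)
        ultimately show ?thesis by (simp only: mult.assoc eq)
      qed
      moreover have "m * Ea = m / 2 * Ea + m / 2 * Ea" by simp
      ultimately show ?thesis using Z(2) by linarith
    qed
    have upos: "u x t > 0" using low H(2) Ea by (smt (verit) half_gt_zero mult_pos_pos)
    have up1: "- 4 * t * ln (u x t) < ?D\<^sup>2 + \<delta>"
    proof -
      have "ln (m / 2 * Ea) \<le> ln (u x t)" using low upos H(2) Ea by simp
      then have "ln (m / 2) - a\<^sup>2 / (4 * t) \<le> ln (u x t)" using ln_mult_pos[of "m / 2" Ea] H(2) Ea by (simp add: Ea_def)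
      then have "4 * t * (ln (m / 2) - a\<^sup>2 / (4 * t)) \<le> 4 * t * ln (u x t)" using t(1) by (intro mult_left_mono) auto
      then have "4 * t * ln (m / 2) - a\<^sup>2 \<le> 4 * t * ln (u x t)" using t(1) by (simp add: right_diff_distrib)
      moreover have "4 * t * ln (m / 2) \<ge> 4 * t * (- L2)" using t(1) unfolding L2_def by (intro mult_left_mono) auto
      moreover have "4 * t * L2 < \<delta> / 2" using lt(4) L by (simp add: field_simps)
      moreover have "4 * t * (- L2) = - (4 * t * L2)" "- 4 * t * ln (u x t) = - (4 * t * ln (u x t))" by simp_all
      ultimately show ?thesis using aD by linarith
    qed
    have L3': "4 * t * ln M \<le> \<delta> / 2"
    proof -
      have "4 * t * ln M \<le> 4 * t * L3" using t(1) unfolding L3_def by (intro mult_left_mono) auto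
      moreover have "4 * t * L3 < \<delta> / 2" using lt(5) L by (simp add: field_simps)
      ultimately show ?thesis by linarith
    qed
    have up2: "- 4 * t * ln (u x t) > ?D\<^sup>2 - \<delta>"
    \<comment> \<open>For small distances the optimal \<epsilon> = 2 t / c need not be small; there
      the bound by \<open>M\<close> is enough, since the squared distance is at most
      \<delta>/4.\<close>
    proof (cases "?D \<ge> 2 * \<delta>1")
      case True
      define c where "c = ?D - \<delta>1"
      have c: "c > 0" "\<delta>1 \<le> c" using True \<delta>1 by (auto simp: c_def)
      define \<epsilon> where "\<epsilon> = 2 * t / c"
      have \<epsilon>: "0 < \<epsilon>" "\<epsilon> < \<epsilon>0"
      proof -
        show "0 < \<epsilon>" using t c by (simp add: \<epsilon>_def)
        have "\<epsilon> \<le> 2 * t / \<delta>1" unfolding \<epsilon>_def using t c \<delta>1 by (intro divide_left_mono) auto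
        also have "\<dots> < \<epsilon>0" using lt(6) \<delta>1 by (simp add: field_simps)
        finally show "\<epsilon> < \<epsilon>0" .
      qed
      have "u x t \<le> M * exp (t / \<epsilon>\<^sup>2 - (?D - \<delta>1) / \<epsilon>)" using \<epsilon>0(2) \<epsilon> xO t(1) by blast
      also have "t / \<epsilon>\<^sup>2 - (?D - \<delta>1) / \<epsilon> = - c\<^sup>2 / (4 * t)" using quarter[OF t(1) c(1)] by (simp add: \<epsilon>_def c_def)
      finally have "ln (u x t) \<le> ln (M * exp (- c\<^sup>2 / (4 * t)))" using upos M by simp
      also have "\<dots> = ln M - c\<^sup>2 / (4 * t)" using M by (simp add: ln_mult)
      finally have "4 * t * ln (u x t) \<le> 4 * t * (ln M - c\<^sup>2 / (4 * t))" using t(1) by (intro mult_left_mono) auto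
      also have "\<dots> = 4 * t * ln M - c\<^sup>2" using t(1) by (simp add: right_diff_distrib)
      finally have "c\<^sup>2 - \<delta> / 2 \<le> - 4 * t * ln (u x t)" using L3' by simp
      moreover have "c\<^sup>2 \<ge> ?D\<^sup>2 - \<delta> / 4"
      proof -
        have "c\<^sup>2 = ?D\<^sup>2 - 2 * (\<delta>1 * ?D) + \<delta>1\<^sup>2" by (simp add: c_def power2_eq_square algebra_simps)
        moreover have "\<delta>1 * ?D \<le> \<delta>1 * B" using D \<delta>1 by (intro mult_left_mono) auto
        moreover have "\<delta>1\<^sup>2 \<ge> 0" by simp
        moreover have "2 * (\<delta>1 * B) \<le> \<delta> / 4" using \<delta>1(1,4) by (simp add: algebra_simps)
        ultimately show ?thesis by linarith
      qed
      ultimately show ?thesis using \<delta> by linarith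
    next
      case False
      have "u x t \<le> M" using uM[OF xc t(1)] by linarith
      then have "ln (u x t) \<le> ln M" using upos M by simp
      then have "4 * t * ln (u x t) \<le> 4 * t * ln M" using t(1) by (intro mult_left_mono) auto
      moreover have "?D\<^sup>2 \<le> \<delta> / 4"
      proof -
        have "?D\<^sup>2 \<le> (2 * \<delta>1)\<^sup>2" using False D by (intro power_mono) auto
        also have "\<dots> = \<delta>1 * (4 * \<delta>1)" by (simp add: power2_eq_square)
        also have "\<dots> \<le> \<delta>1 * (2 * B + 4)" using \<delta>1 B(1) by (intro mult_left_mono) auto
        finally show ?thesis using \<delta>1(4) by linarith
      qed
      ultimately show ?thesis using L3' \<delta> by simp
    qed
    show "u x t > 0 \<and> \<bar>- 4 * t * ln (u x t) - ?D\<^sup>2\<bar> < \<delta>" using upos up1 up2 by (simp add: abs_less_iff)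
  qed
  show ?thesis
    using b1(2) r2(1) H(1) t0 main by (intro exI[of _ "min r1 (min r2 r3)"] conjI exI[of _ t0]) auto
qed

lemma local_elliptic:
  assumes P: "pdata f u M" and Pe: "\<And>\<epsilon>. \<epsilon> > 0 \<Longrightarrow> edata f \<epsilon> (U \<epsilon>) M" and Sp: "Sp = {x \<in> frontier \<Omega>. f x > 0}" "Sp \<noteq> {}" and Sm: "Sm = {x \<in> frontier \<Omega>. f x < 0}" "Sm \<noteq> {}"
    and sep: "separated f Sp Sm y d" and \<delta>: "\<delta> > 0"
  shows "\<exists>r>0. \<exists>t0>0. \<forall>x\<in>\<Omega> \<inter> ball y r. \<forall>\<epsilon>. 0 < \<epsilon> \<longrightarrow> \<epsilon> < t0 \<longrightarrow> U \<epsilon> x > 0 \<and> \<bar>- \<epsilon> * ln (U \<epsilon> x) - dst Sp x\<bar> < \<delta>"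
proof -
  have M: "M > 0" using P unfolding pdata_def by auto
  have d0: "0 \<le> d" using sep unfolding separated_def by blast
  obtain b1 r1 where b1: "b1 > d" "r1 > 0" "\<And>x. x \<in> \<Omega> \<inter> ball y r1 \<Longrightarrow> b1 \<le> dst Sm x"
    using sep unfolding separated_def by blast
  define g where "g = b1 - d"
  have gd: "b1 = d + g" by (simp add: g_def)
  have g: "g > 0" using b1 by (simp add: g_def)
  define e where "e = min (g / 4) (\<delta> / 4)"
  have e: "0 < e" "e \<le> g / 4" "e \<le> \<delta> / 4" using g \<delta> by (auto simp: e_def)
  define a where "a = d + e"
  define b0 where "b0 = b1 - e"
  have ab: "0 < a" "a < b0" using d0 e(1,2) g gd unfolding a_def b0_def by linarith+
  obtain r2 where r2: "r2 > 0" "\<And>x. x \<in> \<Omega> \<inter> ball y r2 \<Longrightarrow> \<bar>dst Sp x - d\<bar> < e"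
    using sep e(1) unfolding separated_def by blast
  have "Hlow f Sp a y" using sep e(1) unfolding separated_def a_def by auto
  then obtain r3 m t1 where H0: "r3 > 0" "m > 0" "t1 > 0"
    "\<forall>Z. good_super f Sp Z \<longrightarrow> (\<forall>x\<in>\<Omega> \<inter> ball y r3. \<forall>t. 0 < t \<longrightarrow> t < t1 \<longrightarrow> m * exp (- a\<^sup>2 / (4 * t)) \<le> Z x t)"
    unfolding Hlow_def by blast
  note H = H0(1-3) H0(4)[rule_format]
  obtain \<epsilon>0 where \<epsilon>0: "\<epsilon>0 > 0" "\<forall>\<epsilon> U. 0 < \<epsilon> \<longrightarrow> \<epsilon> < \<epsilon>0 \<longrightarrow> edata f \<epsilon> U M \<longrightarrow>
     (\<forall>x\<in>\<Omega>. U x \<le> M * exp (- (dst Sp x - e) / \<epsilon>)) \<and>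
     (\<exists>Z. good_super f Sp Z \<and> (\<forall>x\<in>\<Omega>. \<forall>t>0. Z x t \<le> exp (t / \<epsilon>\<^sup>2) * (U x + M * exp (- (dst Sm x - e) / \<epsilon>))))"
    using pdata_bounds(2)[OF P Sp Sm e(1)] by blast
  define L1 where "L1 = \<bar>ln (2 * M / m)\<bar> + 1"
  define L2 where "L2 = \<bar>ln (m / 2)\<bar> + 1"
  define L3 where "L3 = \<bar>ln M\<bar> + 1"
  have L: "L1 > 0" "L2 > 0" "L3 > 0" by (auto simp: L1_def L2_def L3_def)
  define t0 where "t0 = Min {\<epsilon>0, 2 * t1 / a, (b0 - a) / L1, \<delta> / (2 * L2), \<delta> / (2 * L3)}"
  have t0: "t0 > 0" unfolding t0_def using H(3) \<epsilon>0(1) ab L \<delta> by (subst Min_gr_iff) auto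
  have t0le: "t0 \<le> \<epsilon>0" "t0 \<le> 2 * t1 / a" "t0 \<le> (b0 - a) / L1" "t0 \<le> \<delta> / (2 * L2)" "t0 \<le> \<delta> / (2 * L3)"
    unfolding t0_def by (intro Min_le; simp)+
  have main: "U \<epsilon> x > 0 \<and> \<bar>- \<epsilon> * ln (U \<epsilon> x) - dst Sp x\<bar> < \<delta>"
    if x: "x \<in> \<Omega> \<inter> ball y (min r1 (min r2 r3))" and \<epsilon>: "0 < \<epsilon>" "\<epsilon> < t0" for x \<epsilon>
  proof -
    let ?D = "dst Sp x"
    have xO: "x \<in> \<Omega>" using x by auto
    have De: "\<bar>?D - d\<bar> < e" using r2(2) x by auto
    have Dm: "b1 \<le> dst Sm x" using b1(3) x by auto
    have lt: "\<epsilon> < \<epsilon>0" "\<epsilon> < 2 * t1 / a" "\<epsilon> < (b0 - a) / L1" "\<epsilon> < \<delta> / (2 * L2)" "\<epsilon> < \<delta> / (2 * L3)"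
      using \<epsilon>(2) t0le by linarith+
    have bnd: "U \<epsilon> x \<le> M * exp (- (?D - e) / \<epsilon>)" using \<epsilon>0(2) \<epsilon>(1) lt(1) Pe[OF \<epsilon>(1)] xO by blast
    \<comment> \<open>This time minimises t/\<epsilon>^2 + a^2/(4 t). The minimum a/\<epsilon> is
      the exponent sought, so the parabolic lower bound yields the elliptic one.\<close>
    define t where "t = \<epsilon> * a / 2"
    have t: "0 < t" "t < t1" using \<epsilon>(1) ab lt(2) by (auto simp: t_def field_simps)
    obtain Z where Z: "good_super f Sp Z" "Z x t \<le> exp (t / \<epsilon>\<^sup>2) * (U \<epsilon> x + M * exp (- (dst Sm x - e) / \<epsilon>))"
      using \<epsilon>0(2) \<epsilon>(1) lt(1) Pe[OF \<epsilon>(1)] xO t(1) by meson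
    define Ea where "Ea = exp (- a / \<epsilon>)"
    have Ea: "Ea > 0" by (simp add: Ea_def)
    have low: "m / 2 * Ea \<le> U \<epsilon> x"
    proof -
      have "m * exp (- a\<^sup>2 / (4 * t)) \<le> Z x t" using H(4)[OF Z(1), of x t] x t by auto
      then have "m * exp (- a\<^sup>2 / (4 * t)) \<le> exp (t / \<epsilon>\<^sup>2) * (U \<epsilon> x + M * exp (- (dst Sm x - e) / \<epsilon>))" using Z(2) by linarith
      then have "exp (- (t / \<epsilon>\<^sup>2)) * (m * exp (- a\<^sup>2 / (4 * t))) \<le> exp (- (t / \<epsilon>\<^sup>2)) * (exp (t / \<epsilon>\<^sup>2) * (U \<epsilon> x + M * exp (- (dst Sm x - e) / \<epsilon>)))"
        by (intro mult_left_mono) auto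
      also have "\<dots> = (exp (t / \<epsilon>\<^sup>2) * exp (- (t / \<epsilon>\<^sup>2))) * (U \<epsilon> x + M * exp (- (dst Sm x - e) / \<epsilon>))" by (simp only: mult_ac)
      also have "\<dots> = U \<epsilon> x + M * exp (- (dst Sm x - e) / \<epsilon>)" unfolding exp_minus_inverse by simp
      also have "exp (- (t / \<epsilon>\<^sup>2)) * (m * exp (- a\<^sup>2 / (4 * t))) = m * (exp (- (t / \<epsilon>\<^sup>2)) * exp (- a\<^sup>2 / (4 * t)))" by (simp only: mult_ac)
      also have "exp (- (t / \<epsilon>\<^sup>2)) * exp (- a\<^sup>2 / (4 * t)) = Ea"
      proof -
        have "- (t / \<epsilon>\<^sup>2) + - a\<^sup>2 / (4 * t) = - a / \<epsilon>" using \<epsilon>(1) ab by (simp add: t_def power2_eq_square field_simps)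
        then show ?thesis unfolding Ea_def exp_add[symmetric] by simp
      qed
      finally have 1: "m * Ea \<le> U \<epsilon> x + M * exp (- (dst Sm x - e) / \<epsilon>)" .
      have "- (dst Sm x - e) / \<epsilon> \<le> - b0 / \<epsilon>" using Dm \<epsilon>(1) unfolding b0_def by (intro divide_right_mono) auto
      then have "M * exp (- (dst Sm x - e) / \<epsilon>) \<le> M * exp (- b0 / \<epsilon>)" using M by simp
      moreover have "M * exp (- b0 / \<epsilon>) \<le> m / 2 * Ea"
      proof -
        have "\<epsilon> * (\<bar>ln (2 * M / m)\<bar> + 1) < b0 - a"
          using lt(3) L unfolding L1_def[symmetric] by (simp add: field_simps)
        then have "M * exp (- (b0 - a) / \<epsilon>) \<le> m / 2" using H(2) M \<epsilon>(1) ab by (intro exp_gap) auto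
        then have "M * exp (- (b0 - a) / \<epsilon>) * Ea \<le> m / 2 * Ea" using Ea by (intro mult_right_mono) auto
        moreover have eq: "exp (- (b0 - a) / \<epsilon>) * Ea = exp (- b0 / \<epsilon>)"
          unfolding Ea_def exp_add[symmetric] by (simp add: diff_divide_distrib)
        ultimately show ?thesis by (simp only: mult.assoc eq)
      qed
      moreover have "m * Ea = m / 2 * Ea + m / 2 * Ea" by simp
      ultimately show ?thesis using 1 by linarith
    qed
    have upos: "U \<epsilon> x > 0" using low H(2) Ea by (smt (verit) half_gt_zero mult_pos_pos)
    have up1: "- \<epsilon> * ln (U \<epsilon> x) < ?D + \<delta>"
    proof -
      have "ln (m / 2 * Ea) \<le> ln (U \<epsilon> x)" using low upos H(2) Ea by simp
      then have "ln (m / 2) - a / \<epsilon> \<le> ln (U \<epsilon> x)" using ln_mult_pos[of "m / 2" Ea] H(2) Ea by (simp add: Ea_def)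
      then have "\<epsilon> * (ln (m / 2) - a / \<epsilon>) \<le> \<epsilon> * ln (U \<epsilon> x)" using \<epsilon>(1) by (intro mult_left_mono) auto
      then have "\<epsilon> * ln (m / 2) - a \<le> \<epsilon> * ln (U \<epsilon> x)" using \<epsilon>(1) by (simp add: right_diff_distrib)
      moreover have "\<epsilon> * ln (m / 2) \<ge> \<epsilon> * (- L2)" using \<epsilon>(1) unfolding L2_def by (intro mult_left_mono) auto
      moreover have "\<epsilon> * L2 < \<delta> / 2" using lt(4) L by (simp add: field_simps)
      moreover have "a \<le> ?D + \<delta> / 2" using De e(3) unfolding a_def by linarith
      moreover have "\<epsilon> * (- L2) = - (\<epsilon> * L2)" "- \<epsilon> * ln (U \<epsilon> x) = - (\<epsilon> * ln (U \<epsilon> x))" by simp_all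
      ultimately show ?thesis by linarith
    qed
    have up2: "- \<epsilon> * ln (U \<epsilon> x) > ?D - \<delta>"
    proof -
      have "ln (U \<epsilon> x) \<le> ln (M * exp (- (?D - e) / \<epsilon>))" using upos M bnd by simp
      also have "\<dots> = ln M - (?D - e) / \<epsilon>" using M by (simp add: ln_mult diff_divide_distrib)
      finally have "\<epsilon> * ln (U \<epsilon> x) \<le> \<epsilon> * (ln M - (?D - e) / \<epsilon>)" using \<epsilon>(1) by (intro mult_left_mono) auto
      also have "\<dots> = \<epsilon> * ln M - (?D - e)"
      proof -
        have "\<epsilon> * ((?D - e) / \<epsilon>) = ?D - e" using \<epsilon>(1) by simp
        then show ?thesis by (simp only: right_diff_distrib[of \<epsilon> "ln M"])
      qed
      finally have "\<epsilon> * ln (U \<epsilon> x) \<le> \<epsilon> * ln M - (?D - e)" .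
      moreover have "\<epsilon> * ln M \<le> \<epsilon> * L3" using \<epsilon>(1) unfolding L3_def by (intro mult_left_mono) auto
      moreover have "\<epsilon> * L3 < \<delta> / 2" using lt(5) L by (simp add: field_simps)
      ultimately show ?thesis using e(3) \<delta> by simp
    qed
    show ?thesis using upos up1 up2 by (simp add: abs_less_iff)
  qed
  show ?thesis
    using b1(2) r2(1) H(1) t0 main by (intro exI[of _ "min r1 (min r2 r3)"] conjI exI[of _ t0]) auto
qed

subsection \<open>The uniform limits\<close>

lemma elog_scaled: "v > 0 \<Longrightarrow> ereal c * elog \<bar>v\<bar> = ereal (c * ln v)"
  by (simp add: elog_def)

lemma A_dist_real:
  assumes Sp: "Sp \<subseteq> frontier \<Omega>" "Sp \<noteq> {}" and Sm: "Sm \<subseteq> frontier \<Omega>" "Sm \<noteq> {}" and x: "x \<in> \<Omega> \<union> (Sp \<union> Sm)"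
  obtains D where "D \<ge> 0" "A_dist A \<Omega> (Sp \<union> Sm) x = ennreal D"
proof (cases "x \<in> \<Omega>")
  case True
  show thesis
    using that[of "dst (Sp \<union> Sm) x"] A_dist_eq_dst[of "Sp \<union> Sm" x] dst_nonneg[of "Sp \<union> Sm" x] True Sp Sm by auto
next
  case False
  then have "A_dist A \<Omega> (Sp \<union> Sm) x = 0" using A_dist_target[of x "Sp \<union> Sm"] x Sp Sm by auto
  then show thesis using that[of 0] by simp
qed

text \<open>Both problems share one predicate, with \<open>t\<close> in the role of \<epsilon> for
  the second, so that a single compactness argument gives both uniform limits.\<close>

definition local_limits :: "(real ^ 'n) set \<Rightarrow> (real ^ 'n \<Rightarrow> real \<Rightarrow> real) \<Rightarrow> (real \<Rightarrow> real ^ 'n \<Rightarrow> real) \<Rightarrow> real \<Rightarrow> real ^ 'n \<Rightarrow> real \<Rightarrow> bool" where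
  "local_limits S u U \<delta> x t \<longleftrightarrow>
     \<bar>ereal (- 4 * t) * elog \<bar>u x t\<bar> - enn2ereal ((A_dist A \<Omega> S x)\<^sup>2)\<bar> < ereal \<delta> \<and>
     \<bar>ereal (- t) * elog \<bar>U t x\<bar> - enn2ereal (A_dist A \<Omega> S x)\<bar> < ereal \<delta>"

lemma local_limitsI:
  assumes "u x t > 0" "U t x > 0" "A_dist A \<Omega> S x = ennreal D" "D \<ge> 0"
    "\<bar>- 4 * t * ln (u x t) - D\<^sup>2\<bar> < \<delta>" "\<bar>- t * ln (U t x) - D\<bar> < \<delta>"
  shows "local_limits S u U \<delta> x t"
  unfolding local_limits_def elog_scaled[of "u x t", OF assms(1)] elog_scaled[of "U t x", OF assms(2)] assms(3)
  using assms(4-6) by (simp add: ennreal_power enn2ereal_ennreal)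

lemma local_limits_near:
  assumes P: "pdata f u M" and Pe: "\<And>\<epsilon>. \<epsilon> > 0 \<Longrightarrow> edata f \<epsilon> (U \<epsilon>) M" and f: "continuous_on (frontier \<Omega>) f"
    and Sp: "Sp = {x \<in> frontier \<Omega>. f x > 0}" "Sp \<noteq> {}" and Sm: "Sm = {x \<in> frontier \<Omega>. f x < 0}" "Sm \<noteq> {}"
    and y: "y \<in> \<Omega> \<union> (Sp \<union> Sm)" and lt: "A_dist A \<Omega> Sp y < A_dist A \<Omega> Sm y" and \<delta>: "\<delta> > 0"
  shows "\<exists>r>0. \<exists>\<tau>>0. \<forall>x\<in>(\<Omega> \<union> (Sp \<union> Sm)) \<inter> ball y r. \<forall>t. 0 < t \<longrightarrow> t < \<tau> \<longrightarrow> local_limits (Sp \<union> Sm) u U \<delta> x t"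
proof -
  have sub: "Sp \<subseteq> frontier \<Omega>" "Sm \<subseteq> frontier \<Omega>" using Sp Sm by auto
  have interior: "\<exists>r>0. \<exists>\<tau>>0. \<forall>x\<in>\<Omega> \<inter> ball y r. \<forall>t. 0 < t \<longrightarrow> t < \<tau> \<longrightarrow> local_limits (Sp \<union> Sm) u U \<delta> x t"
    if sep: "separated f Sp Sm y d" for d
  proof -
    obtain r1 t1 where 1: "r1 > 0" "t1 > 0" "\<forall>x\<in>\<Omega> \<inter> ball y r1. dst Sp x \<le> dst Sm x \<and>
       (\<forall>t. 0 < t \<longrightarrow> t < t1 \<longrightarrow> u x t > 0 \<and> \<bar>- 4 * t * ln (u x t) - (dst Sp x)\<^sup>2\<bar> < \<delta>)"
      using local_parabolic[OF P Sp Sm sep \<delta>] by blast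
    obtain r2 t2 where 2: "r2 > 0" "t2 > 0" "\<forall>x\<in>\<Omega> \<inter> ball y r2. \<forall>\<epsilon>. 0 < \<epsilon> \<longrightarrow> \<epsilon> < t2 \<longrightarrow> U \<epsilon> x > 0 \<and> \<bar>- \<epsilon> * ln (U \<epsilon> x) - dst Sp x\<bar> < \<delta>"
      using local_elliptic[OF P Pe Sp Sm sep \<delta>] by blast
    have "local_limits (Sp \<union> Sm) u U \<delta> x t" if x: "x \<in> \<Omega> \<inter> ball y (min r1 r2)" and t: "0 < t" "t < min t1 t2" for x t
    proof (rule local_limitsI)
      have xO: "x \<in> \<Omega>" using x by auto
      have "A_dist A \<Omega> (Sp \<union> Sm) x = min (ennreal (dst Sp x)) (ennreal (dst Sm x))"
        unfolding A_dist_union A_dist_eq_dst[OF Sp(2) sub(1) xO] A_dist_eq_dst[OF Sm(2) sub(2) xO] ..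
      moreover have "ennreal (dst Sp x) \<le> ennreal (dst Sm x)" using 1(3) x by (intro ennreal_leI) auto
      ultimately show "A_dist A \<Omega> (Sp \<union> Sm) x = ennreal (dst Sp x)" by (simp add: min_absorb1)
      show "dst Sp x \<ge> 0" by (rule dst_nonneg[OF Sp(2) sub(1) xO])
    qed (use 1(3) 2(3) x t in auto)
    then show ?thesis using 1(1,2) 2(1,2) by (intro exI[of _ "min r1 r2"] conjI exI[of _ "min t1 t2"]) auto
  qed
  consider "y \<in> \<Omega>" | "y \<in> Sp" | "y \<in> Sm" using y by blast
  then show ?thesis
  proof cases
    case 1
    have "dst Sp y < dst Sm y"
      using lt unfolding A_dist_eq_dst[OF Sp(2) sub(1) 1] A_dist_eq_dst[OF Sm(2) sub(2) 1]
      by (metis ennreal_leI not_le)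
    from interior[OF separated_interior[OF f Sp sub(2) Sm(2) 1 this]] obtain r \<tau> where
      rt: "r > 0" "\<tau> > 0" "\<forall>x\<in>\<Omega> \<inter> ball y r. \<forall>t. 0 < t \<longrightarrow> t < \<tau> \<longrightarrow> local_limits (Sp \<union> Sm) u U \<delta> x t" by blast
    obtain r' where r': "r' > 0" "ball y r' \<subseteq> \<Omega>" using 1 open_dom openE by blast
    show ?thesis using rt r' by (intro exI[of _ "min r r'"] conjI exI[of _ \<tau>]) auto
  next
    case 2
    from separated_target[OF f Sp(1) Sm 2] obtain r1 c where
      sep: "separated f Sp Sm y 0" and r1: "r1 > 0" "c > 0" "\<forall>x\<in>frontier \<Omega> \<inter> ball y r1. c \<le> f x" by blast
    from interior[OF sep] obtain r2 \<tau> where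
      rt: "r2 > 0" "\<tau> > 0" "\<forall>x\<in>\<Omega> \<inter> ball y r2. \<forall>t. 0 < t \<longrightarrow> t < \<tau> \<longrightarrow> local_limits (Sp \<union> Sm) u U \<delta> x t" by blast
    \<comment> \<open>At boundary points near \<open>y\<close> both solutions equal
      \<open>f\<close>, which lies between \<open>c\<close> and \<open>M\<close>; so t ln f tends to
      0 uniformly, in accordance with distance 0.\<close>
    define l where "l = \<bar>ln c\<bar> + \<bar>ln M\<bar> + 1"
    have l: "l > 0" by (simp add: l_def)
    define \<tau>' where "\<tau>' = min \<tau> (\<delta> / (4 * l))"
    have \<tau>': "\<tau>' > 0" "\<tau>' \<le> \<tau>" "\<tau>' \<le> \<delta> / (4 * l)" using rt \<delta> l by (auto simp: \<tau>'_def)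
    have "local_limits (Sp \<union> Sm) u U \<delta> x t" if x: "x \<in> (\<Omega> \<union> (Sp \<union> Sm)) \<inter> ball y (min r1 r2)" and t: "0 < t" "t < \<tau>'" for x t
    proof (cases "x \<in> \<Omega>")
      case True
      then show ?thesis using rt(3) x t \<tau>'(2) by auto
    next
      case False
      then have xf: "x \<in> frontier \<Omega>" "x \<in> Sp \<union> Sm" using x sub by auto
      have c: "c \<le> f x" using r1(3) x xf by auto
      have ut: "u x t = f x" "U t x = f x" and fM: "f x \<le> M"
        using P Pe[OF t(1)] xf(1) t(1) unfolding pdata_def edata_def by (auto simp: abs_le_iff)
      have "ln c \<le> ln (f x)" "ln (f x) \<le> ln M" using c fM r1(2) by auto
      then have "\<bar>ln (f x)\<bar> \<le> l" by (auto simp: l_def)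
      then have "4 * t * \<bar>ln (f x)\<bar> \<le> 4 * t * l" using t(1) by (intro mult_left_mono) auto
      also have "\<dots> < \<delta>"
      proof -
        have "t < \<delta> / (4 * l)" using t(2) \<tau>'(3) by linarith
        then show ?thesis using l by (simp add: field_simps)
      qed
      finally have b: "4 * t * \<bar>ln (f x)\<bar> < \<delta>" .
      have ab: "\<bar>- 4 * t * ln (f x)\<bar> = 4 * t * \<bar>ln (f x)\<bar>" "\<bar>- t * ln (f x)\<bar> = t * \<bar>ln (f x)\<bar>"
        using t(1) by (simp_all add: abs_mult)
      have b': "t * \<bar>ln (f x)\<bar> \<le> 4 * t * \<bar>ln (f x)\<bar>" using t(1) by (intro mult_right_mono) auto
      show ?thesis
      proof (rule local_limitsI[where D = 0])
        show "A_dist A \<Omega> (Sp \<union> Sm) x = ennreal 0" using A_dist_target[OF xf(2)] sub by auto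
        show "\<bar>- 4 * t * ln (u x t) - 0\<^sup>2\<bar> < \<delta>" using b ab(1) by (simp add: ut)
        show "\<bar>- t * ln (U t x) - 0\<bar> < \<delta>" using b b' ab(2) by (simp add: ut)
      qed (use c r1(2) in \<open>auto simp: ut\<close>)
    qed
    then show ?thesis using r1(1) rt(1) \<tau>'(1) by (intro exI[of _ "min r1 r2"] conjI exI[of _ \<tau>']) auto
  next
    case 3
    then have "A_dist A \<Omega> Sm y = 0" using A_dist_target sub by blast
    then show ?thesis using lt by simp
  qed
qed

lemma local_limits_uminus: "local_limits S (\<lambda>x t. - u x t) (\<lambda>\<epsilon> x. - U \<epsilon> x) \<delta> x t = local_limits S u U \<delta> x t"
  by (simp add: local_limits_def)

lemma uniform_limits:
  assumes P: "pdata f u M" and Pe: "\<And>\<epsilon>. \<epsilon> > 0 \<Longrightarrow> edata f \<epsilon> (U \<epsilon>) M" and f: "continuous_on (frontier \<Omega>) f"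
    and Sp: "Sp = {x \<in> frontier \<Omega>. f x > 0}" "Sp \<noteq> {}" and Sm: "Sm = {x \<in> frontier \<Omega>. f x < 0}" "Sm \<noteq> {}"
    and K: "compact K" "K \<subseteq> {x \<in> \<Omega> \<union> (Sp \<union> Sm). A_dist A \<Omega> Sp x \<noteq> A_dist A \<Omega> Sm x}" and \<delta>: "\<delta> > 0"
  shows "\<forall>\<^sub>F t in at_right 0. \<forall>x\<in>K. local_limits (Sp \<union> Sm) u U \<delta> x t"
proof -
  have "\<exists>\<tau>>0. \<forall>x\<in>K. \<forall>t. 0 < t \<longrightarrow> t < \<tau> \<longrightarrow> local_limits (Sp \<union> Sm) u U \<delta> x t"
  proof (rule compact_uniform_time[OF K(1)])
    fix y assume "y \<in> K"
    then have y: "y \<in> \<Omega> \<union> (Sp \<union> Sm)" "A_dist A \<Omega> Sp y \<noteq> A_dist A \<Omega> Sm y" using K(2) by auto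
    have "\<exists>r>0. \<exists>\<tau>>0. \<forall>x\<in>(\<Omega> \<union> (Sp \<union> Sm)) \<inter> ball y r. \<forall>t. 0 < t \<longrightarrow> t < \<tau> \<longrightarrow> local_limits (Sp \<union> Sm) u U \<delta> x t"
    proof (cases "A_dist A \<Omega> Sp y < A_dist A \<Omega> Sm y")
      case True
      show ?thesis using local_limits_near[OF P Pe f Sp Sm y(1) True \<delta>] by blast
    next
      case False
      then have lt: "A_dist A \<Omega> Sm y < A_dist A \<Omega> Sp y" using y(2) by simp
      \<comment> \<open>After negating \<open>f\<close>, \<open>u\<close> and \<open>U\<close> the
        nearer target carries the positive data, and \<open>local_limits\<close> is unchanged
        because only absolute values of the solutions enter it.\<close>
      have Sp': "Sp = {x \<in> frontier \<Omega>. - f x < 0}" and Sm': "Sm = {x \<in> frontier \<Omega>. - f x > 0}" using Sp Sm by auto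
      have y': "y \<in> \<Omega> \<union> (Sm \<union> Sp)" using y(1) by auto
      have "continuous_on (frontier \<Omega>) (\<lambda>x. - f x)" using f by (rule continuous_on_minus)
      note near = local_limits_near[OF pdata_uminus[OF P] edata_uminus[OF Pe] this Sm' Sm(2) Sp' Sp(2) y' lt \<delta>]
      show ?thesis using near unfolding local_limits_uminus Un_commute[of Sm Sp] by blast
    qed
    then show "\<exists>\<rho>>0. \<exists>\<tau>>0. \<forall>x\<in>K \<inter> ball y \<rho>. \<forall>t. 0 < t \<longrightarrow> t < \<tau> \<longrightarrow> local_limits (Sp \<union> Sm) u U \<delta> x t"
      using K(2) by blast
  qed
  then show ?thesis unfolding eventually_at_right_field by blast
qed

lemma data_bound:
  assumes u: "parabolic_solution A \<Omega> f u" and U: "\<And>\<epsilon>. \<epsilon> > 0 \<Longrightarrow> elliptic_solution A \<Omega> f \<epsilon> (U \<epsilon>)"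
    and f: "continuous_on (frontier \<Omega>) f"
  obtains M where "pdata f u M" "\<And>\<epsilon>. \<epsilon> > 0 \<Longrightarrow> edata f \<epsilon> (U \<epsilon>) M"
proof -
  have "bounded ((\<lambda>(x, t). u x t) ` (\<Omega> \<times> {0<..}))" using u unfolding parabolic_solution_def by blast
  then obtain M1 where M1: "\<forall>z\<in>(\<lambda>(x, t). u x t) ` (\<Omega> \<times> {0<..}). norm z \<le> M1" unfolding bounded_iff by blast
  have "compact (frontier \<Omega>)" using bounded_dom by (rule compact_frontier_bounded)
  then have "bounded (f ` frontier \<Omega>)" by (intro compact_imp_bounded compact_continuous_image f)
  then obtain M2 where M2: "\<forall>z\<in>f ` frontier \<Omega>. norm z \<le> M2" unfolding bounded_iff by blast
  define M where "M = max 1 (max M1 M2)"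
  have M: "M > 0" "M1 \<le> M" "M2 \<le> M" by (auto simp: M_def)
  have uf: "\<And>x t. x \<in> frontier \<Omega> \<Longrightarrow> t > 0 \<Longrightarrow> u x t = f x" using u unfolding parabolic_solution_def by blast
  have "\<bar>u x t\<bar> \<le> M" if "x \<in> closure \<Omega>" "t > 0" for x t
  proof (cases "x \<in> \<Omega>")
    case True
    then show ?thesis using M1 M that by force
  next
    case False
    then have "x \<in> frontier \<Omega>" using that frontier_dom by blast
    then show ?thesis using uf[OF _ that(2)] M2 M by force
  qed
  then have "pdata f u M"
    unfolding pdata_def using psub_parabolic_solution[OF u] M(1) u unfolding parabolic_solution_def by auto
  moreover have "edata f \<epsilon> (U \<epsilon>) M" if "\<epsilon> > 0" for \<epsilon>
    unfolding edata_def using psub_elliptic_solution[OF U[OF that] that] M M2 U[OF that] unfolding elliptic_solution_def by force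
  ultimately show thesis by (rule that)
qed

end

lemma tendsto_ereal_abs:
  fixes X :: "'a \<Rightarrow> ereal"
  assumes "\<And>\<delta>. \<delta> > 0 \<Longrightarrow> \<forall>\<^sub>F t in F. \<bar>X t - ereal l\<bar> < ereal \<delta>"
  shows "(X \<longlongrightarrow> ereal l) F"
proof (rule order_tendstoI)
  fix a assume "a < ereal l"
  then obtain r where r: "a < ereal r" "ereal r < ereal l" using ereal_dense2 by blast
  have "\<forall>\<^sub>F t in F. \<bar>X t - ereal l\<bar> < ereal (l - r)" using r by (intro assms) simp
  then show "\<forall>\<^sub>F t in F. a < X t"
  proof eventually_elim
    case (elim t)
    then have "ereal r < X t" by (cases "X t") (auto simp: abs_less_iff)
    then show ?case using r(1) by order
  qed
next
  fix a assume "ereal l < a"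
  then obtain r where r: "ereal l < ereal r" "ereal r < a" using ereal_dense2 by blast
  have "\<forall>\<^sub>F t in F. \<bar>X t - ereal l\<bar> < ereal (r - l)" using r by (intro assms) simp
  then show "\<forall>\<^sub>F t in F. X t < a"
  proof eventually_elim
    case (elim t)
    then have "X t < ereal r" by (cases "X t") (auto simp: abs_less_iff)
    then show ?case using r(2) by order
  qed
qed

theorem corollary1p2:
  fixes \<Omega> Sp Sm S :: "(real ^ 'n) set"
    and A :: "real ^ 'n \<Rightarrow> real ^ 'n ^ 'n"
    and f :: "real ^ 'n \<Rightarrow> real"
    and u :: "real ^ 'n \<Rightarrow> real \<Rightarrow> real"
    and U :: "real \<Rightarrow> real ^ 'n \<Rightarrow> real"
  assumes "CARD('n) \<ge> 2"
    and "open \<Omega>" and "connected \<Omega>" and "\<Omega> \<noteq> {}" and "bounded \<Omega>"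
    and "C11_boundary \<Omega>"
    and "\<And>x. transpose (A x) = A x"
    and "coeff_regular A"
    and "uniformly_elliptic A"
    and "continuous_on (frontier \<Omega>) f"
    and Sp_eq: "Sp = {x \<in> frontier \<Omega>. f x > 0}"
    and Sm_eq: "Sm = {x \<in> frontier \<Omega>. f x < 0}"
    and "Sp \<noteq> {}" and "Sm \<noteq> {}"
    and S_eq: "S = Sp \<union> Sm"
    and "parabolic_solution A \<Omega> f u"
    and "\<And>\<epsilon>. \<epsilon> > 0 \<Longrightarrow> elliptic_solution A \<Omega> f \<epsilon> (U \<epsilon>)"
  shows
    "(\<forall>x \<in> \<Omega> \<union> S. A_dist A \<Omega> Sp x \<noteq> A_dist A \<Omega> Sm x \<longrightarrow>
        ((\<lambda>t. ereal (- 4 * t) * elog \<bar>u x t\<bar>) \<longlongrightarrow> enn2ereal ((A_dist A \<Omega> S x)\<^sup>2)) (at_right 0) \<and>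
        (A_dist A \<Omega> S x)\<^sup>2 =
          (if A_dist A \<Omega> Sp x < A_dist A \<Omega> Sm x then (A_dist A \<Omega> Sp x)\<^sup>2
           else (A_dist A \<Omega> Sm x)\<^sup>2) \<and>
        ((\<lambda>\<epsilon>. ereal (- \<epsilon>) * elog \<bar>U \<epsilon> x\<bar>) \<longlongrightarrow> enn2ereal (A_dist A \<Omega> S x)) (at_right 0) \<and>
        A_dist A \<Omega> S x =
          (if A_dist A \<Omega> Sp x < A_dist A \<Omega> Sm x then A_dist A \<Omega> Sp x
           else A_dist A \<Omega> Sm x)) \<and>
     (\<forall>K. compact K \<and> K \<subseteq> {x \<in> \<Omega> \<union> S. A_dist A \<Omega> Sp x \<noteq> A_dist A \<Omega> Sm x} \<longrightarrow>
        (\<forall>\<delta>>0. \<forall>\<^sub>F t in at_right 0. \<forall>x\<in>K.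
            \<bar>ereal (- 4 * t) * elog \<bar>u x t\<bar> - enn2ereal ((A_dist A \<Omega> S x)\<^sup>2)\<bar> < ereal \<delta>) \<and>
        (\<forall>\<delta>>0. \<forall>\<^sub>F \<epsilon> in at_right 0. \<forall>x\<in>K.
            \<bar>ereal (- \<epsilon>) * elog \<bar>U \<epsilon> x\<bar> - enn2ereal (A_dist A \<Omega> S x)\<bar> < ereal \<delta>))"
proof -
  interpret elliptic_domain A \<Omega>
    using assms(2-9) by unfold_locales
  note ne = \<open>Sp \<noteq> {}\<close> \<open>Sm \<noteq> {}\<close>
  note f = \<open>continuous_on (frontier \<Omega>) f\<close>
  obtain M where P: "pdata f u M" and Pe: "\<And>\<epsilon>. \<epsilon> > 0 \<Longrightarrow> edata f \<epsilon> (U \<epsilon>) M"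
    using data_bound[OF \<open>parabolic_solution A \<Omega> f u\<close> assms(17) f] by blast
  have sub: "Sp \<subseteq> frontier \<Omega>" "Sm \<subseteq> frontier \<Omega>" using Sp_eq Sm_eq by auto
  let ?X = "\<lambda>x t. ereal (- 4 * t) * elog \<bar>u x t\<bar>" and ?Y = "\<lambda>x \<epsilon>. ereal (- \<epsilon>) * elog \<bar>U \<epsilon> x\<bar>"
  have unif: "\<forall>\<^sub>F t in at_right 0. \<forall>x\<in>K. \<bar>?X x t - enn2ereal ((A_dist A \<Omega> S x)\<^sup>2)\<bar> < ereal \<delta>"
    "\<forall>\<^sub>F t in at_right 0. \<forall>x\<in>K. \<bar>?Y x t - enn2ereal (A_dist A \<Omega> S x)\<bar> < ereal \<delta>"
    if "compact K" "K \<subseteq> {x \<in> \<Omega> \<union> S. A_dist A \<Omega> Sp x \<noteq> A_dist A \<Omega> Sm x}" "\<delta> > 0" for K \<delta>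
  proof -
    have ev: "\<forall>\<^sub>F t in at_right 0. \<forall>x\<in>K. local_limits S u U \<delta> x t"
      using uniform_limits[OF P Pe f Sp_eq ne(1) Sm_eq ne(2) that(1) _ that(3)] that(2) unfolding S_eq by blast
    show "\<forall>\<^sub>F t in at_right 0. \<forall>x\<in>K. \<bar>?X x t - enn2ereal ((A_dist A \<Omega> S x)\<^sup>2)\<bar> < ereal \<delta>"
      using ev by eventually_elim (simp add: local_limits_def)
    show "\<forall>\<^sub>F t in at_right 0. \<forall>x\<in>K. \<bar>?Y x t - enn2ereal (A_dist A \<Omega> S x)\<bar> < ereal \<delta>"
      using ev by eventually_elim (simp add: local_limits_def)
  qed
  have lim: "(?X x \<longlongrightarrow> enn2ereal ((A_dist A \<Omega> S x)\<^sup>2)) (at_right 0)" "(?Y x \<longlongrightarrow> enn2ereal (A_dist A \<Omega> S x)) (at_right 0)"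
    if x: "x \<in> \<Omega> \<union> S" "A_dist A \<Omega> Sp x \<noteq> A_dist A \<Omega> Sm x" for x
  proof -
    obtain D where D: "D \<ge> 0" "A_dist A \<Omega> S x = ennreal D"
      using A_dist_real[OF sub(1) ne(1) sub(2) ne(2)] x(1) unfolding S_eq by blast
    have e: "enn2ereal ((A_dist A \<Omega> S x)\<^sup>2) = ereal (D\<^sup>2)" "enn2ereal (A_dist A \<Omega> S x) = ereal D"
      unfolding D(2) using D(1) by (simp_all add: ennreal_power enn2ereal_ennreal)
    \<comment> \<open>The pointwise limits are the uniform ones on a single point; finiteness of the
      distance turns the estimates into limits in the extended reals.\<close>
    have "compact {x}" "{x} \<subseteq> {x \<in> \<Omega> \<union> S. A_dist A \<Omega> Sp x \<noteq> A_dist A \<Omega> Sm x}" using x by auto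
    note u = unif[OF this]
    show "(?X x \<longlongrightarrow> enn2ereal ((A_dist A \<Omega> S x)\<^sup>2)) (at_right 0)"
      unfolding e by (rule tendsto_ereal_abs) (use u(1) e in simp)
    show "(?Y x \<longlongrightarrow> enn2ereal (A_dist A \<Omega> S x)) (at_right 0)"
      unfolding e by (rule tendsto_ereal_abs) (use u(2) e in simp)
  qed
  have eq: "A_dist A \<Omega> S x = (if A_dist A \<Omega> Sp x < A_dist A \<Omega> Sm x then A_dist A \<Omega> Sp x else A_dist A \<Omega> Sm x)" for x
    unfolding S_eq A_dist_union by (auto simp: min_def)
  then have eq2: "(A_dist A \<Omega> S x)\<^sup>2 = (if A_dist A \<Omega> Sp x < A_dist A \<Omega> Sm x then (A_dist A \<Omega> Sp x)\<^sup>2 else (A_dist A \<Omega> Sm x)\<^sup>2)" for x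
    by simp
  show ?thesis using lim eq eq2 unif by blast
qed

end
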